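(* Assume $\mu$ satisfies (LC1), (LC2), (LC3), and fix a sign $\pm$. Let $W$ be a restricted $\mathcal U_\hbar^s(\hat{\mathfrak g}_\mu)^\pm$-module, let $(i,j)\in\mathbb I$, let $m$ be a positive integer, let $f^\pm=f^\pm(z,w)\in\mathbb C[[\hbar]][z^{d_i},w^{d_i}]$ be homogeneous, and let $B=(B_0,\dots,B_m)\in\mathbb C[[\hbar]]^{m+1}$ be such that the polynomial $P^\pm_{ij}(m,f^\pm,B)$ is zero. (1) If for all $0\le l<d_{ij}/d_i$ $$:\!x_i^\pm(q_i^{a_{ij}}\xi_{d_{ij}}^lw)\,x_i^\pm(q_i^{a_{ij}+2}\xi_{d_{ij}}^lw)\cdots x_i^\pm(q_i^{-a_{ij}}\xi_{d_{ij}}^lw)\,x_j^\pm(w)\!:\;=0\quad\text{on }W,\qquad( * )$$ where $\xi_{d_{ij}}=e^{2\pi\sqrt{-1}/d_{ij}}$ and the exponents of $q_i$ run over $a_{ij},a_{ij}+2,\dots,-a_{ij}$, then $D^\pm_{ij}(m,f^\pm,B)=0$ on $W$. (2) Conversely, if $m=m_{ij}$ (that is, $m=1-a_{ij}$), $f^\pm(w,q_i^{\pm2n}w)\ne0$ for $n=1,\dots,-a_{ij}$, and $D_{ij}^\pm(m,f^\pm,B)=0$ on $W$, then $( * )$ holds for all $0\le l<d_{ij}/d_i$.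
   Context: Data. $A=(a_{ij})_{i,j\in I}$ ($I$ finite) is a symmetrizable generalized Cartan matrix, $r_i$ positive integers with $(r_ia_{ij})$ symmetric, $\mu$ a permutation of $I$ of order $N$ with $a_{\mu(i)\mu(j)}=a_{ij}$, $r_{\mu(i)}=r_i$. $\mathcal O(i)$ is the $\mu$-orbit of $i$, $N_i=|\mathcal O(i)|$, $d_i=N/N_i$; $k$ runs over $\mathbb Z_N=\mathbb Z/N\mathbb Z$. $\mathbb I=\{(i,j): i\notin\mathcal O(j),a_{ij}<0\}$, $\Gamma_{ij}=\{k:a_{i\mu^k(j)}\ne0\}$. (LC1): $\sum_{p\in\mathcal O(i)}a_{pi}>0$ for all $i$; then the Dynkin subdiagram on $\mathcal O(i)$ is a disjoint union of $A_1$'s ($s_i=1$) or of $A_2$'s with $a_{\mu^{N_i/2}(i),i}=-1$ ($s_i=2$). (LC2): for $(i,j)\in\mathbb I$, $a_{i\mu^k(j)}=a_{ij}$ for all $k\in\Gamma_{ij}$. (LC3): for $(i,j)\in\mathbb I$, $\Gamma_{ij}$ is a subgroup of $\mathbb Z_N$; put then $d_{ij}=|\Gamma_{ij}|$ (a multiple of $d_i$). For $(i,j)\in\mathbb I$, $m_{ij}=1-\min_k a_{i\mu^k(j)}$, which equals $1-a_{ij}$ by (LC2). $q=e^\hbar$, $q_i=q^{r_i}$, $\xi=e^{2\pi\sqrt{-1}/N}$. $F^\pm_{ij}(z,w)=\prod_{k\in\Gamma_{ij}}(z-\xi^kq_i^{\pm a_{i\mu^k(j)}}w)$, $G^\pm_{ij}(z,w)=\prod_{k\in\Gamma_{ij}}(q_i^{\pm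 a_{i\mu^k(j)}}z-\xi^kw)$; if $s_i=2$, $p_i^\pm(z_1,z_2,z_3)=q_i^{\mp\frac32d_i}z_1^{d_i}-(q_i^{d_i/2}+q_i^{-d_i/2})z_2^{d_i}+q_i^{\pm\frac32d_i}z_3^{d_i}$. Algebra and modules. $\mathcal U^s_\hbar(\hat{\mathfrak g}_\mu)^\pm$ is the $\mathbb C[[\hbar]]$-algebra topologically generated by $x^\pm_{i,n}$ ($i\in I,n\in\mathbb Z$) with, for $x_i^\pm(z)=\sum_nx_{i,n}^\pm z^{-n}$, the relations: (Q0) $x^\pm_{\mu(i),n}=\xi^nx^\pm_{i,n}$; (Q8) $F^\pm_{ij}(z,w)x_i^\pm(z)x_j^\pm(w)=G^\pm_{ij}(z,w)x_j^\pm(w)x_i^\pm(z)$; (Q9) if $s_i=2$, $\sum_{\sigma\in S_3}p_i^\pm(z_{\sigma(1)},z_{\sigma(2)},z_{\sigma(3)})x_i^\pm(z_{\sigma(1)})x_i^\pm(z_{\sigma(2)})x_i^\pm(z_{\sigma(3)})=0$. A module $W$ is restricted if $W\cong W^0[[\hbar]]$ for a $\mathbb C$-vector space $W^0$ (topologically free) and for all $i$, $w\in W$, $x^\pm_{i,n}w\to0$ $\hbar$-adically as $n\to+\infty$. Normal ordered products. $f^\pm_{ij}(z,w)=F^\pm_{ij}(z,w)\prod_{k:\,a_{i\mu^k(j)}>0}(z-\xi^kw)^{-1}$, and $:\!x_{i_1}^\pm(z_1)\cdots x_{i_m}^\pm(z_m)\!:\;=\prod_{r<s}\iota_{z_r,z_s}(f^\pm_{i_ri_s}(z_r,z_s))\,x^\pm_{i_1}(z_1)\cdots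 x^\pm_{i_m}(z_m)$, where $\iota_{z_r,z_s}$ expands in nonnegative powers of $z_s$; products are formed modulo each $\hbar^n$ and one passes to the inverse limit. On a restricted module, applied to any vector and modulo any $\hbar^n$, this series lies in $W((z_1,\dots,z_m))$, so substitutions $z_r=c_rw$ with $c_r\in\mathbb C[[\hbar]]^\times$ are defined (modulo each $\hbar^n$, then in the limit). Currents and polynomials: $$D_{ij}^\pm(m,f^\pm,B)=\sum_{\sigma\in S_m}\prod_{1\le a<b\le m}f^\pm(z_{\sigma(a)},z_{\sigma(b)})\sum_{r=0}^m(-1)^rB_r\,x_i^\pm(z_{\sigma(1)})\cdots x_i^\pm(z_{\sigma(r)})x_j^\pm(w)x_i^\pm(z_{\sigma(r+1)})\cdots x_i^\pm(z_{\sigma(m)}),$$ $$P_{ij}^\pm(m,f^\pm,B)=\sum_{\sigma\in S_m}\mathrm{sgn}(\sigma)\sum_{r=0}^m(-1)^rB_r\prod_{1\le a<b\le m}f^\pm(z_{\sigma(a)},z_{\sigma(b)})G_{ii}^\pm(z_{\sigma(a)},z_{\sigma(b)})\prod_{a=1}^rG^\pm_{ij}(z_{\sigma(a)},w)\prod_{b=r+1}^mF^\pm_{ij}(z_{\sigma(b)},w).$$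
   Formalization: In part (2) the tuple B is required to be nonzero, and f(w,q_i^{2n}w) and f(w,q_i^{-2n}w) are both required to be nonzero for n=1,…,-a_ij; without these conditions part (2) is false. *)

theory Defs
  imports
    "HOL-Computational_Algebra.Formal_Power_Series"
    "HOL-Computational_Algebra.Polynomial"
    "HOL-Combinatorics.Permutations"
    "HOL-Combinatorics.Orbits"
    "HOL-Library.Poly_Mapping"
    "HOL-Library.Function_Algebras"
    "HOL-Algebra.QuotRing"
    "HOL-Algebra.Elementary_Groups"
begin

section \<open>The Cartan datum\<close>

text \<open>The finite index set $I$ is the type \<open>'i\<close>.\<close>

record 'i datum =
  cmat :: "'i \<Rightarrow> 'i \<Rightarrow> int"
  sym  :: "'i \<Rightarrow> int"
  aut  :: "'i \<Rightarrow> 'i"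

definition gen_cartan_matrix :: "('i \<Rightarrow> 'i \<Rightarrow> int) \<Rightarrow> bool" where
  "gen_cartan_matrix A \<longleftrightarrow>
     (\<forall>i. A i i = 2) \<and> (\<forall>i j. i \<noteq> j \<longrightarrow> A i j \<le> 0) \<and> (\<forall>i j. A i j = 0 \<longleftrightarrow> A j i = 0)"

definition cartan_datum :: "'i datum \<Rightarrow> bool" where
  "cartan_datum T \<longleftrightarrow>
     gen_cartan_matrix (cmat T) \<and>
     (\<forall>i. sym T i > 0) \<and> (\<forall>i j. sym T i * cmat T i j = sym T j * cmat T j i) \<and>
     bij (aut T) \<and>
     (\<forall>i j. cmat T (aut T i) (aut T j) = cmat T i j) \<and> (\<forall>i. sym T (aut T i) = sym T i)"

definition autord :: "'i datum \<Rightarrow> nat" where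
  "autord T = (LEAST n. 0 < n \<and> aut T ^^ n = id)"

definition orb :: "'i datum \<Rightarrow> 'i \<Rightarrow> 'i set" where
  "orb T i = orbit (aut T) i"

definition orbsize :: "'i datum \<Rightarrow> 'i \<Rightarrow> nat" where
  "orbsize T i = card (orb T i)"

definition dnum :: "'i datum \<Rightarrow> 'i \<Rightarrow> nat" where
  "dnum T i = autord T div orbsize T i"

text \<open>\<open>tmat T i j k\<close> is $a_{i\mu^k(j)}$. Elements of $\mathbb Z_N$ are represented by
  $0,\dots,N-1$.\<close>

definition tmat :: "'i datum \<Rightarrow> 'i \<Rightarrow> 'i \<Rightarrow> nat \<Rightarrow> int" where
  "tmat T i j k = cmat T i ((aut T ^^ k) j)"

definition \<II> :: "'i datum \<Rightarrow> ('i \<times> 'i) set" where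
  "\<II> T = {(i, j). i \<notin> orb T j \<and> cmat T i j < 0}"

definition \<Gamma> :: "'i datum \<Rightarrow> 'i \<Rightarrow> 'i \<Rightarrow> nat set" where
  "\<Gamma> T i j = {k. k < autord T \<and> tmat T i j k \<noteq> 0}"

definition LC1 :: "'i datum \<Rightarrow> bool" where
  "LC1 T \<longleftrightarrow> (\<forall>i. (\<Sum>p\<in>orb T i. cmat T p i) > 0)"

definition LC2 :: "'i datum \<Rightarrow> bool" where
  "LC2 T \<longleftrightarrow> (\<forall>(i, j)\<in>\<II> T. \<forall>k\<in>\<Gamma> T i j. tmat T i j k = cmat T i j)"

definition LC3 :: "'i datum \<Rightarrow> bool" where
  "LC3 T \<longleftrightarrow> (\<forall>(i, j)\<in>\<II> T. subgroup (int ` \<Gamma> T i j) (integer_mod_group (autord T)))"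

definition dpair :: "'i datum \<Rightarrow> 'i \<Rightarrow> 'i \<Rightarrow> nat" where
  "dpair T i j = card (\<Gamma> T i j)"

text \<open>The subdiagram on the orbit of \<open>i\<close> is a disjoint union of copies of $A_2$.\<close>

definition orb_A2 :: "'i datum \<Rightarrow> 'i \<Rightarrow> bool" where
  "orb_A2 T i \<longleftrightarrow> (\<forall>p\<in>orb T i. \<exists>p'\<in>orb T i. p' \<noteq> p \<and> cmat T p p' = -1 \<and> cmat T p' p = -1 \<and>
     (\<forall>p''\<in>orb T i. p'' \<noteq> p \<and> p'' \<noteq> p' \<longrightarrow> cmat T p p'' = 0))"

definition snum :: "'i datum \<Rightarrow> 'i \<Rightarrow> nat" where
  "snum T i = (if orb_A2 T i then 2 else 1)"

definition mnum :: "'i datum \<Rightarrow> 'i \<Rightarrow> 'i \<Rightarrow> nat" where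
  "mnum T i j = nat (1 - Min (tmat T i j ` {..<autord T}))"

section \<open>Scalars and polynomials\<close>

text \<open>\<open>complex fps\<close> is $\mathbb C[[\hbar]]$ with $\hbar$ = \<^term>\<open>fps_X\<close>, and
  $q_i^s = e^{s r_i\hbar}$. The exponent \<open>s\<close> is complex so that half-integral powers are
  covered.\<close>

definition qpow :: "'i datum \<Rightarrow> 'i \<Rightarrow> complex \<Rightarrow> complex fps" where
  "qpow T i s = fps_exp (of_int (sym T i) * s)"

definition prim_root :: "nat \<Rightarrow> complex" where
  "prim_root n = exp (2 * of_real pi * \<i> / of_nat n)"

abbreviation \<xi> :: "'i datum \<Rightarrow> complex" where
  "\<xi> T \<equiv> prim_root (autord T)"

text \<open>Exponents of Laurent monomials, and Laurent polynomials, in variables indexed by \<open>nat\<close>.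
  All polynomials below are regarded as elements of this ring.\<close>

type_synonym expo = "nat \<Rightarrow>\<^sub>0 int"
type_synonym lpoly = "expo \<Rightarrow>\<^sub>0 complex fps"

definition Cst :: "complex fps \<Rightarrow> lpoly" where
  "Cst c = Poly_Mapping.single 0 c"

definition Var :: "nat \<Rightarrow> lpoly" where
  "Var a = Poly_Mapping.single (Poly_Mapping.single a 1) 1"

text \<open>The sign $\pm$ is \<open>\<epsilon> \<in> {1, -1}\<close>. The functions \<open>Fpol\<close>, \<open>Gpol\<close>, \<open>ppol\<close> give
  $F^\pm_{ij}$, $G^\pm_{ij}$, $p^\pm_i$ evaluated at the given arguments.\<close>

definition Fpol :: "'i datum \<Rightarrow> int \<Rightarrow> 'i \<Rightarrow> 'i \<Rightarrow> lpoly \<Rightarrow> lpoly \<Rightarrow> lpoly" where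
  "Fpol T \<epsilon> i j z w =
     (\<Prod>k\<in>\<Gamma> T i j. z - Cst (fps_const (\<xi> T ^ k) * qpow T i (of_int (\<epsilon> * tmat T i j k))) * w)"

definition Gpol :: "'i datum \<Rightarrow> int \<Rightarrow> 'i \<Rightarrow> 'i \<Rightarrow> lpoly \<Rightarrow> lpoly \<Rightarrow> lpoly" where
  "Gpol T \<epsilon> i j z w =
     (\<Prod>k\<in>\<Gamma> T i j. Cst (qpow T i (of_int (\<epsilon> * tmat T i j k))) * z - Cst (fps_const (\<xi> T ^ k)) * w)"

definition ppol :: "'i datum \<Rightarrow> int \<Rightarrow> 'i \<Rightarrow> lpoly \<Rightarrow> lpoly \<Rightarrow> lpoly \<Rightarrow> lpoly" where
  "ppol T \<epsilon> i z1 z2 z3 = (let d = dnum T i in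
     Cst (qpow T i (- of_int \<epsilon> * 3 / 2 * of_nat d)) * z1 ^ d
     - Cst (qpow T i (of_nat d / 2) + qpow T i (- of_nat d / 2)) * z2 ^ d
     + Cst (qpow T i (of_int \<epsilon> * 3 / 2 * of_nat d)) * z3 ^ d)"

text \<open>An element $f(z,w)$ of $\mathbb C[[\hbar]][z,w]$ is a polynomial in $z$ (outer) with
  coefficients in $\mathbb C[[\hbar]][w]$ (inner).\<close>

type_synonym bipoly = "complex fps poly poly"

definition eval2 :: "bipoly \<Rightarrow> lpoly \<Rightarrow> lpoly \<Rightarrow> lpoly" where
  "eval2 f z w = poly (map_poly (\<lambda>p. poly (map_poly Cst p) w) f) z"

definition in_powers :: "nat \<Rightarrow> bipoly \<Rightarrow> bool" where
  "in_powers d f \<longleftrightarrow> (\<forall>a b. coeff (coeff f a) b \<noteq> 0 \<longrightarrow> d dvd a \<and> d dvd b)"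

definition homogeneous :: "bipoly \<Rightarrow> bool" where
  "homogeneous f \<longleftrightarrow> (\<exists>n. \<forall>a b. coeff (coeff f a) b \<noteq> 0 \<longrightarrow> a + b = n)"

text \<open>$P^\pm_{ij}(m,f^\pm,B)$: the variable $w$ has index \<open>0\<close> and $z_a$ has index \<open>a\<close>.\<close>

definition Ppol :: "'i datum \<Rightarrow> int \<Rightarrow> 'i \<Rightarrow> 'i \<Rightarrow> nat \<Rightarrow> bipoly \<Rightarrow> (nat \<Rightarrow> complex fps) \<Rightarrow> lpoly" where
  "Ppol T \<epsilon> i j m f B =
     (\<Sum>\<sigma> | \<sigma> permutes {1..m}. of_int (sign \<sigma>) *
       (\<Sum>r=0..m. (-1) ^ r * Cst (B r) *
          (\<Prod>(a, b)\<in>{(a, b). 1 \<le> a \<and> a < b \<and> b \<le> m}.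
              eval2 f (Var (\<sigma> a)) (Var (\<sigma> b)) * Gpol T \<epsilon> i i (Var (\<sigma> a)) (Var (\<sigma> b))) *
          (\<Prod>a=1..r. Gpol T \<epsilon> i j (Var (\<sigma> a)) (Var 0)) *
          (\<Prod>b=r+1..m. Fpol T \<epsilon> i j (Var (\<sigma> b)) (Var 0))))"

section \<open>Formal distributions\<close>

text \<open>A formal distribution with values in a $\mathbb C[[\hbar]]$-module (with scalar
  multiplication \<open>sc\<close>) assigns to each exponent the coefficient of the corresponding monomial.\<close>

definition poly_times ::
    "(complex fps \<Rightarrow> 'w \<Rightarrow> 'w) \<Rightarrow> lpoly \<Rightarrow> (expo \<Rightarrow> 'w) \<Rightarrow> expo \<Rightarrow> 'w::ab_group_add" where
  "poly_times sc p X e =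
     (\<Sum>k\<in>Poly_Mapping.keys p. sc (Poly_Mapping.lookup p k) (X (e - k)))"

text \<open>\<open>currents x [(i\<^sub>1, a\<^sub>1), \<dots>, (i\<^sub>n, a\<^sub>n)] v\<close> is
  $x_{i_1}(z_{a_1})\cdots x_{i_n}(z_{a_n})v$, where $x_i(z)=\sum_n x_{i,n}z^{-n}$ and the
  \<open>a\<close>'s are distinct.\<close>

definition currents ::
    "('i \<Rightarrow> int \<Rightarrow> 'w \<Rightarrow> 'w) \<Rightarrow> ('i \<times> nat) list \<Rightarrow> 'w \<Rightarrow> expo \<Rightarrow> 'w::ab_group_add" where
  "currents x l v e =
     (if Poly_Mapping.keys e \<subseteq> snd ` set l
      then foldr (\<lambda>(i, a) u. x i (- Poly_Mapping.lookup e a) u) l v else 0)"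

text \<open>\<open>hfilt sc n\<close> is the submodule $\hbar^nW$, and \<open>hsum\<close> is the $\hbar$-adically convergent
  sum of a family: modulo each $\hbar^n$ only finitely many members contribute.\<close>

definition hfilt :: "(complex fps \<Rightarrow> 'w \<Rightarrow> 'w) \<Rightarrow> nat \<Rightarrow> 'w set" where
  "hfilt sc n = range (sc (fps_X ^ n))"

definition has_hsum ::
    "(complex fps \<Rightarrow> 'w \<Rightarrow> 'w::ab_group_add) \<Rightarrow> ('k \<Rightarrow> 'w) \<Rightarrow> 'k set \<Rightarrow> 'w \<Rightarrow> bool" where
  "has_hsum sc g K s \<longleftrightarrow>
     (\<forall>n. \<exists>F0. finite F0 \<and> F0 \<subseteq> K \<and>
        (\<forall>F. finite F \<and> F0 \<subseteq> F \<and> F \<subseteq> K \<longrightarrow> s - sum g F \<in> hfilt sc n))"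

definition hsum ::
    "(complex fps \<Rightarrow> 'w \<Rightarrow> 'w::ab_group_add) \<Rightarrow> ('k \<Rightarrow> 'w) \<Rightarrow> 'k set \<Rightarrow> 'w" where
  "hsum sc g K = (THE s. has_hsum sc g K s)"

text \<open>Product of a scalar formal series with a formal distribution. With \<open>sc = (*)\<close> this is
  the product of two scalar formal series.\<close>

definition series_times ::
    "(complex fps \<Rightarrow> 'w \<Rightarrow> 'w) \<Rightarrow> (expo \<Rightarrow> complex fps) \<Rightarrow> (expo \<Rightarrow> 'w) \<Rightarrow> expo \<Rightarrow> 'w::ab_group_add"
  where
  "series_times sc S X e = hsum sc (\<lambda>k. sc (S k) (X (e - k))) UNIV"

text \<open>The expansion $\sum_{n\ge0}c^nz_a^{-n-1}z_b^n$ of $(z_a-cz_b)^{-1}$, for \<open>a \<noteq> b\<close>.\<close>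

definition geom :: "complex fps \<Rightarrow> nat \<Rightarrow> nat \<Rightarrow> expo \<Rightarrow> complex fps" where
  "geom c a b e =
     (let n = Poly_Mapping.lookup e b in
      if n \<ge> 0 \<and> e = Poly_Mapping.single a (- n - 1) + Poly_Mapping.single b n
      then c ^ nat n else 0)"

text \<open>$\iota_{z_a,z_b}(f^\pm_{ij}(z_a,z_b))$. The expansion map is multiplicative, so the
  rational function $f^\pm_{ij}$ is expanded factor by factor.\<close>

definition iota_f ::
    "'i datum \<Rightarrow> int \<Rightarrow> 'i \<Rightarrow> 'i \<Rightarrow> nat \<Rightarrow> nat \<Rightarrow> expo \<Rightarrow> complex fps" where
  "iota_f T \<epsilon> i j a b =
     foldr (\<lambda>k. series_times (*) (geom (fps_const (\<xi> T ^ k)) a b))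
       (filter (\<lambda>k. tmat T i j k > 0) [0..<autord T])
       (Poly_Mapping.lookup (Fpol T \<epsilon> i j (Var a) (Var b)))"

text \<open>The normal ordered product of the currents with indices \<open>is\<close>, applied to \<open>v\<close>;
  the \<open>a\<close>-th current (counted from \<open>0\<close>) has the variable with index \<open>a\<close>.\<close>

definition nop_kernel :: "'i datum \<Rightarrow> int \<Rightarrow> 'i list \<Rightarrow> expo \<Rightarrow> complex fps" where
  "nop_kernel T \<epsilon> is =
     foldr (\<lambda>(a, b). series_times (*) (iota_f T \<epsilon> (is ! a) (is ! b) a b))
       [(a, b). a \<leftarrow> [0..<length is], b \<leftarrow> [Suc a..<length is]]
       (Poly_Mapping.lookup 1)"

definition nop ::
    "'i datum \<Rightarrow> int \<Rightarrow> (complex fps \<Rightarrow> 'w \<Rightarrow> 'w) \<Rightarrow> ('i \<Rightarrow> int \<Rightarrow> 'w \<Rightarrow> 'w) \<Rightarrow> 'i list \<Rightarrow> 'w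
      \<Rightarrow> expo \<Rightarrow> 'w::ab_group_add" where
  "nop T \<epsilon> sW x is v =
     series_times sW (nop_kernel T \<epsilon> is) (currents x (zip is [0..<length is]) v)"

text \<open>The coefficient of $w^n$ after the substitution of \<open>cs ! a\<close> times $w$ for the variable
  with index \<open>a\<close>; the members of \<open>cs\<close> are units of $\mathbb C[[\hbar]]$.\<close>

definition subst_coeff ::
    "(complex fps \<Rightarrow> 'w \<Rightarrow> 'w) \<Rightarrow> complex fps list \<Rightarrow> (expo \<Rightarrow> 'w) \<Rightarrow> int \<Rightarrow> 'w::ab_group_add" where
  "subst_coeff sW cs Y n =
     hsum sW (\<lambda>e. sW (\<Prod>a<length cs. (cs ! a) powi Poly_Mapping.lookup e a) (Y e))
       {e. Poly_Mapping.keys e \<subseteq> {..<length cs} \<and> (\<Sum>a<length cs. Poly_Mapping.lookup e a) = n}"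

section \<open>The algebra\<close>

text \<open>The $\hbar$-adic completion of the free associative $\mathbb C[[\hbar]]$-algebra on the
  generators $x_{i,n}$. An element is given by its coefficients at the words in the generators;
  modulo each $\hbar^n$ only finitely many of them are nonzero.\<close>

type_synonym 'i wfun = "('i \<times> int) list \<Rightarrow> complex fps"

definition free_alg :: "'i wfun ring" where
  "free_alg = \<lparr>carrier = {u. \<forall>n. finite {w. \<not> fps_X ^ n dvd u w}},
     monoid.mult = (\<lambda>u v w. \<Sum>k\<le>length w. u (take k w) * v (drop k w)),
     one = (\<lambda>w. if w = [] then 1 else 0),
     zero = (\<lambda>w. 0),
     add = (\<lambda>u v w. u w + v w)\<rparr>"

definition wscale :: "complex fps \<Rightarrow> 'i wfun \<Rightarrow> 'i wfun" where
  "wscale c u = (\<lambda>w. c * u w)"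

definition gen :: "'i \<Rightarrow> int \<Rightarrow> 'i wfun" where
  "gen i n = (\<lambda>w. if w = [(i, n)] then 1 else 0)"

text \<open>Currents of generators as formal distributions with values in \<^const>\<open>free_alg\<close>.\<close>

definition gcurrents :: "('i \<times> nat) list \<Rightarrow> expo \<Rightarrow> 'i wfun" where
  "gcurrents l = currents (\<lambda>i n u. gen i n \<otimes>\<^bsub>free_alg\<^esub> u) l \<one>\<^bsub>free_alg\<^esub>"

definition relQ0 :: "'i datum \<Rightarrow> 'i wfun set" where
  "relQ0 T = {gen (aut T i) n - wscale (fps_const (\<xi> T powi n)) (gen i n) | i n. True}"

definition relQ8 :: "'i datum \<Rightarrow> int \<Rightarrow> 'i wfun set" where
  "relQ8 T \<epsilon> =
     {poly_times wscale (Fpol T \<epsilon> i j (Var 0) (Var 1)) (gcurrents [(i, 0), (j, 1)]) e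
      - poly_times wscale (Gpol T \<epsilon> i j (Var 0) (Var 1)) (gcurrents [(j, 1), (i, 0)]) e | i j e. True}"

definition relQ9 :: "'i datum \<Rightarrow> int \<Rightarrow> 'i wfun set" where
  "relQ9 T \<epsilon> =
     {(\<Sum>\<sigma> | \<sigma> permutes {1..3::nat}.
         poly_times wscale (ppol T \<epsilon> i (Var (\<sigma> 1)) (Var (\<sigma> 2)) (Var (\<sigma> 3)))
           (gcurrents [(i, \<sigma> 1), (i, \<sigma> 2), (i, \<sigma> 3)]) e) | i e. snum T i = 2}"

definition hclosed :: "'i wfun set \<Rightarrow> bool" where
  "hclosed J \<longleftrightarrow>
     (\<forall>u\<in>carrier free_alg. (\<forall>n. \<exists>v\<in>J. \<forall>w. fps_X ^ n dvd u w - v w) \<longrightarrow> u \<in> J)"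

definition rel_ideal :: "'i datum \<Rightarrow> int \<Rightarrow> 'i wfun set" where
  "rel_ideal T \<epsilon> =
     \<Inter>{J. ideal J free_alg \<and> hclosed J \<and> relQ0 T \<union> relQ8 T \<epsilon> \<union> relQ9 T \<epsilon> \<subseteq> J}"

text \<open>$\mathcal U^s_\hbar(\hat{\mathfrak g}_\mu)^\pm$, and the class in it of an element of
  \<^const>\<open>free_alg\<close>.\<close>

definition Ualg :: "'i datum \<Rightarrow> int \<Rightarrow> 'i wfun set ring" where
  "Ualg T \<epsilon> = free_alg Quot (rel_ideal T \<epsilon>)"

definition Ucls :: "'i datum \<Rightarrow> int \<Rightarrow> 'i wfun \<Rightarrow> 'i wfun set" where
  "Ucls T \<epsilon> u = rel_ideal T \<epsilon> +>\<^bsub>free_alg\<^esub> u"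

section \<open>Modules\<close>

definition U_module ::
    "'i datum \<Rightarrow> int \<Rightarrow> (complex fps \<Rightarrow> 'w \<Rightarrow> 'w) \<Rightarrow> ('i wfun set \<Rightarrow> 'w \<Rightarrow> 'w::ab_group_add) \<Rightarrow> bool"
  where
  "U_module T \<epsilon> sW act \<longleftrightarrow>
     Modules.module sW \<and>
     (\<forall>u\<in>carrier (Ualg T \<epsilon>). \<forall>v w. act u (v + w) = act u v + act u w) \<and>
     (\<forall>u\<in>carrier (Ualg T \<epsilon>). \<forall>u'\<in>carrier (Ualg T \<epsilon>). \<forall>w.
        act (u \<oplus>\<^bsub>Ualg T \<epsilon>\<^esub> u') w = act u w + act u' w \<and>
        act (u \<otimes>\<^bsub>Ualg T \<epsilon>\<^esub> u') w = act u (act u' w)) \<and>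
     (\<forall>c w. act (Ucls T \<epsilon> (wscale c \<one>\<^bsub>free_alg\<^esub>)) w = sW c w)"

text \<open>$W\cong W^0[[\hbar]]$, where \<open>s0\<close> is the scalar multiplication of the complex vector
  space $W^0$ and a sequence \<open>g\<close> stands for $\sum_n g_n\hbar^n$.\<close>

definition pseries_scale ::
    "(complex \<Rightarrow> 'v \<Rightarrow> 'v) \<Rightarrow> complex fps \<Rightarrow> (nat \<Rightarrow> 'v) \<Rightarrow> nat \<Rightarrow> 'v::ab_group_add" where
  "pseries_scale s0 c g n = (\<Sum>k\<le>n. s0 (fps_nth c k) (g (n - k)))"

definition top_free ::
    "(complex fps \<Rightarrow> 'w \<Rightarrow> 'w::ab_group_add) \<Rightarrow> (complex \<Rightarrow> 'v \<Rightarrow> 'v::ab_group_add) \<Rightarrow> bool" where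
  "top_free sW s0 \<longleftrightarrow>
     vector_space s0 \<and>
     (\<exists>\<phi> :: (nat \<Rightarrow> 'v) \<Rightarrow> 'w. bij \<phi> \<and> module_hom (pseries_scale s0) sW \<phi>)"

definition xop :: "'i datum \<Rightarrow> int \<Rightarrow> ('i wfun set \<Rightarrow> 'w \<Rightarrow> 'w) \<Rightarrow> 'i \<Rightarrow> int \<Rightarrow> 'w \<Rightarrow> 'w" where
  "xop T \<epsilon> act i n = act (Ucls T \<epsilon> (gen i n))"

definition restricted_module ::
    "'i datum \<Rightarrow> int \<Rightarrow> (complex fps \<Rightarrow> 'w \<Rightarrow> 'w) \<Rightarrow> (complex \<Rightarrow> 'v \<Rightarrow> 'v::ab_group_add)
      \<Rightarrow> ('i wfun set \<Rightarrow> 'w \<Rightarrow> 'w::ab_group_add) \<Rightarrow> bool" where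
  "restricted_module T \<epsilon> sW s0 act \<longleftrightarrow>
     U_module T \<epsilon> sW act \<and> top_free sW s0 \<and>
     (\<forall>i w p. \<forall>\<^sub>F n in at_top. xop T \<epsilon> act i n w \<in> hfilt sW p)"

text \<open>The formal distribution $D^\pm_{ij}(m,f^\pm,B)v$; variables are indexed as in
  \<^const>\<open>Ppol\<close>.\<close>

definition Ddist ::
    "(complex fps \<Rightarrow> 'w \<Rightarrow> 'w) \<Rightarrow> ('i \<Rightarrow> int \<Rightarrow> 'w \<Rightarrow> 'w) \<Rightarrow> 'i \<Rightarrow> 'i \<Rightarrow> nat \<Rightarrow> bipoly
      \<Rightarrow> (nat \<Rightarrow> complex fps) \<Rightarrow> 'w \<Rightarrow> expo \<Rightarrow> 'w::ab_group_add" where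
  "Ddist sW x i j m f B v e =
     (\<Sum>\<sigma> | \<sigma> permutes {1..m}.
       poly_times sW
         (\<Prod>(a, b)\<in>{(a, b). 1 \<le> a \<and> a < b \<and> b \<le> m}. eval2 f (Var (\<sigma> a)) (Var (\<sigma> b)))
         (\<lambda>e'. \<Sum>r=0..m. sW ((-1) ^ r * B r)
            (currents x
               (map (\<lambda>a. (i, \<sigma> a)) [1..<Suc r] @ [(j, 0)] @ map (\<lambda>a. (i, \<sigma> a)) [Suc r..<Suc m])
               v e'))
         e)"

text \<open>The vanishing on $W$ of
  $:x_i(q_i^{a_{ij}}\xi_{d_{ij}}^lw)x_i(q_i^{a_{ij}+2}\xi_{d_{ij}}^lw)\cdots
   x_i(q_i^{-a_{ij}}\xi_{d_{ij}}^lw)x_j(w):$.\<close>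

definition nop_vanishes ::
    "'i datum \<Rightarrow> int \<Rightarrow> (complex fps \<Rightarrow> 'w \<Rightarrow> 'w::ab_group_add) \<Rightarrow> ('i \<Rightarrow> int \<Rightarrow> 'w \<Rightarrow> 'w)
      \<Rightarrow> 'i \<Rightarrow> 'i \<Rightarrow> nat \<Rightarrow> bool" where
  "nop_vanishes T \<epsilon> sW x i j l \<longleftrightarrow>
     (let a = cmat T i j; M = nat (1 - a);
          cs = map (\<lambda>t. qpow T i (of_int (a + 2 * int t)) * fps_const (prim_root (dpair T i j) ^ l))
                 [0..<M] @ [1]
      in \<forall>v n. subst_coeff sW cs (nop T \<epsilon> sW x (replicate M i @ [j]) v) n = 0)"

end

theory Submission
  imports Defs
begin

text \<open>The relation (Q8) is an exchange relation for linear forms in $z_a^d$ and $w^d$. Multiplied by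
  suitable forms, the products of $x_i(z_1),\dots,x_i(z_m),x_j(w)$ in all orders become, up to sign,
  one and the same series, which is bounded below in every variable and divisible by
  $\prod_{a<b}(z_a^d-z_b^d)$. The quotient $\Psi$ is the normally ordered product. Conversely a product
  of currents is recovered from $\Psi$ by division, since multiplication by a form is injective on
  series that decay in the direction of its expansion. Hence $P=0$ yields $D=0$ as soon as the forms
  can be divided out one at a time, and this is obstructed only by directed cycles of forms with a
  common zero. These cycles are the wheels, on which $\Psi$ vanishes by (Q9), and the chains through
  $w$, on which $\Psi$ vanishes by $(*)$. If $m=1-a_{ij}$ and $D=0$, then all summands but the one
  ordered along a given chain decay against some edge of the chain, so that the remaining one does so
  too; therefore $\Psi$ vanishes on the chain.\<close>

text \<open>Two-sided series can be multiplied by polynomials but not cancelled: a form kills a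
  delta series. Every cancellation is therefore tied to a direction of decay, modulo each power of
  \<open>fps_X\<close>. Let D be a sum in which some forms are still divided out. If each of them
  annihilates D, then z_a^d = g z_b^d holds on D for every such edge, and along it the coefficients
  of D are a geometric progression with unit ratio. Decay of all summands in one such direction
  makes D zero. Directions are found by cuts. A set of variables that no edge leaves keeps its
  degree bounded below under division; edges that do leave it must be supplied beforehand. The
  Vandermonde factor serves for this: by Lagrange interpolation it is a sum of products that contain
  all edges but one from a given vertex. The constants are cA = q_i^(2 \<epsilon> d_i), cB =
  -q_i^(-\<epsilon> d_i) and \<alpha>_l = \<beta>_l = \<zeta>^l q_i^(\<epsilon> a_ij d_i), where
  \<zeta> has order d_ij / d_i. Wheels close by cA cB^2 = 1, chains by \<beta> cA^(-a_ij) \<alpha> =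
  1 for inverse roots of unity.\<close>

abbreviation lk :: "('a \<Rightarrow>\<^sub>0 'b::zero) \<Rightarrow> 'a \<Rightarrow> 'b" where "lk \<equiv> Poly_Mapping.lookup"
abbreviation ks :: "('a \<Rightarrow>\<^sub>0 'b::zero) \<Rightarrow> 'a set" where "ks \<equiv> Poly_Mapping.keys"
abbreviation mk :: "('a \<Rightarrow> 'b) \<Rightarrow> ('b \<Rightarrow>\<^sub>0 'c::zero) \<Rightarrow> 'a \<Rightarrow>\<^sub>0 'c" where "mk \<equiv> Poly_Mapping.map_key"
abbreviation unit0 :: "complex fps \<Rightarrow> bool" where "unit0 c \<equiv> fps_nth c 0 \<noteq> 0"

lemma poly_mapping_sum_single:
  fixes p :: "'a \<Rightarrow>\<^sub>0 'b::comm_monoid_add"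
  shows "p = (\<Sum>k\<in>ks p. Poly_Mapping.single k (lk p k))"
proof (rule poly_mapping_eqI)
  fix a
  show "lk p a =
    lk (\<Sum>k\<in>ks p. Poly_Mapping.single k (lk p k)) a"
    by (simp add: lookup_sum lookup_single when_def not_in_keys_iff_lookup_eq_zero)
qed

locale hmodule = Modules.module sc
  for sc :: "complex fps \<Rightarrow> 'w \<Rightarrow> 'w::ab_group_add" +
  fixes s0 :: "complex \<Rightarrow> 'v \<Rightarrow> 'v::ab_group_add" and co :: "'w \<Rightarrow> nat \<Rightarrow> 'v"
  assumes vs0: "vector_space s0"
    and bij_co: "bij co"
    and co_add: "co (x + y) n = co x n + co y n"
    and co_sc: "co (sc c x) n = (\<Sum>k\<le>n. s0 (fps_nth c k) (co x (n - k)))"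
begin

interpretation V0: vector_space s0 by (rule vs0)

lemma co_0 [simp]: "co 0 n = 0"
  using co_add[of 0 0 n] by simp

lemma co_uminus: "co (- x) n = - co x n"
  using co_add[of x "- x" n] by (simp add: eq_neg_iff_add_eq_0 add.commute)

lemma co_diff: "co (x - y) n = co x n - co y n"
  using co_add[of x "- y" n] by (simp add: co_uminus)

lemma co_sum: "co (sum g F) n = (\<Sum>x\<in>F. co (g x) n)"
  by (induction F rule: infinite_finite_induct) (auto simp: co_add)

lemma co_eqI: "(\<And>n. co x n = co y n) \<Longrightarrow> x = y"
  using bij_co by (metis bij_is_inj ext inj_eq)

lemma co_surj: "\<exists>s. co s = h"
  using surjD[OF bij_is_surj[OF bij_co], of h] by metis

text \<open>Membership in \<open>hfilt sc p\<close>, as \<open>hfilt_zt\<close> shows, in a form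
  that can be checked on coordinates.\<close>

definition zt :: "nat \<Rightarrow> 'w \<Rightarrow> bool" where
  "zt p w \<longleftrightarrow> (\<forall>j<p. co w j = 0)"

lemma zt_0 [simp]: "zt p 0" by (simp add: zt_def)
lemma zt_zero [simp]: "zt 0 w" by (simp add: zt_def)
lemma zt_add: "zt p x \<Longrightarrow> zt p y \<Longrightarrow> zt p (x + y)" by (simp add: zt_def co_add)
lemma zt_uminus: "zt p x \<Longrightarrow> zt p (- x)" by (simp add: zt_def co_uminus)
lemma zt_diff: "zt p x \<Longrightarrow> zt p y \<Longrightarrow> zt p (x - y)" by (simp add: zt_def co_diff)
lemma zt_sum: "(\<And>i. i \<in> F \<Longrightarrow> zt p (g i)) \<Longrightarrow> zt p (sum g F)" by (simp add: zt_def co_sum)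
lemma zt_sc: "zt p x \<Longrightarrow> zt p (sc c x)" by (simp add: zt_def co_sc)
lemma zt_mono: "zt p x \<Longrightarrow> q \<le> p \<Longrightarrow> zt q x" by (simp add: zt_def)
lemma zt_all: "(\<And>p. zt p x) \<Longrightarrow> x = 0"
  by (rule co_eqI) (auto simp: zt_def)

text \<open>In the lowest possible degree of the product only the lowest coefficient of c meets the
  lowest nonzero coordinate of w, and the complex vector space has no torsion.\<close>

lemma sc_eq_0:
  assumes "sc c w = 0" "c \<noteq> 0" shows "w = 0"
proof (rule ccontr)
  assume "w \<noteq> 0"
  then obtain n0 where "co w n0 \<noteq> 0" using co_eqI[of w 0] by auto
  define n where "n = (LEAST n. co w n \<noteq> 0)"
  have n: "co w n \<noteq> 0"
    unfolding n_def by (rule LeastI[of "\<lambda>n. co w n \<noteq> 0", OF \<open>co w n0 \<noteq> 0\<close>])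
  have n2: "co w j = 0" if "j < n" for j
    using not_less_Least[of j "\<lambda>n. co w n \<noteq> 0"] that unfolding n_def by blast
  define k where "k = subdegree c"
  have k: "fps_nth c k \<noteq> 0" "\<And>j. j < k \<Longrightarrow> fps_nth c j = 0"
    using assms(2) by (auto simp: k_def)
  have "co (sc c w) (k + n) = (\<Sum>i\<le>k+n. if i = k then s0 (fps_nth c k) (co w n) else 0)"
    unfolding co_sc
  proof (rule sum.cong)
    fix i assume i: "i \<in> {..k+n}"
    show "s0 (fps_nth c i) (co w (k + n - i)) = (if i = k then s0 (fps_nth c k) (co w n) else 0)"
    proof (cases "i < k")
      case True then show ?thesis using k by simp
    next
      case False
      then show ?thesis using n2[of "k+n-i"] i by (cases "i = k") auto
    qed
  qed simp
  also have "\<dots> = s0 (fps_nth c k) (co w n)" by simp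
  finally show False using n k(1) assms(1) by simp
qed

lemma zt_unit:
  assumes "unit0 c" shows "zt p (sc c w) \<longleftrightarrow> zt p w"
proof
  assume "zt p (sc c w)"
  then have "zt p (sc (inverse c) (sc c w))" by (rule zt_sc)
  then show "zt p w" using assms by (simp add: inverse_mult_eq_1)
qed (rule zt_sc)

lemma hfilt_zt: "w \<in> hfilt sc p \<longleftrightarrow> zt p w"
proof
  assume "w \<in> hfilt sc p"
  then obtain v where w: "w = sc (fps_X ^ p) v" unfolding hfilt_def by auto
  show "zt p w"
    unfolding zt_def w co_sc by (auto simp: fps_X_power_nth)
next
  assume z: "zt p w"
  \<comment> \<open>Moving the coordinates down by p divides by \<open>fps_X ^ p\<close>; the
    quotient exists because \<open>co\<close> is onto.\<close>
  obtain v where v: "co v = (\<lambda>n. co w (n + p))" using co_surj by blast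
  have "w = sc (fps_X ^ p) v"
  proof (rule co_eqI)
    fix n
    have "co (sc (fps_X ^ p) v) n = (\<Sum>k\<le>n. if k = p then co w n else 0)"
      unfolding co_sc v by (rule sum.cong) (auto simp: fps_X_power_nth)
    also have "\<dots> = co w n" using z by (auto simp: zt_def)
    finally show "co w n = co (sc (fps_X ^ p) v) n" by simp
  qed
  then show "w \<in> hfilt sc p" unfolding hfilt_def by auto
qed

subsection \<open>Convergent sums\<close>

definition sm :: "('k \<Rightarrow> 'w) \<Rightarrow> 'k set \<Rightarrow> bool" where
  "sm g K \<longleftrightarrow> (\<forall>p. finite {x \<in> K. \<not> zt p (g x)})"

lemma has_hsum_unique:
  assumes "has_hsum sc g K s" "has_hsum sc g K t" shows "s = t"
proof -
  have "zt n (s - t)" for n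
  proof -
    obtain F where F: "finite F" "F \<subseteq> K" "\<And>F'. finite F' \<Longrightarrow> F \<subseteq> F' \<Longrightarrow> F' \<subseteq> K \<Longrightarrow> zt n (s - sum g F')"
      using assms(1) unfolding has_hsum_def hfilt_zt by meson
    obtain G where G: "finite G" "G \<subseteq> K" "\<And>F'. finite F' \<Longrightarrow> G \<subseteq> F' \<Longrightarrow> F' \<subseteq> K \<Longrightarrow> zt n (t - sum g F')"
      using assms(2) unfolding has_hsum_def hfilt_zt by meson
    have "zt n (s - sum g (F \<union> G))" "zt n (t - sum g (F \<union> G))" using F(1,2) G(1,2) by (auto intro!: F(3) G(3))
    from zt_diff[OF this] show ?thesis by simp
  qed
  then show ?thesis using zt_all[of "s - t"] by simp
qed

lemma hsum_eqI: "has_hsum sc g K s \<Longrightarrow> hsum sc g K = s"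
  unfolding hsum_def by (rule the_equality) (auto dest: has_hsum_unique)

text \<open>Coordinate n of the sum is a finite sum, since only finitely many members survive modulo
  \<open>fps_X ^ Suc n\<close>. Surjectivity of \<open>co\<close> is the completeness of the
  module.\<close>

lemma has_hsum_hsum:
  assumes "sm g K" shows "has_hsum sc g K (hsum sc g K)"
proof -
  let ?F = "\<lambda>p. {x \<in> K. \<not> zt p (g x)}"
  obtain s where s: "co s = (\<lambda>n. \<Sum>x\<in>?F (Suc n). co (g x) n)" using co_surj by blast
  have "has_hsum sc g K s"
    unfolding has_hsum_def hfilt_zt
  proof (rule allI)
    fix n
    have "zt n (s - sum g F)" if F: "finite F" "?F n \<subseteq> F" "F \<subseteq> K" for F
      unfolding zt_def
    proof (intro allI impI)
      fix j assume j: "j < n"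
      have "(\<Sum>x\<in>?F (Suc j). co (g x) j) = (\<Sum>x\<in>F. co (g x) j)"
      proof (rule sum.mono_neutral_left)
        show "?F (Suc j) \<subseteq> F" using F(2) j zt_mono[of n _ "Suc j"] by (auto simp: subset_iff)
        show "\<forall>i\<in>F - ?F (Suc j). co (g i) j = 0" using F(3) by (auto simp: zt_def)
      qed fact
      then show "co (s - sum g F) j = 0" by (simp add: co_diff co_sum s)
    qed
    then show "\<exists>F0. finite F0 \<and> F0 \<subseteq> K \<and> (\<forall>F. finite F \<and> F0 \<subseteq> F \<and> F \<subseteq> K \<longrightarrow> zt n (s - sum g F))"
      using assms unfolding sm_def by (intro exI[of _ "?F n"]) blast
  qed
  from hsum_eqI[OF this] this show ?thesis by simp
qed

lemma zt_hsum_diff: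
  assumes "sm g K" "finite F" "F \<subseteq> K" "\<And>x. x \<in> K \<Longrightarrow> x \<notin> F \<Longrightarrow> zt p (g x)"
  shows "zt p (hsum sc g K - sum g F)"
proof -
  obtain F0 where F0: "finite F0" "F0 \<subseteq> K" "\<And>F'. finite F' \<Longrightarrow> F0 \<subseteq> F' \<Longrightarrow> F' \<subseteq> K \<Longrightarrow> zt p (hsum sc g K - sum g F')"
    using has_hsum_hsum[OF assms(1)] unfolding has_hsum_def hfilt_zt by meson
  have 1: "zt p (hsum sc g K - sum g (F \<union> F0))" using F0(1,2) assms(2,3) by (intro F0(3)) auto
  have 2: "sum g (F \<union> F0) = sum g F + sum g (F0 - F)"
    using sum.union_disjoint[of F "F0 - F" g] assms(2) F0(1) by auto
  have "zt p (sum g (F0 - F))" using assms(4) F0(2) by (intro zt_sum) auto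
  from zt_add[OF 1 this] show ?thesis by (simp add: 2)
qed

text \<open>The form in which limits are computed: for each p a single finite set serves both for
  the tail and for the value. Summability comes out as the first conclusion.\<close>

lemma hsum_eqI2:
  assumes "\<And>p. \<exists>F. finite F \<and> F \<subseteq> K \<and> (\<forall>x\<in>K - F. zt p (g x)) \<and> zt p (s - sum g F)"
  shows "sm g K" "hsum sc g K = s"
proof -
  show sm: "sm g K" unfolding sm_def
  proof
    fix p
    obtain F where "finite F" "F \<subseteq> K" "\<forall>x\<in>K - F. zt p (g x)" using assms by meson
    then show "finite {x \<in> K. \<not> zt p (g x)}" by (elim finite_subset[rotated]) auto
  qed
  have "zt p (hsum sc g K - s)" for p
  proof -
    obtain F where F: "finite F" "F \<subseteq> K" "\<forall>x\<in>K - F. zt p (g x)" "zt p (s - sum g F)" using assms by meson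
    have "zt p (hsum sc g K - sum g F)" by (rule zt_hsum_diff) (use F sm in auto)
    from zt_diff[OF this F(4)] show ?thesis by simp
  qed
  then show "hsum sc g K = s" using zt_all[of "hsum sc g K - s"] by simp
qed

lemma sm_obtain:
  assumes "sm g K" obtains F where "finite F" "F \<subseteq> K" "\<forall>x\<in>K - F. zt p (g x)" "zt p (hsum sc g K - sum g F)"
proof -
  let ?F = "{x \<in> K. \<not> zt p (g x)}"
  have "finite ?F" using assms by (auto simp: sm_def)
  then show thesis using zt_hsum_diff[OF assms, of ?F p] by (intro that[of ?F]) auto
qed

lemma sm_cong: "(\<And>x. x \<in> K \<Longrightarrow> g x = h x) \<Longrightarrow> sm g K \<longleftrightarrow> sm h K"
proof -
  assume "\<And>x. x \<in> K \<Longrightarrow> g x = h x"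
  then have "{x \<in> K. \<not> zt p (g x)} = {x \<in> K. \<not> zt p (h x)}" for p by auto
  then show ?thesis unfolding sm_def by simp
qed

lemma hsum_cong: "(\<And>x. x \<in> K \<Longrightarrow> g x = h x) \<Longrightarrow> hsum sc g K = hsum sc h K"
proof -
  assume a: "\<And>x. x \<in> K \<Longrightarrow> g x = h x"
  have "sum g F = sum h F" if "F \<subseteq> K" for F using a that by (intro sum.cong) auto
  then have "has_hsum sc g K s \<longleftrightarrow> has_hsum sc h K s" for s
    unfolding has_hsum_def by (simp cong: conj_cong)
  then have "has_hsum sc g K = has_hsum sc h K" by (rule ext)
  then show ?thesis unfolding hsum_def by simp
qed

lemma sm_add: assumes "sm g K" "sm h K" shows "sm (\<lambda>x. g x + h x) K"
  unfolding sm_def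
proof
  fix p
  have "{x \<in> K. \<not> zt p (g x + h x)} \<subseteq> {x \<in> K. \<not> zt p (g x)} \<union> {x \<in> K. \<not> zt p (h x)}" using zt_add by auto
  then show "finite {x \<in> K. \<not> zt p (g x + h x)}" using assms by (auto simp: sm_def elim: finite_subset)
qed

lemma sm_sc: assumes "sm g K" shows "sm (\<lambda>x. sc c (g x)) K"
  unfolding sm_def
proof
  fix p
  have "{x \<in> K. \<not> zt p (sc c (g x))} \<subseteq> {x \<in> K. \<not> zt p (g x)}" using zt_sc by auto
  then show "finite {x \<in> K. \<not> zt p (sc c (g x))}" using assms by (auto simp: sm_def elim: finite_subset)
qed

lemma sm_subset: "sm g K \<Longrightarrow> K' \<subseteq> K \<Longrightarrow> sm g K'"
  unfolding sm_def
proof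
  fix p assume a: "\<forall>p. finite {x \<in> K. \<not> zt p (g x)}" "K' \<subseteq> K"
  then have "{x \<in> K'. \<not> zt p (g x)} \<subseteq> {x \<in> K. \<not> zt p (g x)}" by auto
  then show "finite {x \<in> K'. \<not> zt p (g x)}" by (rule finite_subset) (use a in blast)
qed

text \<open>Additivity and preservation of the filtration suffice, so that scalars, negation and
  words of currents are all covered.\<close>

lemma hsum_linear:
  assumes sm: "sm g K" and "\<And>x y. L (x + y) = L x + L y" "\<And>p x. zt p x \<Longrightarrow> zt p (L x)"
  shows "sm (\<lambda>x. L (g x)) K" "hsum sc (\<lambda>x. L (g x)) K = L (hsum sc g K)"
proof -
  have L0: "L 0 = 0" using assms(2)[of 0 0] by simp
  have Ls: "L (sum g F) = (\<Sum>x\<in>F. L (g x))" for F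
    by (induction F rule: infinite_finite_induct) (auto simp: assms L0)
  have Ld: "L (x - y) = L x - L y" for x y using assms(2)[of "x - y" y] by simp
  have *: "\<exists>F. finite F \<and> F \<subseteq> K \<and> (\<forall>x\<in>K - F. zt p (L (g x))) \<and> zt p (L (hsum sc g K) - (\<Sum>x\<in>F. L (g x)))" for p
  proof -
    obtain F where F: "finite F" "F \<subseteq> K" "\<forall>x\<in>K - F. zt p (g x)" "zt p (hsum sc g K - sum g F)"
      using sm_obtain[OF sm, where p = p] by metis
    have "zt p (L (hsum sc g K - sum g F))" using F(4) assms(3) by blast
    then show ?thesis using F assms(3) by (intro exI[of _ F]) (auto simp: Ld Ls)
  qed
  show "sm (\<lambda>x. L (g x)) K" using hsum_eqI2[OF *] by simp
  show "hsum sc (\<lambda>x. L (g x)) K = L (hsum sc g K)" using hsum_eqI2[OF *] by simp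
qed

lemma hsum_sc: "sm g K \<Longrightarrow> hsum sc (\<lambda>x. sc c (g x)) K = sc c (hsum sc g K)"
  using hsum_linear[of g K "sc c"] scale_right_distrib zt_sc by blast

lemma hsum_add:
  assumes "sm g K" "sm h K" shows "hsum sc (\<lambda>x. g x + h x) K = hsum sc g K + hsum sc h K"
proof (rule hsum_eqI2)
  fix p
  obtain F where F: "finite F" "F \<subseteq> K" "\<forall>x\<in>K - F. zt p (g x)" "zt p (hsum sc g K - sum g F)"
    using sm_obtain[OF assms(1), where p = p] by metis
  obtain G where G: "finite G" "G \<subseteq> K" "\<forall>x\<in>K - G. zt p (h x)" "zt p (hsum sc h K - sum h G)"
    using sm_obtain[OF assms(2), where p = p] by metis
  have "zt p (hsum sc g K - sum g (F \<union> G))" "zt p (hsum sc h K - sum h (F \<union> G))"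
    by (rule zt_hsum_diff; use F G assms in auto)+
  from zt_add[OF this]
  have "zt p (hsum sc g K + hsum sc h K - (\<Sum>x\<in>F \<union> G. g x + h x))"
    by (simp add: sum.distrib algebra_simps)
  then show "\<exists>F. finite F \<and> F \<subseteq> K \<and> (\<forall>x\<in>K - F. zt p (g x + h x)) \<and>
     zt p (hsum sc g K + hsum sc h K - (\<Sum>x\<in>F. g x + h x))"
    using F G by (intro exI[of _ "F \<union> G"]) (auto intro: zt_add)
qed

lemma hsum_uminus: "sm g K \<Longrightarrow> sm (\<lambda>x. - g x) K" "sm g K \<Longrightarrow> hsum sc (\<lambda>x. - g x) K = - hsum sc g K"
  using hsum_linear[of g K uminus] zt_uminus by (auto simp: algebra_simps)

lemma hsum_diff:
  assumes "sm g K" "sm h K"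
  shows "sm (\<lambda>x. g x - h x) K" "hsum sc (\<lambda>x. g x - h x) K = hsum sc g K - hsum sc h K"
  using sm_add[OF assms(1) hsum_uminus(1)[OF assms(2)]] hsum_add[OF assms(1) hsum_uminus(1)[OF assms(2)]]
    hsum_uminus(2)[OF assms(2)] by auto

lemma sm_finite_support: "finite {x \<in> K. g x \<noteq> 0} \<Longrightarrow> sm g K"
proof -
  assume "finite {x \<in> K. g x \<noteq> 0}"
  then show ?thesis unfolding sm_def by (intro allI, rule finite_subset[of _ "{x \<in> K. g x \<noteq> 0}", rotated]) auto
qed

lemma hsum_finite:
  assumes "finite F" "F \<subseteq> K" "\<And>x. x \<in> K \<Longrightarrow> x \<notin> F \<Longrightarrow> g x = 0"
  shows "hsum sc g K = sum g F"
  by (rule hsum_eqI2) (use assms in \<open>auto intro!: exI[of _ F]\<close>)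

lemma hsum_0: "(\<And>x. x \<in> K \<Longrightarrow> g x = 0) \<Longrightarrow> hsum sc g K = 0"
  using hsum_finite[of "{}" K g] by auto

lemma sm_sum: "finite J \<Longrightarrow> (\<And>i. i \<in> J \<Longrightarrow> sm (g i) K) \<Longrightarrow> sm (\<lambda>x. \<Sum>i\<in>J. g i x) K"
  by (induction J rule: finite_induct) (auto intro: sm_add simp: sm_finite_support)

lemma hsum_sum: "finite J \<Longrightarrow> (\<And>i. i \<in> J \<Longrightarrow> sm (g i) K) \<Longrightarrow>
   hsum sc (\<lambda>x. \<Sum>i\<in>J. g i x) K = (\<Sum>i\<in>J. hsum sc (g i) K)"
  by (induction J rule: finite_induct) (auto simp: hsum_add sm_sum hsum_0)

lemma zt_hsum: "sm g K \<Longrightarrow> (\<And>x. x \<in> K \<Longrightarrow> zt p (g x)) \<Longrightarrow> zt p (hsum sc g K)"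
  using zt_hsum_diff[of g K "{}" p] by simp

lemma hsum_reindex:
  assumes b: "bij_betw t K' K"
  shows "sm (\<lambda>x. g (t x)) K' \<longleftrightarrow> sm g K"
    and "sm g K \<Longrightarrow> hsum sc (\<lambda>x. g (t x)) K' = hsum sc g K"
proof -
  have "bij_betw t {x \<in> K'. \<not> zt p (g (t x))} {x \<in> K. \<not> zt p (g x)}" for p
    using b unfolding bij_betw_def inj_on_def by auto
  then show "sm (\<lambda>x. g (t x)) K' \<longleftrightarrow> sm g K" unfolding sm_def using bij_betw_finite by blast
  assume sm: "sm g K"
  show "hsum sc (\<lambda>x. g (t x)) K' = hsum sc g K"
  proof (rule hsum_eqI2)
    fix p
    obtain F where F: "finite F" "F \<subseteq> K" "\<forall>x\<in>K - F. zt p (g x)" "zt p (hsum sc g K - sum g F)"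
      using sm_obtain[OF sm, where p = p] by metis
    define F' where "F' = {x \<in> K'. t x \<in> F}"
    have bb: "bij_betw t F' F" using b F(2) unfolding bij_betw_def inj_on_def F'_def by auto
    have "sum g F = (\<Sum>x\<in>F'. g (t x))" using sum.reindex_bij_betw[OF bb, of g] by simp
    moreover have "finite F'" using bb F(1) bij_betw_finite by blast
    ultimately show "\<exists>F. finite F \<and> F \<subseteq> K' \<and> (\<forall>x\<in>K' - F. zt p (g (t x))) \<and>
       zt p (hsum sc g K - (\<Sum>x\<in>F. g (t x)))"
      using F b by (intro exI[of _ F']) (auto simp: F'_def bij_betw_def)
  qed
qed

lemma hsum_split:
  assumes "sm g K" "K = A \<union> B" "A \<inter> B = {}" shows "hsum sc g K = hsum sc g A + hsum sc g B"
proof (rule hsum_eqI2)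
  fix p
  have sA: "sm g A" "sm g B" using assms sm_subset by auto
  obtain F where F: "finite F" "F \<subseteq> A" "\<forall>x\<in>A - F. zt p (g x)" "zt p (hsum sc g A - sum g F)"
    using sm_obtain[OF sA(1), where p = p] by metis
  obtain G where G: "finite G" "G \<subseteq> B" "\<forall>x\<in>B - G. zt p (g x)" "zt p (hsum sc g B - sum g G)"
    using sm_obtain[OF sA(2), where p = p] by metis
  have "sum g (F \<union> G) = sum g F + sum g G" using F G assms by (intro sum.union_disjoint) auto
  then have "zt p (hsum sc g A + hsum sc g B - sum g (F \<union> G))" using zt_add[OF F(4) G(4)] by (simp add: algebra_simps)
  then show "\<exists>F. finite F \<and> F \<subseteq> K \<and> (\<forall>x\<in>K - F. zt p (g x)) \<and> zt p (hsum sc g A + hsum sc g B - sum g F)"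
    using F G assms by (intro exI[of _ "F \<union> G"]) auto
qed

subsection \<open>Action of Laurent polynomials\<close>

abbreviation pt :: "lpoly \<Rightarrow> (expo \<Rightarrow> 'w) \<Rightarrow> expo \<Rightarrow> 'w" (infixr "\<bullet>" 70) where
  "p \<bullet> X \<equiv> poly_times sc p X"

lemma pt_superset:
  assumes "finite A" "ks p \<subseteq> A"
  shows "(p \<bullet> X) e = (\<Sum>k\<in>A. sc (lk p k) (X (e - k)))"
  unfolding poly_times_def by (rule sum.mono_neutral_left) (use assms in \<open>auto simp: in_keys_iff\<close>)

lemma pt_single: "(Poly_Mapping.single k c \<bullet> X) e = sc c (X (e - k))"
  by (subst pt_superset[of "{k}"]) auto

lemma pt_add: "(p + q) \<bullet> X = (\<lambda>e. (p \<bullet> X) e + (q \<bullet> X) e)"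
proof
  fix e
  let ?A = "ks p \<union> ks q"
  show "((p + q) \<bullet> X) e = (p \<bullet> X) e + (q \<bullet> X) e"
    by (subst (1 2 3) pt_superset[of ?A])
      (use keys_add[of p q] in \<open>auto simp: lookup_add scale_left_distrib sum.distrib\<close>)
qed

lemma pt_0 [simp]: "0 \<bullet> X = (\<lambda>e. 0)" by (auto simp: poly_times_def)

lemma pt_zero_right [simp]: "p \<bullet> (\<lambda>e. 0) = (\<lambda>e. 0)" by (auto simp: poly_times_def)

lemma pt_sum: "(\<Sum>i\<in>J. p i) \<bullet> X = (\<lambda>e. \<Sum>i\<in>J. (p i \<bullet> X) e)"
  by (induction J rule: infinite_finite_induct) (auto simp: pt_add)

lemma pt_add_right: "p \<bullet> (\<lambda>e. X e + Y e) = (\<lambda>e. (p \<bullet> X) e + (p \<bullet> Y) e)"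
  by (auto simp: poly_times_def scale_right_distrib sum.distrib)

lemma pt_sum_right: "p \<bullet> (\<lambda>e. \<Sum>i\<in>J. X i e) = (\<lambda>e. \<Sum>i\<in>J. (p \<bullet> X i) e)"
  by (induction J rule: infinite_finite_induct) (auto simp: pt_add_right)

lemma pt_single_single: "(Poly_Mapping.single k c * Poly_Mapping.single l b) \<bullet> X = Poly_Mapping.single k c \<bullet> (Poly_Mapping.single l b \<bullet> X)"
  by (auto simp: mult_single pt_single algebra_simps)

text \<open>Only finitely many monomials take part, so this associativity holds for arbitrary
  two-sided series, without decay. Associativity with infinite series is what fails in
  general.\<close>

lemma pt_mult: "(p * q) \<bullet> X = p \<bullet> (q \<bullet> X)"
proof -
  let ?s = "\<lambda>p k. Poly_Mapping.single k (lk p k) :: lpoly"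
  have "(p * q) \<bullet> X = ((\<Sum>k\<in>ks p. ?s p k) * (\<Sum>l\<in>ks q. ?s q l)) \<bullet> X"
    by (simp only: poly_mapping_sum_single[symmetric])
  also have "\<dots> = (\<lambda>e. \<Sum>k\<in>ks p. \<Sum>l\<in>ks q. (?s p k \<bullet> (?s q l \<bullet> X)) e)"
    unfolding sum_product by (simp only: pt_sum pt_single_single)
  also have "\<dots> = (\<Sum>k\<in>ks p. ?s p k) \<bullet> ((\<Sum>l\<in>ks q. ?s q l) \<bullet> X)"
    by (simp only: pt_sum pt_sum_right) (rule ext, rule sum.swap)
  also have "\<dots> = p \<bullet> (q \<bullet> X)"
    by (simp only: poly_mapping_sum_single[symmetric])
  finally show ?thesis .
qed

lemma pt_commute: "p \<bullet> (q \<bullet> X) = q \<bullet> (p \<bullet> X)"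
  by (simp add: pt_mult[symmetric] mult.commute)

lemma pt_uminus: "(- p) \<bullet> X = (\<lambda>e. - (p \<bullet> X) e)"
  by (auto simp: poly_times_def sum_negf)

lemma pt_diff: "(p - q) \<bullet> X = (\<lambda>e. (p \<bullet> X) e - (q \<bullet> X) e)"
  using pt_add[of p "- q" X] by (simp add: pt_uminus)

lemma pt_uminus_right: "p \<bullet> (\<lambda>e. - X e) = (\<lambda>e. - (p \<bullet> X) e)"
  by (auto simp: poly_times_def sum_negf)

lemma pt_diff_right: "p \<bullet> (\<lambda>e. X e - Y e) = (\<lambda>e. (p \<bullet> X) e - (p \<bullet> Y) e)"
  using pt_add_right[of p X "\<lambda>e. - Y e"] by (simp add: pt_uminus_right)

lemma pt_Cst: "Cst c \<bullet> X = (\<lambda>e. sc c (X e))"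
  by (auto simp: Cst_def pt_single)

lemma pt_1 [simp]: "1 \<bullet> X = X"
  using pt_Cst[of 1 X] by (simp add: Cst_def)

end

lemma Cst_mult: "Cst (a * b) = Cst a * Cst b" by (simp add: Cst_def mult_single)
lemma Cst_add: "Cst (a + b) = Cst a + Cst b" by (simp add: Cst_def single_add)
lemma Cst_uminus: "Cst (- a) = - Cst a" by (simp add: Cst_def single_uminus)
lemma Cst_0 [simp]: "Cst 0 = 0" by (simp add: Cst_def)
lemma Cst_1 [simp]: "Cst 1 = 1" by (simp add: Cst_def)
lemma Cst_power: "Cst (a ^ n) = Cst a ^ n" by (induction n) (auto simp: Cst_mult)
lemma Var_power: "Var a ^ n = Poly_Mapping.single (Poly_Mapping.single a (int n)) 1"
  by (induction n) (auto simp: Var_def mult_single single_add[symmetric] algebra_simps)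

section \<open>Linear forms and the decay of two-sided series\<close>

abbreviation sg :: "nat \<Rightarrow> int \<Rightarrow> expo" where "sg \<equiv> Poly_Mapping.single"

definition lf :: "nat \<Rightarrow> nat \<Rightarrow> complex fps \<Rightarrow> nat \<Rightarrow> lpoly" where
  "lf d a c b = Var a ^ d - Cst c * Var b ^ d"

definition esum :: "nat set \<Rightarrow> expo \<Rightarrow> int" where
  "esum U e = (\<Sum>v\<in>U. lk e v)"

lemma esum_add: "esum U (e + f) = esum U e + esum U f"
  by (simp add: esum_def lookup_add sum.distrib)
lemma esum_diff: "esum U (e - f) = esum U e - esum U f"
  by (simp add: esum_def lookup_minus sum_subtractf)
lemma esum_sg: "finite U \<Longrightarrow> esum U (sg a t) = (if a \<in> U then t else 0)"
  by (auto simp: esum_def lookup_single when_def)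
lemma esum_single: "esum {v} e = lk e v"
  by (simp add: esum_def)

definition ipw :: "complex fps \<Rightarrow> int \<Rightarrow> complex fps" where
  "ipw c n = (if n \<ge> 0 then c ^ nat n else inverse c ^ nat (- n))"

lemma fps_unit_inverse: "unit0 c \<Longrightarrow> inverse c * c = (1 :: complex fps)"
  "unit0 c \<Longrightarrow> c * inverse c = (1 :: complex fps)"
  by (auto simp: inverse_mult_eq_1 inverse_mult_eq_1')

lemma ipw_0 [simp]: "ipw c 0 = 1" by (simp add: ipw_def)

lemma ipw_Suc:
  assumes "unit0 c" shows "ipw c (n + 1) = c * ipw c n"
proof (cases "n \<ge> 0")
  case True then show ?thesis by (simp add: ipw_def nat_add_distrib)
next
  case False
  define m where "m = nat (- n - 1)"
  have n: "n = - int (Suc m)" using False by (simp add: m_def)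
  show ?thesis
  proof (cases m)
    case 0 then show ?thesis using fps_unit_inverse[OF assms] by (simp add: ipw_def n)
  next
    case (Suc k)
    have "c * ipw c n = (c * inverse c) * inverse c ^ m"
      by (simp add: ipw_def n nat_add_distrib mult.assoc)
    then show ?thesis using Suc fps_unit_inverse[OF assms] by (simp add: ipw_def n nat_add_distrib)
  qed
qed

lemma ipw_unit: "unit0 c \<Longrightarrow> unit0 (ipw c n)"
  by (auto simp: ipw_def fps_nth_power_0)

lemma fps_unit_prod: "(\<And>x. x \<in> A \<Longrightarrow> unit0 (g x)) \<Longrightarrow> fps_nth (prod g A) 0 \<noteq> (0::complex)"
  by (induction A rule: infinite_finite_induct) auto

locale hmodule_step = hmodule sc s0 co
  for sc :: "complex fps \<Rightarrow> 'w \<Rightarrow> 'w::ab_group_add"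
    and s0 :: "complex \<Rightarrow> 'v \<Rightarrow> 'v::ab_group_add" and co :: "'w \<Rightarrow> nat \<Rightarrow> 'v" +
  fixes d :: nat
  assumes d_pos: "0 < d"
begin

lemma pt_Var_d: "(Var a ^ d \<bullet> X) e = X (e - sg a (int d))"
  by (simp add: Var_power pt_single)

lemma pt_lf: "(lf d a c b \<bullet> X) e = X (e - sg a (int d)) - sc c (X (e - sg b (int d)))"
  by (simp add: lf_def pt_diff pt_mult pt_Cst pt_Var_d)

text \<open>The total degree in U is bounded below, not each exponent, and only modulo each power of
  \<open>fps_X\<close>. Such a bound survives division by forms whose edges do not leave U.\<close>

definition Bd :: "nat set \<Rightarrow> (expo \<Rightarrow> 'w) \<Rightarrow> bool" where
  "Bd U X \<longleftrightarrow> (\<forall>p. \<exists>N. \<forall>e. esum U e < N \<longrightarrow> zt p (X e))"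

text \<open>One step trades z_b^d for z_a^d: multiplication by z_a^d - c z_b^d compares coefficients
  whose exponents differ by \<open>mv a b 1\<close>.\<close>

definition mv :: "nat \<Rightarrow> nat \<Rightarrow> nat \<Rightarrow> expo" where
  "mv a b j = sg a (int j * int d) - sg b (int j * int d)"

text \<open>Decay in the direction in which the inverse of $z_a^d-cz_b^d$ is expanded.\<close>

definition FD :: "nat \<Rightarrow> nat \<Rightarrow> (expo \<Rightarrow> 'w) \<Rightarrow> bool" where
  "FD a b X \<longleftrightarrow> (\<forall>e p. \<exists>J. \<forall>j\<ge>J. zt p (X (e + mv a b j)))"

lemma mv_0 [simp]: "mv a b 0 = 0" by (simp add: mv_def)
lemma mv_add: "mv a b (i + j) = mv a b i + mv a b j"
  by (simp add: mv_def single_add algebra_simps)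
lemma mv_Suc: "mv a b (Suc j) = mv a b j + sg a (int d) - sg b (int d)"
  using mv_add[of a b j 1] by (simp add: mv_def algebra_simps)
lemma esum_mv: "finite U \<Longrightarrow> esum U (mv a b j) = (if a \<in> U then int j * int d else 0) - (if b \<in> U then int j * int d else 0)"
  by (simp add: mv_def esum_diff esum_sg)

lemma Bd_zero [simp]: "Bd U (\<lambda>e. 0)" by (simp add: Bd_def)

lemma Bd_add: assumes "Bd U X" "Bd U Y" shows "Bd U (\<lambda>e. X e + Y e)"
  unfolding Bd_def
proof
  fix p
  obtain M N where "\<And>e. esum U e < M \<Longrightarrow> zt p (X e)" "\<And>e. esum U e < N \<Longrightarrow> zt p (Y e)"
    using assms by (metis Bd_def)
  then show "\<exists>N. \<forall>e. esum U e < N \<longrightarrow> zt p (X e + Y e)"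
    by (intro exI[of _ "min M N"]) (auto intro: zt_add)
qed

lemma Bd_sc: assumes "Bd U X" shows "Bd U (\<lambda>e. sc c (X e))"
  using assms zt_sc unfolding Bd_def by meson

lemma Bd_uminus: assumes "Bd U X" shows "Bd U (\<lambda>e. - X e)"
  using assms zt_uminus unfolding Bd_def by meson

lemma Bd_diff: "Bd U X \<Longrightarrow> Bd U Y \<Longrightarrow> Bd U (\<lambda>e. X e - Y e)"
  using Bd_add[of U X "\<lambda>e. - Y e"] Bd_uminus by simp

lemma Bd_shift: assumes "Bd U X" shows "Bd U (\<lambda>e. X (e - k))"
  unfolding Bd_def
proof
  fix p
  obtain N where "\<And>e. esum U e < N \<Longrightarrow> zt p (X e)" using assms by (metis Bd_def)
  then show "\<exists>N. \<forall>e. esum U e < N \<longrightarrow> zt p (X (e - k))"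
    by (intro exI[of _ "N + esum U k"]) (auto simp: esum_diff)
qed

lemma Bd_sum: "(\<And>i. i \<in> J \<Longrightarrow> Bd U (X i)) \<Longrightarrow> Bd U (\<lambda>e. \<Sum>i\<in>J. X i e)"
  by (induction J rule: infinite_finite_induct) (auto intro: Bd_add)

lemma Bd_pt: "Bd U X \<Longrightarrow> Bd U (p \<bullet> X)"
  unfolding poly_times_def by (intro Bd_sum Bd_sc Bd_shift)

lemma FD_add: assumes "FD a b X" "FD a b Y" shows "FD a b (\<lambda>e. X e + Y e)"
  unfolding FD_def
proof (intro allI)
  fix e p
  obtain I J where "\<And>j. j \<ge> I \<Longrightarrow> zt p (X (e + mv a b j))" "\<And>j. j \<ge> J \<Longrightarrow> zt p (Y (e + mv a b j))"
    using assms by (metis FD_def)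
  then show "\<exists>J. \<forall>j\<ge>J. zt p (X (e + mv a b j) + Y (e + mv a b j))"
    by (intro exI[of _ "max I J"]) (auto intro: zt_add)
qed

lemma FD_zero [simp]: "FD a b (\<lambda>e. 0)" by (simp add: FD_def)
lemma FD_sc: "FD a b X \<Longrightarrow> FD a b (\<lambda>e. sc c (X e))"
  using zt_sc unfolding FD_def by meson
lemma FD_sum: "(\<And>i. i \<in> J \<Longrightarrow> FD a b (X i)) \<Longrightarrow> FD a b (\<lambda>e. \<Sum>i\<in>J. X i e)"
  by (induction J rule: infinite_finite_induct) (auto intro: FD_add)
lemma FD_shift: assumes "FD a b X" shows "FD a b (\<lambda>e. X (e - k))"
  unfolding FD_def
proof (intro allI)
  fix e p
  obtain J where "\<And>j. j \<ge> J \<Longrightarrow> zt p (X ((e - k) + mv a b j))" using assms by (metis FD_def)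
  then show "\<exists>J. \<forall>j\<ge>J. zt p (X (e + mv a b j - k))" by (intro exI[of _ J]) (simp add: algebra_simps)
qed
lemma FD_pt: "FD a b X \<Longrightarrow> FD a b (p \<bullet> X)"
  unfolding poly_times_def by (intro FD_sum FD_sc FD_shift)

text \<open>Moving weight from b inside U to a outside U lowers the degree in U without
  bound.\<close>

lemma FD_Bd:
  assumes "Bd U X" "finite U" "a \<notin> U" "b \<in> U" shows "FD a b X"
  unfolding FD_def
proof (intro allI)
  fix e p
  obtain N where N: "\<And>e. esum U e < N \<Longrightarrow> zt p (X e)" using assms(1) by (metis Bd_def)
  have "zt p (X (e + mv a b j))" if "j \<ge> nat (esum U e - N + 1)" for j
  proof (rule N)
    have "esum U e - N + 1 \<le> int j" using that by simp
    also have "\<dots> \<le> int j * int d" using mult_left_mono[of 1 "int d" "int j"] d_pos by simp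
    finally show "esum U (e + mv a b j) < N" using assms by (simp add: esum_add esum_mv)
  qed
  then show "\<exists>J. \<forall>j\<ge>J. zt p (X (e + mv a b j))" by blast
qed

subsection \<open>Division by linear forms\<close>

text \<open>The geometric series for the inverse of the form, stopped after J terms, with its
  remainder. It iterates the definition of the product solved for the coefficient at e.\<close>

lemma lf_unroll:
  "X e = (\<Sum>j<J. sc (c ^ j) ((lf d a c b \<bullet> X) (e + sg a (int d) + mv a b j))) + sc (c ^ J) (X (e + mv a b J))"
proof (induction J)
  case (Suc J)
  have "sc (c ^ J) (X (e + mv a b J)) = sc (c ^ J) ((lf d a c b \<bullet> X) (e + sg a (int d) + mv a b J))
    + sc (c ^ Suc J) (X (e + mv a b (Suc J)))"
    by (simp add: pt_lf mv_Suc scale_right_diff_distrib algebra_simps)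
  with Suc show ?case by (simp add: add.assoc)
qed auto

text \<open>In \<open>lf_unroll\<close> the arguments never exceed e by more than d in the degree of
  U, because a move raises this degree only if a is in U and b is not. Decay of X disposes of the
  remainder.\<close>

lemma Bd_div:
  assumes fd: "FD a b X" and bd: "Bd U (lf d a c b \<bullet> X)" and U: "finite U" "a \<in> U \<Longrightarrow> b \<in> U"
  shows "Bd U X"
  unfolding Bd_def
proof
  fix p
  obtain N where N: "\<And>e. esum U e < N \<Longrightarrow> zt p ((lf d a c b \<bullet> X) e)" using bd by (metis Bd_def)
  have "zt p (X e)" if e: "esum U e < N - int d" for e
  proof -
    obtain J where J: "zt p (X (e + mv a b J))" using fd unfolding FD_def by (meson order_refl)
    have "zt p ((lf d a c b \<bullet> X) (e + sg a (int d) + mv a b j))" for j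
    proof (rule N)
      obtain t where t: "t = int j * int d" "0 \<le> t" by simp
      show "esum U (e + sg a (int d) + mv a b j) < N"
        using e U t(2) unfolding esum_add esum_mv[OF U(1)] esum_sg[OF U(1)] t(1)[symmetric]
        by (cases "a \<in> U"; cases "b \<in> U") simp_all
    qed
    then show ?thesis using J by (subst lf_unroll[where J=J and c=c and a=a and b=b]) (intro zt_add zt_sum zt_sc; simp)
  qed
  then show "\<exists>N. \<forall>e. esum U e < N \<longrightarrow> zt p (X e)" by blast
qed

text \<open>All terms of the unrolled sum vanish and the remainder tends to zero. Without decay, for
  a unit c, delta series would lie in the kernel.\<close>

lemma lf_inj:
  assumes fd: "FD a b X" and z: "lf d a c b \<bullet> X = (\<lambda>e. 0)"
  shows "X = (\<lambda>e. 0)"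
proof
  fix e
  show "X e = 0"
  proof (rule zt_all)
    fix p
    obtain J where J: "zt p (X (e + mv a b J))" using fd unfolding FD_def by (meson order_refl)
    then show "zt p (X e)" by (subst lf_unroll[where J=J and c=c and a=a and b=b]) (simp add: z zt_sc)
  qed
qed

lemma lf_inj2:
  assumes "FD a b X" "FD a b Y" and "lf d a c b \<bullet> X = lf d a c b \<bullet> Y"
  shows "X = Y"
proof -
  have "FD a b (\<lambda>e. X e - Y e)" using FD_add[OF assms(1) FD_sc[OF assms(2), of "-1"]] by simp
  moreover have "lf d a c b \<bullet> (\<lambda>e. X e - Y e) = (\<lambda>e. 0)" using assms(3) by (simp add: pt_diff_right)
  ultimately have "(\<lambda>e. X e - Y e) = (\<lambda>e. 0)" by (rule lf_inj)
  then show ?thesis by (metis eq_iff_diff_eq_0 ext)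
qed

lemma sm_nat: assumes "\<And>p. \<exists>J. \<forall>j\<ge>J. zt p (g j)" shows "sm g (UNIV :: nat set)"
  unfolding sm_def
proof
  fix p
  obtain J where "\<forall>j\<ge>J. zt p (g j)" using assms by blast
  then have "{x \<in> UNIV. \<not> zt p (g x)} \<subseteq> {..<J}" by (auto simp: not_less[symmetric])
  then show "finite {x \<in> UNIV. \<not> zt p (g x)}" by (rule finite_subset) simp
qed

lemma hsum_nat_Suc: assumes "sm g (UNIV :: nat set)"
  shows "hsum sc g UNIV = g 0 + hsum sc (\<lambda>j. g (Suc j)) UNIV" "sm (\<lambda>j. g (Suc j)) UNIV"
proof -
  have "n \<in> {0} \<union> range Suc" for n by (cases n) auto
  then have U: "UNIV = {0} \<union> range Suc" by blast
  have b: "bij_betw Suc UNIV (range Suc)" by (simp add: bij_betw_def)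
  have s: "sm g (range Suc)" using assms sm_subset by blast
  have "hsum sc g UNIV = hsum sc g {0} + hsum sc g (range Suc)" by (rule hsum_split[OF assms U]) auto
  also have "hsum sc g {0} = g 0" using hsum_finite[of "{0}" "{0}" g] by simp
  also have "hsum sc g (range Suc) = hsum sc (\<lambda>j. g (Suc j)) UNIV" using hsum_reindex(2)[OF b s] by simp
  finally show "hsum sc g UNIV = g 0 + hsum sc (\<lambda>j. g (Suc j)) UNIV" .
  show "sm (\<lambda>j. g (Suc j)) UNIV" using hsum_reindex(1)[OF b, of g] s by simp
qed

text \<open>The quotient is the geometric series itself. Decay of X makes it summable and is
  inherited by the sum.\<close>

lemma lf_exists:
  assumes fd: "FD a b X"
  shows "\<exists>Y. lf d a c b \<bullet> Y = X \<and> FD a b Y"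
proof -
  let ?g = "\<lambda>e j. sc (c ^ j) (X (e + mv a b j))"
  have sm: "sm (?g e) UNIV" for e
    by (rule sm_nat) (use fd in \<open>auto simp: FD_def intro: zt_sc\<close>, meson zt_sc)
  define Y where "Y e = hsum sc (?g (e + sg a (int d))) UNIV" for e
  have "(lf d a c b \<bullet> Y) e = X e" for e
  proof -
    have "hsum sc (?g e) UNIV = X e + hsum sc (\<lambda>j. sc c (?g (e - sg b (int d) + sg a (int d)) j)) UNIV"
      unfolding hsum_nat_Suc(1)[OF sm] by (simp add: mv_Suc algebra_simps)
    also have "\<dots> = X e + sc c (Y (e - sg b (int d)))"
      unfolding Y_def by (subst hsum_sc[OF sm]) simp
    finally show ?thesis by (simp add: pt_lf Y_def)
  qed
  moreover have "FD a b Y"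
    unfolding FD_def
  proof (intro allI)
    fix e p
    obtain J where J: "\<And>j. j \<ge> J \<Longrightarrow> zt p (X (e + sg a (int d) + mv a b j))" using fd by (metis FD_def)
    have "zt p (Y (e + mv a b k))" if "k \<ge> J" for k
      unfolding Y_def
    proof (rule zt_hsum[OF sm])
      fix j
      have "zt p (X (e + sg a (int d) + mv a b (k + j)))" using that by (intro J) simp
      then show "zt p (?g (e + mv a b k + sg a (int d)) j)" by (intro zt_sc) (simp add: mv_add algebra_simps)
    qed
    then show "\<exists>J. \<forall>j\<ge>J. zt p (Y (e + mv a b j))" by blast
  qed
  ultimately show ?thesis by auto
qed

end

lemma dvd_minus_mult_iff:
  fixes n x k :: int
  shows "n dvd x - k * n \<longleftrightarrow> n dvd x" "n dvd x - n \<longleftrightarrow> n dvd x"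
proof -
  show "n dvd x - k * n \<longleftrightarrow> n dvd x" for k using dvd_add_left_iff[of n "k * n" "x - k * n"] by simp
  from this[of 1] show "n dvd x - n \<longleftrightarrow> n dvd x" by simp
qed

section \<open>Series bounded below in every variable, and division with remainder\<close>

locale hmodule_vars = hmodule_step sc s0 co d
  for sc :: "complex fps \<Rightarrow> 'w \<Rightarrow> 'w::ab_group_add"
    and s0 :: "complex \<Rightarrow> 'v \<Rightarrow> 'v::ab_group_add" and co :: "'w \<Rightarrow> nat \<Rightarrow> 'v" and d :: nat +
  fixes V Z :: "nat set"
  assumes fin_V: "finite V" and Z_V: "Z \<subseteq> V"
begin

text \<open>The space in which normally ordered products live. Z holds the variables of the currents
  x_i, whose modes vanish off the multiples of d; the variable of x_j will be in V only.\<close>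

definition BB :: "(expo \<Rightarrow> 'w) \<Rightarrow> bool" where
  "BB X \<longleftrightarrow> (\<forall>v\<in>V. Bd {v} X) \<and> (\<forall>e. X e \<noteq> 0 \<longrightarrow> (\<forall>a\<in>Z. int d dvd lk e a))"

lemma BB_zero [simp]: "BB (\<lambda>e. 0)" by (simp add: BB_def)

lemma BB_add: "BB X \<Longrightarrow> BB Y \<Longrightarrow> BB (\<lambda>e. X e + Y e)"
  unfolding BB_def using Bd_add by (metis add.right_neutral add.left_neutral)

lemma BB_sc: "BB X \<Longrightarrow> BB (\<lambda>e. sc c (X e))"
  unfolding BB_def using Bd_sc by (metis scale_zero_right)

lemma BB_sum: "(\<And>i. i \<in> J \<Longrightarrow> BB (X i)) \<Longrightarrow> BB (\<lambda>e. \<Sum>i\<in>J. X i e)"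
  by (induction J rule: infinite_finite_induct) (auto intro: BB_add)

lemma BB_diff: "BB X \<Longrightarrow> BB Y \<Longrightarrow> BB (\<lambda>e. X e - Y e)"
  using BB_add[of X "\<lambda>e. - Y e"] BB_sc[of Y "-1"] by simp

lemma BB_shift:
  assumes "BB X" shows "BB (\<lambda>e. X (e - sg a (int d)))"
proof -
  have "Bd {v} (\<lambda>e. X (e - sg a (int d)))" if "v \<in> V" for v
    using assms that by (auto simp: BB_def intro: Bd_shift)
  moreover have "int d dvd lk e b" if "X (e - sg a (int d)) \<noteq> 0" "b \<in> Z" for e b
  proof -
    have "int d dvd lk (e - sg a (int d)) b" using assms that by (auto simp: BB_def)
    then show ?thesis by (cases "a = b") (auto simp: lookup_minus lookup_single when_def dvd_minus_mult_iff)
  qed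
  ultimately show ?thesis by (auto simp: BB_def)
qed

lemma BB_lf: "BB X \<Longrightarrow> BB (lf d a c b \<bullet> X)"
  unfolding pt_lf[abs_def] by (intro BB_diff BB_shift BB_sc)

lemma zt_esum:
  assumes "BB X" "U \<subseteq> V" shows "\<exists>N. (\<forall>e. (\<exists>v\<in>U. lk e v < N) \<longrightarrow> zt p (X e))"
proof -
  have "\<exists>N. \<forall>e. lk e v < N \<longrightarrow> zt p (X e)" if "v \<in> U" for v
    using assms that unfolding BB_def Bd_def esum_single by blast
  then obtain N where N: "\<And>v e. v \<in> U \<Longrightarrow> lk e v < N v \<Longrightarrow> zt p (X e)" by metis
  have fin: "finite U" using assms(2) fin_V finite_subset by blast
  show ?thesis
  proof (intro exI allI impI)
    fix e assume "\<exists>v\<in>U. lk e v < Min (insert 0 (N ` U))"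
    then obtain v where "v \<in> U" "lk e v < N v"
      using fin by auto
    then show "zt p (X e)" by (rule N)
  qed
qed

lemma BB_Bd: assumes "BB X" "U \<subseteq> V" shows "Bd U X"
  unfolding Bd_def
proof
  fix p
  obtain N where N: "\<And>e v. v \<in> U \<Longrightarrow> lk e v < N \<Longrightarrow> zt p (X e)"
    using zt_esum[OF assms, of p] by blast
  show "\<exists>N. \<forall>e. esum U e < N \<longrightarrow> zt p (X e)"
  proof (intro exI allI impI)
    fix e assume "esum U e < (\<Sum>v\<in>U. N)"
    then obtain v where "v \<in> U" "lk e v < N" unfolding esum_def by (meson not_less sum_mono)
    then show "zt p (X e)" by (rule N)
  qed
qed

lemma BB_FD: "BB X \<Longrightarrow> b \<in> V \<Longrightarrow> a \<noteq> b \<Longrightarrow> FD a b X"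
  by (rule FD_Bd[of "{b}"]) (auto simp: BB_def)

text \<open>Euclidean division in z_a^d. At nonnegative exponents of z_a the quotient is the series
  expanded in negative powers of z_a, at negative exponents the one expanded the other way, so that
  both tails cancel. The last clause, that no new variable enters, is what allows division by
  several forms in succession.\<close>

lemma divrem:
  assumes X: "BB X" and aV: "a \<in> V" and b: "b \<in> V" and ab: "a \<noteq> b" and c: "unit0 c"
  shows "\<exists>Q R. BB Q \<and> BB R \<and> X = (\<lambda>e. (lf d a c b \<bullet> Q) e + R e) \<and>
     (\<forall>e. R e \<noteq> 0 \<longrightarrow> 0 \<le> lk e a \<and> lk e a < int d) \<and>
     (\<forall>v. v \<noteq> a \<longrightarrow> v \<noteq> b \<longrightarrow> (\<forall>e. X e \<noteq> 0 \<longrightarrow> lk e v = 0) \<longrightarrow>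
        (\<forall>e. Q e \<noteq> 0 \<longrightarrow> lk e v = 0) \<and> (\<forall>e. R e \<noteq> 0 \<longrightarrow> lk e v = 0))"
proof -
  let ?L = lk
  have ba: "b \<noteq> a" using ab by auto
  note lk = lookup_add lookup_minus lookup_single when_def mv_def dvd_minus_mult_iff
  let ?g = "\<lambda>e j. sc (c ^ j) (X (e + mv a b j))"
  let ?h = "\<lambda>e j. sc (inverse c ^ j) (X (e + mv b a j))"
  have smg: "sm (?g e) UNIV" for e
    by (rule sm_nat) (use BB_FD[OF X b ab] in \<open>auto simp: FD_def\<close>, meson zt_sc)
  have smh: "sm (?h e) UNIV" for e
    by (rule sm_nat) (use BB_FD[OF X aV ba] in \<open>auto simp: FD_def\<close>, meson zt_sc)
  have cc: "c * inverse c = 1" "inverse c * c = 1" using fps_unit_inverse[OF c] by auto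
  define G where "G e = hsum sc (?g e) UNIV" for e
  define H where "H e = hsum sc (?h e) UNIV" for e
  have G: "G e = X e + sc c (G (e + sg a (int d) - sg b (int d)))" for e
  proof -
    have "G e = X e + hsum sc (\<lambda>j. sc c (?g (e + sg a (int d) - sg b (int d)) j)) UNIV"
      unfolding G_def hsum_nat_Suc(1)[OF smg] by (simp add: mv_Suc algebra_simps)
    then show ?thesis unfolding G_def by (simp only: hsum_sc[OF smg])
  qed
  have H: "H e = X e + sc (inverse c) (H (e - sg a (int d) + sg b (int d)))" for e
  proof -
    have "H e = X e + hsum sc (\<lambda>j. sc (inverse c) (?h (e - sg a (int d) + sg b (int d)) j)) UNIV"
      unfolding H_def hsum_nat_Suc(1)[OF smh] by (simp add: mv_Suc algebra_simps)
    then show ?thesis unfolding H_def by (simp only: hsum_sc[OF smh])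
  qed
  \<comment> \<open>With the switch at exponent 0, R can be nonzero only where the exponent of z_a
    is nonnegative but becomes negative after subtracting d.\<close>
  define Q where "Q e = (if ?L e a \<ge> 0 then G (e + sg a (int d)) else - sc (inverse c) (H (e + sg b (int d))))" for e
  define R where "R e = X e - (lf d a c b \<bullet> Q) e" for e
  have X0: "X e = 0" if "\<not> int d dvd ?L e v" "v \<in> Z" for e v using X that by (auto simp: BB_def)
  have dsG: "G e = 0" if "\<not> int d dvd ?L e v" "v \<in> Z" for e v
    unfolding G_def
  proof (rule hsum_0)
    fix j
    have "\<not> int d dvd ?L (e + mv a b j) v" using that by (auto simp: lk)
    then show "?g e j = 0" using X0[OF _ that(2)] by simp
  qed
  have dsH: "H e = 0" if "\<not> int d dvd ?L e v" "v \<in> Z" for e v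
    unfolding H_def
  proof (rule hsum_0)
    fix j
    have "\<not> int d dvd ?L (e + mv b a j) v" using that by (auto simp: lk)
    then show "?h e j = 0" using X0[OF _ that(2)] by simp
  qed
  have dsQ: "Q e = 0" if "\<not> int d dvd ?L e v" "v \<in> Z" for e v
  proof -
    have "\<not> int d dvd ?L (e + sg a (int d)) v" "\<not> int d dvd ?L (e + sg b (int d)) v"
      using that by (auto simp: lk)
    then show ?thesis unfolding Q_def using dsG[OF _ that(2)] dsH[OF _ that(2)] by simp
  qed
  have R0: "R e = 0" if e: "\<not> (0 \<le> ?L e a \<and> ?L e a < int d)" for e
  proof -
    have La: "?L (e - sg a (int d)) a = ?L e a - int d" "?L (e - sg b (int d)) a = ?L e a"
      using ab by (auto simp: lk)
    show ?thesis
    proof (cases "?L e a > 0")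
      case True2: True
      then have "?L e a \<ge> int d" using e by simp
      then show ?thesis
        unfolding R_def pt_lf Q_def La using True2 G[of e] by (simp add: algebra_simps)
    next
      case False
      then have "?L e a < 0" using e d_pos by auto
      then show ?thesis
        unfolding R_def pt_lf Q_def La using H[of e] d_pos cc
        by (simp add: algebra_simps)
           (metis (no_types, lifting) scale_one scale_scale scale_right_distrib add.commute H mult.commute add_diff_eq diff_add_eq)
    qed
  qed
  have BBQ: "BB Q"
  proof -
    have "Bd {v} Q" if v: "v \<in> V" for v
      unfolding Bd_def esum_single
    proof
      fix p
      obtain N where N: "\<And>e v. v \<in> V \<Longrightarrow> ?L e v < N \<Longrightarrow> zt p (X e)" using zt_esum[OF X subset_refl, of p] by blast
      have zG: "zt p (G e)" if e: "v \<noteq> a" "?L e v < N" for e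
        unfolding G_def
      proof (intro zt_hsum[OF smg] zt_sc N[OF v])
        fix j
        obtain t where t: "t = int j * int d" "0 \<le> t" by simp
        then show "?L (e + mv a b j) v < N" using e t(2) unfolding mv_def t(1)[symmetric] by (auto simp: lookup_add lookup_minus lookup_single when_def)
      qed
      \<comment> \<open>The descent in z_a matters only while its exponent stays at least N, so the
        exponent of z_b can grow by at most -N; the summand \<open>min 0 (N - int d)\<close> absorbs
        this.\<close>
      have zH: "zt p (H e)" if e: "?L e a \<le> 0" "?L e v < N + min 0 (N - int d)" for e
        unfolding H_def
      proof (intro zt_hsum[OF smh] zt_sc)
        fix j
        define t where "t = int j * int d"
        have t0: "0 \<le> t" by (simp add: t_def)
        have Le: "?L (e + mv b a j) v = ?L e v + (if v = b then t else 0) - (if v = a then t else 0)"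
          "?L (e + mv b a j) a = ?L e a - t" using ab by (auto simp: lk t_def)
        show "zt p (X (e + mv b a j))"
        proof (cases "?L e a - t < N")
          case True then show ?thesis using N[OF aV, of "e + mv b a j"] Le by simp
        next
          case False
          then have "?L (e + mv b a j) v < N" using e t0 unfolding Le by (auto split: if_splits)
          then show ?thesis using N[OF v] by blast
        qed
      qed
      have "zt p (Q e)" if e: "?L e v < min 0 (N + min 0 (N - int d) - int d)" for e
      proof (cases "?L e a \<ge> 0")
        case True
        then have va: "v \<noteq> a" using e by auto
        then have "?L (e + sg a (int d)) v < N" using e by (auto simp: lk)
        then show ?thesis using zG[OF va] True by (simp add: Q_def)
      next
        case False
        then have "?L (e + sg b (int d)) a \<le> 0" "?L (e + sg b (int d)) v < N + min 0 (N - int d)"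
          using ab e by (auto simp: lk)
        from zH[OF this] show ?thesis using False by (simp add: Q_def zt_uminus zt_sc)
      qed
      then show "\<exists>N. \<forall>e. ?L e v < N \<longrightarrow> zt p (Q e)" by blast
    qed
    then show ?thesis unfolding BB_def using dsQ by blast
  qed
  have Qs: "\<forall>e. Q e \<noteq> 0 \<longrightarrow> ?L e v = 0" if v: "v \<noteq> a" "v \<noteq> b" and Xv: "\<forall>e. X e \<noteq> 0 \<longrightarrow> ?L e v = 0" for v
  proof (intro allI impI)
    fix e assume q: "Q e \<noteq> 0"
    show "?L e v = 0"
    proof (rule ccontr)
      assume n: "?L e v \<noteq> 0"
      have "X (e + sg a (int d) + mv a b j) = 0" "X (e + sg b (int d) + mv b a j) = 0" for j
        using Xv[rule_format, of "e + sg a (int d) + mv a b j"] Xv[rule_format, of "e + sg b (int d) + mv b a j"] n v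
        by (auto simp: lk)
      then have "G (e + sg a (int d)) = 0" "H (e + sg b (int d)) = 0"
        unfolding G_def H_def by (auto intro!: hsum_0)
      then show False using q by (simp add: Q_def split: if_splits)
    qed
  qed
  have Rs: "\<forall>e. R e \<noteq> 0 \<longrightarrow> ?L e v = 0" if v: "v \<noteq> a" "v \<noteq> b" and Xv: "\<forall>e. X e \<noteq> 0 \<longrightarrow> ?L e v = 0" for v
  proof (intro allI impI)
    fix e assume q: "R e \<noteq> 0"
    show "?L e v = 0"
    proof (rule ccontr)
      assume n: "?L e v \<noteq> 0"
      have "X e = 0" using Xv n by auto
      moreover have "Q (e - sg a (int d)) = 0" "Q (e - sg b (int d)) = 0"
        using Qs[OF that, rule_format, of "e - sg a (int d)"] Qs[OF that, rule_format, of "e - sg b (int d)"] n v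
        by (auto simp: lk)
      ultimately show False using q by (simp add: R_def pt_lf)
    qed
  qed
  have BBR: "BB R" unfolding R_def[abs_def] by (intro BB_diff X BB_lf BBQ)
  show ?thesis
  proof (rule exI[of _ Q], rule exI[of _ R], intro conjI)
    show "X = (\<lambda>e. (lf d a c b \<bullet> Q) e + R e)" by (simp add: R_def)
    show "\<forall>e. R e \<noteq> 0 \<longrightarrow> 0 \<le> ?L e a \<and> ?L e a < int d" using R0 by blast
    show "\<forall>v. v \<noteq> a \<longrightarrow> v \<noteq> b \<longrightarrow> (\<forall>e. X e \<noteq> 0 \<longrightarrow> ?L e v = 0) \<longrightarrow>
        (\<forall>e. Q e \<noteq> 0 \<longrightarrow> ?L e v = 0) \<and> (\<forall>e. R e \<noteq> 0 \<longrightarrow> ?L e v = 0)"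
      using Qs Rs by blast
  qed (fact BBQ BBR)+
qed

subsection \<open>Substitution along a cluster of variables\<close>

text \<open>The division by d rounds down only for a variable outside Z. Even there a shift of the
  exponent by d changes the weight by exactly u v, which is all that the calculus of forms
  uses.\<close>

definition wt :: "(nat \<Rightarrow> complex fps) \<Rightarrow> nat set \<Rightarrow> expo \<Rightarrow> complex fps" where
  "wt u C e = (\<Prod>v\<in>C. ipw (u v) (lk e v div int d))"

definition sl :: "nat set \<Rightarrow> expo \<Rightarrow> int \<Rightarrow> expo set" where
  "sl C \<kappa> n = {e. (\<forall>v. v \<notin> C \<longrightarrow> lk e v = lk \<kappa> v) \<and> esum C e = n}"

text \<open>A coefficient of the substituted series: the variables of C are merged into one, with
  exponent n, and the others keep their exponents from \<kappa>.\<close>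

definition subs :: "nat set \<Rightarrow> (nat \<Rightarrow> complex fps) \<Rightarrow> (expo \<Rightarrow> 'w) \<Rightarrow> expo \<Rightarrow> int \<Rightarrow> 'w" where
  "subs C u X \<kappa> n = hsum sc (\<lambda>e. sc (wt u C e) (X e)) (sl C \<kappa> n)"

text \<open>If all exponents in C are at least N and their sum is n, none exceeds n - N * (card C -
  1).\<close>

lemma finite_sl:
  assumes C: "finite C" shows "finite {e \<in> sl C \<kappa> n. \<forall>v\<in>C. N \<le> lk e v}"
proof -
  let ?S = "{e \<in> sl C \<kappa> n. \<forall>v\<in>C. N \<le> lk e v}"
  let ?f = "\<lambda>e. restrict (lk e) C"
  define M where "M = n - N * (int (card C) - 1)"
  have "?f ` ?S \<subseteq> C \<rightarrow>\<^sub>E {N..M}"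
  proof (intro image_subsetI PiE_I)
    fix e v assume e: "e \<in> ?S" and v: "v \<in> C"
    have cd: "int (card C) - 1 = int (card (C - {v}))" using card_Suc_Diff1[OF C v] by linarith
    have "N * (int (card C) - 1) = (\<Sum>w\<in>C - {v}. N)" unfolding cd by (simp add: mult.commute)
    also have "\<dots> \<le> (\<Sum>w\<in>C - {v}. lk e w)" using e by (intro sum_mono) auto
    also have "\<dots> = n - lk e v"
      using e C v by (auto simp: sl_def esum_def sum.remove[of C v])
    finally show "restrict (lk e) C v \<in> {N..M}" using e v by (auto simp: M_def)
  qed auto
  then have "finite (?f ` ?S)" using C by (meson finite_PiE finite_atLeastAtMost_int finite_subset)
  moreover have "inj_on ?f ?S"
  proof (rule inj_onI)
    fix e f assume ef: "e \<in> ?S" "f \<in> ?S" "?f e = ?f f"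
    show "e = f"
    proof (rule poly_mapping_eqI)
      fix v show "lk e v = lk f v"
        using ef by (cases "v \<in> C") (auto simp: sl_def dest!: fun_cong[of _ _ v])
    qed
  qed
  ultimately show ?thesis using finite_imageD by blast
qed

lemma fin_C: "C \<subseteq> V \<Longrightarrow> finite C" using fin_V finite_subset by blast

lemma subs_sm:
  assumes "BB X" "C \<subseteq> V" shows "sm (\<lambda>e. sc (wt u C e) (X e)) (sl C \<kappa> n)"
  unfolding sm_def
proof
  fix p
  obtain N where N: "\<And>e v. v \<in> C \<Longrightarrow> lk e v < N \<Longrightarrow> zt p (X e)"
    using zt_esum[OF assms, of p] by blast
  have "{e \<in> sl C \<kappa> n. \<not> zt p (sc (wt u C e) (X e))} \<subseteq> {e \<in> sl C \<kappa> n. \<forall>v\<in>C. N \<le> lk e v}"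
    using N zt_sc by (auto simp: not_less[symmetric])
  then show "finite {e \<in> sl C \<kappa> n. \<not> zt p (sc (wt u C e) (X e))}"
    using finite_sl[OF fin_C[OF assms(2)]] finite_subset by blast
qed

lemma subs_zero [simp]: "subs C u (\<lambda>e. 0) \<kappa> n = 0"
  unfolding subs_def by (rule hsum_0) simp

lemma subs_add: "BB X \<Longrightarrow> BB Y \<Longrightarrow> C \<subseteq> V \<Longrightarrow> subs C u (\<lambda>e. X e + Y e) \<kappa> n = subs C u X \<kappa> n + subs C u Y \<kappa> n"
  unfolding subs_def by (subst hsum_add[symmetric]) (auto intro: subs_sm simp: scale_right_distrib)

lemma subs_sc: "BB X \<Longrightarrow> C \<subseteq> V \<Longrightarrow> subs C u (\<lambda>e. sc c (X e)) \<kappa> n = sc c (subs C u X \<kappa> n)"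
  unfolding subs_def by (subst hsum_sc[symmetric]) (auto intro: subs_sm simp: mult.commute)

lemma subs_diff: "BB X \<Longrightarrow> BB Y \<Longrightarrow> C \<subseteq> V \<Longrightarrow> subs C u (\<lambda>e. X e - Y e) \<kappa> n = subs C u X \<kappa> n - subs C u Y \<kappa> n"
  using subs_add[of X "\<lambda>e. sc (-1) (Y e)" C u \<kappa> n] subs_sc[of Y C u "-1" \<kappa> n] BB_sc[of Y "-1"] by simp

lemma subs_sum: "(\<And>i. i \<in> J \<Longrightarrow> BB (X i)) \<Longrightarrow> C \<subseteq> V \<Longrightarrow>
  subs C u (\<lambda>e. \<Sum>i\<in>J. X i e) \<kappa> n = (\<Sum>i\<in>J. subs C u (X i) \<kappa> n)"
  by (induction J rule: infinite_finite_induct) (auto simp: subs_add BB_sum)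

lemma wt_shift:
  assumes "finite C" "\<And>v. v \<in> C \<Longrightarrow> unit0 (u v)"
  shows "wt u C e = (if x \<in> C then u x else 1) * wt u C (e - sg x (int d))"
proof -
  have "ipw (u v) (lk e v div int d) =
     (if v = x then u x else 1) * ipw (u v) (lk (e - sg x (int d)) v div int d)" if "v \<in> C" for v
  proof (cases "v = x")
    case True
    have "lk e x div int d = (lk e x - int d) div int d + 1"
      using d_pos div_add_self2[of "int d" "lk e x - int d"] by simp
    then show ?thesis using True ipw_Suc[OF assms(2)[OF that]] by (simp add: lookup_minus)
  qed (simp add: lookup_minus lookup_single)
  then show ?thesis using assms(1) unfolding wt_def by (simp add: prod.distrib prod.delta)
qed

text \<open>Stated for bare summability instead of \<open>BB\<close>, because \<open>van0_lf\<close>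
  applies it to series that need not be bounded below in the variables outside C.\<close>

lemma subs_shift_sm:
  assumes sm0: "\<And>\<kappa> n. sm (\<lambda>e. sc (wt u C e) (X e)) (sl C \<kappa> n)" and fC: "finite C"
    and u: "\<And>v. v \<in> C \<Longrightarrow> unit0 (u v)"
  shows "sm (\<lambda>e. sc (wt u C e) (X (e - sg x (int d)))) (sl C \<kappa> n)"
    and "subs C u (\<lambda>e. X (e - sg x (int d))) \<kappa> n =
    (if x \<in> C then sc (u x) (subs C u X \<kappa> (n - int d)) else subs C u X (\<kappa> - sg x (int d)) n)"
proof -
  define c where "c = (if x \<in> C then u x else 1)"
  define \<kappa>' where "\<kappa>' = (if x \<in> C then \<kappa> else \<kappa> - sg x (int d))"
  define n' where "n' = (if x \<in> C then n - int d else n)"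
  have bij: "bij_betw (\<lambda>e. e - sg x (int d)) (sl C \<kappa> n) (sl C \<kappa>' n')"
    by (rule bij_betw_byWitness[where f' = "\<lambda>e. e + sg x (int d)"])
      (auto simp: sl_def \<kappa>'_def n'_def esum_diff esum_add esum_sg[OF fC] lookup_minus lookup_add lookup_single when_def)
  have sm: "sm (\<lambda>e. sc c (sc (wt u C e) (X e))) (sl C \<kappa>' n')" by (intro sm_sc sm0)
  have sh: "sc (wt u C e) (X (e - sg x (int d))) = sc c (sc (wt u C (e - sg x (int d))) (X (e - sg x (int d))))" for e
    by (subst wt_shift[where x = x, OF fC u], auto simp: c_def)
  show "sm (\<lambda>e. sc (wt u C e) (X (e - sg x (int d)))) (sl C \<kappa> n)"
    unfolding sh using hsum_reindex(1)[OF bij, of "\<lambda>e. sc c (sc (wt u C e) (X e))"] sm by simp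
  have "subs C u (\<lambda>e. X (e - sg x (int d))) \<kappa> n =
      hsum sc (\<lambda>e. sc c (sc (wt u C (e - sg x (int d))) (X (e - sg x (int d))))) (sl C \<kappa> n)"
    unfolding subs_def by (rule hsum_cong) (rule sh)
  also have "\<dots> = hsum sc (\<lambda>e. sc c (sc (wt u C e) (X e))) (sl C \<kappa>' n')"
    using hsum_reindex(2)[OF bij sm] .
  also have "\<dots> = sc c (subs C u X \<kappa>' n')" unfolding subs_def by (intro hsum_sc sm0)
  finally show "subs C u (\<lambda>e. X (e - sg x (int d))) \<kappa> n =
    (if x \<in> C then sc (u x) (subs C u X \<kappa> (n - int d)) else subs C u X (\<kappa> - sg x (int d)) n)" by (auto simp: c_def \<kappa>'_def n'_def)
qed

lemma subs_shift:
  assumes X: "BB X" and C: "C \<subseteq> V" and u: "\<And>v. v \<in> C \<Longrightarrow> unit0 (u v)"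
  shows "subs C u (\<lambda>e. X (e - sg x (int d))) \<kappa> n =
    (if x \<in> C then sc (u x) (subs C u X \<kappa> (n - int d)) else subs C u X (\<kappa> - sg x (int d)) n)"
  by (rule subs_shift_sm[OF subs_sm[OF X C] fin_C[OF C] u])

lemma subs_lf:
  assumes X: "BB X" and C: "C \<subseteq> V" and u: "\<And>v. v \<in> C \<Longrightarrow> unit0 (u v)"
  shows "subs C u (lf d a c b \<bullet> X) \<kappa> n =
    (if a \<in> C then sc (u a) (subs C u X \<kappa> (n - int d)) else subs C u X (\<kappa> - sg a (int d)) n) -
    sc c (if b \<in> C then sc (u b) (subs C u X \<kappa> (n - int d)) else subs C u X (\<kappa> - sg b (int d)) n)"
  unfolding pt_lf[abs_def]
  using assms by (subst subs_diff) (auto simp: BB_shift BB_sc subs_sc subs_shift)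

text \<open>Vanishing after the substitution \<open>z\<^sub>v\<^sup>d = u v t\<close> for all \<open>v \<in> C\<close>.\<close>

definition van :: "nat set \<Rightarrow> (nat \<Rightarrow> complex fps) \<Rightarrow> (expo \<Rightarrow> 'w) \<Rightarrow> bool" where
  "van C u X \<longleftrightarrow> (\<forall>\<kappa> n. subs C u X \<kappa> n = 0)"

lemma van_lf: "BB X \<Longrightarrow> C \<subseteq> V \<Longrightarrow> (\<And>v. v \<in> C \<Longrightarrow> unit0 (u v)) \<Longrightarrow> van C u X \<Longrightarrow> van C u (lf d a c b \<bullet> X)"
  by (simp add: van_def subs_lf)

lemma van_lf_edge:
  "BB X \<Longrightarrow> C \<subseteq> V \<Longrightarrow> (\<And>v. v \<in> C \<Longrightarrow> unit0 (u v)) \<Longrightarrow> a \<in> C \<Longrightarrow> b \<in> C \<Longrightarrow> u a = c * u b \<Longrightarrow> van C u (lf d a c b \<bullet> X)"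
  by (simp add: van_def subs_lf)

lemma van_diff: "BB X \<Longrightarrow> BB Y \<Longrightarrow> C \<subseteq> V \<Longrightarrow> van C u X \<Longrightarrow> van C u Y \<Longrightarrow> van C u (\<lambda>e. X e - Y e)"
  by (simp add: van_def subs_diff)

definition van0 :: "nat set \<Rightarrow> (nat \<Rightarrow> complex fps) \<Rightarrow> (expo \<Rightarrow> 'w) \<Rightarrow> bool" where
  "van0 C u X \<longleftrightarrow> (\<forall>\<kappa> n. sm (\<lambda>e. sc (wt u C e) (X e)) (sl C \<kappa> n) \<and> subs C u X \<kappa> n = 0)"

lemma van0_lf:
  assumes v: "van0 C u X" and C: "finite C" and u: "\<And>v. v \<in> C \<Longrightarrow> unit0 (u v)"
  shows "van0 C u (lf d a c b \<bullet> X)"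
proof -
  have sm0: "sm (\<lambda>e. sc (wt u C e) (X e)) (sl C \<kappa> n)" and z: "subs C u X \<kappa> n = 0" for \<kappa> n
    using v by (auto simp: van0_def)
  have s: "sm (\<lambda>e. sc (wt u C e) (X (e - sg y (int d)))) (sl C \<kappa> n)" "subs C u (\<lambda>e. X (e - sg y (int d))) \<kappa> n = 0" for y \<kappa> n
    using subs_shift_sm[OF sm0 C u, where x = y and \<kappa> = \<kappa> and n = n] z by auto
  have eq: "sc (wt u C e) ((lf d a c b \<bullet> X) e) = sc (wt u C e) (X (e - sg a (int d))) - sc c (sc (wt u C e) (X (e - sg b (int d))))" for e
    by (simp add: pt_lf scale_right_diff_distrib mult.commute)
  show ?thesis unfolding van0_def
  proof (intro allI conjI)
    fix \<kappa> n
    show "sm (\<lambda>e. sc (wt u C e) ((lf d a c b \<bullet> X) e)) (sl C \<kappa> n)"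
      unfolding eq by (intro hsum_diff(1) s sm_sc)
    show "subs C u (lf d a c b \<bullet> X) \<kappa> n = 0"
      unfolding subs_def eq using hsum_diff(2)[OF s(1) sm_sc[OF s(1)], where c1 = c] s(2) hsum_sc[OF s(1)]
      by (simp add: subs_def)
  qed
qed

lemma subs_small:
  assumes "BB X" "C \<subseteq> V" "v \<in> V" "v \<notin> C"
  shows "\<exists>N. \<forall>\<kappa> n. lk \<kappa> v < N \<longrightarrow> zt p (subs C u X \<kappa> n)"
proof -
  obtain N where N: "\<And>e. lk e v < N \<Longrightarrow> zt p (X e)"
    using zt_esum[OF assms(1) subset_refl, of p] assms(3) by blast
  have "zt p (subs C u X \<kappa> n)" if "lk \<kappa> v < N" for \<kappa> n
    unfolding subs_def
  proof (intro zt_hsum subs_sm assms zt_sc N)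
    fix e assume "e \<in> sl C \<kappa> n"
    then show "lk e v < N" using assms(4) that by (auto simp: sl_def)
  qed
  then show ?thesis by blast
qed

text \<open>If both variables are merged, the form becomes the nonzero scalar u a - c * u b, and
  there is no torsion. If one of them stays free, the equation expresses each value of
  \<open>subs\<close> by one whose exponent in the free variable is smaller by d; by
  \<open>subs_small\<close> these values tend to zero.\<close>

lemma van_cancel:
  assumes X: "BB X" and C: "C \<subseteq> V" and u: "\<And>v. v \<in> C \<Longrightarrow> unit0 (u v)" and
    ab: "a \<in> V" "b \<in> V" "a \<noteq> b" and c: "unit0 c" and
    n: "\<not> (a \<in> C \<and> b \<in> C \<and> u a = c * u b)" and v: "van C u (lf d a c b \<bullet> X)"
  shows "van C u X"
proof -
  let ?S = "subs C u X"
  let ?L = lk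
  have v': "(if a \<in> C then sc (u a) (?S \<kappa> (n - int d)) else ?S (\<kappa> - sg a (int d)) n) =
    sc c (if b \<in> C then sc (u b) (?S \<kappa> (n - int d)) else ?S (\<kappa> - sg b (int d)) n)" for \<kappa> n
    using v[unfolded van_def, rule_format, of \<kappa> n] subs_lf[where a = a and b = b and c = c and \<kappa> = \<kappa> and n = n, OF X C u] by simp
  note cc = fps_unit_inverse
  consider (both) "a \<in> C" "b \<in> C" | (nb) "b \<notin> C" | (na) "a \<notin> C" by blast
  then have "?S \<kappa> n = 0" for \<kappa> n
  proof cases
    case both
    have "sc (u a - c * u b) (?S \<kappa> n) = 0"
      using v'[of \<kappa> "n + int d"] both by (simp add: scale_left_diff_distrib)
    then show ?thesis using sc_eq_0 n both by (metis eq_iff_diff_eq_0)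
  next
    case nb
    define g where "g = (if a \<in> C then inverse (u a) * c else c)"
    define k where "k = (\<lambda>\<kappa> :: expo. if a \<in> C then \<kappa> - sg b (int d) else \<kappa> + sg a (int d) - sg b (int d))"
    define h where "h = (if a \<in> C then int d else 0)"
    have step: "?S \<kappa> n = sc g (?S (k \<kappa>) (n + h))" for \<kappa> n
    proof (cases "a \<in> C")
      case True
      have "sc (u a) (?S \<kappa> n) = sc c (?S (\<kappa> - sg b (int d)) (n + int d))" using v'[of \<kappa> "n + int d"] True nb by simp
      then have "sc (inverse (u a)) (sc (u a) (?S \<kappa> n)) = sc (inverse (u a)) (sc c (?S (\<kappa> - sg b (int d)) (n + int d)))" by simp
      then show ?thesis using True cc(1)[OF u[OF True]] by (simp add: g_def k_def h_def)
    next
      case False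
      then show ?thesis using v'[of "\<kappa> + sg a (int d)" n] nb by (simp add: g_def k_def h_def)
    qed
    have it: "?S \<kappa> n = sc (g ^ j) (?S ((k ^^ j) \<kappa>) (n + int j * h))" for j
    proof (induction j)
      case (Suc j) then show ?case using step[of "(k ^^ j) \<kappa>" "n + int j * h"] by (simp add: algebra_simps)
    qed simp
    have lk: "?L ((k ^^ j) \<kappa>) b = ?L \<kappa> b - int j * int d" for j
      by (induction j) (use ab in \<open>auto simp: k_def lookup_minus lookup_add lookup_single algebra_simps\<close>)
    show ?thesis
    proof (rule zt_all)
      fix p
      obtain N where N: "\<And>\<kappa> n. ?L \<kappa> b < N \<Longrightarrow> zt p (?S \<kappa> n)" using subs_small[OF X C ab(2) nb] by metis
      define j where "j = nat (?L \<kappa> b - N + 1)"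
      have "?L \<kappa> b - N + 1 \<le> int j * 1" by (simp add: j_def)
      also have "\<dots> \<le> int j * int d" using d_pos by (intro mult_left_mono) auto
      finally have "zt p (?S ((k ^^ j) \<kappa>) (n + int j * h))" using lk[of j] by (intro N) simp
      then show "zt p (?S \<kappa> n)" by (subst it[of j]) (rule zt_sc)
    qed
  next
    case na
    define g where "g = (if b \<in> C then inverse (u b) * inverse c else inverse c)"
    define k where "k = (\<lambda>\<kappa> :: expo. if b \<in> C then \<kappa> - sg a (int d) else \<kappa> + sg b (int d) - sg a (int d))"
    define h where "h = (if b \<in> C then int d else 0)"
    have ic: "sc (inverse c) (sc c w) = w" for w using cc(1)[OF c] by simp
    have step: "?S \<kappa> n = sc g (?S (k \<kappa>) (n + h))" for \<kappa> n
    proof (cases "b \<in> C")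
      case True
      have "?S (\<kappa> - sg a (int d)) (n + int d) = sc c (sc (u b) (?S \<kappa> n))" using v'[of \<kappa> "n + int d"] True na by simp
      then have "sc (inverse (u b)) (sc (inverse c) (?S (\<kappa> - sg a (int d)) (n + int d))) = sc (inverse (u b)) (sc (u b) (?S \<kappa> n))"
        using ic by metis
      then show ?thesis using True cc(1)[OF u[OF True]] by (simp add: g_def k_def h_def)
    next
      case False
      have "?S (\<kappa> + sg b (int d) - sg a (int d)) n = sc c (?S \<kappa> n)" using v'[of "\<kappa> + sg b (int d)" n] na False by simp
      then have "sc (inverse c) (?S (\<kappa> + sg b (int d) - sg a (int d)) n) = ?S \<kappa> n" using ic by metis
      then show ?thesis using False by (simp add: g_def k_def h_def)
    qed
    have it: "?S \<kappa> n = sc (g ^ j) (?S ((k ^^ j) \<kappa>) (n + int j * h))" for j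
    proof (induction j)
      case (Suc j) then show ?case using step[of "(k ^^ j) \<kappa>" "n + int j * h"] by (simp add: algebra_simps)
    qed simp
    have lk: "?L ((k ^^ j) \<kappa>) a = ?L \<kappa> a - int j * int d" for j
      by (induction j) (use ab in \<open>auto simp: k_def lookup_minus lookup_add lookup_single algebra_simps\<close>)
    show ?thesis
    proof (rule zt_all)
      fix p
      obtain N where N: "\<And>\<kappa> n. ?L \<kappa> a < N \<Longrightarrow> zt p (?S \<kappa> n)" using subs_small[OF X C ab(1) na] by metis
      define j where "j = nat (?L \<kappa> a - N + 1)"
      have "?L \<kappa> a - N + 1 \<le> int j * 1" by (simp add: j_def)
      also have "\<dots> \<le> int j * int d" using d_pos by (intro mult_left_mono) auto
      finally have "zt p (?S ((k ^^ j) \<kappa>) (n + int j * h))" using lk[of j] by (intro N) simp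
      then show "zt p (?S \<kappa> n)" by (subst it[of j]) (rule zt_sc)
    qed
  qed
  then show ?thesis by (simp add: van_def)
qed

lemma subs_single:
  assumes C: "C \<subseteq> V" "r \<in> C" and X: "\<And>e b. X e \<noteq> 0 \<Longrightarrow> b \<in> C - {r} \<Longrightarrow> lk e b = 0"
    and e: "\<And>b. b \<in> C - {r} \<Longrightarrow> lk e b = 0"
  shows "subs C u X e (lk e r) = sc (wt u C e) (X e)"
proof -
  note fC = fin_C[OF C(1)]
  have es: "esum C f = lk f r" if "\<And>b. b \<in> C - {r} \<Longrightarrow> lk f b = 0" for f
    unfolding esum_def sum.remove[OF fC C(2)] using that by simp
  have "subs C u X e (lk e r) = (\<Sum>f\<in>{e}. sc (wt u C f) (X f))"
    unfolding subs_def
  proof (rule hsum_finite)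
    show "{e} \<subseteq> sl C e (lk e r)" using es[OF e] by (auto simp: sl_def)
    fix f assume f: "f \<in> sl C e (lk e r)" "f \<notin> {e}"
    show "sc (wt u C f) (X f) = 0"
    proof (rule ccontr)
      assume "sc (wt u C f) (X f) \<noteq> 0"
      then have "X f \<noteq> 0" by auto
      then have f0: "\<And>b. b \<in> C - {r} \<Longrightarrow> lk f b = 0" using X by blast
      have "f = e"
      proof (rule poly_mapping_eqI)
        fix v
        have "esum C f = lk e r" "v \<notin> C \<Longrightarrow> lk f v = lk e v"
          using f(1) by (auto simp: sl_def)
        moreover have "esum C f = lk f r" using es f0 by blast
        moreover have "lk f v = 0" "lk e v = 0" if "v \<in> C - {r}"
          using f0 e that by blast+
        ultimately show "lk f v = lk e v"
          by (cases "v \<in> C"; cases "v = r") simp_all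
      qed
      then show False using f(2) by simp
    qed
  qed simp
  then show ?thesis by simp
qed

lemma divrem_Z:
  assumes X: "BB X" and a: "a \<in> Z" and b: "b \<in> V" and ab: "a \<noteq> b" and c: "unit0 c"
  shows "\<exists>Q R. BB Q \<and> BB R \<and> X = (\<lambda>e. (lf d a c b \<bullet> Q) e + R e) \<and>
     (\<forall>e. R e \<noteq> 0 \<longrightarrow> lk e a = 0) \<and>
     (\<forall>v. v \<noteq> a \<longrightarrow> v \<noteq> b \<longrightarrow> (\<forall>e. X e \<noteq> 0 \<longrightarrow> lk e v = 0) \<longrightarrow>
        (\<forall>e. Q e \<noteq> 0 \<longrightarrow> lk e v = 0) \<and> (\<forall>e. R e \<noteq> 0 \<longrightarrow> lk e v = 0))"
proof -
  have aV: "a \<in> V" using a Z_V by auto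
  obtain Q R where QR: "BB Q \<and> BB R \<and> X = (\<lambda>e. (lf d a c b \<bullet> Q) e + R e) \<and>
     (\<forall>e. R e \<noteq> 0 \<longrightarrow> 0 \<le> lk e a \<and> lk e a < int d) \<and>
     (\<forall>v. v \<noteq> a \<longrightarrow> v \<noteq> b \<longrightarrow> (\<forall>e. X e \<noteq> 0 \<longrightarrow> lk e v = 0) \<longrightarrow>
        (\<forall>e. Q e \<noteq> 0 \<longrightarrow> lk e v = 0) \<and> (\<forall>e. R e \<noteq> 0 \<longrightarrow> lk e v = 0))"
    using divrem[OF X aV b ab c] by (elim exE) (rule that)
  have "lk e a = 0" if "R e \<noteq> 0" for e
  proof -
    have "int d dvd lk e a" using QR a that by (auto simp: BB_def)
    then show ?thesis using QR that by (metis zdvd_not_zless order_le_less)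
  qed
  then show ?thesis by (rule_tac exI[of _ Q], rule_tac exI[of _ R]) (use QR in blast)
qed

text \<open>Division by the forms from b to the centre r, one b after the other. Each remainder
  loses z_b and stays free of the variables removed before.\<close>

lemma star_decomp:
  assumes B: "finite B" "B \<subseteq> Z" "r \<in> V" "r \<notin> B" and c: "\<And>b. b \<in> B \<Longrightarrow> unit0 (c b)" and X: "BB X"
  shows "\<exists>Q R. (\<forall>b\<in>B. BB (Q b)) \<and> BB R \<and> X = (\<lambda>e. (\<Sum>b\<in>B. (lf d b (c b) r \<bullet> Q b) e) + R e) \<and>
     (\<forall>b\<in>B. \<forall>e. R e \<noteq> 0 \<longrightarrow> lk e b = 0)"
  using B c
proof (induction B rule: finite_induct)
  case empty then show ?case using X by auto
next
  case (insert b B)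
  obtain Q R where QR: "\<forall>b\<in>B. BB (Q b)" "BB R" "X = (\<lambda>e. (\<Sum>b\<in>B. (lf d b (c b) r \<bullet> Q b) e) + R e)"
     "\<forall>b\<in>B. \<forall>e. R e \<noteq> 0 \<longrightarrow> lk e b = 0"
    using insert.IH insert.prems by auto
  have b: "b \<in> Z" "b \<noteq> r" "unit0 (c b)" using insert.prems by auto
  obtain Q' R' where QR': "BB Q'" "BB R'" "R = (\<lambda>e. (lf d b (c b) r \<bullet> Q') e + R' e)"
     "\<forall>e. R' e \<noteq> 0 \<longrightarrow> lk e b = 0"
     "\<And>v. v \<noteq> b \<Longrightarrow> v \<noteq> r \<Longrightarrow> (\<forall>e. R e \<noteq> 0 \<longrightarrow> lk e v = 0) \<Longrightarrow> (\<forall>e. R' e \<noteq> 0 \<longrightarrow> lk e v = 0)"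
  proof -
    obtain Q' R' where a: "BB Q' \<and> BB R' \<and> R = (\<lambda>e. (lf d b (c b) r \<bullet> Q') e + R' e) \<and>
     (\<forall>e. R' e \<noteq> 0 \<longrightarrow> lk e b = 0) \<and>
     (\<forall>v. v \<noteq> b \<longrightarrow> v \<noteq> r \<longrightarrow> (\<forall>e. R e \<noteq> 0 \<longrightarrow> lk e v = 0) \<longrightarrow>
        (\<forall>e. Q' e \<noteq> 0 \<longrightarrow> lk e v = 0) \<and> (\<forall>e. R' e \<noteq> 0 \<longrightarrow> lk e v = 0))"
      using divrem_Z[OF QR(2) b(1) insert.prems(2) b(2,3)] by (elim exE) (rule that)
    show thesis by (rule that[of Q' R']) (use a in blast)+
  qed
  define Q2 where "Q2 = Q(b := Q')"
  have Q2: "Q2 b = Q'" "\<And>x. x \<in> B \<Longrightarrow> Q2 x = Q x" using insert.hyps by (auto simp: Q2_def)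
  show ?case
  proof (intro exI[of _ Q2] exI[of _ R'] conjI)
    show "\<forall>b\<in>insert b B. BB (Q2 b)" using QR(1) QR'(1) Q2 by auto
    show "X = (\<lambda>e. (\<Sum>b\<in>insert b B. (lf d b (c b) r \<bullet> Q2 b) e) + R' e)"
      unfolding QR(3) by (subst QR'(3)) (use insert.hyps Q2 in \<open>simp add: algebra_simps\<close>)
    show "\<forall>b\<in>insert b B. \<forall>e. R' e \<noteq> 0 \<longrightarrow> lk e b = 0"
    proof
      fix x assume x: "x \<in> insert b B"
      show "\<forall>e. R' e \<noteq> 0 \<longrightarrow> lk e x = 0"
      proof (cases "x = b")
        case False
        then show ?thesis using x insert.prems QR(4) by (intro QR'(5)) auto
      qed (use QR'(4) in simp)
    qed
  qed (fact QR'(2))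
qed

text \<open>The ideal counterpart of \<open>van\<close>. Unlike vanishing on a cluster, a
  combination of forms can be evaluated afterwards on any larger cluster that contains their
  edges.\<close>

definition Id :: "(nat \<times> complex fps \<times> nat) set \<Rightarrow> (expo \<Rightarrow> 'w) \<Rightarrow> bool" where
  "Id E X \<longleftrightarrow> (\<exists>Q. (\<forall>t\<in>E. BB (Q t)) \<and> X = (\<lambda>e. \<Sum>(a, c, b)\<in>E. (lf d a c b \<bullet> Q (a, c, b)) e))"

lemma Id_van:
  assumes "Id E X" "C \<subseteq> V" "\<And>v. v \<in> C \<Longrightarrow> unit0 (u v)"
    "\<And>a c b. (a, c, b) \<in> E \<Longrightarrow> a \<in> C \<and> b \<in> C \<and> u a = c * u b"
  shows "van C u X"
proof -
  obtain Q where Q: "\<And>t. t \<in> E \<Longrightarrow> BB (Q t)" "X = (\<lambda>e. \<Sum>(a, c, b)\<in>E. (lf d a c b \<bullet> Q (a, c, b)) e)"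
    using assms(1) by (auto simp: Id_def)
  have "subs C u X \<kappa> n = (\<Sum>t\<in>E. subs C u (\<lambda>e. case t of (a, c, b) \<Rightarrow> (lf d a c b \<bullet> Q (a, c, b)) e) \<kappa> n)" for \<kappa> n
    unfolding Q(2) by (rule subs_sum) (use Q(1) assms(2) in \<open>auto simp: BB_lf\<close>)
  also have "\<dots> \<kappa> n = (\<Sum>t\<in>E. 0)" for \<kappa> n
  proof (rule sum.cong)
    fix t assume t: "t \<in> E"
    obtain a c b where abc: "t = (a, c, b)" by (cases t)
    have "van C u (lf d a c b \<bullet> Q (a, c, b))" using t Q(1) assms unfolding abc by (intro van_lf_edge) auto
    then show "subs C u (\<lambda>e. case t of (a, c, b) \<Rightarrow> (lf d a c b \<bullet> Q (a, c, b)) e) \<kappa> n = 0"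
      by (simp add: abc van_def)
  qed simp
  finally show ?thesis by (simp add: van_def)
qed

text \<open>A linear Nullstellensatz. After division by the star at r the remainder involves z_r
  only among the variables of C, so each coefficient of its substitution is one of its own
  coefficients times a unit.\<close>

lemma van_Id:
  assumes v: "van C u X" and X: "BB X" and C: "C \<subseteq> V" "r \<in> C" "C - {r} \<subseteq> Z"
    and u: "\<And>v. v \<in> C \<Longrightarrow> unit0 (u v)"
  shows "Id ((\<lambda>b. (b, u b * inverse (u r), r)) ` (C - {r})) X"
proof -
  define c where "c b = u b * inverse (u r)" for b
  note cc = fps_unit_inverse[OF u[OF C(2)]]
  have c0: "unit0 (c b)" if "b \<in> C - {r}" for b using u that C(2) by (auto simp: c_def)
  have uc: "u b = c b * u r" for b using cc by (simp add: c_def mult.assoc)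
  note fC = fin_C[OF C(1)]
  obtain Q R where Q: "\<And>b. b\<in>C - {r} \<Longrightarrow> BB (Q b)" "BB R" "X = (\<lambda>e. (\<Sum>b\<in>C - {r}. (lf d b (c b) r \<bullet> Q b) e) + R e)"
     "\<And>b e. b\<in>C - {r} \<Longrightarrow> R e \<noteq> 0 \<Longrightarrow> lk e b = 0"
    using star_decomp[of "C - {r}" r c X] fC C X c0 by blast
  have "van C u (\<lambda>e. X e - (\<Sum>b\<in>C - {r}. (lf d b (c b) r \<bullet> Q b) e))"
  proof (intro van_diff X v C BB_sum BB_lf Q)
    show "van C u (\<lambda>e. (\<Sum>b\<in>C - {r}. (lf d b (c b) r \<bullet> Q b) e))"
      unfolding van_def
    proof (intro allI)
      fix \<kappa> n
      have "subs C u (lf d b (c b) r \<bullet> Q b) \<kappa> n = 0" if "b \<in> C - {r}" for b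
        using van_lf_edge[where u = u and C = C and a = b and b = r and c = "c b", OF Q(1)[OF that] C(1) u _ C(2) uc] that
        by (auto simp: van_def)
      then show "subs C u (\<lambda>e. (\<Sum>b\<in>C - {r}. (lf d b (c b) r \<bullet> Q b) e)) \<kappa> n = 0"
        by (subst subs_sum) (auto intro: BB_lf Q(1) simp: C(1))
    qed
  qed
  then have vR: "van C u R" unfolding Q(3) by simp
  have "R e = 0" for e
  proof (rule ccontr)
    assume "R e \<noteq> 0"
    then have "subs C u R e (lk e r) = sc (wt u C e) (R e)"
      using Q(4) by (intro subs_single C) auto
    moreover have "wt u C e \<noteq> 0" using fps_unit_prod[of C "\<lambda>v. ipw (u v) (lk e v div int d)"] ipw_unit u
      by (auto simp: wt_def)
    ultimately show False using vR \<open>R e \<noteq> 0\<close> sc_eq_0 by (auto simp: van_def)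
  qed
  then have "X = (\<lambda>e. \<Sum>b\<in>C - {r}. (lf d b (c b) r \<bullet> Q b) e)" using Q(3) by simp
  then show ?thesis unfolding Id_def using Q(1)
    by (intro exI[of _ "\<lambda>(a, c, b). Q a"]) (auto simp: sum.reindex inj_on_def c_def)
qed

text \<open>The factor theorem, as the star with a single edge.\<close>

lemma van_dvd:
  assumes v: "van {a, b} u X" and X: "BB X" and ab: "a \<in> Z" "b \<in> V" "a \<noteq> b"
    and u: "unit0 (u a)" "unit0 (u b)"
    and c: "u a = c * u b"
  shows "\<exists>Y. BB Y \<and> X = lf d a c b \<bullet> Y"
proof -
  have "{a, b} - {b} = {a}" using ab by auto
  then have "Id {(a, u a * inverse (u b), b)} X"
    using van_Id[OF v X, of b] ab Z_V u by auto
  moreover have "u a * inverse (u b) = c" using c fps_unit_inverse[OF u(2)] by (simp add: mult.assoc)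
  ultimately show ?thesis by (auto simp: Id_def)
qed

end

text \<open>A triple \<open>(a, c, b)\<close> is thought of as an edge from \<open>a\<close> to \<open>b\<close>, and stands for the
  form $z_a^d-cz_b^d$. Inverses are expanded in the variable at the head.\<close>

definition PT :: "nat \<Rightarrow> (nat \<times> complex fps \<times> nat) set \<Rightarrow> lpoly" where
  "PT d T = (\<Prod>(a, c, b)\<in>T. lf d a c b)"

lemma PT_empty [simp]: "PT d {} = 1" by (simp add: PT_def)
lemma PT_insert: "finite T \<Longrightarrow> (a, c, b) \<notin> T \<Longrightarrow> PT d (insert (a, c, b) T) = lf d a c b * PT d T"
  by (simp add: PT_def)
lemma PT_union: "finite S \<Longrightarrow> finite T \<Longrightarrow> S \<inter> T = {} \<Longrightarrow> PT d (S \<union> T) = PT d S * PT d T"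
  by (simp add: PT_def prod.union_disjoint)
lemma PT_dvd: "finite T \<Longrightarrow> S \<subseteq> T \<Longrightarrow> PT d S dvd PT d T"
  unfolding PT_def by (rule prod_dvd_prod_subset)
lemma PT_split: "finite T \<Longrightarrow> PT d T = PT d (T \<inter> S) * PT d (T - S)"
  by (subst PT_union[symmetric]) (auto intro: arg_cong[where f = "PT d"])

text \<open>Modulo \<open>t = u a\<close> all summands but one vanish, as in Lagrange interpolation.\<close>

lemma vandermonde_ideal:
  fixes u :: "nat \<Rightarrow> 'r::comm_ring_1"
  assumes "finite N" "N \<noteq> {}"
  shows "\<exists>h. (\<Prod>(x, y)\<in>{(x, y). x \<in> N \<and> y \<in> N \<and> x < y}. u x - u y) = (\<Sum>a\<in>N. h a * (\<Prod>x\<in>N - {a}. t - u x))"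
  using assms
proof (induction N rule: finite_linorder_max_induct)
  case (insert b N)
  let ?P = "\<lambda>N. {(x, y). x \<in> N \<and> y \<in> N \<and> x < y}"
  have fin: "finite (?P N)" by (rule finite_subset[of _ "N \<times> N"]) (use insert.hyps in auto)
  have "?P (insert b N) = ?P N \<union> (\<lambda>x. (x, b)) ` N" using insert.hyps by fastforce
  then have P: "(\<Prod>(x, y)\<in>?P (insert b N). u x - u y) = (\<Prod>(x, y)\<in>?P N. u x - u y) * (\<Prod>x\<in>N. u x - u b)"
  proof -
    have "?P N \<inter> (\<lambda>x. (x, b)) ` N = {}" using insert.hyps by auto
    then have "(\<Prod>(x, y)\<in>?P N \<union> (\<lambda>x. (x, b)) ` N. u x - u y) = (\<Prod>(x, y)\<in>?P N. u x - u y) * (\<Prod>(x, y)\<in>(\<lambda>x. (x, b)) ` N. u x - u y)"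
      using fin insert.hyps by (intro prod.union_disjoint) auto
    also have "(\<Prod>(x, y)\<in>(\<lambda>x. (x, b)) ` N. u x - u y) = (\<Prod>x\<in>N. u x - u b)"
      by (simp add: prod.reindex inj_on_def)
    finally show ?thesis using \<open>?P (insert b N) = _\<close> by simp
  qed
  have bN: "b \<notin> N" using insert.hyps by auto
  show ?case
  proof (cases "N = {}")
    case True then show ?thesis by (intro exI[of _ "\<lambda>_. 1"]) (auto simp: prod.neutral)
  next
    case False
    then obtain h where h: "(\<Prod>(x, y)\<in>?P N. u x - u y) = (\<Sum>a\<in>N. h a * (\<Prod>x\<in>N - {a}. t - u x))"
      using insert.IH by blast
    define w where "w a = h a * (\<Prod>x\<in>N - {a}. u x - u b)" for a
    have "(\<Prod>(x, y)\<in>?P (insert b N). u x - u y) = (\<Sum>a\<in>N. w a * ((u a - u b) * (\<Prod>x\<in>N - {a}. t - u x)))"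
      unfolding P h sum_distrib_right
    proof (rule sum.cong)
      fix a assume "a \<in> N"
      then have "(\<Prod>x\<in>N. u x - u b) = (u a - u b) * (\<Prod>x\<in>N - {a}. u x - u b)"
        using insert.hyps by (simp add: prod.remove)
      then show "h a * (\<Prod>x\<in>N - {a}. t - u x) * (\<Prod>x\<in>N. u x - u b) = w a * ((u a - u b) * (\<Prod>x\<in>N - {a}. t - u x))"
        by (simp add: w_def mult_ac)
    qed simp
    \<comment> \<open>u a - u b = (t - u b) - (t - u a) turns each summand into one that omits a,
      minus one that omits b.\<close>
    also have "\<dots> = (\<Sum>a\<in>N. w a * (\<Prod>x\<in>insert b N - {a}. t - u x) - w a * (\<Prod>x\<in>N. t - u x))"
    proof (rule sum.cong)
      fix a assume a: "a \<in> N"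
      have 1: "(\<Prod>x\<in>N. t - u x) = (t - u a) * (\<Prod>x\<in>N - {a}. t - u x)"
        using a insert.hyps by (simp add: prod.remove)
      have "insert b N - {a} = insert b (N - {a})" using a bN by auto
      then have 2: "(\<Prod>x\<in>insert b N - {a}. t - u x) = (t - u b) * (\<Prod>x\<in>N - {a}. t - u x)"
        using bN insert.hyps by simp
      show "w a * ((u a - u b) * (\<Prod>x\<in>N - {a}. t - u x)) = w a * (\<Prod>x\<in>insert b N - {a}. t - u x) - w a * (\<Prod>x\<in>N. t - u x)"
        unfolding 1 2 by (simp add: algebra_simps)
    qed simp
    also have "\<dots> = (\<Sum>a\<in>insert b N. (if a = b then - sum w N else w a) * (\<Prod>x\<in>insert b N - {a}. t - u x))"
    proof -
      have "insert b N - {b} = N" using bN by auto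
      moreover have "(\<Sum>a\<in>N. (if a = b then - sum w N else w a) * (\<Prod>x\<in>insert b N - {a}. t - u x)) = (\<Sum>a\<in>N. w a * (\<Prod>x\<in>insert b N - {a}. t - u x))"
        using bN by (intro sum.cong) auto
      ultimately show ?thesis using bN insert.hyps by (simp add: sum_subtractf sum_distrib_right)
    qed
    finally show ?thesis by (intro exI[of _ "\<lambda>a. if a = b then - sum w N else w a"])
  qed
qed simp

section \<open>Orders of the variables and division by products of forms\<close>

context hmodule_vars
begin

text \<open>The decay common to all products of currents whose factors stand in the order
  \<open>pos\<close>.\<close>

definition FDp :: "(nat \<Rightarrow> nat) \<Rightarrow> (expo \<Rightarrow> 'w) \<Rightarrow> bool" where
  "FDp pos X \<longleftrightarrow> (\<forall>a\<in>V. \<forall>b\<in>V. pos a < pos b \<longrightarrow> FD a b X)"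

text \<open>Stronger than \<open>FDp\<close>, and stable under division by forward edges, since the
  tails of the order are closed under them. Quotients are constructed with \<open>Sp\<close> and
  compared with others within \<open>FDp\<close>.\<close>

definition Sp :: "(nat \<Rightarrow> nat) \<Rightarrow> (expo \<Rightarrow> 'w) \<Rightarrow> bool" where
  "Sp pos X \<longleftrightarrow> (\<forall>b\<in>V. Bd {x \<in> V. pos b \<le> pos x} X)"

definition ok :: "(nat \<Rightarrow> nat) \<Rightarrow> (nat \<times> complex fps \<times> nat) set \<Rightarrow> bool" where
  "ok pos T \<longleftrightarrow> finite T \<and> (\<forall>(a, c, b)\<in>T. a \<in> V \<and> b \<in> V \<and> pos a < pos b)"

lemma okD: "ok pos T \<Longrightarrow> (a, c, b) \<in> T \<Longrightarrow> a \<in> V \<and> b \<in> V \<and> pos a < pos b"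
  by (auto simp: ok_def)
lemma ok_finite: "ok pos T \<Longrightarrow> finite T" by (simp add: ok_def)
lemma ok_subset: "ok pos T \<Longrightarrow> S \<subseteq> T \<Longrightarrow> ok pos S"
  unfolding ok_def using finite_subset by blast

lemma Sp_FDp: "Sp pos X \<Longrightarrow> FDp pos X"
  unfolding FDp_def
proof (intro ballI impI)
  fix a b assume X: "Sp pos X" "a \<in> V" "b \<in> V" "pos a < pos b"
  then have "Bd {x \<in> V. pos b \<le> pos x} X" by (auto simp: Sp_def)
  then show "FD a b X" by (rule FD_Bd) (use X fin_V in auto)
qed

lemma BB_Sp: "BB X \<Longrightarrow> Sp pos X" unfolding Sp_def by (auto intro: BB_Bd)
lemma Sp_pt: "Sp pos X \<Longrightarrow> Sp pos (p \<bullet> X)" unfolding Sp_def by (auto intro: Bd_pt)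
lemma Sp_add: "Sp pos X \<Longrightarrow> Sp pos Y \<Longrightarrow> Sp pos (\<lambda>e. X e + Y e)" unfolding Sp_def by (auto intro: Bd_add)
lemma FDp_pt: "FDp pos X \<Longrightarrow> FDp pos (p \<bullet> X)" unfolding FDp_def by (auto intro: FD_pt)
lemma FD_diff: "FD a b X \<Longrightarrow> FD a b Y \<Longrightarrow> FD a b (\<lambda>e. X e - Y e)"
  using FD_add[of a b X "\<lambda>e. sc (-1) (Y e)"] FD_sc[of a b Y "-1"] by simp
lemma FDp_diff: "FDp pos X \<Longrightarrow> FDp pos Y \<Longrightarrow> FDp pos (\<lambda>e. X e - Y e)" unfolding FDp_def by (auto intro: FD_diff)

lemma PT_inj:
  assumes "ok pos T" "FDp pos X" "FDp pos Y" "PT d T \<bullet> X = PT d T \<bullet> Y" shows "X = Y"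
proof -
  have "finite T" using assms ok_finite by blast
  then show ?thesis using assms
  proof (induction T rule: finite_induct)
    case (insert t T)
    obtain a c b where t: "t = (a, c, b)" by (cases t)
    have ab: "a \<in> V" "b \<in> V" "pos a < pos b" using okD[OF insert.prems(1)] t by blast+
    have "lf d a c b \<bullet> (PT d T \<bullet> X) = lf d a c b \<bullet> (PT d T \<bullet> Y)"
      using insert t by (simp add: PT_insert pt_mult)
    moreover have "FD a b (PT d T \<bullet> X)" "FD a b (PT d T \<bullet> Y)"
      using insert.prems ab by (auto simp: FDp_def intro: FD_pt)
    ultimately have "PT d T \<bullet> X = PT d T \<bullet> Y" using lf_inj2 by blast
    then show ?case using insert.IH insert.prems ok_subset by blast
  qed simp
qed

text \<open>As no edge of T leaves U, \<open>Bd_div\<close> applies to each edge in turn.\<close>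

lemma PT_Bd:
  assumes "ok pos T" "FDp pos X" "Bd U (PT d T \<bullet> X)" "finite U" "\<And>a c b. (a, c, b) \<in> T \<Longrightarrow> a \<in> U \<Longrightarrow> b \<in> U"
  shows "Bd U X"
proof -
  have "finite T" using assms ok_finite by blast
  then show ?thesis using assms
  proof (induction T rule: finite_induct)
    case (insert t T)
    obtain a c b where t: "t = (a, c, b)" by (cases t)
    have ab: "a \<in> V" "b \<in> V" "pos a < pos b" using okD[OF insert.prems(1)] t by blast+
    have "Bd U (lf d a c b \<bullet> (PT d T \<bullet> X))" using insert t by (simp add: PT_insert pt_mult)
    moreover have "FD a b (PT d T \<bullet> X)" using insert.prems ab by (auto simp: FDp_def intro: FD_pt)
    moreover have "a \<in> U \<Longrightarrow> b \<in> U" using insert.prems(5)[of a c b] t by simp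
    ultimately have "Bd U (PT d T \<bullet> X)" using Bd_div insert.prems(4) by blast
    then show ?case
      using insert.IH[OF ok_subset[OF insert.prems(1)] insert.prems(2) _ insert.prems(4)] insert.prems(5) by blast
  qed simp
qed

lemma PT_solve:
  assumes "ok pos T" "Sp pos \<Theta>" shows "\<exists>X. Sp pos X \<and> PT d T \<bullet> X = \<Theta>"
proof -
  have "finite T" using assms ok_finite by blast
  then show ?thesis using assms
  proof (induction T arbitrary: \<Theta> rule: finite_induct)
    case (insert t T)
    obtain a c b where t: "t = (a, c, b)" by (cases t)
    have ab: "a \<in> V" "b \<in> V" "pos a < pos b" using okD[OF insert.prems(1)] t by blast+
    have "FD a b \<Theta>" using Sp_FDp[OF insert.prems(2)] ab by (auto simp: FDp_def)
    then obtain Y where Y: "lf d a c b \<bullet> Y = \<Theta>" "FD a b Y" using lf_exists by blast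
    have "Sp pos Y" unfolding Sp_def
    proof
      fix x assume "x \<in> V"
      then have "Bd {y \<in> V. pos x \<le> pos y} (lf d a c b \<bullet> Y)" using insert.prems(2) Y by (auto simp: Sp_def)
      then show "Bd {y \<in> V. pos x \<le> pos y} Y" by (rule Bd_div[OF Y(2)]) (use fin_V ab in auto)
    qed
    then obtain X where "Sp pos X" "PT d T \<bullet> X = Y" using insert.IH insert.prems ok_subset by blast
    then show ?case using Y insert t by (intro exI[of _ X]) (simp add: PT_insert pt_mult)
  qed auto
qed

lemma PT_Sp:
  assumes "ok pos T" "FDp pos X" "BB \<Theta>" "PT d T \<bullet> X = p \<bullet> \<Theta>" shows "Sp pos X"
proof -
  obtain Y where "Sp pos Y" "PT d T \<bullet> Y = p \<bullet> \<Theta>" using PT_solve[OF assms(1)] assms(3) BB_Sp Sp_pt by meson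
  then show ?thesis using PT_inj[OF assms(1,2) Sp_FDp] assms(4) by metis
qed

subsection \<open>Cuts\<close>

definition bdry :: "(nat \<times> complex fps \<times> nat) set \<Rightarrow> nat set \<Rightarrow> (nat \<times> complex fps \<times> nat) set" where
  "bdry T U = {(a, c, b) \<in> T. a \<in> U \<and> b \<notin> U}"

text \<open>Sums of series whose quotients by all edges of \<open>T\<close> decay from \<open>c1\<close> to \<open>c0\<close>: a set \<open>U\<close> with
  \<open>c0 \<in> U\<close> and \<open>c1 \<notin> U\<close> suffices for this when no edge leaves it.\<close>

inductive Kc :: "(nat \<times> complex fps \<times> nat) set \<Rightarrow> nat \<Rightarrow> nat \<Rightarrow> (expo \<Rightarrow> 'w) \<Rightarrow> bool" for T c0 c1 where
  gen: "U \<subseteq> V \<Longrightarrow> c0 \<in> U \<Longrightarrow> c1 \<notin> U \<Longrightarrow> BB \<Theta> \<Longrightarrow> PT d (bdry T U) dvd p \<Longrightarrow> Kc T c0 c1 (p \<bullet> \<Theta>)"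
| add: "Kc T c0 c1 X \<Longrightarrow> Kc T c0 c1 Y \<Longrightarrow> Kc T c0 c1 (\<lambda>e. X e + Y e)"

lemma Kc_pt: "Kc T c0 c1 X \<Longrightarrow> Kc T c0 c1 (p \<bullet> X)"
proof (induction rule: Kc.induct)
  case (gen U \<Theta> q)
  then show ?case unfolding pt_mult[symmetric] by (intro Kc.gen) auto
qed (auto simp: pt_add_right intro: Kc.add)

lemma Kc_sum: "finite A \<Longrightarrow> A \<noteq> {} \<Longrightarrow> (\<And>i. i \<in> A \<Longrightarrow> Kc T c0 c1 (X i)) \<Longrightarrow> Kc T c0 c1 (\<lambda>e. \<Sum>i\<in>A. X i e)"
  by (induction A rule: finite_ne_induct) (auto intro: Kc.add)

text \<open>For a generator the factor p already contains the edges that leave U, so only the others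
  are divided out. U is closed under these, hence the quotient stays bounded below in the degree of
  U, which contains c0 and not c1.\<close>

lemma Kc_solve:
  assumes "Kc T c0 c1 \<Theta>" "ok pos T" "c1 \<in> V"
  shows "\<exists>X. Sp pos X \<and> PT d T \<bullet> X = \<Theta> \<and> FD c1 c0 X"
  using assms(1)
proof (induction rule: Kc.induct)
  case (gen U \<Theta> p)
  obtain q where p: "p = PT d (bdry T U) * q" using gen by (auto elim: dvdE)
  have T: "T = bdry T U \<union> (T - bdry T U)" by (auto simp: bdry_def)
  have fin: "finite T" using assms ok_finite by blast
  have sub: "bdry T U \<subseteq> T" by (auto simp: bdry_def)
  have ok2: "ok pos (T - bdry T U)" using assms(2) ok_subset by blast
  have Sp: "Sp pos (q \<bullet> \<Theta>)" using gen BB_Sp Sp_pt by blast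
  obtain X where X: "Sp pos X" "PT d (T - bdry T U) \<bullet> X = q \<bullet> \<Theta>" using PT_solve[OF ok2 Sp] by blast
  have "PT d T = PT d (bdry T U) * PT d (T - bdry T U)"
    using fin sub by (subst T, intro PT_union) (auto intro: finite_subset)
  then have "PT d T \<bullet> X = p \<bullet> \<Theta>" using X p by (simp add: pt_mult)
  moreover have "Bd U X"
    by (rule PT_Bd[OF ok2 Sp_FDp[OF X(1)]])
      (use X(2) gen fin_V finite_subset in \<open>auto simp: bdry_def intro: Bd_pt BB_Bd\<close>)
  then have "FD c1 c0 X" by (rule FD_Bd) (use gen fin_V finite_subset in auto)
  ultimately show ?case using X by blast
next
  case (add X Y)
  then obtain X' Y' where "Sp pos X'" "PT d T \<bullet> X' = X" "FD c1 c0 X'" "Sp pos Y'" "PT d T \<bullet> Y' = Y" "FD c1 c0 Y'" by blast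
  then show ?case by (intro exI[of _ "\<lambda>e. X' e + Y' e"]) (auto simp: pt_add_right intro: Sp_add FD_add)
qed

lemma Kc_FD:
  assumes "Kc T c0 c1 \<Theta>" "ok pos T" "c1 \<in> V" "FDp pos X" "PT d T \<bullet> X = \<Theta>" shows "FD c1 c0 X"
  using Kc_solve[OF assms(1-3)] PT_inj[OF assms(2) assms(4) Sp_FDp] assms(5) by metis

subsection \<open>Extraction of a value on a path\<close>

fun pedges :: "nat list \<Rightarrow> complex fps list \<Rightarrow> (nat \<times> complex fps \<times> nat) set" where
  "pedges (a # b # vs) (c # cs) = insert (a, c, b) (pedges (b # vs) cs)"
| "pedges _ _ = {}"

lemma pedges_set: "(a, c, b) \<in> pedges vs cs \<Longrightarrow> a \<in> set vs \<and> b \<in> set vs \<and> c \<in> set cs"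
  by (induction vs cs rule: pedges.induct) auto

lemma finite_pedges: "finite (pedges vs cs)" by (induction vs cs rule: pedges.induct) auto

lemma pedges_pos: "sorted_wrt (\<lambda>a b. pos a < pos b) ws \<Longrightarrow> (x, z, y) \<in> pedges ws ds \<Longrightarrow> pos x < pos y"
  by (induction ws ds rule: pedges.induct) auto

lemma ok_pedges: "sorted_wrt (\<lambda>a b. pos a < pos b) vs \<Longrightarrow> set vs \<subseteq> V \<Longrightarrow> ok pos (pedges vs cs)"
  unfolding ok_def using pedges_pos pedges_set finite_pedges by fastforce

lemma Id_insert:
  assumes "Id E X" "BB Q" "finite E" "(a, c, b) \<notin> E"
  shows "Id (insert (a, c, b) E) (\<lambda>e. (lf d a c b \<bullet> Q) e + X e)"
proof -
  obtain Q' where "\<forall>t\<in>E. BB (Q' t)" "X = (\<lambda>e. \<Sum>(a, c, b)\<in>E. (lf d a c b \<bullet> Q' (a, c, b)) e)"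
    using assms(1) by (auto simp: Id_def)
  moreover have "(\<Sum>t\<in>E. case t of (x, y, z) \<Rightarrow> (lf d x y z \<bullet> (Q'((a, c, b) := Q)) (x, y, z)) e) =
    (\<Sum>t\<in>E. case t of (x, y, z) \<Rightarrow> (lf d x y z \<bullet> Q' (x, y, z)) e)" for e
    using assms(4) by (intro sum.cong) auto
  ultimately show ?thesis unfolding Id_def using assms
    by (intro exI[of _ "Q'((a, c, b) := Q)"]) auto
qed

lemma FD_refl: "FD v v X \<Longrightarrow> X = (\<lambda>e. 0)"
proof
  fix e assume F: "FD v v X"
  show "X e = 0"
  proof (rule zt_all)
    fix p
    obtain J where "\<forall>j\<ge>J. zt p (X (e + mv v v j))" using F unfolding FD_def by blast
    then show "zt p (X e)" by (auto simp: mv_def)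
  qed
qed

text \<open>X decays along the path and also from its end to its start. The first form is split off
  by division with remainder; the part of X that belongs to the remainder, multiplied by this form,
  solves the problem for the path without its first vertex, and its decay from the end now leads to
  the second vertex. On a single vertex the two ends coincide and X must be zero.\<close>

lemma path_extract:
  assumes "distinct vs" "set vs \<subseteq> V" "length vs = Suc (length cs)" "sorted_wrt (\<lambda>a b. pos a < pos b) vs"
    and "\<And>c. c \<in> set cs \<Longrightarrow> unit0 c"
    and "FDp pos X" "PT d (pedges vs cs) \<bullet> X = \<Theta>" "BB \<Theta>" "FD (last vs) (hd vs) X"
  shows "Id (pedges vs cs) \<Theta>"
  using assms
proof (induction vs cs arbitrary: X \<Theta> rule: pedges.induct)
  case (1 a b vs c cs)
  let ?P = "pedges (b # vs) cs"
  let ?L = lk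
  have ab: "a \<in> V" "b \<in> V" "a \<noteq> b" "pos a < pos b" "unit0 c" using 1 by auto
  have aP: "(a, c', b') \<notin> ?P" "(b', c', a) \<notin> ?P" for c' b' using pedges_set[of _ _ _ "b # vs" cs] 1 by auto
  have okP: "ok pos ?P" using 1 by (intro ok_pedges) auto
  have "PT d (insert (a, c, b) ?P) = lf d a c b * PT d ?P"
    using aP finite_pedges by (simp add: PT_insert)
  then have X\<Theta>: "lf d a c b \<bullet> PT d ?P \<bullet> X = \<Theta>" using 1(8) by (simp add: pt_mult)
  obtain Q R where QR: "BB Q" "BB R" "\<Theta> = (\<lambda>e. (lf d a c b \<bullet> Q) e + R e)"
     "\<And>e. R e \<noteq> 0 \<Longrightarrow> 0 \<le> ?L e a \<and> ?L e a < int d"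
    using divrem[OF 1(9) ab(1,2,3,5)] by blast
  \<comment> \<open>XQ accounts for the multiple of the first form. It is bounded below in z_a,
    since no other edge of the path meets a, so subtracting it keeps the decay from the end to
    a.\<close>
  obtain XQ where XQ: "Sp pos XQ" "PT d ?P \<bullet> XQ = Q" using PT_solve[OF okP BB_Sp[OF QR(1)]] by blast
  define XR where "XR e = X e - XQ e" for e
  have FDXR: "FDp pos XR" unfolding XR_def[abs_def] using 1 XQ Sp_FDp by (intro FDp_diff) auto
  define X' where "X' = lf d a c b \<bullet> XR"
  have X'R: "PT d ?P \<bullet> X' = R"
  proof -
    have "PT d ?P \<bullet> X' = (lf d a c b * PT d ?P) \<bullet> XR" by (simp add: X'_def pt_mult pt_commute)
    also have "\<dots> = (\<lambda>e. \<Theta> e - (lf d a c b \<bullet> Q) e)"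
      unfolding XR_def[abs_def] pt_diff_right using X\<Theta> XQ by (simp add: pt_mult)
    finally show ?thesis by (simp add: QR(3))
  qed
  have FDX': "FDp pos X'" unfolding X'_def by (intro FDp_pt FDXR)
  \<comment> \<open>X' cut down to these exponents of z_a is another solution for the same R,
    because the other forms do not involve z_a. Uniqueness of quotients makes the two equal.\<close>
  have X'0: "0 \<le> ?L e a \<and> ?L e a < int d" if "X' e \<noteq> 0" for e
  proof -
    define W where "W e = (if 0 \<le> ?L e a \<and> ?L e a < int d then X' e else 0)" for e
    have "FDp pos W" unfolding FDp_def FD_def
    proof (intro ballI impI allI)
      fix x y e p assume xy: "x \<in> V" "y \<in> V" "pos x < pos y"
      then obtain J where "\<forall>j\<ge>J. zt p (X' (e + mv x y j))" using FDX' unfolding FDp_def FD_def by blast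
      then show "\<exists>J. \<forall>j\<ge>J. zt p (W (e + mv x y j))" by (intro exI[of _ J]) (auto simp: W_def)
    qed
    moreover have "PT d ?P \<bullet> W = R"
    proof -
      have "(PT d E \<bullet> W) e = (if 0 \<le> ?L e a \<and> ?L e a < int d then (PT d E \<bullet> X') e else 0)"
        if "finite E" "\<And>x z y. (x, z, y) \<in> E \<Longrightarrow> x \<noteq> a \<and> y \<noteq> a" for E e
        using that
      proof (induction E arbitrary: e rule: finite_induct)
        case empty then show ?case by (simp add: W_def)
      next
        case (insert t E)
        obtain x z y where t: "t = (x, z, y)" by (cases t)
        have xy: "x \<noteq> a" "y \<noteq> a" using insert.prems t by auto
        have IH: "(PT d E \<bullet> W) e = (if 0 \<le> ?L e a \<and> ?L e a < int d then (PT d E \<bullet> X') e else 0)" for e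
          using insert by blast
        have "PT d (insert t E) = lf d x z y * PT d E" using insert t by (simp add: PT_insert)
        then show ?case using xy by (simp add: pt_mult pt_lf IH lookup_minus lookup_single when_def)
      qed
      then have "(PT d ?P \<bullet> W) e = (if 0 \<le> ?L e a \<and> ?L e a < int d then R e else 0)" for e
        unfolding X'R[symmetric] using aP by (metis finite_pedges)
      then show ?thesis using QR(4) by fastforce
    qed
    ultimately have "W = X'" using PT_inj[OF okP _ FDX'] X'R by metis
    then show ?thesis using that by (metis W_def)
  qed
  define l where "l = last (b # vs)"
  have la: "l \<noteq> a" using 1 unfolding l_def by (metis distinct.simps(2) last_in_set list.discI)
  have FDl: "FD l a XR"
  proof -
    have "Bd {a} XQ"
      by (rule PT_Bd[OF okP Sp_FDp[OF XQ(1)]]) (use XQ(2) QR(1) ab aP in \<open>auto simp: BB_def\<close>)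
    then have "FD l a XQ" using la by (intro FD_Bd[of "{a}"]) auto
    moreover have "FD l a X" using 1(10) by (simp add: l_def)
    ultimately show ?thesis unfolding XR_def[abs_def] by (intro FD_diff)
  qed
  \<comment> \<open>XR is unrolled at an exponent moved j times from a to l. Only the term i = j
    meets the admissible exponents of z_a, and its argument is moved j times from b to l. So the
    decay of XR in the first direction bounds X' in the second.\<close>
  have "FD l b X'" unfolding FD_def
  proof (intro allI)
    fix e p
    obtain J where J: "\<And>j. j \<ge> J \<Longrightarrow> zt p (XR ((e - sg a (int d)) + mv l a j))" using FDl by (metis FD_def)
    have "zt p (X' (e + mv l b j))" if j: "j \<ge> J" for j
    proof (cases "0 \<le> ?L e a \<and> ?L e a < int d")
      case False
      have "?L (e + mv l b j) a = ?L e a" using ab la by (simp add: mv_def lookup_add lookup_minus lookup_single)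
      then have "X' (e + mv l b j) = 0" using X'0[of "e + mv l b j"] False by metis
      then show ?thesis by simp
    next
      case True
      let ?k = "(e - sg a (int d)) + mv l a j"
      have arg: "?k + sg a (int d) + mv a b i = e + mv l a j + mv a b i" for i by simp
      have La: "?L (e + mv l a j + mv a b i) a = ?L e a + (int i - int j) * int d" for i
        using ab la by (simp add: mv_def lookup_add lookup_minus lookup_single algebra_simps)
      have z: "X' (e + mv l a j + mv a b i) = 0" if "i \<noteq> j" for i
      proof (rule ccontr)
        assume "X' (e + mv l a j + mv a b i) \<noteq> 0"
        then have *: "0 \<le> ?L e a + (int i - int j) * int d" "?L e a + (int i - int j) * int d < int d"
          using X'0 La by metis+
        have "int i - int j \<noteq> 0" using that by simp
        then consider "int i - int j \<ge> 1" | "int i - int j \<le> -1" by linarith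
        then show False
        proof cases
          case 1
          then have "1 * int d \<le> (int i - int j) * int d" by (intro mult_right_mono) auto
          then show False using * True by linarith
        next
          case 2
          then have "(int i - int j) * int d \<le> (-1) * int d" by (intro mult_right_mono) auto
          then show False using * True by linarith
        qed
      qed
      obtain M where M: "\<And>i. i \<ge> M \<Longrightarrow> zt p (XR (?k + mv a b i))"
        using FDXR ab unfolding FDp_def FD_def by meson
      define J' where "J' = M + Suc j"
      have J': "M \<le> J'" "j < J'" by (auto simp: J'_def)
      have "XR ?k = (\<Sum>i<J'. sc (c ^ i) (X' (?k + sg a (int d) + mv a b i))) + sc (c ^ J') (XR (?k + mv a b J'))"
        unfolding X'_def by (rule lf_unroll)
      also have "(\<Sum>i<J'. sc (c ^ i) (X' (?k + sg a (int d) + mv a b i))) = (\<Sum>i<J'. if i = j then sc (c ^ j) (X' (e + mv l a j + mv a b j)) else 0)"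
        by (intro sum.cong) (auto simp: arg z)
      also have "\<dots> = sc (c ^ j) (X' (e + mv l a j + mv a b j))" using J' by simp
      finally have "sc (c ^ j) (X' (e + mv l a j + mv a b j)) = XR ?k - sc (c ^ J') (XR (?k + mv a b J'))" by simp
      moreover have "zt p (XR ?k)" using J[OF j] .
      moreover have "zt p (sc (c ^ J') (XR (?k + mv a b J')))" by (intro zt_sc M J')
      ultimately have "zt p (sc (c ^ j) (X' (e + mv l a j + mv a b j)))" by (simp add: zt_diff)
      then have "zt p (X' (e + mv l a j + mv a b j))" using zt_unit[of "c ^ j"] ab by (simp add: fps_nth_power_0)
      moreover have "mv l a j + mv a b j = mv l b j" by (simp add: mv_def)
      ultimately show ?thesis by (simp add: add.assoc)
    qed
    then show "\<exists>J. \<forall>j\<ge>J. zt p (X' (e + mv l b j))" by blast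
  qed
  then have "FD (last (b # vs)) (hd (b # vs)) X'" by (simp add: l_def)
  then have "Id ?P R" using 1 FDX' X'R QR(2) by (intro "1.IH"[of X' R]) auto
  then show ?case unfolding QR(3) pedges.simps using QR(1) finite_pedges aP by (intro Id_insert) auto
next
  \<comment> \<open>Decay from a vertex to itself says that each coefficient lies in every power of
    the filtration.\<close>
  case ("2_2" v cs)
  then have "X = (\<lambda>e. 0)" using FD_refl[of v X] by simp
  then have "\<Theta> = (\<lambda>e. 0)" using "2_2"(7) by auto
  then show ?case by (auto simp: Id_def)
next
  case ("2_3" vs)
  then obtain v where "vs = [v]" by (auto simp: length_Suc_conv)
  then have "X = (\<lambda>e. 0)" using "2_3" FD_refl[of v X] by simp
  then have "\<Theta> = (\<lambda>e. 0)" using "2_3"(7) by auto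
  then show ?case by (auto simp: Id_def)
qed auto

end

section \<open>Vandermonde products and cuts along paths\<close>

definition VD :: "nat \<Rightarrow> nat set \<Rightarrow> lpoly" where
  "VD d A = (\<Prod>(x, y)\<in>{(x, y). x \<in> A \<and> y \<in> A \<and> x < y}. Var x ^ d - Var y ^ d)"

lemma finite_pairs: "finite A \<Longrightarrow> finite {(x, y). x \<in> A \<and> y \<in> A \<and> x < (y::nat)}"
  by (rule finite_subset[of _ "A \<times> A"]) auto

lemma VD_split:
  assumes "finite A" "N \<subseteq> A" shows "VD d N * VD d (A - N) dvd VD d A"
proof -
  let ?P = "\<lambda>A. {(x, y). x \<in> A \<and> y \<in> A \<and> x < (y::nat)}"
  have "VD d N * VD d (A - N) = (\<Prod>(x, y)\<in>?P N \<union> ?P (A - N). Var x ^ d - Var y ^ d)"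
    unfolding VD_def using assms by (intro prod.union_disjoint[symmetric] finite_pairs) (auto intro: finite_subset)
  also have "\<dots> dvd VD d A"
    unfolding VD_def using assms by (intro prod_dvd_prod_subset finite_pairs) auto
  finally show ?thesis .
qed

text \<open>\<open>vandermonde_ideal\<close> with t = z_b^d and nodes c z_x^d: each summand supplies
  all edges from b into N but one. The powers of the unit c are divided out.\<close>

lemma VD_lagrange:
  assumes "finite N" "N \<noteq> {}" and c: "unit0 c"
  shows "\<exists>h. VD d N = (\<Sum>a\<in>N. h a * (\<Prod>x\<in>N - {a}. lf d b c x))"
proof -
  let ?P = "{(x, y). x \<in> N \<and> y \<in> N \<and> x < (y::nat)}"
  obtain h where h: "(\<Prod>(x, y)\<in>?P. Cst c * Var x ^ d - Cst c * Var y ^ d) = (\<Sum>a\<in>N. h a * (\<Prod>x\<in>N - {a}. Var b ^ d - Cst c * Var x ^ d))"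
    using vandermonde_ideal[OF assms(1,2), of "\<lambda>x. Cst c * Var x ^ d" "Var b ^ d"] by auto
  have 1: "(\<Prod>(x, y)\<in>?P. Cst c * Var x ^ d - Cst c * Var y ^ d) = Cst c ^ card ?P * VD d N"
    unfolding VD_def right_diff_distrib[symmetric] by (subst prod.distrib[symmetric, where g = "\<lambda>_. Cst c", simplified prod_constant, symmetric] | simp add: case_prod_unfold prod.distrib)+
  have 2: "Cst (inverse c) ^ card ?P * Cst c ^ card ?P = 1"
    using fps_unit_inverse(1)[OF c] by (simp add: power_mult_distrib[symmetric] Cst_mult[symmetric])
  have "VD d N = Cst (inverse c) ^ card ?P * (Cst c ^ card ?P * VD d N)" using 2 by (simp add: mult.assoc[symmetric])
  also have "\<dots> = (\<Sum>a\<in>N. (Cst (inverse c) ^ card ?P * h a) * (\<Prod>x\<in>N - {a}. lf d b c x))"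
    unfolding 1[symmetric] h sum_distrib_left lf_def by (simp add: mult.assoc)
  finally show ?thesis by (intro exI)
qed

text \<open>Paths that start at c0 and follow edges of TA, written backwards: the head of the list
  is the end of the path, so every nonempty suffix is a path again.\<close>

inductive RP :: "(nat \<times> complex fps \<times> nat) set \<Rightarrow> complex fps \<Rightarrow> nat \<Rightarrow> nat list \<Rightarrow> bool" for TA cA c0 where
  base: "RP TA cA c0 [c0]"
| step: "RP TA cA c0 (b # ps) \<Longrightarrow> (b, cA, x) \<in> TA \<Longrightarrow> RP TA cA c0 (x # b # ps)"

lemma RP_suffix: "RP TA cA c0 (qs @ b # ps) \<Longrightarrow> RP TA cA c0 (b # ps)"
proof (induction qs)
  case (Cons q qs)
  have "RP TA cA c0 (qs @ b # ps)" using Cons.prems by (cases rule: RP.cases) (auto simp: append_eq_Cons_conv Cons_eq_append_conv)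
  then show ?case by (rule Cons.IH)
qed simp

context hmodule_vars
begin

lemma BB_PT: "finite T \<Longrightarrow> BB X \<Longrightarrow> BB (PT d T \<bullet> X)"
proof (induction T rule: finite_induct)
  case (insert t T)
  obtain a c b where t: "t = (a, c, b)" by (cases t)
  show ?case using insert t by (simp add: PT_insert pt_mult BB_lf)
qed simp

lemma van_PT_cancel:
  assumes "finite T" "C \<subseteq> V" "\<And>v. v \<in> C \<Longrightarrow> unit0 (u v)" "BB X"
    "\<And>a c b. (a, c, b) \<in> T \<Longrightarrow> a \<in> V \<and> b \<in> V \<and> a \<noteq> b \<and> unit0 c \<and> \<not> (a \<in> C \<and> b \<in> C \<and> u a = c * u b)"
    "van C u (PT d T \<bullet> X)"
  shows "van C u X"
  using assms
proof (induction T rule: finite_induct)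
  case (insert t T)
  obtain a c b where t: "t = (a, c, b)" by (cases t)
  have *: "a \<in> V" "b \<in> V" "a \<noteq> b" "unit0 c" "\<not> (a \<in> C \<and> b \<in> C \<and> u a = c * u b)"
    using insert.prems(4)[of a c b] t by auto
  have "van C u (lf d a c b \<bullet> (PT d T \<bullet> X))" using insert t by (simp add: PT_insert pt_mult)
  then have "van C u (PT d T \<bullet> X)"
    by (rule van_cancel[rotated -1]) (use insert * in \<open>auto intro: BB_PT\<close>)
  note v = this
  have T': "a \<in> V \<and> b \<in> V \<and> a \<noteq> b \<and> unit0 c \<and> \<not> (a \<in> C \<and> b \<in> C \<and> u a = c * u b)"
    if "(a, c, b) \<in> T" for a c b using insert.prems(4)[of a c b] that by blast
  show ?case by (rule insert.IH[OF insert.prems(1,2,3) T' v])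
qed simp

text \<open>Only exponents that are 0 at b contribute, and on these the weights and slices for C and
  for C without b agree.\<close>

lemma van_drop:
  assumes C: "C \<subseteq> V" and b: "b \<in> C" and R: "BB R" "\<And>e. R e \<noteq> 0 \<Longrightarrow> lk e b = 0"
    and v: "van C u R"
  shows "van (C - {b}) u R"
  unfolding van_def
proof (intro allI)
  fix \<kappa> n
  let ?L = lk
  note fC = fin_C[OF C]
  let ?f = "\<lambda>e. sc (wt u C e) (R e)"
  show "subs (C - {b}) u R \<kappa> n = 0"
  proof (cases "?L \<kappa> b = 0")
    case False
    have "R e = 0" if "e \<in> sl (C - {b}) \<kappa> n" for e using that R(2)[of e] False by (auto simp: sl_def)
    then show ?thesis unfolding subs_def by (intro hsum_0) simp
  next
    case True
    have es: "esum C e = ?L e b + esum (C - {b}) e" for e unfolding esum_def using sum.remove[OF fC b] by simp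
    let ?A = "sl (C - {b}) \<kappa> n" and ?B = "{e \<in> sl C \<kappa> n. ?L e b \<noteq> 0}"
    have "e \<in> ?A \<longleftrightarrow> e \<in> sl C \<kappa> n \<and> ?L e b = 0" for e
    proof
      assume e: "e \<in> ?A"
      then have "?L e b = 0" using True by (auto simp: sl_def)
      then show "e \<in> sl C \<kappa> n \<and> ?L e b = 0" using e by (auto simp: sl_def es[of e])
    next
      assume e: "e \<in> sl C \<kappa> n \<and> ?L e b = 0"
      then show "e \<in> ?A" using True by (auto simp: sl_def es[of e])
    qed
    then have un: "sl C \<kappa> n = ?A \<union> ?B" by blast
    have dis: "?A \<inter> ?B = {}" using True by (auto simp: sl_def)
    have "hsum sc ?f (sl C \<kappa> n) = hsum sc ?f ?A + hsum sc ?f ?B"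
      by (rule hsum_split[OF subs_sm[OF R(1) C] un dis])
    also have "hsum sc ?f ?B = 0" 
    proof (rule hsum_0)
      fix e assume "e \<in> ?B"
      then have "R e = 0" using R(2)[of e] by blast
      then show "?f e = 0" by simp
    qed
    also have "hsum sc ?f ?A = subs (C - {b}) u R \<kappa> n" unfolding subs_def
    proof (rule hsum_cong)
      fix e assume "e \<in> ?A"
      then have "?L e b = 0" using True by (auto simp: sl_def)
      then have "wt u C e = wt u (C - {b}) e" unfolding wt_def prod.remove[OF fC b] by simp
      then show "?f e = sc (wt u (C - {b}) e) (R e)" by simp
    qed
    finally show ?thesis using v by (auto simp: van_def subs_def)
  qed
qed

text \<open>One form is divided out after the other. Those already removed do not vanish on the next
  pair: two edges from a0 to the same x would have the same coefficient.\<close>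

lemma multi_div:
  assumes "finite E" and a0: "a0 \<in> Z" and u: "\<And>v. v \<in> V \<Longrightarrow> unit0 (u v)"
    and E: "\<And>a c x. (a, c, x) \<in> E \<Longrightarrow> a = a0 \<and> x \<in> V \<and> x \<noteq> a0 \<and> u a0 = c * u x \<and> unit0 c"
    and R: "BB R" and v: "\<And>a c x. (a, c, x) \<in> E \<Longrightarrow> van {a0, x} u R"
  shows "\<exists>R'. BB R' \<and> R = PT d E \<bullet> R'"
  using assms(1) E v
proof (induction E rule: finite_induct)
  case (insert t E)
  obtain a c x where t: "t = (a, c, x)" by (cases t)
  have x: "a = a0" "x \<in> V" "x \<noteq> a0" "u a0 = c * u x" "unit0 c" using insert.prems(1)[of a c x] t by auto
  obtain R' where R': "BB R'" "R = PT d E \<bullet> R'" using insert.IH insert.prems by (meson insertI2)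
  have a0V: "a0 \<in> V" using a0 Z_V by auto
  have "van {a0, x} u (PT d E \<bullet> R')" using insert.prems(2)[of a c x] t R'(2) by auto
  then have "van {a0, x} u R'"
  proof (rule van_PT_cancel[rotated -1])
    fix a' c' y assume e: "(a', c', y) \<in> E"
    then have y: "a' = a0" "y \<in> V" "y \<noteq> a0" "u a0 = c' * u y" "fps_nth c' 0 \<noteq> 0" using insert.prems(1)[of a' c' y] by auto
    have "y \<noteq> x"
    proof
      assume "y = x"
      then have "c' * u x * inverse (u x) = c * u x * inverse (u x)" using x y by simp
      then have "c' = c" using fps_unit_inverse[OF u[OF x(2)]] by (simp add: mult.assoc)
      then show False using \<open>y = x\<close> y x insert.hyps e t by auto
    qed
    then show "a' \<in> V \<and> y \<in> V \<and> a' \<noteq> y \<and> fps_nth c' 0 \<noteq> 0 \<and> \<not> (a' \<in> {a0, x} \<and> y \<in> {a0, x} \<and> u a' = c' * u y)"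
      using y a0V by auto
  qed (use insert.hyps a0V x u R' in auto)
  then obtain Y where "BB Y" "R' = lf d a0 c x \<bullet> Y"
    using van_dvd[of a0 x u R' c] R' a0 x u a0V by blast
  then show ?case using R' insert.hyps t x by (intro exI[of _ Y]) (auto simp: PT_insert pt_mult pt_commute)
qed (use R in auto)

end

text \<open>What the recursion over cuts uses, detached from the concrete graph. Paths follow TA,
  whose edges all have coefficient cA; TO holds the other edges, and Z0 is part of every cut from
  the start. \<open>lev\<close> keeps the neighbourhoods along a path disjoint, so that each has its
  own share of the Vandermonde product. \<open>Psi\<close> and \<open>sep\<close> allow the edges of
  TO at the end of a path to be divided out.\<close>

locale cut_setup = hmodule_vars sc s0 co d V Z
  for sc :: "complex fps \<Rightarrow> 'w \<Rightarrow> 'w::ab_group_add"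
    and s0 :: "complex \<Rightarrow> 'v \<Rightarrow> 'v::ab_group_add" and co :: "'w \<Rightarrow> nat \<Rightarrow> 'v" and d :: nat and V Z +
  fixes pos :: "nat \<Rightarrow> nat" and TA TO :: "(nat \<times> complex fps \<times> nat) set" and cA :: "complex fps"
    and c0 c1 :: nat and Z0 :: "nat set" and u :: "nat \<Rightarrow> complex fps" and \<Psi> :: "expo \<Rightarrow> 'w"
  assumes okT: "ok pos (TA \<union> TO)" and disj: "TA \<inter> TO = {}"
    and TA: "\<And>a c b. (a, c, b) \<in> TA \<Longrightarrow> c = cA \<and> a \<in> Z \<and> b \<in> Z"
    and c0: "c0 \<in> Z" and Z0: "Z0 \<subseteq> V" "Z0 \<inter> Z = {}" and Z0s: "\<And>a c b. (a, c, b) \<in> TA \<union> TO \<Longrightarrow> a \<notin> Z0"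
    and c1: "c1 \<notin> Z0" "\<And>ps. RP TA cA c0 ps \<Longrightarrow> c1 \<notin> set ps"
    and uu: "\<And>v. v \<in> V \<Longrightarrow> unit0 (u v)" and cAu: "unit0 cA"
    and ue: "\<And>a c b. (a, c, b) \<in> TA \<union> TO \<Longrightarrow> u a = c * u b \<and> unit0 c"
    and lev: "\<And>b ps b' ps' x. RP TA cA c0 (b # ps) \<Longrightarrow> RP TA cA c0 (b' # ps') \<Longrightarrow> (b, cA, x) \<in> TA \<Longrightarrow> (b', cA, x) \<in> TA \<Longrightarrow> length ps = length ps'"
    and O0: "\<And>c x. (c0, c, x) \<in> TO \<Longrightarrow> x \<in> Z0"
    and PsiBB: "BB \<Psi>"
    and Psi: "\<And>b ps c x. RP TA cA c0 (b # ps) \<Longrightarrow> ps \<noteq> [] \<Longrightarrow> (b, c, x) \<in> TO \<Longrightarrow> x \<notin> Z0 \<Longrightarrow> van (insert x (set (b # ps))) u \<Psi>"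
    and sep: "\<And>b ps y c x c' x'. RP TA cA c0 (b # ps) \<Longrightarrow> y \<in> set (b # ps) \<Longrightarrow> (b, c, x) \<in> TO \<Longrightarrow> (y, c', x') \<in> TO \<Longrightarrow> x \<notin> Z0 \<Longrightarrow> x' \<notin> Z0 \<Longrightarrow>
       x' \<notin> set (b # ps) \<and> (x' = x \<longrightarrow> y = b)"
begin

abbreviation "rp \<equiv> RP TA cA c0"

lemma TV: "(a, c, b) \<in> TA \<union> TO \<Longrightarrow> a \<in> V \<and> b \<in> V \<and> pos a < pos b \<and> a \<noteq> b"
  using okD[OF okT, of a c b] by auto

lemma finT: "finite TA" "finite TO" using ok_finite[OF okT] by auto

lemma rp_Z: "rp ps \<Longrightarrow> set ps \<subseteq> Z"
proof (induction rule: RP.induct)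
  case (step b ps x) then show ?case using TA[of b cA x] by simp
qed (simp add: c0)
lemma rp_c0: "rp ps \<Longrightarrow> c0 \<in> set ps" by (induction rule: RP.induct) auto
lemma rp_sorted: "rp ps \<Longrightarrow> sorted_wrt (\<lambda>a b. pos b < pos a) ps"
proof (induction rule: RP.induct)
  case (step b ps x)
  then have "pos b < pos x" using TV by blast
  then show ?case using step by auto
qed auto
lemma rp_distinct: "rp ps \<Longrightarrow> distinct ps"
proof -
  have "sorted_wrt (\<lambda>a b. pos b < pos a) qs \<Longrightarrow> distinct qs" for qs by (induction qs) auto
  then show "rp ps \<Longrightarrow> distinct ps" using rp_sorted by blast
qed

definition N :: "nat \<Rightarrow> nat set" where "N b = {x. (b, cA, x) \<in> TA}"
definition O' :: "nat \<Rightarrow> (nat \<times> complex fps \<times> nat) set" where "O' b = {(a, c, x) \<in> TO. a = b \<and> x \<notin> Z0}"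
text \<open>The edges leaving the cut, except the edges of TA at the end b of the path; those are
  left to the Vandermonde product.\<close>

definition Ec :: "nat \<Rightarrow> nat list \<Rightarrow> (nat \<times> complex fps \<times> nat) set" where
  "Ec b ps = {(a, c, x) \<in> TA \<union> TO. a \<in> set ps \<and> x \<notin> set (b # ps) \<union> Z0} \<union> O' b"
text \<open>The variables whose differences are still available in the Vandermonde product, after
  the vertices before the end of the path have spent their neighbourhoods.\<close>

definition rest :: "nat list \<Rightarrow> nat set" where "rest ps = Z - (\<Union>y\<in>set ps. N y)"

lemma N_Z: "N b \<subseteq> Z" using TA[of b cA] by (auto simp: N_def)
lemma fin_Z: "finite Z" using fin_V Z_V finite_subset by blast
lemma finN: "finite (N b)" using N_Z fin_Z finite_subset by blast
lemma finO: "finite (O' b)" using finT by (auto simp: O'_def elim: rev_finite_subset)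
lemma Ec_sub: "Ec b ps \<subseteq> TA \<union> TO" by (auto simp: Ec_def O'_def)
lemma finEc: "finite (Ec b ps)" using Ec_sub finT finite_subset by blast

text \<open>The vanishing that later steps will rely on: for each prolongation of the path to some q
  and each edge of TO from q, on the part of the path from b onwards. Earlier vertices are absent
  because the remainders did not involve their variables.\<close>

definition pr :: "nat \<Rightarrow> nat list \<Rightarrow> (expo \<Rightarrow> 'w) \<Rightarrow> bool" where
  "pr b ps \<Theta> \<longleftrightarrow> (\<forall>q qs c x. rp (q # qs @ b # ps) \<longrightarrow> (q, c, x) \<in> O' q \<longrightarrow> van (insert x (set (q # qs @ [b]))) u \<Theta>)"

lemma bdry_path:
  assumes "PT d (Ec b ps \<union> (\<lambda>x. (b, cA, x)) ` N b) dvd p"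
  shows "PT d (bdry (TA \<union> TO) (set (b # ps) \<union> Z0)) dvd p"
proof -
  have "bdry (TA \<union> TO) (set (b # ps) \<union> Z0) \<subseteq> Ec b ps \<union> (\<lambda>x. (b, cA, x)) ` N b"
  proof
    fix t assume t: "t \<in> bdry (TA \<union> TO) (set (b # ps) \<union> Z0)"
    obtain a c x where abc: "t = (a, c, x)" by (cases t)
    have e: "(a, c, x) \<in> TA \<union> TO" "a \<in> set (b # ps) \<union> Z0" "x \<notin> set (b # ps) \<union> Z0"
      using t abc by (auto simp: bdry_def)
    have "a \<notin> Z0" using Z0s e(1) by blast
    then consider "a \<in> set ps" | "a = b" "(a, c, x) \<in> TA" | "a = b" "(a, c, x) \<in> TO" using e by auto
    then show "t \<in> Ec b ps \<union> (\<lambda>x. (b, cA, x)) ` N b"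
    proof cases
      case 1 then show ?thesis using e by (auto simp: abc Ec_def)
    next
      case 2 then show ?thesis using TA[of a c x] by (auto simp: abc N_def)
    next
      case 3 then show ?thesis using e by (auto simp: abc Ec_def O'_def)
    qed
  qed
  then have "PT d (bdry (TA \<union> TO) (set (b # ps) \<union> Z0)) dvd PT d (Ec b ps \<union> (\<lambda>x. (b, cA, x)) ` N b)"
    by (intro PT_dvd) (auto simp: finEc finN)
  then show ?thesis using assms dvd_trans by blast
qed

text \<open>Induction on the number of vertices off the path. If no edge of TA starts at b, the path
  together with Z0 is a cut. Otherwise the Vandermonde product supplies all edges from b except one,
  to a, and \<Theta> is divided by the form of this edge. The quotient is cut here; the remainder,
  free of z_b, is passed on with a appended to the path.\<close>

lemma cut_rec:
  assumes "rp (b # ps)" "BB \<Theta>" "pr b ps \<Theta>" "PT d (Ec b ps) dvd G"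
  shows "Kc (TA \<union> TO) c0 c1 ((G * VD d (rest ps)) \<bullet> \<Theta>)"
  using assms
proof (induction "card (Z - set (b # ps))" arbitrary: b ps \<Theta> G rule: less_induct)
  case less
  let ?U = "set (b # ps) \<union> Z0"
  note rpb = less.prems(1)
  have bZ: "b \<in> Z" using rp_Z[OF rpb] by auto
  have bV: "b \<in> V" using bZ Z_V by auto
  have U: "?U \<subseteq> V" "c0 \<in> ?U" "c1 \<notin> ?U"
    using rp_Z[OF rpb] Z_V Z0 rp_c0[OF rpb] c1(2)[OF rpb] c1(1) by auto
  show ?case
  proof (cases "N b = {}")
    case True
    then have "PT d (bdry (TA \<union> TO) ?U) dvd G * VD d (rest ps)"
      using less.prems(4) by (intro bdry_path) (auto intro: dvd_mult2)
    then show ?thesis using U less.prems by (intro Kc.gen)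
  next
    case False
    obtain h where h: "VD d (N b) = (\<Sum>a\<in>N b. h a * (\<Prod>x\<in>N b - {a}. lf d b cA x))"
      using VD_lagrange[OF finN False cAu] by blast
    \<comment> \<open>A vertex reached from b and from an earlier y would give both paths the same
      length, by \<open>lev\<close>.\<close>
    have Nr: "N b \<subseteq> rest ps"
    proof
      fix x assume x: "x \<in> N b"
      have "x \<notin> N y" if "y \<in> set ps" for y
      proof
        assume xy: "x \<in> N y"
        obtain q1 q2 where q: "ps = q1 @ y # q2" using \<open>y \<in> set ps\<close> by (meson split_list)
        have "rp (y # q2)" using rpb q by (intro RP_suffix[of _ _ _ "b # q1"]) simp
        then have "length ps = length q2" using lev[OF rpb _ x[unfolded N_def mem_Collect_eq] xy[unfolded N_def mem_Collect_eq]] by blast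
        then show False using q by simp
      qed
      then show "x \<in> rest ps" using x N_Z by (auto simp: rest_def)
    qed
    have restb: "rest (b # ps) = rest ps - N b" by (auto simp: rest_def)
    obtain k where k: "VD d (rest ps) = VD d (N b) * VD d (rest (b # ps)) * k"
    proof -
      have "finite (rest ps)" using fin_Z by (simp add: rest_def)
      from VD_split[OF this Nr, of d] show thesis unfolding restb[symmetric] by (elim dvdE) (rule that)
    qed
    let ?P = "\<lambda>a. \<Prod>x\<in>N b - {a}. lf d b cA x"
    have eq: "G * VD d (rest ps) = (\<Sum>a\<in>N b. (G * ?P a * (h a * k)) * VD d (rest (b # ps)))"
      unfolding k h by (simp add: sum_distrib_left sum_distrib_right mult_ac)
    have PP: "?P a = PT d ((\<lambda>x. (b, cA, x)) ` (N b - {a}))" for a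
      unfolding PT_def by (simp add: prod.reindex inj_on_def)
    have Pall: "?P a * lf d b cA a = PT d ((\<lambda>x. (b, cA, x)) ` N b)" if "a \<in> N b" for a
      unfolding PT_def using finN that by (simp add: prod.reindex inj_on_def prod.remove[of "N b" a] mult.commute)
    have EN: "Ec b ps \<inter> (\<lambda>x. (b, cA, x)) ` N b = {}"
      using disj rp_distinct[OF rpb] by (auto simp: Ec_def O'_def N_def)
    have "Kc (TA \<union> TO) c0 c1 (((G * ?P a * (h a * k)) * VD d (rest (b # ps))) \<bullet> \<Theta>)" if a: "a \<in> N b" for a
    proof -
      have aT: "(b, cA, a) \<in> TA" using a by (simp add: N_def)
      have aZ: "a \<in> Z" "b \<noteq> a" "a \<in> V" using TA[OF aT] TV[of b cA a] aT by auto
      have rpa: "rp (a # b # ps)" by (rule RP.step[OF rpb aT])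
      have anp: "a \<notin> set (b # ps)" using rp_distinct[OF rpa] by auto
      obtain Q R where QR: "BB Q" "BB R" "\<Theta> = (\<lambda>e. (lf d b cA a \<bullet> Q) e + R e)" "\<And>e. R e \<noteq> 0 \<Longrightarrow> lk e b = 0"
        using divrem_Z[OF less.prems(2) bZ aZ(3,2) cAu] by blast
      have vR: "van (insert x (set (q # qs) \<union> {a}) ) u R" if q: "rp ((q # qs) @ b # ps)" "a \<in> set (q # qs)" "(q, c, x) \<in> O' q" for q qs c x
      proof -
        have q': "rp (q # qs @ b # ps)" using q by simp
        let ?C = "insert x (set (q # qs @ [b]))"
        have xT: "(q, c, x) \<in> TO" "x \<notin> Z0" using q(3) by (auto simp: O'_def)
        have CV: "?C \<subseteq> V" using rp_Z[OF q'] Z_V TV[of q c x] xT by auto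
        have "van ?C u \<Theta>" using less.prems(3) q' q(3) unfolding pr_def by blast
        moreover have "van ?C u (lf d b cA a \<bullet> Q)"
          by (rule van_lf_edge[OF QR(1) CV]) (use uu CV q(2) ue[of b cA a] aT in auto)
        ultimately have "van ?C u (\<lambda>e. \<Theta> e - (lf d b cA a \<bullet> Q) e)"
          by (intro van_diff less.prems(2) BB_lf QR CV)
        then have "van ?C u R" using QR(3) by simp
        then have "van (?C - {b}) u R" by (intro van_drop CV QR) auto
        moreover have "x \<noteq> b" using sep[OF q' _ xT(1) xT(1) xT(2) xT(2)] by auto
        moreover have "b \<notin> set (q # qs)" using rp_distinct[OF q'] by auto
        ultimately show ?thesis using q(2) by (metis (no_types, lifting) Diff_insert_absorb Un_insert_right append_Cons insert_Diff_if insert_absorb list.simps(15) set_append singletonD sup_bot_right empty_set)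
      qed
      have Ox: "x \<in> V \<and> x \<noteq> a \<and> u a = c * u x \<and> unit0 c \<and> y = a" if "(y, c, x) \<in> O' a" for y c x
        using that TV[of a c x] ue[of a c x] by (auto simp: O'_def)
      \<comment> \<open>The trivial prolongation, which ends at a, shows that R vanishes on each
        pair {a, x}; hence all forms of \<open>O' a\<close> divide R.\<close>
      obtain R' where R': "BB R'" "R = PT d (O' a) \<bullet> R'"
      proof -
        have "\<exists>R'. BB R' \<and> R = PT d (O' a) \<bullet> R'"
        proof (rule multi_div[OF finO aZ(1) uu _ QR(2)])
          fix y c x assume e: "(y, c, x) \<in> O' a"
          then show "y = a \<and> x \<in> V \<and> x \<noteq> a \<and> u a = c * u x \<and> unit0 c" using Ox by blast
          have "(a, c, x) \<in> O' a" using e Ox by auto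
          from vR[of a "[]", OF _ _ this] rpa show "van {a, x} u R" by (simp add: insert_commute)
        qed
        then show thesis using that by blast
      qed
      \<comment> \<open>By \<open>sep\<close> the forms just divided out do not vanish on the
        clusters of longer paths, and so they can be cancelled.\<close>
      have prR': "pr a (b # ps) R'"
        unfolding pr_def
      proof (intro allI impI)
        fix q qs c x assume q: "rp (q # qs @ a # b # ps)" and e: "(q, c, x) \<in> O' q"
        let ?C = "insert x (set (q # qs @ [a]))"
        have xT: "(q, c, x) \<in> TO" "x \<notin> Z0" using e by (auto simp: O'_def)
        have CV: "?C \<subseteq> V" using rp_Z[OF q] Z_V TV[of q c x] xT by auto
        have "van (insert x (set (q # qs @ [a]) \<union> {a})) u R" using q e by (intro vR) auto
        moreover have "insert x (set (q # qs @ [a]) \<union> {a}) = ?C" by auto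
        ultimately have "van ?C u (PT d (O' a) \<bullet> R')" using R'(2) by metis
        then show "van ?C u R'"
        proof (rule van_PT_cancel[rotated -1])
          fix y c' x' assume y: "(y, c', x') \<in> O' a"
          then have yT: "(a, c', x') \<in> TO" "x' \<notin> Z0" "y = a" by (auto simp: O'_def)
          have s: "x' \<notin> set (q # qs @ a # b # ps)" "x' = x \<longrightarrow> a = q"
            using sep[OF q _ xT(1) yT(1) xT(2) yT(2)] by auto
          have "q \<noteq> a" using rp_distinct[OF q] by auto
          then have "x' \<notin> ?C" using s by auto
          then show "y \<in> V \<and> x' \<in> V \<and> y \<noteq> x' \<and> fps_nth c' 0 \<noteq> 0 \<and> \<not> (y \<in> ?C \<and> x' \<in> ?C \<and> u y = c' * u x')"
            using Ox[OF y] aZ yT by auto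
        qed (use finO CV uu R' in auto)
      qed
      let ?G1 = "G * ?P a * (h a * k)"
      \<comment> \<open>The part with Q brings the missing form itself, which completes the product
        of the edges leaving the cut.\<close>
      have "PT d (Ec b ps) * PT d ((\<lambda>x. (b, cA, x)) ` N b) dvd (?G1 * VD d (rest (b # ps))) * lf d b cA a"
      proof -
        have "PT d (Ec b ps) * (?P a * lf d b cA a) dvd G * (?P a * lf d b cA a)" using less.prems(4) by (rule mult_dvd_mono) simp
        also have "\<dots> dvd (?G1 * VD d (rest (b # ps))) * lf d b cA a" by (rule dvdI[of _ _ "h a * k * VD d (rest (b # ps))"]) (simp add: mult_ac)
        finally show ?thesis unfolding Pall[OF a] .
      qed
      then have "PT d (Ec b ps \<union> (\<lambda>x. (b, cA, x)) ` N b) dvd (?G1 * VD d (rest (b # ps))) * lf d b cA a"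
        by (subst PT_union) (use finEc finN EN in auto)
      then have 1: "Kc (TA \<union> TO) c0 c1 (((?G1 * VD d (rest (b # ps))) * lf d b cA a) \<bullet> Q)"
        by (intro Kc.gen[OF U QR(1)] bdry_path)
      have "PT d (Ec a (b # ps)) dvd ?G1 * PT d (O' a)"
      proof -
        let ?S = "Ec b ps \<union> (\<lambda>x. (b, cA, x)) ` (N b - {a})"
        have sub: "Ec a (b # ps) \<subseteq> ?S \<union> O' a"
        proof
          fix t assume t: "t \<in> Ec a (b # ps)"
          obtain y c x where abc: "t = (y, c, x)" by (cases t)
          consider "t \<in> O' a" | "(y, c, x) \<in> TA \<union> TO" "y \<in> set (b # ps)" "x \<notin> set (a # b # ps) \<union> Z0"
            using t by (auto simp: Ec_def abc)
          then show "t \<in> ?S \<union> O' a"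
          proof cases
            case 2
            then consider "y \<in> set ps" | "y = b" "(y, c, x) \<in> TA" | "y = b" "(y, c, x) \<in> TO" by auto
            then show ?thesis
            proof cases
              case 1 then show ?thesis using 2 by (auto simp: abc Ec_def)
            next
              case c2: 2 then show ?thesis using 2 TA[of y c x] by (auto simp: abc N_def)
            next
              case 3 then show ?thesis using 2 by (auto simp: abc Ec_def O'_def)
            qed
          qed simp
        qed
        have dis: "?S \<inter> O' a = {}" using anp by (auto simp: Ec_def O'_def)
        have "PT d (Ec a (b # ps)) dvd PT d (?S \<union> O' a)" by (intro PT_dvd sub) (auto simp: finEc finN finO)
        also have "PT d (?S \<union> O' a) = PT d ?S * PT d (O' a)" by (intro PT_union dis) (auto simp: finEc finN finO)
        also have "PT d ?S = PT d (Ec b ps) * ?P a" unfolding PP by (intro PT_union) (use EN finEc finN in auto)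
        also have "PT d (Ec b ps) * ?P a * PT d (O' a) dvd (G * ?P a) * PT d (O' a)"
          using less.prems(4) by (intro mult_dvd_mono) auto
        also have "\<dots> dvd ?G1 * PT d (O' a)" by (rule dvdI[of _ _ "h a * k"]) (simp add: mult_ac)
        finally show ?thesis .
      qed
      moreover have "card (Z - set (a # b # ps)) < card (Z - set (b # ps))"
        using anp aZ fin_Z by (intro psubset_card_mono) auto
      ultimately have 2: "Kc (TA \<union> TO) c0 c1 (((?G1 * PT d (O' a)) * VD d (rest (b # ps))) \<bullet> R')"
        using rpa R'(1) prR' by (intro less.hyps) auto
      have "((?G1 * VD d (rest (b # ps))) \<bullet> \<Theta>) =
         (\<lambda>e. (((?G1 * VD d (rest (b # ps))) * lf d b cA a) \<bullet> Q) e + (((?G1 * PT d (O' a)) * VD d (rest (b # ps))) \<bullet> R') e)"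
        unfolding QR(3) pt_add_right R'(2) pt_mult[symmetric] by (simp add: mult_ac)
      then show ?thesis using Kc.add[OF 1 2] by simp
    qed
    then show ?thesis unfolding eq pt_sum using finN False by (intro Kc_sum) auto
  qed
qed

text \<open>At the start nothing has to be supplied: by \<open>O0\<close> all edges of TO at c0 end
  in Z0.\<close>

lemma cut: "Kc (TA \<union> TO) c0 c1 (VD d Z \<bullet> \<Psi>)"
proof -
  have "Ec c0 [] = {}" using O0 by (auto simp: Ec_def O'_def)
  moreover have "pr c0 [] \<Psi>" unfolding pr_def
  proof (intro allI impI)
    fix q qs c x assume q: "rp (q # qs @ [c0])" "(q, c, x) \<in> O' q"
    then show "van (insert x (set (q # qs @ [c0]))) u \<Psi>" using Psi[of q "qs @ [c0]" c x] by (auto simp: O'_def)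
  qed
  ultimately show ?thesis using cut_rec[OF RP.base PsiBB, of 1] by (simp add: rest_def)
qed

end

section \<open>The graph of forms and its closed cycles\<close>

locale linkage = hmodule_vars sc s0 co d "insert w Z" Z
  for sc :: "complex fps \<Rightarrow> 'w \<Rightarrow> 'w::ab_group_add"
    and s0 :: "complex \<Rightarrow> 'v \<Rightarrow> 'v::ab_group_add" and co :: "'w \<Rightarrow> nat \<Rightarrow> 'v" and d :: nat
    and w :: nat and Z :: "nat set" +
  fixes cA cB :: "complex fps" and \<alpha> \<beta> :: "nat \<Rightarrow> complex fps" and ne M :: nat and hasB :: bool
  assumes wZ: "w \<notin> Z"
    and cA: "unit0 cA" and cB: "unit0 cB"
    and \<alpha>: "\<And>l. unit0 (\<alpha> l)" and \<beta>: "\<And>l. unit0 (\<beta> l)"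
    and cAB: "cA * cB ^ 2 = 1"
    and cBA: "\<And>n t. cB ^ n * cA ^ t = 1 \<Longrightarrow> n = 2 * t"
    and closed: "\<And>l l' n t. l < ne \<Longrightarrow> l' < ne \<Longrightarrow> \<beta> l * cB ^ n * cA ^ t * \<alpha> l' = 1 \<Longrightarrow> n + 2 * (M - 1) = 2 * t"
    and \<alpha>\<alpha>: "\<And>l l' k. l < ne \<Longrightarrow> l' < ne \<Longrightarrow> \<alpha> l' = cA ^ k * \<alpha> l \<Longrightarrow> k = 0"
    and M2: "2 \<le> M"
begin

text \<open>Edges of EA and EB join variables of x_i in both directions, those of E\<alpha> lead
  into w and those of E\<beta> out of it. The assumptions \<open>cAB\<close>, \<open>cBA\<close> and
  \<open>closed\<close> govern which products of their coefficients can be 1.\<close>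

definition EA where "EA = {(a, c, b). c = cA \<and> a \<in> Z \<and> b \<in> Z \<and> a \<noteq> b}"
definition EB where "EB = {(a, c, b). hasB \<and> c = cB \<and> a \<in> Z \<and> b \<in> Z \<and> a \<noteq> b}"
definition E\<alpha> where "E\<alpha> = {(a, c, b). b = w \<and> a \<in> Z \<and> c \<in> \<alpha> ` {..<ne}}"
definition E\<beta> where "E\<beta> = {(a, c, b). a = w \<and> b \<in> Z \<and> c \<in> \<beta> ` {..<ne}}"
definition LL where "LL = EA \<union> EB \<union> E\<alpha> \<union> E\<beta>"
text \<open>The edges that agree with the order. A product of currents in this order is multiplied
  by their forms to become bounded below.\<close>

definition EL :: "(nat \<Rightarrow> nat) \<Rightarrow> (nat \<times> complex fps \<times> nat) set" where
  "EL pos = {(a, c, b) \<in> LL. pos a < pos b}"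

lemma fin_Z: "finite Z" using fin_V by simp

lemma fin_LL: "finite LL"
proof -
  have "LL \<subseteq> insert w Z \<times> ({cA, cB} \<union> \<alpha> ` {..<ne} \<union> \<beta> ` {..<ne}) \<times> insert w Z"
    by (auto simp: LL_def EA_def EB_def E\<alpha>_def E\<beta>_def)
  then show ?thesis by (rule finite_subset) (use fin_Z in auto)
qed

lemma LL_unit: "(a, c, b) \<in> LL \<Longrightarrow> unit0 c"
  using cA cB \<alpha> \<beta> by (auto simp: LL_def EA_def EB_def E\<alpha>_def E\<beta>_def)

lemma LL_V: "(a, c, b) \<in> LL \<Longrightarrow> a \<in> insert w Z \<and> b \<in> insert w Z \<and> a \<noteq> b"
  using wZ by (auto simp: LL_def EA_def EB_def E\<alpha>_def E\<beta>_def)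

lemma ok_EL: "ok pos (EL pos)"
  using fin_LL LL_V unfolding ok_def EL_def by (auto elim: rev_finite_subset)

lemma cA_pow_inj: "cA ^ i = cA ^ j \<Longrightarrow> i = j"
proof (induction i j rule: linorder_wlog)
  case (le i j)
  then have "cA ^ i * cA ^ (j - i) = cA ^ i * 1" using power_add[of cA i "j - i"] by simp
  moreover have "cA ^ i \<noteq> 0" using cA by auto
  ultimately have "cA ^ (j - i) = 1" by (metis mult_left_cancel)
  then show ?case using cBA[of 0 "j - i"] le by simp
qed simp

text \<open>Otherwise \<open>cAB\<close> would give cA ^ (2 * i + 1) = 1, against
  \<open>cBA\<close>.\<close>

lemma cA_cB: "cA ^ i \<noteq> cB"
proof
  assume "cA ^ i = cB"
  then have "cA ^ (2 * i + 1) = cB ^ 2 * cA" by (simp add: power_mult mult.commute power_mult_distrib)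
  then have "cA ^ (2 * i + 1) = 1" using cAB by (simp add: mult.commute)
  then show False using cBA[of 0 "2 * i + 1"] by simp
qed

lemma cB_cA: "cB * cA ^ i \<noteq> 1" using cBA[of 1 i] by (auto dest: arg_cong[where f = even])

lemma cA_neq_cB: "cA \<noteq> cB" using cA_cB[of 1] by simp

text \<open>\<open>wheel\<close> comes from the Serre relation (Q9), \<open>chain\<close> is the condition $(*)$.\<close>

definition wheel :: "(expo \<Rightarrow> 'w) \<Rightarrow> bool" where
  "wheel \<Psi> \<longleftrightarrow> (hasB \<longrightarrow> (\<forall>x\<in>Z. \<forall>y\<in>Z. \<forall>z\<in>Z. x \<noteq> y \<longrightarrow> y \<noteq> z \<longrightarrow> x \<noteq> z \<longrightarrow>
     Id {(x, cA * cB, z), (y, cB, z)} \<Psi>))"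

definition chain :: "(expo \<Rightarrow> 'w) \<Rightarrow> bool" where
  "chain \<Psi> \<longleftrightarrow> (\<forall>bs l. inj_on bs {..<M} \<longrightarrow> bs ` {..<M} \<subseteq> Z \<longrightarrow> l < ne \<longrightarrow>
     Id ((\<lambda>t. (bs t, cA ^ (M - 1 - t) * \<alpha> l, w)) ` {..<M}) \<Psi>)"

lemma RP_u:
  assumes "RP TA cA c0 ps" and uA: "\<And>a b. (a, cA, b) \<in> TA \<Longrightarrow> u a = cA * u b"
  shows "u c0 = cA ^ (length ps - 1) * u (hd ps) \<and> (\<forall>i<length ps. u (ps ! i) = cA ^ i * u (hd ps))"
  using assms(1)
proof (induction rule: RP.induct)
  case (step b ps x)
  have *: "u b = cA * u x" using step uA by blast
  have "u ((x # b # ps) ! i) = cA ^ i * u x" if "i < length (x # b # ps)" for i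
  proof (cases i)
    case (Suc k)
    then have "u ((b # ps) ! k) = cA ^ k * u b" using step.IH that by simp
    then show ?thesis using Suc * by (simp add: mult_ac)
  qed simp
  then show ?case using step.IH * by (simp add: mult_ac)
qed simp

text \<open>An edge of TO that leaves a path is either a cB edge, which forms a wheel with the last
  two vertices of the path, or an \<alpha> edge into w. The latter occurs by
  \<open>h\<alpha>\<close> only after M - 1 steps, when the last M vertices form a chain.
  \<open>wheel\<close> and \<open>chain\<close> thus provide the vanishing that
  \<open>cut_setup\<close> asks for.\<close>

lemma cut_apply:
  assumes T: "T \<subseteq> LL" "ok pos T" and u: "\<And>v. unit0 (u v)" "\<And>a c b. (a, c, b) \<in> T \<Longrightarrow> u a = c * u b"
    and TA: "TA = T \<inter> EA"
    and c0: "c0 \<in> Z" "\<And>y. (c0, cB, y) \<in> T \<inter> EB \<Longrightarrow> False"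
    and Z0: "Z0 = {} \<or> Z0 = {w}" "\<And>a c b. (a, c, b) \<in> T \<Longrightarrow> a \<notin> Z0"
    and c1: "c1 \<in> insert w Z" "c1 \<notin> Z0" "\<And>ps. RP TA cA c0 ps \<Longrightarrow> c1 \<notin> set ps"
    and h\<alpha>: "\<And>a ps l. w \<notin> Z0 \<Longrightarrow> RP TA cA c0 (a # ps) \<Longrightarrow> l < ne \<Longrightarrow> (a, \<alpha> l, w) \<in> T \<Longrightarrow> M - 1 \<le> length ps"
    and Psi: "BB \<Psi>" "wheel \<Psi>" "chain \<Psi>"
    and X: "FDp pos X" "PT d T \<bullet> X = p \<bullet> (VD d Z \<bullet> \<Psi>)"
  shows "FD c1 c0 X"
proof -
  note c1V = c1(1)
  define TO where "TO = T - TA"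
  have TT: "TA \<union> TO = T" using TA by (auto simp: TO_def)
  have TAe: "c = cA \<and> a \<in> Z \<and> b \<in> Z \<and> a \<noteq> b" if "(a, c, b) \<in> TA" for a c b
    using that by (auto simp: TA EA_def)
  have uA: "u a = cA * u b" if "(a, cA, b) \<in> TA" for a b using u(2) that by (auto simp: TA)
  have ru1: "u c0 = cA ^ (length ps - 1) * u (hd ps)" if "RP TA cA c0 ps" for ps
    using RP_u[OF that, of u] uA by blast
  have ru2: "u (ps ! i) = cA ^ i * u (hd ps)" if "RP TA cA c0 ps" "i < length ps" for ps i
    using RP_u[OF that(1), of u] uA that(2) by blast
  have unz: "u v \<noteq> 0" for v using u(1)[of v] by auto
  have TOe: "(hasB \<and> c = cB \<and> a \<in> Z \<and> b \<in> Z \<and> a \<noteq> b) \<or> (b = w \<and> a \<in> Z \<and> (\<exists>l<ne. c = \<alpha> l)) \<or> (a = w \<and> b \<in> Z)"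
    if "(a, c, b) \<in> TO" for a c b
    using that T(1) by (auto simp: TO_def TA LL_def EA_def EB_def E\<alpha>_def E\<beta>_def)
  have rpZ: "set ps \<subseteq> Z" if "RP TA cA c0 ps" for ps
    using that
  proof (induction rule: RP.induct)
    case (step b ps x) then show ?case using TAe[of b cA x] by simp
  qed (simp add: c0)
  have pinj: "i = j" if "RP TA cA c0 ps" "i < length ps" "j < length ps" "ps ! i = ps ! j" for ps i j
  proof -
    have "cA ^ i * u (hd ps) = cA ^ j * u (hd ps)" using ru2[OF that(1,2)] ru2[OF that(1,3)] that(4) by metis
    then have "cA ^ i = cA ^ j" using unz by (metis mult_right_cancel)
    then show ?thesis by (rule cA_pow_inj)
  qed
  interpret cut_setup sc s0 co d "insert w Z" Z pos TA TO cA c0 c1 Z0 u \<Psi>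
  proof unfold_locales
    show "ok pos (TA \<union> TO)" using T TT by simp
    show "TA \<inter> TO = {}" by (auto simp: TO_def)
    show "c = cA \<and> a \<in> Z \<and> b \<in> Z" if "(a, c, b) \<in> TA" for a c b using TAe that by blast
    show "c0 \<in> Z" by fact
    show "Z0 \<subseteq> insert w Z" "Z0 \<inter> Z = {}" using Z0 wZ by auto
    show "a \<notin> Z0" if "(a, c, b) \<in> TA \<union> TO" for a c b using Z0(2) that TT by blast
    show "c1 \<notin> Z0" by fact
    show "c1 \<notin> set ps" if "RP TA cA c0 ps" for ps using c1 that by blast
    show "unit0 (u v)" for v by (rule u)
    show "unit0 cA" by (rule cA)
    show "u a = c * u b \<and> unit0 c" if "(a, c, b) \<in> TA \<union> TO" for a c b
      using u(2) that TT T(1) LL_unit by blast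
    show "length ps = length ps'"
      if r: "RP TA cA c0 (b # ps)" "RP TA cA c0 (b' # ps')" and x: "(b, cA, x) \<in> TA" "(b', cA, x) \<in> TA" for b ps b' ps' x
    proof -
      have "u c0 = cA ^ Suc (length ps) * u x" "u c0 = cA ^ Suc (length ps') * u x"
        using ru1[OF r(1)] ru1[OF r(2)] uA[OF x(1)] uA[OF x(2)] by (simp_all add: mult_ac)
      then have "cA ^ Suc (length ps) * u x = cA ^ Suc (length ps') * u x" by metis
      then have "cA ^ Suc (length ps) = cA ^ Suc (length ps')" using unz by (metis mult_right_cancel)
      then show ?thesis using cA_pow_inj by blast
    qed
    \<comment> \<open>At c0 itself a cB edge is excluded by assumption, and an \<alpha> edge would
      require M - 1 <= 0 unless w is in Z0.\<close>
    show "x \<in> Z0" if x: "(c0, c, x) \<in> TO" for c x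
    proof -
      have xT: "(c0, c, x) \<in> T" using x TT by blast
      consider "hasB" "c = cB" "x \<in> Z" "c0 \<noteq> x" | l where "x = w" "l < ne" "c = \<alpha> l" using TOe[OF x] c0 wZ by blast
      then show ?thesis
      proof cases
        case 1
        then have "(c0, cB, x) \<in> T \<inter> EB" unfolding EB_def using xT c0 by auto
        then show ?thesis using c0(2) by blast
      next
        case 2
        then have "w \<in> Z0" using h\<alpha>[OF _ RP.base, of l] xT M2 by auto
        then show ?thesis using 2 by simp
      qed
    qed
    show "BB \<Psi>" by fact
    show "van (insert x (set (b # ps))) u \<Psi>"
      if r: "RP TA cA c0 (b # ps)" and ne: "ps \<noteq> []" and x: "(b, c, x) \<in> TO" "x \<notin> Z0" for b ps c x
    proof -
      have xT: "(b, c, x) \<in> T" using x TT by blast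
      have bZ: "b \<in> Z" "set ps \<subseteq> Z" using rpZ[OF r] by auto
      have CV: "insert x (set (b # ps)) \<subseteq> insert w Z" using bZ TOe[OF x(1)] by auto
      consider "hasB" "c = cB" "x \<in> Z" "b \<noteq> x" | l where "x = w" "l < ne" "c = \<alpha> l" using TOe[OF x(1)] bZ wZ by blast
      then show ?thesis
      proof cases
        case 1
        obtain a qs where ps: "ps = a # qs" using ne by (cases ps) auto
        have ua: "u a = cA * u b" using ru2[OF r, of 1] ps by simp
        have ub: "u b = cB * u x" using u(2)[OF xT] 1 by simp
        have "a \<noteq> b" using pinj[OF r, of 1 0] ps by auto
        moreover have "a \<noteq> x"
        proof
          assume "a = x"
          then have "1 * u x = (cB * cA ^ 1) * u x" using ua ub by (simp add: mult_ac)
          then have "cB * cA ^ 1 = 1" using unz by (metis mult_right_cancel)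
          then show False using cB_cA by blast
        qed
        \<comment> \<open>With a before b on the path, the weights of a, b, x are cA * cB, cB and 1,
          up to the factor u x.\<close>
        ultimately have "Id {(a, cA * cB, x), (b, cB, x)} \<Psi>"
          using Psi(2) 1 bZ ps unfolding wheel_def by auto
        then show ?thesis
          by (rule Id_van[OF _ CV]) (use u ua ub ps in \<open>auto simp: mult.assoc\<close>)
      next
        case 2
        define ql where "ql = b # ps"
        have "M - 1 \<le> length ps" using h\<alpha>[OF _ r 2(2)] x 2 xT by auto
        then have Ml: "M - 1 - t < length ql" for t by (auto simp: ql_def)
        \<comment> \<open>The last M vertices of the path in their order along it; the list
          \<open>ql\<close> runs backwards, so the first of them has index M - 1.\<close>
        define bs where "bs t = ql ! (M - 1 - t)" for t
        have rq: "RP TA cA c0 ql" using r by (simp add: ql_def)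
        have inj: "inj_on bs {..<M}"
        proof (rule inj_onI)
          fix s t assume st: "s \<in> {..<M}" "t \<in> {..<M}" "bs s = bs t"
          then have "M - 1 - s = M - 1 - t" using pinj[OF rq Ml Ml] by (auto simp: bs_def)
          then show "s = t" using st by auto
        qed
        have bsq: "bs t \<in> set ql" for t using Ml by (simp add: bs_def)
        moreover have "set ql \<subseteq> Z" using bZ by (simp add: ql_def)
        ultimately have "bs t \<in> Z" for t by blast
        then have "bs ` {..<M} \<subseteq> Z" by blast
        then have "Id ((\<lambda>t. (bs t, cA ^ (M - 1 - t) * \<alpha> l, w)) ` {..<M}) \<Psi>"
          using inj Psi(3) 2 unfolding chain_def by blast
        then show ?thesis
        proof (rule Id_van[OF _ CV])
          fix a c' y assume "(a, c', y) \<in> (\<lambda>t. (bs t, cA ^ (M - 1 - t) * \<alpha> l, w)) ` {..<M}"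
          then obtain t where t: "a = bs t" "c' = cA ^ (M - 1 - t) * \<alpha> l" "y = w" by auto
          have "u a = cA ^ (M - 1 - t) * u b" using ru2[OF rq Ml, of t] by (simp add: t bs_def ql_def)
          moreover have "u b = \<alpha> l * u w" using u(2)[OF xT] 2 by simp
          ultimately show "a \<in> insert x (set (b # ps)) \<and> y \<in> insert x (set (b # ps)) \<and> u a = c' * u y"
            using bsq[of t] t 2 by (auto simp: ql_def mult.assoc)
        qed (rule u)
      qed
    qed
    show "x' \<notin> set (b # ps) \<and> (x' = x \<longrightarrow> y = b)"
      if r: "RP TA cA c0 (b # ps)" and y: "y \<in> set (b # ps)" and x: "(b, c, x) \<in> TO" "(y, c', x') \<in> TO" "x \<notin> Z0" "x' \<notin> Z0"
      for b ps y c x c' x'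
    proof -
      obtain i where i: "i < length (b # ps)" "y = (b # ps) ! i" using y by (metis in_set_conv_nth)
      have uy: "u y = cA ^ i * u b" using ru2[OF r i(1)] i by simp
      have bZ: "set (b # ps) \<subseteq> Z" using rpZ[OF r] by auto
      have yZ: "y \<in> Z" "b \<in> Z" using y bZ by auto
      have uu1: "u b = c * u x" "u y = c' * u x'" using u(2) x TT by blast+
      have n: "x' \<notin> set (b # ps)"
      proof
        assume "x' \<in> set (b # ps)"
        then obtain k where k: "k < length (b # ps)" "x' = (b # ps) ! k" by (metis in_set_conv_nth)
        have ux': "u x' = cA ^ k * u b" using ru2[OF r k(1)] k by simp
        have "x' \<in> Z" using \<open>x' \<in> set (b # ps)\<close> bZ by auto
        then have "c' = cB" using TOe[OF x(2)] yZ wZ by auto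
        then have "u y = (cB * cA ^ k) * u b" using uu1(2) ux' by (simp add: mult.assoc)
        then have "cA ^ i * u b = (cB * cA ^ k) * u b" using uy by metis
        then have eq: "cA ^ i = cB * cA ^ k" using unz by simp
        show False
        proof (cases "k \<le> i")
          case True
          then have "cA ^ (i - k) * cA ^ k = cB * cA ^ k" using eq by (simp add: power_add[symmetric])
          moreover have "cA ^ k \<noteq> 0" using cA by auto
          ultimately show False using cA_cB[of "i - k"] by simp
        next
          case False
          have "cA ^ k = cA ^ (k - i) * cA ^ i" using False by (simp add: power_add[symmetric])
          then have "1 * cA ^ i = (cB * cA ^ (k - i)) * cA ^ i" using eq by (simp add: mult.assoc)
          moreover have "cA ^ i \<noteq> 0" using cA by auto
          ultimately have "cB * cA ^ (k - i) = 1" by (metis mult_right_cancel)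
          then show False using cB_cA by blast
        qed
      qed
      moreover have "y = b" if xx: "x' = x"
      proof -
        have "i = 0"
        proof (cases "x \<in> Z")
          case True
          then have "c = cB" "c' = cB" using TOe[OF x(1)] TOe[OF x(2)] yZ wZ xx by auto
          then have "u y = 1 * u b" using uu1 xx by simp
          then have "cA ^ i * u b = 1 * u b" using uy by metis
          then have "cA ^ i = cA ^ 0" using unz by (metis mult_right_cancel power_0)
          then show ?thesis by (rule cA_pow_inj)
        next
          case False
          then obtain l l' where l: "l < ne" "c = \<alpha> l" "l' < ne" "c' = \<alpha> l'"
            using TOe[OF x(1)] TOe[OF x(2)] yZ wZ xx by auto
          have "u y = (cA ^ i * \<alpha> l) * u x" using uy uu1(1) l by (simp add: mult.assoc)
          then have "\<alpha> l' * u x = (cA ^ i * \<alpha> l) * u x" using uu1(2) xx l by metis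
          then have "\<alpha> l' = cA ^ i * \<alpha> l" using unz by (metis mult_right_cancel)
          then show ?thesis using \<alpha>\<alpha> l by blast
        qed
        then show ?thesis using i by simp
      qed
      ultimately show ?thesis by blast
    qed
  qed
  have "Kc T c0 c1 (p \<bullet> (VD d Z \<bullet> \<Psi>))" using Kc_pt[OF cut] unfolding TT .
  then show ?thesis using Kc_FD[OF _ T(2) c1V X(1)] X(2) by blast
qed

text \<open>The equation z_a^d = g z_b^d on D, read off coefficients. For a unit g it says that the
  form with coefficient g annihilates D.\<close>

definition Rel :: "(expo \<Rightarrow> 'w) \<Rightarrow> nat \<Rightarrow> nat \<Rightarrow> complex fps \<Rightarrow> bool" where
  "Rel D a b g \<longleftrightarrow> unit0 g \<and> (\<forall>k. D (k + sg b (int d) - sg a (int d)) = sc g (D k))"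

lemma Rel_lf: assumes "lf d a c b \<bullet> D = (\<lambda>e. 0)" "unit0 c" shows "Rel D a b c"
  unfolding Rel_def
proof (intro conjI allI)
  fix k
  have "(lf d a c b \<bullet> D) (k + sg b (int d)) = 0" using assms by simp
  then show "D (k + sg b (int d) - sg a (int d)) = sc c (D k)" by (simp add: pt_lf)
qed (fact assms)

lemma Rel_trans: assumes "Rel D a b g" "Rel D b c h" shows "Rel D a c (g * h)"
  unfolding Rel_def
proof (intro conjI allI)
  fix k
  have "D ((k + sg b (int d) - sg a (int d)) + sg c (int d) - sg b (int d)) = sc h (D (k + sg b (int d) - sg a (int d)))"
    using assms(2) unfolding Rel_def by blast
  also have "\<dots> = sc (g * h) (D k)" using assms(1) by (simp add: Rel_def mult.commute)
  finally show "D (k + sg c (int d) - sg a (int d)) = sc (g * h) (D k)" by (simp add: algebra_simps)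
qed (use assms in \<open>auto simp: Rel_def\<close>)

lemma Rel_sym: assumes "Rel D a b g" shows "Rel D b a (inverse g)"
  unfolding Rel_def
proof (intro conjI allI)
  fix k
  have g: "unit0 g" using assms by (simp add: Rel_def)
  have "D ((k + sg a (int d) - sg b (int d)) + sg b (int d) - sg a (int d)) = sc g (D (k + sg a (int d) - sg b (int d)))"
    using assms unfolding Rel_def by blast
  then have "D k = sc g (D (k + sg a (int d) - sg b (int d)))" by (simp add: algebra_simps)
  then show "D (k + sg a (int d) - sg b (int d)) = sc (inverse g) (D k)"
    using fps_unit_inverse(1)[OF g] by simp
qed (use assms in \<open>auto simp: Rel_def\<close>)

lemma Rel_refl: "Rel D a a 1" by (simp add: Rel_def)

lemma Rel_unique: assumes "D k0 \<noteq> 0" "Rel D a b g" "Rel D a b h" shows "g = h"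
proof -
  have "sc g (D k0) = sc h (D k0)" using assms(2,3) unfolding Rel_def by metis
  then have "sc (g - h) (D k0) = 0" by (simp add: scale_left_diff_distrib)
  then show ?thesis using sc_eq_0 assms(1) by (metis eq_iff_diff_eq_0)
qed

text \<open>In the direction from c1 to c0 the coefficients of D are a geometric progression with
  unit ratio g, which tends to zero only if it is zero.\<close>

lemma Rel_contra:
  assumes "Rel D c0 c1 g" "FD c1 c0 D" shows "D k = 0"
proof (rule zt_all)
  fix p
  have *: "D (k + mv c1 c0 j) = sc (g ^ j) (D k)" for j
  proof (induction j)
    case (Suc j)
    have "D ((k + mv c1 c0 j) + sg c1 (int d) - sg c0 (int d)) = sc g (D (k + mv c1 c0 j))"
      using assms(1) unfolding Rel_def by blast
    then show ?case using Suc by (simp add: mv_Suc algebra_simps)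
  qed simp
  obtain J where "zt p (D (k + mv c1 c0 J))" using assms(2) unfolding FD_def by blast
  then show "zt p (D k)" unfolding * using assms(1) zt_unit[of "g ^ J"] by (simp add: Rel_def fps_nth_power_0)
qed

text \<open>In each class of variables linked by \<open>Rel\<close> a representative is chosen, and
  the weight is the ratio to it; \<open>Rel_unique\<close> makes it well defined as soon as D is
  nonzero.\<close>

lemma weights:
  assumes "D k0 \<noteq> 0"
  shows "\<exists>u. (\<forall>v. unit0 (u v)) \<and> (\<forall>a b g. Rel D a b g \<longrightarrow> u a = g * u b)"
proof -
  define rep where "rep a = (SOME r. \<exists>g. Rel D a r g)" for a
  define u where "u a = (SOME g. Rel D a (rep a) g)" for a
  have "\<exists>r g. Rel D a r g" for a using Rel_refl by blast
  then have "\<exists>g. Rel D a (rep a) g" for a unfolding rep_def by (rule someI_ex)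
  then have u: "Rel D a (rep a) (u a)" for a unfolding u_def by (rule someI_ex)
  have "u a = g * u b" if g: "Rel D a b g" for a b g
  proof -
    have "(\<exists>h. Rel D a r h) = (\<exists>h. Rel D b r h)" for r using Rel_trans[OF g] Rel_trans[OF Rel_sym[OF g]] by blast
    then have "rep a = rep b" unfolding rep_def by simp
    then show ?thesis using Rel_unique[where D = D and ?k0.0 = k0, OF assms u, of a] Rel_trans[OF g u[of b]] by metis
  qed
  then show ?thesis using u by (intro exI[of _ u]) (auto simp: Rel_def)
qed

text \<open>Each variable admits at most one exponent n, so finitely many occur; c belongs to the
  largest.\<close>

lemma lowest:
  assumes D: "D k0 \<noteq> 0" and v0: "v0 \<in> Z" and q: "unit0 q" "\<And>i j. q ^ i = q ^ j \<Longrightarrow> i = j"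
  shows "\<exists>c\<in>Z. \<exists>n. Rel D v0 c (q ^ n) \<and> (\<forall>y\<in>Z. \<not> Rel D c y q)"
proof -
  define S where "S = {n. \<exists>v\<in>Z. Rel D v0 v (q ^ n)}"
  have "finite {n. Rel D v0 v (q ^ n)}" for v
  proof (cases "\<exists>n. Rel D v0 v (q ^ n)")
    case True
    then obtain n where "Rel D v0 v (q ^ n)" by blast
    then have "{n. Rel D v0 v (q ^ n)} \<subseteq> {n}" using Rel_unique[where D = D and ?k0.0 = k0, OF D] q(2) by blast
    then show ?thesis using finite_subset by blast
  qed simp
  then have "finite (\<Union>v\<in>Z. {n. Rel D v0 v (q ^ n)})" using fin_Z by blast
  moreover have "S = (\<Union>v\<in>Z. {n. Rel D v0 v (q ^ n)})" by (auto simp: S_def)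
  ultimately have fS: "finite S" by simp
  have "0 \<in> S" using v0 Rel_refl by (auto simp: S_def)
  then have "Max S \<in> S" using fS by (intro Max_in) auto
  then obtain c where c: "c \<in> Z" "Rel D v0 c (q ^ Max S)" by (auto simp: S_def)
  have "\<not> Rel D c y q" if "y \<in> Z" for y
  proof
    assume "Rel D c y q"
    then have "Suc (Max S) \<in> S" using Rel_trans[OF c(2)] that by (auto simp: S_def mult.commute)
    then show False using Max_ge[OF fS] by fastforce
  qed
  then show ?thesis using c by blast
qed

lemma cB_pow_inj: "cB ^ i = cB ^ j \<Longrightarrow> i = j"
proof (induction i j rule: linorder_wlog)
  case (le i j)
  then have "cB ^ i * cB ^ (j - i) = cB ^ i * 1" using power_add[of cB i "j - i"] by simp
  moreover have "cB ^ i \<noteq> 0" using cB by auto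
  ultimately have "cB ^ (j - i) = 1" by (metis mult_left_cancel)
  then show ?case using cBA[of "j - i" 0] le by simp
qed simp

text \<open>G contains the forms still divided out. By induction each of them annihilates the sum D.
  If D were nonzero, \<open>weights\<close> would turn all edges of G into equations between
  numbers, and then two variables related on D can be found such that every summand decays from one
  to the other, against \<open>Rel_contra\<close>.\<close>

theorem current_relation:
  fixes I :: "'i set" and num :: "'i \<Rightarrow> lpoly"
  assumes I: "finite I" and Y: "\<And>\<iota>. \<iota> \<in> I \<Longrightarrow> FDp (pos \<iota>) (Y \<iota>)"
    and Phi: "\<And>\<iota>. \<iota> \<in> I \<Longrightarrow> PT d (EL (pos \<iota>)) \<bullet> Y \<iota> = Cst (s \<iota>) \<bullet> (VD d Z \<bullet> \<Psi>)"
    and Psi: "BB \<Psi>" "wheel \<Psi>" "chain \<Psi>"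
    and rel: "(\<Sum>\<iota>\<in>I. Cst (s \<iota>) * num \<iota> * PT d (LL - EL (pos \<iota>))) = 0"
  shows "(\<Sum>\<iota>\<in>I. (num \<iota> \<bullet> Y \<iota>) e) = 0"
proof -
  define E where "E \<iota> = EL (pos \<iota>)" for \<iota>
  have okE: "ok (pos \<iota>) (E \<iota>)" for \<iota> using ok_EL by (simp add: E_def)
  have finE: "finite (E \<iota>)" for \<iota> using ok_finite[OF okE] .
  \<comment> \<open>A summand is its numerator times s \<iota> and the Vandermonde multiple of
    \<Psi>, divided by the edges of its order that lie in G. Multiplied by all of G, the sum becomes
    the polynomial identity in the third hypothesis.\<close>
  have claim: "(\<lambda>e. \<Sum>\<iota>\<in>I. ((num \<iota> * PT d (E \<iota> - G)) \<bullet> Y \<iota>) e) = (\<lambda>e. 0)"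
    if "finite G" "G \<subseteq> LL" "(\<Sum>\<iota>\<in>I. Cst (s \<iota>) * num \<iota> * PT d (G - E \<iota>)) = 0" for G num
    using that
  proof (induction "card G" arbitrary: G num rule: less_induct)
    case less
    define D where "D e = (\<Sum>\<iota>\<in>I. ((num \<iota> * PT d (E \<iota> - G)) \<bullet> Y \<iota>) e)" for e
    have XY: "PT d (E \<iota> \<inter> G) \<bullet> (PT d (E \<iota> - G) \<bullet> Y \<iota>) = Cst (s \<iota>) \<bullet> (VD d Z \<bullet> \<Psi>)" if "\<iota> \<in> I" for \<iota>
      using Phi[OF that] PT_split[OF finE[of \<iota>], of d G] by (simp add: E_def pt_mult)
    show ?case
    proof (cases "G = {}")
      case True
      have "((num \<iota> * PT d (E \<iota> - G)) \<bullet> Y \<iota>) e = ((Cst (s \<iota>) * num \<iota>) \<bullet> (VD d Z \<bullet> \<Psi>)) e" if "\<iota> \<in> I" for \<iota> e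
        using XY[OF that] True by (simp add: pt_mult pt_commute)
      then have "(\<lambda>e. \<Sum>\<iota>\<in>I. ((num \<iota> * PT d (E \<iota> - G)) \<bullet> Y \<iota>) e) = (\<Sum>\<iota>\<in>I. Cst (s \<iota>) * num \<iota>) \<bullet> (VD d Z \<bullet> \<Psi>)"
        by (simp add: pt_sum)
      also have "(\<Sum>\<iota>\<in>I. Cst (s \<iota>) * num \<iota>) = 0" using less.prems(3) True by simp
      finally show ?thesis by simp
    next
      case False
      have lfD: "lf d a c b \<bullet> D = (\<lambda>e. 0)" if t: "(a, c, b) \<in> G" for a c b
      proof -
        let ?t = "(a, c, b)"
        let ?G = "G - {?t}"
        \<comment> \<open>Multiplying D by the form of this edge undoes a division where the order
          contains the edge, and enlarges the numerator where it does not.\<close>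
        define num' where "num' \<iota> = (if ?t \<in> E \<iota> then num \<iota> else lf d a c b * num \<iota>)" for \<iota>
        have 1: "lf d a c b * (num \<iota> * PT d (E \<iota> - G)) = num' \<iota> * PT d (E \<iota> - ?G)" for \<iota>
        proof (cases "?t \<in> E \<iota>")
          case True
          then have "E \<iota> - ?G = insert ?t (E \<iota> - G)" using t by auto
          then show ?thesis using True t finE[of \<iota>] by (simp add: num'_def PT_insert mult_ac)
        next
          case False
          then have "E \<iota> - ?G = E \<iota> - G" by auto
          then show ?thesis using False by (simp add: num'_def mult_ac)
        qed
        have 2: "num' \<iota> * PT d (?G - E \<iota>) = num \<iota> * PT d (G - E \<iota>)" for \<iota>
        proof (cases "?t \<in> E \<iota>")
          case True
          then have "?G - E \<iota> = G - E \<iota>" by auto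
          then show ?thesis using True by (simp add: num'_def)
        next
          case False
          then have "G - E \<iota> = insert ?t (?G - E \<iota>)" using t by auto
          then show ?thesis using False less.prems(1) by (simp add: num'_def PT_insert mult_ac)
        qed
        have "lf d a c b \<bullet> D = (\<lambda>e. \<Sum>\<iota>\<in>I. ((num' \<iota> * PT d (E \<iota> - ?G)) \<bullet> Y \<iota>) e)"
          unfolding D_def[abs_def] pt_sum_right pt_mult[symmetric, of "lf d a c b"] 1 ..
        also have "\<dots> = (\<lambda>e. 0)"
        proof (rule less.hyps)
          show "card ?G < card G" using t less.prems(1) by (meson card_Diff1_less)
          show "(\<Sum>\<iota>\<in>I. Cst (s \<iota>) * num' \<iota> * PT d (?G - E \<iota>)) = 0"
            using less.prems(3) 2 by (simp add: mult.assoc)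
        qed (use less.prems in auto)
        finally show ?thesis .
      qed
      have "D k0 = 0" for k0
      proof (rule ccontr)
        assume k0: "D k0 \<noteq> 0"
        have Re: "Rel D a b c" if "(a, c, b) \<in> G" for a c b
          using Rel_lf[OF lfD[OF that]] LL_unit that less.prems(2) by blast
        obtain u where u: "\<And>v. unit0 (u v)" "\<And>a b g. Rel D a b g \<Longrightarrow> u a = g * u b"
          using weights[where D = D and ?k0.0 = k0, OF k0] by blast
        have unz: "u v \<noteq> 0" for v using u(1)[of v] by auto
        define X where "X \<iota> = PT d (E \<iota> - G) \<bullet> Y \<iota>" for \<iota>
        define T where "T \<iota> = E \<iota> \<inter> G" for \<iota>
        have FX: "FDp (pos \<iota>) (X \<iota>)" if "\<iota> \<in> I" for \<iota> unfolding X_def using Y[OF that] by (rule FDp_pt)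
        have TX: "PT d (T \<iota>) \<bullet> X \<iota> = Cst (s \<iota>) \<bullet> (VD d Z \<bullet> \<Psi>)" if "\<iota> \<in> I" for \<iota>
          using XY[OF that] by (simp add: X_def T_def)
        have okTi: "ok (pos \<iota>) (T \<iota>)" for \<iota> using ok_subset[OF okE] by (simp add: T_def)
        have TG: "T \<iota> \<subseteq> G" for \<iota> by (simp add: T_def)
        have fin0: False if r: "Rel D c0 c1 g" and F: "\<And>\<iota>. \<iota> \<in> I \<Longrightarrow> FD c1 c0 (X \<iota>)" for c0 c1 g
        proof -
          have "FD c1 c0 D" unfolding D_def[abs_def] pt_mult X_def[symmetric] by (intro FD_sum FD_pt F)
          then show False using Rel_contra[OF r] k0 by blast
        qed
        \<comment> \<open>A vertex from which no edge of G starts is closed as a singleton, so the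
          quotients stay bounded below in its variable.\<close>
        have sink: False if r: "Rel D c0 c1 g" and c: "c0 \<in> insert w Z" "c1 \<noteq> c0" "\<And>c b. (c0, c, b) \<notin> G" for c0 c1 g
        proof (rule fin0[OF r])
          fix \<iota> assume i: "\<iota> \<in> I"
          have "Bd {c0} (VD d Z \<bullet> \<Psi>)" using Psi(1) c(1) by (intro Bd_pt) (auto simp: BB_def)
          then have "Bd {c0} (PT d (T \<iota>) \<bullet> X \<iota>)" unfolding TX[OF i] by (rule Bd_pt)
          then have "Bd {c0} (X \<iota>)"
            by (rule PT_Bd[OF okTi FX[OF i]]) (use c(3) TG in blast)+
          then show "FD c1 c0 (X \<iota>)" by (rule FD_Bd) (use c in auto)
        qed
        have cut: "FD c1 c0 (X \<iota>)" if i: "\<iota> \<in> I" and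
           c0: "c0 \<in> Z" "\<And>y. y \<in> Z \<Longrightarrow> \<not> Rel D c0 y cB" and
           ZZ: "ZZ = {} \<or> ZZ = {w}" "\<And>a c b. (a, c, b) \<in> G \<Longrightarrow> a \<notin> ZZ" and
           c1: "c1 \<in> insert w Z" "c1 \<notin> ZZ" "\<And>t. u c0 \<noteq> cA ^ t * u c1 \<or> c1 = w" and
           h\<alpha>: "\<And>a t l. w \<notin> ZZ \<Longrightarrow> u c0 = cA ^ t * u a \<Longrightarrow> l < ne \<Longrightarrow> (a, \<alpha> l, w) \<in> G \<Longrightarrow> M - 1 \<le> t"
          for \<iota> c0 c1 ZZ
        proof (rule cut_apply[where T = "T \<iota>" and pos = "pos \<iota>" and u = u and TA = "T \<iota> \<inter> EA" and ?Z0.0 = ZZ and \<Psi> = \<Psi> and p = "Cst (s \<iota>)"])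
          show "T \<iota> \<subseteq> LL" using TG less.prems(2) by blast
          show "u a = c * u b" if "(a, c, b) \<in> T \<iota>" for a c b using u(2)[OF Re] TG that by blast
          show False if "(c0, cB, y) \<in> T \<iota> \<inter> EB" for y
          proof -
            have "y \<in> Z" "(c0, cB, y) \<in> G" using that TG by (auto simp: EB_def)
            then show False using c0(2) Re by blast
          qed
          show "a \<notin> ZZ" if "(a, c, b) \<in> T \<iota>" for a c b using ZZ(2) TG that by blast
          have rpu: "u c0 = cA ^ (length ps - 1) * u (hd ps) \<and> (\<forall>i<length ps. u (ps ! i) = cA ^ i * u (hd ps))"
            if "RP (T \<iota> \<inter> EA) cA c0 ps" for ps
            using RP_u[OF that, of u] u(2)[OF Re] TG by blast
          show "M - 1 \<le> length ps" if "w \<notin> ZZ" "RP (T \<iota> \<inter> EA) cA c0 (a # ps)" "l < ne" "(a, \<alpha> l, w) \<in> T \<iota>" for a ps l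
          proof (rule h\<alpha>[OF that(1) _ that(3)])
            show "u c0 = cA ^ length ps * u a" using rpu[OF that(2)] by simp
            show "(a, \<alpha> l, w) \<in> G" using that(4) TG by blast
          qed
          show "c1 \<notin> set ps" if rp: "RP (T \<iota> \<inter> EA) cA c0 ps" for ps
          proof
            assume c1p: "c1 \<in> set ps"
            have psZ: "set ps \<subseteq> Z"
              using rp
            proof (induction rule: RP.induct)
              case (step b ps x) then show ?case by (auto simp: EA_def)
            qed (simp add: c0)
            obtain qs rs where q: "ps = qs @ c1 # rs" using c1p by (meson split_list)
            then have "RP (T \<iota> \<inter> EA) cA c0 (c1 # rs)" using rp RP_suffix by blast
            from rpu[OF this] have "u c0 = cA ^ length rs * u c1" by simp
            then show False using c1(3)[of "length rs"] c1p psZ wZ by auto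
          qed
        qed (use u okTi c0 ZZ c1 Psi FX[OF i] TX[OF i] in auto)
        \<comment> \<open>The choice of the pair depends on the kinds of edges in G. An edge out of
          w or a cB edge leads to a variable that is lowest with respect to cB. If both are absent
          and an edge ends in w, then w is a sink. If only cA edges remain, a variable lowest for cA
          is a sink.\<close>
        consider (beta) l c0 where "l < ne" "c0 \<in> Z" "(w, \<beta> l, c0) \<in> G"
          | (nobeta) "\<And>c b. (w, c, b) \<notin> G"
          using less.prems(2) wZ by (auto simp: LL_def EA_def EB_def E\<alpha>_def E\<beta>_def) blast
        then show False
        proof cases
          case beta
          obtain c n where c: "c \<in> Z" "Rel D c0 c (cB ^ n)" "\<And>y. y \<in> Z \<Longrightarrow> \<not> Rel D c y cB"
            using lowest[where D = D and ?k0.0 = k0, OF k0 beta(2) cB cB_pow_inj] by blast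
          have wc: "Rel D w c (\<beta> l * cB ^ n)" using Rel_trans[OF Re[OF beta(3)] c(2)] .
          show False
          proof (rule fin0[OF Rel_sym[OF wc]])
            fix \<iota> assume i: "\<iota> \<in> I"
            show "FD w c (X \<iota>)"
            proof (rule cut[of \<iota> c "{}", OF i c(1)])
              \<comment> \<open>The walk from w to c, along cA to a and back to w has product 1, so
                \<open>closed\<close> gives n + 2 * (M - 1) = 2 * t, that is at least M - 1 steps
                along cA.\<close>
              fix a t l' assume a: "u c = cA ^ t * u a" "l' < ne" "(a, \<alpha> l', w) \<in> G"
              have "u w = (\<beta> l * cB ^ n * cA ^ t * \<alpha> l') * u w"
                using u(2)[OF wc] a(1) u(2)[OF Re[OF a(3)]] by (simp add: mult.assoc)
              then have "\<beta> l * cB ^ n * cA ^ t * \<alpha> l' = 1" using unz by (metis mult_1 mult_right_cancel)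
              from closed[OF beta(1) a(2) this] show "M - 1 \<le> t" by linarith
            qed (use c in auto)
          qed
        next
          case nobeta
          show False
          proof (cases "\<exists>x y. (x, cB, y) \<in> G \<inter> EB")
            case True
            then obtain x y where xy: "(x, cB, y) \<in> G" "x \<in> Z" "y \<in> Z" by (auto simp: EB_def)
            obtain c n where c: "c \<in> Z" "Rel D y c (cB ^ n)" "\<And>y. y \<in> Z \<Longrightarrow> \<not> Rel D c y cB"
              using lowest[where D = D and ?k0.0 = k0, OF k0 xy(3) cB cB_pow_inj] by blast
            have xc: "Rel D x c (cB ^ Suc n)" using Rel_trans[OF Re[OF xy(1)] c(2)] by simp
            \<comment> \<open>One of x and y is an odd number of cB steps away from c. For odd k no
              power of cA leads from c back to z, by \<open>cBA\<close>, so paths along cA starting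
              at c avoid z.\<close>
            obtain z k where z: "z \<in> Z" "Rel D z c (cB ^ k)" "odd k"
            proof (cases "odd n")
              case True then show thesis using that[of y n] xy c(2) by blast
            next
              case False then show thesis using that[of x "Suc n"] xy xc by simp
            qed
            show False
            proof (rule fin0[OF Rel_sym[OF z(2)]])
              fix \<iota> assume i: "\<iota> \<in> I"
              show "FD z c (X \<iota>)"
              proof (rule cut[of \<iota> c "{w}", OF i c(1)])
                show "u c \<noteq> cA ^ t * u z \<or> z = w" for t
                proof (rule disjI1, rule notI)
                  assume "u c = cA ^ t * u z"
                  then have "1 * u z = (cB ^ k * cA ^ t) * u z" using u(2)[OF z(2)] by (simp add: mult.assoc)
                  then have "cB ^ k * cA ^ t = 1" using unz by (metis mult_right_cancel)
                  then show False using cBA z(3) by fastforce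
                qed
              qed (use c z wZ nobeta in auto)
            qed
          next
            case noB: False
            show False
            proof (cases "\<exists>a c. (a, c, w) \<in> G")
              case True
              then obtain a c where a: "(a, c, w) \<in> G" by blast
              then have "a \<noteq> w" using nobeta by blast
              then show False using sink[OF Rel_sym[OF Re[OF a]]] nobeta by blast
            next
              case noa: False
              have GA: "t \<in> EA" if "t \<in> G" for t
              proof -
                obtain a c b where t: "t = (a, c, b)" by (cases t)
                have "t \<in> LL" using that less.prems(2) by blast
                then consider "t \<in> EA" | "t \<in> EB" | "b = w" | "a = w" by (auto simp: LL_def E\<alpha>_def E\<beta>_def t)
                then show ?thesis
                proof cases
                  case 2
                  then have "c = cB" by (simp add: t EB_def)
                  then show ?thesis using that noB 2 t by blast
                next
                  case 3 then show ?thesis using that noa t by blast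
                next
                  case 4 then show ?thesis using that nobeta t by blast
                qed
              qed
              obtain x y where xy: "(x, cA, y) \<in> G" "x \<in> Z" "y \<in> Z"
              proof -
                obtain t where t: "t \<in> G" using False by blast
                then have "t \<in> EA" by (rule GA)
                then show thesis using t by (intro that[of "fst t" "snd (snd t)"]) (auto simp: EA_def)
              qed
              obtain c n where c: "c \<in> Z" "Rel D y c (cA ^ n)" "\<And>y. y \<in> Z \<Longrightarrow> \<not> Rel D c y cA"
                using lowest[where D = D and ?k0.0 = k0, OF k0 xy(3) cA cA_pow_inj] by blast
              have xc: "Rel D x c (cA ^ Suc n)" using Rel_trans[OF Re[OF xy(1)] c(2)] by simp
              have "x \<noteq> c"
              proof
                assume "x = c"
                then have "cA ^ Suc n = cA ^ 0" using Rel_unique[where D = D and ?k0.0 = k0, OF k0 xc] Rel_refl by auto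
                then show False using cA_pow_inj by blast
              qed
              moreover have "(c, c', b) \<notin> G" for c' b
                using GA[of "(c, c', b)"] c(3) Re by (auto simp: EA_def)
              ultimately show False using sink[OF Rel_sym[OF xc]] c by auto
            qed
          qed
        qed
      qed
      then show ?thesis unfolding D_def by simp
    qed
  qed
  have E0: "E \<iota> - LL = {}" for \<iota> by (auto simp: E_def EL_def)
  have "(\<lambda>e. \<Sum>\<iota>\<in>I. ((num \<iota>) \<bullet> Y \<iota>) e) = (\<lambda>e. 0)"
    using claim[OF fin_LL subset_refl, of num, unfolded E0] rel by (simp add: E_def)
  then show ?thesis by metis
qed

end

subsection \<open>Families of orders\<close>

definition pos :: "nat list \<Rightarrow> nat \<Rightarrow> nat" where
  "pos l v = length (takeWhile (\<lambda>x. x \<noteq> v) l)"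

lemma pos_append: "v \<notin> set l1 \<Longrightarrow> pos (l1 @ v # l2) v = length l1"
  by (simp add: pos_def takeWhile_append2 takeWhile_append)

lemma pos_lt_split:
  assumes "a \<in> set l" "b \<in> set l" "distinct l" "pos l a < pos l b"
  shows "\<exists>l1 l2 l3. l = l1 @ a # l2 @ b # l3"
proof -
  obtain k1 k2 where k: "l = k1 @ a # k2" using assms(1) by (meson split_list)
  show ?thesis
  proof (cases "b \<in> set k2")
    case True
    then obtain l2 l3 where "k2 = l2 @ b # l3" by (meson split_list)
    then show ?thesis using k by auto
  next
    case False
    moreover have "a \<noteq> b" using assms(4) by auto
    ultimately have "b \<in> set k1" using assms(2) k by auto
    then obtain m1 m2 where m: "k1 = m1 @ b # m2" by (meson split_list)
    have "pos l b = length m1" using pos_append[of b m1] assms(3) by (auto simp: k m)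
    moreover have "pos l a = length k1" using pos_append[of a k1] assms(3) by (auto simp: k)
    ultimately show ?thesis using assms(4) m by simp
  qed
qed

lemma pos_split_lt: "distinct (l1 @ a # l2 @ b # l3) \<Longrightarrow> pos (l1 @ a # l2 @ b # l3) a < pos (l1 @ a # l2 @ b # l3) b"
  using pos_append[of a l1 "l2 @ b # l3"] pos_append[of b "l1 @ a # l2" l3] by auto

lemma pos_notin: "v \<notin> set l1 \<Longrightarrow> pos (l1 @ l2) v = length l1 + pos l2 v"
  by (induction l1) (auto simp: pos_def)

lemma pos_in: "v \<in> set l1 \<Longrightarrow> pos (l1 @ l2) v = pos l1 v"
  by (induction l1) (auto simp: pos_def)

lemma pos_in_less: "v \<in> set l \<Longrightarrow> pos l v < length l"
  unfolding pos_def by (induction l) auto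

lemma pos_swap:
  assumes "distinct (l1 @ a # b # l2)" "x \<in> set (l1 @ a # b # l2)" "y \<in> set (l1 @ a # b # l2)" "{x, y} \<noteq> {a, b}"
  shows "pos (l1 @ a # b # l2) x < pos (l1 @ a # b # l2) y \<longleftrightarrow> pos (l1 @ b # a # l2) x < pos (l1 @ b # a # l2) y"
proof -
  have p: "pos (l1 @ a # b # l2) z = (if z \<in> set l1 then pos l1 z else if z = a then length l1 else if z = b then Suc (length l1) else length l1 + 2 + pos l2 z)"
    "pos (l1 @ b # a # l2) z = (if z \<in> set l1 then pos l1 z else if z = b then length l1 else if z = a then Suc (length l1) else length l1 + 2 + pos l2 z)" for z
    using assms(1) by (auto simp: pos_in pos_notin) (auto simp: pos_def)
  have l: "pos l1 z < length l1" if "z \<in> set l1" for z using pos_in_less that by blast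
  show ?thesis unfolding p using assms l[of x] l[of y] by auto
qed

definition rl :: "(nat \<Rightarrow> nat) \<Rightarrow> nat \<times> complex fps \<times> nat \<Rightarrow> nat \<times> complex fps \<times> nat" where
  "rl g = (\<lambda>(a, c, b). (g a, c, g b))"

lemma map_key_minus_sg:
  fixes g :: "nat \<Rightarrow> nat"
  assumes "inj g" shows "mk g (e - sg (g a) k) = mk g e - sg a k"
proof -
  have "mk g (e - sg (g a) k + sg (g a) k) = mk g (e - sg (g a) k) + mk g (sg (g a) k)"
    by (rule map_key_plus[OF assms])
  then show ?thesis using assms by (simp add: map_key_single)
qed

lemma lookup_map_key: "inj g \<Longrightarrow> lk (mk g e) a = lk e (g a)"
  by (simp add: map_key.rep_eq)

context hmodule_step
begin

lemma lf_rename: "inj g \<Longrightarrow> (lf d (g a) c (g b) \<bullet> (\<lambda>e. X (mk g e))) e = (lf d a c b \<bullet> X) (mk g e)"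
  by (simp add: pt_lf map_key_minus_sg)

lemma PT_rename:
  assumes "inj g" "finite T"
  shows "(PT d (rl g ` T) \<bullet> (\<lambda>e. X (mk g e))) e = (PT d T \<bullet> X) (mk g e)"
  using assms(2)
proof (induction T arbitrary: e rule: finite_induct)
  case (insert t T)
  obtain a c b where t: "t = (a, c, b)" by (cases t)
  have inj: "inj (rl g)" using assms(1) by (auto simp: inj_def rl_def)
  have n: "(g a, c, g b) \<notin> rl g ` T"
  proof
    assume "(g a, c, g b) \<in> rl g ` T"
    then have "rl g t \<in> rl g ` T" by (simp add: t rl_def)
    then show False using inj insert.hyps by (metis inj_image_mem_iff)
  qed
  have eq: "(PT d (rl g ` T) \<bullet> (\<lambda>e. X (mk g e))) = (\<lambda>e. (PT d T \<bullet> X) (mk g e))"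
    using insert.IH by blast
  have "rl g ` insert t T = insert (g a, c, g b) (rl g ` T)" by (simp add: t rl_def)
  then have "PT d (rl g ` insert t T) = lf d (g a) c (g b) * PT d (rl g ` T)"
    using n insert.hyps by (simp add: PT_insert)
  then show ?case using insert.hyps lf_rename[OF assms(1)] t by (simp add: PT_insert pt_mult eq)
qed simp

end

context linkage
begin

lemma pedges_nth: "(a, c, b) \<in> pedges vs cs \<Longrightarrow> \<exists>j. Suc j < length vs \<and> j < length cs \<and> a = vs ! j \<and> c = cs ! j \<and> b = vs ! Suc j"
proof (induction vs cs rule: pedges.induct)
  case (1 x y vs c' cs)
  show ?case
  proof (cases "(a, c, b) = (x, c', y)")
    case True then show ?thesis by (intro exI[of _ 0]) auto
  next
    case False
    then have "(a, c, b) \<in> pedges (y # vs) cs" using 1 by auto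
    then obtain j where "Suc j < length (y # vs) \<and> j < length cs \<and> a = (y # vs) ! j \<and> c = cs ! j \<and> b = (y # vs) ! Suc j"
      using 1 by blast
    then show ?thesis by (intro exI[of _ "Suc j"]) auto
  qed
qed auto

lemma pedges_nth_in: "length vs = Suc (length cs) \<Longrightarrow> j < length cs \<Longrightarrow> (vs ! j, cs ! j, vs ! Suc j) \<in> pedges vs cs"
proof (induction vs cs arbitrary: j rule: pedges.induct)
  case (1 a b vs c cs)
  show ?case
  proof (cases j)
    case (Suc k)
    then have "((b # vs) ! k, cs ! k, (b # vs) ! Suc k) \<in> pedges (b # vs) cs" using 1 by auto
    then show ?thesis using Suc by simp
  qed simp
qed auto

text \<open>Only \<iota>0 respects every step of the path vs. Any other \<iota> has a step out of
  order, and the vertices before this gap are closed under the edges of C in its order; so its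
  summand decays from the last vertex to the first. The relation transfers this decay to \<iota>0,
  to which \<open>path_extract\<close> applies. By \<open>nu\<close> the other forms do not vanish
  at u and can be cancelled.\<close>

lemma family_extract:
  fixes I :: "'i set"
  assumes I: "finite I" "\<iota>0 \<in> I" and Y: "\<And>\<iota>. \<iota> \<in> I \<Longrightarrow> FDp (p \<iota>) (Y \<iota>)"
    and Phi: "\<And>\<iota>. \<iota> \<in> I \<Longrightarrow> PT d (EL (p \<iota>)) \<bullet> Y \<iota> = Cst (s \<iota>) \<bullet> \<Phi>"
    and BB: "BB \<Phi>" "BB ((num \<iota>0 * Cst (s \<iota>0)) \<bullet> \<Phi>)"
    and rel: "\<And>e. (\<Sum>\<iota>\<in>I. (num \<iota> \<bullet> Y \<iota>) e) = 0"
    and vs: "distinct vs" "set vs \<subseteq> insert w Z" "length vs = Suc (length cs)" "cs \<noteq> []" "sorted_wrt (\<lambda>a b. p \<iota>0 a < p \<iota>0 b) vs"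
    and pe: "pedges vs cs \<subseteq> LL"
    and other: "\<And>\<iota>. \<iota> \<in> I \<Longrightarrow> \<iota> \<noteq> \<iota>0 \<Longrightarrow> \<exists>i<length cs. \<not> p \<iota> (vs ! i) < p \<iota> (vs ! Suc i)"
    and u: "\<And>v. unit0 (u v)" "\<And>a c b. (a, c, b) \<in> pedges vs cs \<Longrightarrow> u a = c * u b"
    and nu: "\<And>a c b. (a, c, b) \<in> LL \<Longrightarrow> a \<in> set vs \<Longrightarrow> b \<in> set vs \<Longrightarrow> \<not> p \<iota>0 a < p \<iota>0 b \<Longrightarrow> (a, c, b) \<noteq> (last vs, cf, hd vs) \<Longrightarrow> u a \<noteq> c * u b"
  shows "van (set vs) u ((num \<iota>0 * Cst (s \<iota>0)) \<bullet> \<Phi>)"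
proof -
  \<comment> \<open>The edge that closes the path may vanish at u, so it must not be among the forms
    cancelled at the end. Placing it in C keeps it out of the multipliers; it does no harm there, as
    it starts at the last vertex.\<close>
  define C where "C = insert (last vs, cf, hd vs) (pedges vs cs)"
  define E where "E \<iota> = EL (p \<iota>)" for \<iota>
  have okE: "ok (p \<iota>) (E \<iota>)" for \<iota> using ok_EL by (simp add: E_def)
  have finE: "finite (E \<iota>)" for \<iota> using ok_finite[OF okE] .
  have ELL: "E \<iota> \<subseteq> LL" for \<iota> by (auto simp: E_def EL_def)
  define X where "X \<iota> = PT d (E \<iota> - C) \<bullet> Y \<iota>" for \<iota>
  have FX: "FDp (p \<iota>) (X \<iota>)" if "\<iota> \<in> I" for \<iota> unfolding X_def using Y[OF that] by (rule FDp_pt)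
  have TX: "PT d (E \<iota> \<inter> C) \<bullet> X \<iota> = Cst (s \<iota>) \<bullet> \<Phi>" if "\<iota> \<in> I" for \<iota>
    using Phi[OF that] PT_split[OF finE[of \<iota>], of d C] by (simp add: E_def X_def pt_mult)
  define h where "h \<iota> = num \<iota> * PT d (LL - C - E \<iota>)" for \<iota>
  have rel2: "(\<Sum>\<iota>\<in>I. (h \<iota> \<bullet> X \<iota>) e) = 0" for e
  proof -
    have "h \<iota> \<bullet> X \<iota> = PT d (LL - C) \<bullet> (num \<iota> \<bullet> Y \<iota>)" for \<iota>
    proof -
      have "PT d (LL - C) = PT d ((LL - C) \<inter> E \<iota>) * PT d (LL - C - E \<iota>)" by (rule PT_split) (simp add: fin_LL)
      moreover have "(LL - C) \<inter> E \<iota> = E \<iota> - C" using ELL by auto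
      ultimately show ?thesis by (simp add: h_def X_def pt_mult[symmetric] mult_ac)
    qed
    then have "(\<Sum>\<iota>\<in>I. (h \<iota> \<bullet> X \<iota>) e) = (PT d (LL - C) \<bullet> (\<lambda>e. \<Sum>\<iota>\<in>I. (num \<iota> \<bullet> Y \<iota>) e)) e"
      by (simp add: pt_sum_right)
    also have "(\<lambda>e. \<Sum>\<iota>\<in>I. (num \<iota> \<bullet> Y \<iota>) e) = (\<lambda>e. 0)" using rel by blast
    finally show ?thesis by simp
  qed
  have lh: "last vs = vs ! length cs" "hd vs = vs ! 0" "last vs \<in> insert w Z" "hd vs \<in> insert w Z"
  proof -
    have ne: "vs \<noteq> []" using vs(3) by auto
    show "last vs = vs ! length cs" "hd vs = vs ! 0" using ne vs(3) by (auto simp: last_conv_nth hd_conv_nth)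
    show "last vs \<in> insert w Z" "hd vs \<in> insert w Z" using last_in_set[OF ne] hd_in_set[OF ne] vs(2) by blast+
  qed
  have FDo: "FD (last vs) (hd vs) (X \<iota>)" if i: "\<iota> \<in> I" "\<iota> \<noteq> \<iota>0" for \<iota>
  proof -
    obtain k where k: "k < length cs" "\<not> p \<iota> (vs ! k) < p \<iota> (vs ! Suc k)" using other[OF i] by blast
    \<comment> \<open>The initial part of the path up to the step out of order. Path edges could
      leave it only at this step.\<close>
    define U where "U = set (take (Suc k) vs)"
    have Unth: "vs ! j \<in> U \<longleftrightarrow> j \<le> k" if "j < length vs" for j
    proof
      assume "vs ! j \<in> U"
      then obtain j' where "j' < Suc k" "j' < length vs" "vs ! j' = vs ! j" by (auto simp: U_def in_set_conv_nth)
      then show "j \<le> k" using vs(1) that by (auto simp: nth_eq_iff_index_eq)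
    next
      assume "j \<le> k"
      then have "take (Suc k) vs ! j = vs ! j" "j < length (take (Suc k) vs)" using that by auto
      then show "vs ! j \<in> U" unfolding U_def by (metis nth_mem)
    qed
    have UV: "U \<subseteq> insert w Z" using vs(2) set_take_subset by (fastforce simp: U_def)
    have "Bd U (X \<iota>)"
    proof (rule PT_Bd[OF _ FX[OF i(1)]])
      show "ok (p \<iota>) (E \<iota> \<inter> C)" using ok_subset[OF okE] by blast
      show "Bd U (PT d (E \<iota> \<inter> C) \<bullet> X \<iota>)" unfolding TX[OF i(1)] by (intro Bd_pt BB_Bd BB UV)
      fix a c b assume e: "(a, c, b) \<in> E \<iota> \<inter> C" "a \<in> U"
      have "a \<noteq> last vs" using e(2) Unth[of "length cs"] k vs(3) lh(1) by auto
      then have "(a, c, b) \<in> pedges vs cs" using e by (auto simp: C_def)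
      then obtain j where j: "Suc j < length vs" "a = vs ! j" "b = vs ! Suc j" using pedges_nth by blast
      have "p \<iota> a < p \<iota> b" using e by (auto simp: E_def EL_def)
      then have "j \<noteq> k" using j k by auto
      moreover have "j \<le> k" using e(2) j Unth[of j] by auto
      ultimately show "b \<in> U" using j Unth[of "Suc j"] by auto
    qed (simp add: U_def)
    moreover have "last vs \<notin> U" using Unth[of "length cs"] k vs(3) lh(1) by auto
    moreover have "hd vs \<in> U" using Unth[of 0] vs(3) lh(2) by auto
    ultimately show ?thesis by (intro FD_Bd[of U]) (auto simp: U_def)
  qed
  have FD0: "FD (last vs) (hd vs) (h \<iota>0 \<bullet> X \<iota>0)"
  proof -
    have "(h \<iota>0 \<bullet> X \<iota>0) e = (\<Sum>\<iota>\<in>I - {\<iota>0}. ((Cst (-1) * h \<iota>) \<bullet> X \<iota>) e)" for e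
    proof -
      have "(h \<iota>0 \<bullet> X \<iota>0) e + (\<Sum>\<iota>\<in>I - {\<iota>0}. (h \<iota> \<bullet> X \<iota>) e) = 0"
        using rel2[of e] I by (simp add: sum.remove)
      then show ?thesis by (simp add: pt_mult pt_Cst sum_negf eq_neg_iff_add_eq_0)
    qed
    then have "h \<iota>0 \<bullet> X \<iota>0 = (\<lambda>e. \<Sum>\<iota>\<in>I - {\<iota>0}. ((Cst (-1) * h \<iota>) \<bullet> X \<iota>) e)" by blast
    then show ?thesis using FDo by (auto intro!: FD_sum FD_pt)
  qed
  have E0C: "E \<iota>0 \<inter> C = pedges vs cs"
  proof -
    have "p \<iota>0 (hd vs) < p \<iota>0 (last vs)"
      using sorted_wrt_nth_less[OF vs(5), of 0 "length cs"] vs(3,4) lh(1,2) by simp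
    then have "(last vs, cf, hd vs) \<notin> E \<iota>0" by (auto simp: E_def EL_def)
    moreover have "pedges vs cs \<subseteq> E \<iota>0" using pe pedges_pos[OF vs(5)] by (auto simp: E_def EL_def)
    ultimately show ?thesis unfolding C_def by blast
  qed
  define \<Theta> where "\<Theta> = (num \<iota>0 * Cst (s \<iota>0)) \<bullet> \<Phi>"
  have finR: "finite (LL - C - E \<iota>0)" using fin_LL by simp
  have BR: "BB (PT d (LL - C - E \<iota>0) \<bullet> \<Theta>)" using BB(2) finR by (simp add: \<Theta>_def BB_PT)
  have "Id (pedges vs cs) (PT d (LL - C - E \<iota>0) \<bullet> \<Theta>)"
  proof (rule path_extract[OF vs(1,2,3,5)])
    show "unit0 c" if cin: "c \<in> set cs" for c
    proof -
      obtain j where j: "j < length cs" "cs ! j = c"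
        using cin by (auto simp: in_set_conv_nth)
      have "(vs ! j, cs ! j, vs ! Suc j) \<in> pedges vs cs" using pedges_nth_in[OF vs(3) j(1)] .
      then have "(vs ! j, c, vs ! Suc j) \<in> LL" using j(2) pe by blast
      then show ?thesis by (rule LL_unit)
    qed
    show "FDp (p \<iota>0) (h \<iota>0 \<bullet> X \<iota>0)" by (rule FDp_pt[OF FX[OF I(2)]])
    have "PT d (pedges vs cs) \<bullet> (h \<iota>0 \<bullet> X \<iota>0) = h \<iota>0 \<bullet> (PT d (E \<iota>0 \<inter> C) \<bullet> X \<iota>0)"
      unfolding E0C by (rule pt_commute)
    also have "\<dots> = PT d (LL - C - E \<iota>0) \<bullet> \<Theta>"
      unfolding TX[OF I(2)] h_def \<Theta>_def by (simp add: pt_mult[symmetric] mult_ac)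
    finally show "PT d (pedges vs cs) \<bullet> (h \<iota>0 \<bullet> X \<iota>0) = PT d (LL - C - E \<iota>0) \<bullet> \<Theta>" .
    show "BB (PT d (LL - C - E \<iota>0) \<bullet> \<Theta>)" by (rule BR)
    show "FD (last vs) (hd vs) (h \<iota>0 \<bullet> X \<iota>0)" by (rule FD0)
  qed
  then have "van (set vs) u (PT d (LL - C - E \<iota>0) \<bullet> \<Theta>)"
    by (rule Id_van[OF _ vs(2) u(1)]) (use u(2) pedges_set in blast)
  then show ?thesis unfolding \<Theta>_def[symmetric]
  proof (rule van_PT_cancel[rotated -1])
    fix a c b assume e: "(a, c, b) \<in> LL - C - E \<iota>0"
    then have "(a, c, b) \<in> LL" "\<not> p \<iota>0 a < p \<iota>0 b" "(a, c, b) \<noteq> (last vs, cf, hd vs)" by (auto simp: E_def EL_def C_def)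
    then show "a \<in> insert w Z \<and> b \<in> insert w Z \<and> a \<noteq> b \<and> unit0 c \<and> \<not> (a \<in> set vs \<and> b \<in> set vs \<and> u a = c * u b)"
      using LL_V LL_unit nu by blast
  qed (use finR vs(2) u BB(2) in \<open>auto simp: \<Theta>_def\<close>)
qed

end

subsection \<open>Products of currents\<close>

definition pv :: "nat set \<Rightarrow> lpoly \<Rightarrow> bool" where
  "pv B p \<longleftrightarrow> (\<forall>k\<in>ks p. ks k \<subseteq> B)"

lemma pv_mult: assumes "pv B p" "pv B q" shows "pv B (p * q)"
  unfolding pv_def
proof
  fix k assume "k \<in> ks (p * q)"
  then obtain a b where "k = a + b" "a \<in> ks p" "b \<in> ks q" using keys_mult by blast
  moreover have "ks (a + b) \<subseteq> ks a \<union> ks b" by (rule keys_add)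
  ultimately show "ks k \<subseteq> B" using assms unfolding pv_def by blast
qed

lemma pv_diff: assumes "pv B p" "pv B q" shows "pv B (p - q)"
  using assms keys_diff[of p q] unfolding pv_def by blast

lemma pv_add: assumes "pv B p" "pv B q" shows "pv B (p + q)"
  using assms Poly_Mapping.keys_add[of p q] unfolding pv_def by blast

lemma pv_single: "ks k \<subseteq> B \<Longrightarrow> pv B (Poly_Mapping.single k c)"
  unfolding pv_def by (auto split: if_splits)

lemma pv_Cst: "pv B (Cst c)" unfolding Cst_def by (rule pv_single) simp

lemma pv_Var: "a \<in> B \<Longrightarrow> pv B (Var a ^ n)"
  unfolding Var_power by (rule pv_single) auto

lemma pv_1: "pv B 1" using pv_Cst[of B 1] by (simp add: Cst_1)

lemma pv_lf: "a \<in> B \<Longrightarrow> b \<in> B \<Longrightarrow> pv B (lf d a c b)"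
  unfolding lf_def by (intro pv_diff pv_mult pv_Var pv_Cst)

lemma pv_PT:
  assumes "finite T" "\<And>a c b. (a, c, b) \<in> T \<Longrightarrow> a \<in> B \<and> b \<in> B" shows "pv B (PT d T)"
  using assms
proof (induction T rule: finite_induct)
  case (insert t T)
  obtain a c b where t: "t = (a, c, b)" by (cases t)
  show ?case using insert t by (auto simp: PT_insert intro!: pv_mult pv_lf)
qed (simp add: pv_1)

text \<open>\<open>currents\<close> without the support condition: the series does not depend on the
  exponents of variables that do not occur. This makes words in different variables comparable under
  renaming; \<open>rs\<close> later restores the condition.\<close>

definition rc :: "('i \<Rightarrow> int \<Rightarrow> 'w \<Rightarrow> 'w) \<Rightarrow> ('i \<times> nat) list \<Rightarrow> 'w \<Rightarrow> expo \<Rightarrow> 'w" where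
  "rc x l v e = foldr (\<lambda>(a, b) u. x a (- lk e b) u) l v"

lemma rc_Nil [simp]: "rc x [] v e = v" by (simp add: rc_def)
lemma rc_Cons: "rc x ((a, b) # l) v e = x a (- lk e b) (rc x l v e)" by (simp add: rc_def)
lemma rc_append: "rc x (l1 @ l2) v e = rc x l1 (rc x l2 v e) e" by (simp add: rc_def)

lemma rc_cong:
  "(\<And>b. b \<in> snd ` set l \<Longrightarrow> lk e b = lk e' b) \<Longrightarrow> rc x l v e = rc x l v e'"
  by (induction l) (auto simp: rc_Cons)

lemma rc_rename: "inj g \<Longrightarrow> rc x (map (\<lambda>(a, b). (a, g b)) l) v e = rc x l v (mk g e)"
  by (induction l) (auto simp: rc_Cons lookup_map_key)

text \<open>An injection of all natural numbers that sends 0, 1, 2, ... to the members of l. The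
  shift by \<open>Suc (sum_list l)\<close> moves the remaining indices above every member.\<close>

definition ren :: "nat list \<Rightarrow> nat \<Rightarrow> nat" where
  "ren l k = (if k < length l then l ! k else k + Suc (sum_list l))"

lemma inj_ren: assumes "distinct l" shows "inj (ren l)"
proof (rule injI)
  fix a b assume e: "ren l a = ren l b"
  have "l ! k \<le> sum_list l" if "k < length l" for k
    by (rule member_le_sum_list) (use that in auto)
  then show "a = b" using e assms unfolding ren_def
    by (smt (verit, ccfv_SIG) add_Suc_right add_diff_cancel_right' less_Suc_eq_le not_add_less2 nth_eq_iff_index_eq)
qed

definition pS :: "nat \<Rightarrow> complex fps \<Rightarrow> complex fps \<Rightarrow> complex fps \<Rightarrow> nat \<Rightarrow> nat \<Rightarrow> nat \<Rightarrow> lpoly" where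
  "pS d k1 k2 k3 a b c = Cst k1 * Var a ^ d - Cst k2 * Var b ^ d + Cst k3 * Var c ^ d"

text \<open>What is extracted from a restricted module. \<open>x_sup\<close> comes from (Q0),
  \<open>swap_ii\<close> and \<open>swap_ij\<close> are (Q8) with both sides written as products of
  forms, and \<open>serre\<close> is (Q9). The expression in \<open>serre_ne\<close> is the value of
  the Serre polynomial on a wheel.\<close>

locale current_module = hmodule_step sc s0 co d
  for sc :: "complex fps \<Rightarrow> 'w \<Rightarrow> 'w::ab_group_add"
    and s0 :: "complex \<Rightarrow> 'v \<Rightarrow> 'v::ab_group_add" and co :: "'w \<Rightarrow> nat \<Rightarrow> 'v" and d :: nat +
  fixes x :: "'i \<Rightarrow> int \<Rightarrow> 'w \<Rightarrow> 'w" and i j :: 'i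
    and cA cB :: "complex fps" and \<alpha> \<beta> :: "nat \<Rightarrow> complex fps" and ne M :: nat and hasB :: bool
    and k1 k2 k3 :: "complex fps"
  assumes x_add: "x a n (u + v) = x a n u + x a n v"
    and x_sc: "x a n (sc c u) = sc c (x a n u)"
    and x_res: "\<exists>N. \<forall>n\<ge>N. zt p (x a n v)"
    and x_sup: "\<not> int d dvd n \<Longrightarrow> x i n v = 0"
    and cA: "unit0 cA" and cB: "unit0 cB"
    and \<alpha>: "\<And>l. unit0 (\<alpha> l)" and \<beta>: "\<And>l. unit0 (\<beta> l)"
    and cAB: "cA * cB ^ 2 = 1"
    and cBA: "\<And>n t. cB ^ n * cA ^ t = 1 \<Longrightarrow> n = 2 * t"
    and closed: "\<And>l l' n t. l < ne \<Longrightarrow> l' < ne \<Longrightarrow> \<beta> l * cB ^ n * cA ^ t * \<alpha> l' = 1 \<Longrightarrow> n + 2 * (M - 1) = 2 * t"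
    and \<alpha>\<alpha>: "\<And>l l' k. l < ne \<Longrightarrow> l' < ne \<Longrightarrow> \<alpha> l' = cA ^ k * \<alpha> l \<Longrightarrow> k = 0"
    and M2: "2 \<le> M"
    and swap_ii: "\<And>v e. (PT d (insert (0, cA, 1) (if hasB then {(0, cB, 1)} else {})) \<bullet> rc x [(i, 0), (i, 1)] v) e =
       - (PT d (insert (1, cA, 0) (if hasB then {(1, cB, 0)} else {})) \<bullet> rc x [(i, 1), (i, 0)] v) e"
    and swap_ij: "\<And>v e. (PT d ((\<lambda>l. (0, \<alpha> l, 1)) ` {..<ne}) \<bullet> rc x [(i, 0), (j, 1)] v) e =
       - (PT d ((\<lambda>l. (1, \<beta> l, 0)) ` {..<ne}) \<bullet> rc x [(j, 1), (i, 0)] v) e"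
    and serre: "\<And>v e. hasB \<Longrightarrow> (\<Sum>\<sigma> | \<sigma> permutes {1..3::nat}.
       (pS d k1 k2 k3 (\<sigma> 1) (\<sigma> 2) (\<sigma> 3) \<bullet> rc x [(i, \<sigma> 1), (i, \<sigma> 2), (i, \<sigma> 3)] v) e) = 0"
    and serre_ne: "hasB \<Longrightarrow> k1 * (cA * cB) - k2 * cB + k3 \<noteq> 0"
begin

lemma x_0 [simp]: "x a n 0 = 0" using x_add[of a n 0 0] by simp

lemma rc_add: "rc x l (u + v) e = rc x l u e + rc x l v e"
  by (induction l) (auto simp: rc_Cons x_add)
lemma rc_sc: "rc x l (sc c u) e = sc c (rc x l u e)"
  by (induction l) (auto simp: rc_Cons x_sc)
lemma rc_0 [simp]: "rc x l 0 e = 0" by (induction l) (auto simp: rc_Cons)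
lemma rc_uminus: "rc x l (- u) e = - rc x l u e"
  using rc_add[of l u "- u" e] by (simp add: eq_neg_iff_add_eq_0 add.commute)
lemma rc_sum: "rc x l (\<Sum>k\<in>K. g k) e = (\<Sum>k\<in>K. rc x l (g k) e)"
  by (induction K rule: infinite_finite_induct) (auto simp: rc_add)

lemma zt_x: assumes "zt p u" shows "zt p (x a n u)"
proof -
  obtain u' where "u = sc (fps_X ^ p) u'" using assms hfilt_zt unfolding hfilt_def by blast
  then have "x a n u \<in> hfilt sc p" unfolding hfilt_def by (auto simp: x_sc)
  then show ?thesis using hfilt_zt by blast
qed

lemma zt_rc: "zt p u \<Longrightarrow> zt p (rc x l u e)"
  by (induction l) (auto simp: rc_Cons zt_x)

text \<open>A polynomial in the variables of a block shifts only their exponents, which the factors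
  on either side do not see.\<close>

lemma pt_block:
  assumes p: "pv B p" and l: "B \<inter> snd ` set l1 = {}" "B \<inter> snd ` set l2 = {}"
  shows "(p \<bullet> rc x (l1 @ blk @ l2) v) e = rc x l1 ((p \<bullet> rc x blk (rc x l2 v e)) e) e"
proof -
  have k: "lk (e - k) b = lk e b" if "k \<in> ks p" "b \<notin> B" for k b
  proof -
    have "b \<notin> ks k" using p that unfolding pv_def by blast
    then show ?thesis by (simp add: lookup_minus in_keys_iff)
  qed
  have "rc x (l1 @ blk @ l2) v (e - k) = rc x l1 (rc x blk (rc x l2 v e) (e - k)) e" if "k \<in> ks p" for k
  proof -
    have "rc x l2 v (e - k) = rc x l2 v e" by (rule rc_cong) (use k[OF that] l(2) in blast)
    moreover have "rc x l1 u (e - k) = rc x l1 u e" for u by (rule rc_cong) (use k[OF that] l(1) in blast)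
    ultimately show ?thesis by (simp add: rc_append)
  qed
  then show ?thesis by (simp add: poly_times_def rc_sum rc_sc)
qed

text \<open>The factors to the right of b stay fixed while the exponent of z_b falls, so a mode of
  large index acts on a fixed vector. Here the module being restricted enters.\<close>

lemma FD_rc:
  assumes "b \<notin> snd ` set l3" "a \<notin> snd ` set l3" "a \<noteq> b"
  shows "FD a b (rc x (l1 @ (ib, b) # l3) v)"
  unfolding FD_def
proof (intro allI)
  fix e p
  obtain N where N: "\<forall>n\<ge>N. zt p (x ib n (rc x l3 v e))" using x_res by blast
  have "zt p (rc x (l1 @ (ib, b) # l3) v (e + mv a b t))" if t: "nat (N + lk e b) \<le> t" for t
  proof -
    have "rc x l3 v (e + mv a b t) = rc x l3 v e"
      by (rule rc_cong) (use assms in \<open>auto simp: mv_def lookup_add lookup_minus lookup_single when_def\<close>)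
    moreover have "lk (e + mv a b t) b = lk e b - int t * int d"
      using assms by (simp add: mv_def lookup_add lookup_minus lookup_single)
    moreover have "int t \<le> int t * int d" using d_pos by (cases t) auto
    ultimately show ?thesis using N t by (auto simp: rc_append rc_Cons intro!: zt_rc)
  qed
  then show "\<exists>J. \<forall>j\<ge>J. zt p (rc x (l1 @ (ib, b) # l3) v (e + mv a b j))" by blast
qed

lemma Bd_rc: "Bd {b} (rc x (l @ [(ib, b)]) v)"
  unfolding Bd_def
proof
  fix p
  obtain N where N: "\<forall>n\<ge>N. zt p (x ib n v)" using x_res by blast
  then show "\<exists>N. \<forall>e. esum {b} e < N \<longrightarrow> zt p (rc x (l @ [(ib, b)]) v e)"
    by (intro exI[of _ "- N"]) (auto simp: esum_single rc_append rc_Cons intro!: zt_rc)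
qed

lemma rc_sup: "(i, a) \<in> set l \<Longrightarrow> \<not> int d dvd lk e a \<Longrightarrow> rc x l v e = 0"
  by (induction l) (auto simp: rc_Cons x_sup)

lemma swap_block:
  assumes ab: "a \<noteq> b" and T: "finite T" "finite T'"
    and TB: "\<And>y c z. (y, c, z) \<in> T \<union> T' \<Longrightarrow> y \<in> {0, 1} \<and> z \<in> {0, 1}"
    and s: "\<And>v e. (PT d T \<bullet> rc x [(ia, 0), (ib, 1)] v) e = - (PT d T' \<bullet> rc x [(ib, 1), (ia, 0)] v) e"
  shows "(PT d (rl (ren [a, b]) ` T) \<bullet> rc x [(ia, a), (ib, b)] v) e = - (PT d (rl (ren [a, b]) ` T') \<bullet> rc x [(ib, b), (ia, a)] v) e"
proof -
  let ?g = "ren [a, b]"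
  have g: "inj ?g" "?g 0 = a" "?g 1 = b" using inj_ren[of "[a, b]"] ab by (auto simp: ren_def)
  have "rc x [(ia, a), (ib, b)] v = (\<lambda>e. rc x [(ia, 0), (ib, 1)] v (mk ?g e))"
    "rc x [(ib, b), (ia, a)] v = (\<lambda>e. rc x [(ib, 1), (ia, 0)] v (mk ?g e))"
    using rc_rename[OF g(1), of x "[(ia, 0), (ib, 1)]" v] rc_rename[OF g(1), of x "[(ib, 1), (ia, 0)]" v] g by auto
  then show ?thesis using PT_rename[OF g(1)] T s by simp
qed

end

lemma (in hmodule_step) dsup_PT:
  assumes "finite T" "\<And>e. X e \<noteq> 0 \<Longrightarrow> int d dvd lk e a" "(PT d T \<bullet> X) e \<noteq> 0"
  shows "int d dvd lk e a"
  using assms(1,3)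
proof (induction T arbitrary: e rule: finite_induct)
  case (insert t T)
  obtain y c z where t: "t = (y, c, z)" by (cases t)
  have eq: "PT d (insert t T) \<bullet> X = lf d y c z \<bullet> (PT d T \<bullet> X)" using insert.hyps t by (simp add: PT_insert pt_mult)
  have "(PT d T \<bullet> X) (e - sg y (int d)) \<noteq> 0 \<or> (PT d T \<bullet> X) (e - sg z (int d)) \<noteq> 0"
    using insert.prems unfolding eq by (auto simp: pt_lf)
  then have "int d dvd lk (e - sg y (int d)) a \<or> int d dvd lk (e - sg z (int d)) a"
    using insert.IH by blast
  then show ?case by (auto simp: lookup_minus lookup_single when_def dvd_minus_mult_iff split: if_splits)
qed (use assms(2) in simp)

locale current_order = current_module sc s0 co d x i j cA cB \<alpha> \<beta> ne M hasB k1 k2 k3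
  for sc :: "complex fps \<Rightarrow> 'w \<Rightarrow> 'w::ab_group_add"
    and s0 :: "complex \<Rightarrow> 'v \<Rightarrow> 'v::ab_group_add" and co :: "'w \<Rightarrow> nat \<Rightarrow> 'v" and d :: nat
    and x :: "'i \<Rightarrow> int \<Rightarrow> 'w \<Rightarrow> 'w" and i j :: 'i
    and cA cB :: "complex fps" and \<alpha> \<beta> :: "nat \<Rightarrow> complex fps" and ne M :: nat and hasB :: bool
    and k1 k2 k3 :: "complex fps" +
  fixes w :: nat and Z :: "nat set"
  assumes finZ: "finite Z" and wnZ: "w \<notin> Z"

sublocale current_order \<subseteq> linkage sc s0 co d w Z cA cB \<alpha> \<beta> ne M hasB
  by unfold_locales (use finZ wnZ cA cB \<alpha> \<beta> cAB cBA closed \<alpha>\<alpha> M2 in auto)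

context current_order
begin

definition wd :: "nat list \<Rightarrow> ('i \<times> nat) list" where
  "wd \<tau> = map (\<lambda>v. (if v = w then j else i, v)) \<tau>"
definition order :: "nat list \<Rightarrow> bool" where "order \<tau> \<longleftrightarrow> distinct \<tau> \<and> set \<tau> = insert w Z"
text \<open>The product of currents in the order \<tau>, multiplied by the forms of that order; up
  to sign it turns out to be independent of \<tau>.\<close>

definition Phi :: "nat list \<Rightarrow> 'w \<Rightarrow> expo \<Rightarrow> 'w" where
  "Phi \<tau> v = PT d (EL (pos \<tau>)) \<bullet> rc x (wd \<tau>) v"
definition pairE :: "nat \<Rightarrow> nat \<Rightarrow> (nat \<times> complex fps \<times> nat) set" where
  "pairE a b = {(a', c, b') \<in> LL. a' = a \<and> b' = b}"

lemma wd_append: "wd (l1 @ l2) = wd l1 @ wd l2" by (simp add: wd_def)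
lemma snd_wd: "snd ` set (wd l) = set l" by (auto simp: wd_def image_iff)

lemma fin_EL: "finite (EL p)" using ok_finite[OF ok_EL] .

lemma FDp_rc: assumes "order \<tau>" shows "FDp (pos \<tau>) (rc x (wd \<tau>) v)"
  unfolding FDp_def
proof (intro ballI impI)
  fix a b assume ab: "a \<in> insert w Z" "b \<in> insert w Z" "pos \<tau> a < pos \<tau> b"
  then obtain l1 l2 l3 where t: "\<tau> = l1 @ a # l2 @ b # l3"
    using pos_lt_split[of a \<tau> b] assms unfolding order_def by blast
  have "wd \<tau> = wd (l1 @ a # l2) @ (if b = w then j else i, b) # wd l3" by (simp add: t wd_def)
  then show "FD a b (rc x (wd \<tau>) v)" using FD_rc[of b "wd l3" a] assms
    by (simp add: snd_wd order_def t)
qed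

lemma pair_swap:
  assumes "a \<in> insert w Z" "b \<in> insert w Z" "a \<noteq> b"
  shows "(PT d (pairE a b) \<bullet> rc x (wd [a, b]) v) e = - (PT d (pairE b a) \<bullet> rc x (wd [b, a]) v) e"
proof -
  have r: "ren [y, z] 0 = y" "ren [y, z] (Suc 0) = z" for y z by (auto simp: ren_def)
  have ij: "(PT d (pairE y w) \<bullet> rc x (wd [y, w]) v) e = - (PT d (pairE w y) \<bullet> rc x (wd [w, y]) v) e" if y: "y \<in> Z" for y e
  proof -
    have "pairE y w = (\<lambda>l. (y, \<alpha> l, w)) ` {..<ne}" "pairE w y = (\<lambda>l. (w, \<beta> l, y)) ` {..<ne}"
      using y wnZ by (auto simp: pairE_def LL_def EA_def EB_def E\<alpha>_def E\<beta>_def)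
    then have "pairE y w = rl (ren [y, w]) ` (\<lambda>l. (0, \<alpha> l, 1)) ` {..<ne}" "pairE w y = rl (ren [y, w]) ` (\<lambda>l. (1, \<beta> l, 0)) ` {..<ne}"
      by (simp_all add: image_image rl_def r)
    moreover have "y \<noteq> w" using y wnZ by auto
    ultimately show ?thesis using swap_block[of y w "(\<lambda>l. (0, \<alpha> l, 1)) ` {..<ne}" "(\<lambda>l. (1, \<beta> l, 0)) ` {..<ne}" i j v e] swap_ij
      by (auto simp: wd_def)
  qed
  consider "a \<in> Z" "b \<in> Z" | "b = w" "a \<in> Z" | "a = w" "b \<in> Z" using assms by auto
  then show ?thesis
  proof cases
    case 1
    let ?T = "\<lambda>a b. insert (a, cA, b) (if hasB then {(a, cB, b)} else {})"
    have "pairE a b = rl (ren [a, b]) ` ?T 0 1" "pairE b a = rl (ren [a, b]) ` ?T 1 0"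
      using 1 assms wnZ by (auto simp: pairE_def LL_def EA_def EB_def E\<alpha>_def E\<beta>_def rl_def r)
    moreover have "a \<noteq> w" "b \<noteq> w" using 1 wnZ by auto
    ultimately show ?thesis using swap_block[of a b "?T 0 1" "?T 1 0" i i v e] swap_ii assms(3)
      by (auto simp: wd_def split: if_splits)
  next
    case 2 then show ?thesis using ij[of a e] by simp
  next
    case 3 then show ?thesis using ij[of b e] by simp
  qed
qed

text \<open>Both orders share all edges except those between a and b, and for these the exchange
  relation is precisely a change of sign.\<close>

lemma Phi_swap:
  assumes o: "order (l1 @ a # b # l2)"
  shows "Phi (l1 @ a # b # l2) v e = - Phi (l1 @ b # a # l2) v e"
proof -
  let ?t = "l1 @ a # b # l2" and ?t' = "l1 @ b # a # l2"
  define R where "R = {(y, c, z) \<in> LL. pos ?t y < pos ?t z \<and> {y, z} \<noteq> {a, b}}"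
  have dist: "distinct ?t" "set ?t = insert w Z" using o by (auto simp: order_def)
  have lt: "pos ?t a < pos ?t b" "pos ?t' b < pos ?t' a"
    using pos_split_lt[of l1 a "[]" b l2] pos_split_lt[of l1 b "[]" a l2] dist by auto
  have ps: "pos ?t y < pos ?t z \<longleftrightarrow> pos ?t' y < pos ?t' z" if "(y, c, z) \<in> LL" "{y, z} \<noteq> {a, b}" for y c z
    using pos_swap[OF dist(1), of y z] LL_V[OF that(1)] dist(2) that(2) by blast
  have R': "R = {(y, c, z) \<in> LL. pos ?t' y < pos ?t' z \<and> {y, z} \<noteq> {a, b}}" unfolding R_def using ps by blast
  have E: "EL (pos ?t) = pairE a b \<union> R" unfolding EL_def pairE_def R_def using lt(1)
    by (auto simp: doubleton_eq_iff)
  have E': "EL (pos ?t') = pairE b a \<union> R" unfolding EL_def pairE_def R' using lt(2)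
    by (auto simp: doubleton_eq_iff)
  have fin: "finite R" "finite (pairE y z)" for y z using fin_LL by (auto simp: R_def pairE_def elim: rev_finite_subset)
  have dj: "pairE a b \<inter> R = {}" "pairE b a \<inter> R = {}" by (auto simp: pairE_def R_def)
  have pv: "pv {a, b} (PT d (pairE y z))" if "{y, z} \<subseteq> {a, b}" for y z
    by (rule pv_PT[OF fin(2)]) (use that in \<open>auto simp: pairE_def\<close>)
  have bl: "(PT d (pairE y z) \<bullet> rc x (wd (l1 @ [y', z'] @ l2)) v) e = rc x (wd l1) ((PT d (pairE y z) \<bullet> rc x (wd [y', z']) (rc x (wd l2) v e)) e) e"
    if "{y, z} \<subseteq> {a, b}" for y z y' z' e
    unfolding wd_append by (rule pt_block[OF pv[OF that]]) (use dist in \<open>auto simp: snd_wd\<close>)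
  have ab: "a \<in> insert w Z" "b \<in> insert w Z" "a \<noteq> b" using dist by auto
  have eq: "PT d (pairE a b) \<bullet> rc x (wd ?t) v = (\<lambda>e. - (PT d (pairE b a) \<bullet> rc x (wd ?t') v) e)"
  proof
    fix e
    show "(PT d (pairE a b) \<bullet> rc x (wd ?t) v) e = - (PT d (pairE b a) \<bullet> rc x (wd ?t') v) e"
      using bl[of a b a b e] bl[of b a b a e] pair_swap[OF ab] by (simp add: rc_uminus)
  qed
  have "Phi ?t v e = (PT d R \<bullet> (PT d (pairE a b) \<bullet> rc x (wd ?t) v)) e"
    unfolding Phi_def E using PT_union[OF fin(2) fin(1) dj(1)] by (simp add: pt_mult[symmetric] mult.commute)
  also have "\<dots> = - (PT d R \<bullet> (PT d (pairE b a) \<bullet> rc x (wd ?t') v)) e" unfolding eq by (simp add: pt_uminus_right)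
  also have "\<dots> = - Phi ?t' v e"
    unfolding Phi_def E' using PT_union[OF fin(2) fin(1) dj(2)] by (simp add: pt_mult[symmetric] mult.commute)
  finally show ?thesis .
qed

lemma order_perm: "order l \<Longrightarrow> set l' = set l \<Longrightarrow> length l' = length l \<Longrightarrow> order l'"
  unfolding order_def by (metis card_distinct distinct_card)

text \<open>An exchange at a distance amounts to an odd number of adjacent ones.\<close>

lemma Phi_exch: "order (l1 @ a # m @ b # l2) \<Longrightarrow> Phi (l1 @ a # m @ b # l2) v e = - Phi (l1 @ b # m @ a # l2) v e"
proof (induction m arbitrary: l1)
  case Nil then show ?case using Phi_swap[of l1 a b l2] by simp
next
  case (Cons c m)
  have o: "order (l1 @ c # a # m @ b # l2)" "order (l1 @ c # b # m @ a # l2)"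
    by (rule order_perm[OF Cons.prems]; auto)+
  have "Phi (l1 @ a # (c # m) @ b # l2) v e = - Phi (l1 @ c # a # m @ b # l2) v e"
    using Phi_swap[of l1 a c "m @ b # l2"] Cons.prems by simp
  also have "\<dots> = Phi (l1 @ c # b # m @ a # l2) v e" using Cons.IH[of "l1 @ [c]"] o by simp
  also have "\<dots> = - Phi (l1 @ b # (c # m) @ a # l2) v e" using Phi_swap[OF o(2)] by simp
  finally show ?case .
qed

lemma Phi_transpose:
  assumes o: "order \<tau>" and ab: "a \<in> insert w Z" "b \<in> insert w Z" "a \<noteq> b"
  shows "Phi (map (Transposition.transpose a b) \<tau>) v e = - Phi \<tau> v e"
proof -
  have main: "Phi (map (Transposition.transpose a b) \<tau>) v e = - Phi \<tau> v e"
    if t: "\<tau> = l1 @ a' # m @ b' # l2" and ab': "{a', b'} = {a, b}" for l1 m l2 a' b'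
  proof -
    have tr: "Transposition.transpose a b a' = b'" "Transposition.transpose a b b' = a'"
      using ab' ab(3) by (auto simp: doubleton_eq_iff)
    have id: "map (Transposition.transpose a b) l = l" if "a \<notin> set l" "b \<notin> set l" for l
      by (rule map_idI) (use that in \<open>auto simp: Transposition.transpose_def\<close>)
    have "distinct \<tau>" using o by (simp add: order_def)
    then have "map (Transposition.transpose a b) \<tau> = l1 @ b' # m @ a' # l2"
      using ab' by (auto simp: t tr id doubleton_eq_iff)
    then show ?thesis using Phi_exch[of l1 a' m b' l2 v e] o t by simp
  qed
  have "a \<in> set \<tau>" "b \<in> set \<tau>" "distinct \<tau>" using o ab by (auto simp: order_def)
  moreover have "pos \<tau> a \<noteq> pos \<tau> b"
  proof
    assume "pos \<tau> a = pos \<tau> b"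
    moreover obtain l1 l2 where "\<tau> = l1 @ a # l2" "a \<notin> set l1" using \<open>a \<in> set \<tau>\<close> by (meson split_list_first)
    moreover obtain m1 m2 where "\<tau> = m1 @ b # m2" "b \<notin> set m1" using \<open>b \<in> set \<tau>\<close> by (meson split_list_first)
    ultimately have "length l1 = length m1" using pos_append by metis
    then show False using \<open>\<tau> = l1 @ a # l2\<close> \<open>\<tau> = m1 @ b # m2\<close> ab(3) by simp
  qed
  ultimately consider "\<exists>l1 m l2. \<tau> = l1 @ a # m @ b # l2" | "\<exists>l1 m l2. \<tau> = l1 @ b # m @ a # l2"
    using pos_lt_split[of a \<tau> b] pos_lt_split[of b \<tau> a] by (meson linorder_neqE_nat)
  then show ?thesis
  proof cases
    case 1 then show ?thesis using main by blast
  next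
    case 2 then show ?thesis using main by (metis insert_commute)
  qed
qed

lemma order_map: "order \<tau> \<Longrightarrow> \<sigma> permutes insert w Z \<Longrightarrow> order (map \<sigma> \<tau>)"
  unfolding order_def using permutes_image permutes_inj_on by (metis distinct_map set_map)

lemma Phi_perm:
  assumes "\<sigma> permutes insert w Z" "order \<tau>"
  shows "Phi (map \<sigma> \<tau>) v e = sc (of_int (sign \<sigma>)) (Phi \<tau> v e)"
proof -
  have "Phi (map \<sigma> \<tau>) v e = sc (of_int (sign \<sigma>)) (Phi \<tau> v e) \<and> \<sigma> permutes insert w Z"
    using assms(1) fin_V
  proof (induction rule: permutes_induct)
    case (swap a b p)
    have "order (map p \<tau>)" using order_map assms(2) swap by blast
    then have "Phi (map (Transposition.transpose a b) (map p \<tau>)) v e = - Phi (map p \<tau>) v e"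
      using Phi_transpose swap by blast
    moreover have "sign (Transposition.transpose a b \<circ> p) = - sign p"
    proof -
      have "permutation p" by (rule permutes_imp_permutation[OF fin_V]) (use swap.IH in blast)
      then show ?thesis using swap(3) by (simp add: sign_compose permutation_swap_id sign_swap_id)
    qed
    moreover have "Transposition.transpose a b \<circ> p permutes insert w Z"
      using swap by (simp add: permutes_compose permutes_swap_id)
    ultimately show ?case using swap.IH by (simp add: o_def)
  qed (use permutes_id in \<open>auto simp: id_def\<close>)
  then show ?thesis by blast
qed

text \<open>Every variable can be brought to the last place at the cost of a sign, and there the
  last current acts on the fixed vector v.\<close>

lemma BB_Phi: assumes o: "order \<tau>" shows "BB (Phi \<tau> v)"
proof -
  have last: "Bd {b} (Phi (l @ [b]) v)" for l b
    unfolding Phi_def using Bd_rc by (auto intro!: Bd_pt simp: wd_def)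
  have "Bd {b} (Phi \<tau> v)" if b: "b \<in> insert w Z" for b
  proof -
    obtain l1 l2 where t: "\<tau> = l1 @ b # l2" using b o unfolding order_def by (metis split_list)
    show ?thesis
    proof (cases l2 rule: rev_cases)
      case Nil then show ?thesis using last t by simp
    next
      case (snoc m c)
      have "Phi \<tau> v e = - Phi (l1 @ c # m @ [b]) v e" for e
        using Phi_exch[of l1 b m c "[]"] o t snoc by simp
      moreover have "Bd {b} (\<lambda>e. - Phi (l1 @ c # m @ [b]) v e)"
        by (rule Bd_uminus) (use last[of b "l1 @ c # m"] in simp)
      ultimately show ?thesis by presburger
    qed
  qed
  moreover have "int d dvd lk e a" if "Phi \<tau> v e \<noteq> 0" "a \<in> Z" for e a
  proof (rule dsup_PT[OF fin_EL])
    show "(PT d (EL (pos \<tau>)) \<bullet> rc x (wd \<tau>) v) e \<noteq> 0" using that by (simp add: Phi_def)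
    have "(i, a) \<in> set (wd \<tau>)" using that(2) o wnZ by (auto simp: wd_def order_def image_iff)
    then show "int d dvd lk e a" if "rc x (wd \<tau>) v e \<noteq> 0" for e using rc_sup that by blast
  qed
  ultimately show ?thesis unfolding BB_def by blast
qed

end

lemma pos_nth: "distinct l \<Longrightarrow> k < length l \<Longrightarrow> pos l (l ! k) = k"
proof -
  assume d: "distinct l" and k: "k < length l"
  have l: "l = take k l @ l ! k # drop (Suc k) l" using k by (rule id_take_nth_drop)
  then have "distinct (take k l @ l ! k # drop (Suc k) l)" using d by simp
  then have "l ! k \<notin> set (take k l)" by auto
  then have "pos (take k l @ l ! k # drop (Suc k) l) (l ! k) = length (take k l)" by (rule pos_append)
  then show ?thesis using l k by simp
qed

lemma sorted_pos_unique:
  assumes "distinct l" "set vs = set l" "sorted_wrt (\<lambda>a b. pos l a < pos l b) vs"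
  shows "vs = l"
proof -
  have p: "map (pos l) l = [0..<length l]" using pos_nth[OF assms(1)] by (intro nth_equalityI) auto
  have "sorted_wrt (<) (map (pos l) l)" unfolding p by simp
  moreover have "sorted_wrt (<) (map (pos l) vs)" using assms(3) by (simp add: sorted_wrt_map)
  ultimately have "map (pos l) vs = map (pos l) l" by (rule strict_sorted_equal) (use assms(2) in simp)
  moreover have "inj_on (pos l) (set l)" using p distinct_map[of "pos l" l] by simp
  ultimately show ?thesis using assms(2) by (metis map_inj_on sup.idem)
qed

lemma pos_map_inj: "inj g \<Longrightarrow> pos (map g l) (g v) = pos l v"
  by (simp add: pos_def takeWhile_map o_def inj_eq)

context hmodule_vars
begin

lemma van0_PT:
  assumes "finite T" "van0 C u X" "finite C" "\<And>v. v \<in> C \<Longrightarrow> unit0 (u v)"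
  shows "van0 C u (PT d T \<bullet> X)"
  using assms(1)
proof (induction T rule: finite_induct)
  case (insert t T)
  obtain a c b where t: "t = (a, c, b)" by (cases t)
  show ?case using insert van0_lf[OF insert.IH assms(3,4)] t by (simp add: PT_insert pt_mult)
qed (use assms in simp)

lemma van_PT:
  assumes "finite T" "van C u X" "BB X" "C \<subseteq> V" "\<And>v. v \<in> C \<Longrightarrow> unit0 (u v)"
  shows "van C u (PT d T \<bullet> X)"
  using assms(1)
proof (induction T rule: finite_induct)
  case (insert t T)
  obtain a c b where t: "t = (a, c, b)" by (cases t)
  have "van C u (lf d a c b \<bullet> (PT d T \<bullet> X))"
    by (rule van_lf[OF BB_PT[OF insert.hyps(1) assms(3)] assms(4,5) insert.IH])
  then show ?case using insert.hyps t by (simp add: PT_insert pt_mult)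
qed (use assms in simp)

text \<open>The cluster is renamed by g, and L e stands for the currents further left. It depends
  only on the exponents outside the cluster, so it is constant on each slice and passes through the
  convergent sum.\<close>

lemma transfer_van0:
  assumes g: "inj g" and C0: "finite C0" and v: "van0 C0 u0 X" and u: "\<And>c. c \<in> C0 \<Longrightarrow> u (g c) = u0 c"
    and L: "\<And>e x y. L e (x + y) = L e x + L e y" "\<And>e p x. zt p x \<Longrightarrow> zt p (L e x)" "\<And>e c x. L e (sc c x) = sc c (L e x)"
    and L_eq: "\<And>e e'. (\<And>v. v \<notin> g ` C0 \<Longrightarrow> lk e v = lk e' v) \<Longrightarrow> L e = L e'"
  shows "van0 (g ` C0) u (\<lambda>e. L e (X (mk g e)))"
  unfolding van0_def
proof (intro allI)
  fix \<kappa> n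
  let ?t = "mk g" and ?S = "sl (g ` C0) \<kappa> n" and ?F = "\<lambda>f. sc (wt u0 C0 f) (X f)"
  let ?SS = "sl C0 (?t \<kappa>) n"
  have lk: "lk (?t e) a = lk e (g a)" for e a by (rule lookup_map_key[OF g])
  have ig: "inj_on g C0" using g by (meson inj_on_subset subset_UNIV)
  have es: "esum (g ` C0) e = esum C0 (?t e)" for e unfolding esum_def lk by (simp add: sum.reindex[OF ig])
  have bij: "bij_betw ?t ?S ?SS"
    unfolding bij_betw_def
  proof
    show "inj_on ?t ?S"
    proof (rule inj_onI)
      fix e e' assume h: "e \<in> ?S" "e' \<in> ?S" "?t e = ?t e'"
      have "lk e v = lk e' v" for v
      proof (cases "v \<in> g ` C0")
        case True
        then obtain c where "v = g c" by blast
        then show ?thesis using arg_cong[OF h(3), of "\<lambda>f. lk f c"] by (simp add: lk)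
      qed (use h in \<open>simp add: sl_def\<close>)
      then show "e = e'" by (rule poly_mapping_eqI)
    qed
    show "?t ` ?S = ?SS"
    proof
      show "?t ` ?S \<subseteq> ?SS" using g by (auto simp: sl_def lk es inj_image_mem_iff)
      show "?SS \<subseteq> ?t ` ?S"
      proof
        fix e0 assume e0: "e0 \<in> ?SS"
        \<comment> \<open>The preimage of e0: it agrees with \<kappa> off the renamed cluster and
          carries the exponents of e0 on it.\<close>
        define e where "e = \<kappa> + (\<Sum>c\<in>C0. sg (g c) (lk e0 c - lk \<kappa> (g c)))"
        have l: "lk e v = lk \<kappa> v +
            (\<Sum>c\<in>C0. if g c = v then lk e0 c - lk \<kappa> (g c) else 0)" for v
          unfolding e_def by (simp add: lookup_add lookup_sum lookup_single when_def)
        have l1: "lk e (g c) = lk e0 c" if "c \<in> C0" for c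
          unfolding l using that C0 by (simp add: inj_eq[OF g])
        have l2: "lk e v = lk \<kappa> v" if "v \<notin> g ` C0" for v
          unfolding l using that by (auto intro!: sum.neutral)
        have "?t e = e0"
        proof (rule poly_mapping_eqI)
          fix c show "lk (?t e) c = lk e0 c"
          proof (cases "c \<in> C0")
            case False
            then have "g c \<notin> g ` C0" using g by (simp add: inj_image_mem_iff)
            then show ?thesis using l2 e0 False by (simp add: lk sl_def)
          qed (simp add: lk l1)
        qed
        moreover have "e \<in> ?S" using l2 e0 calculation by (auto simp: sl_def es)
        ultimately show "e0 \<in> ?t ` ?S" by blast
      qed
    qed
  qed
  have wt: "wt u (g ` C0) e = wt u0 C0 (?t e)" for e
    unfolding wt_def lk prod.reindex[OF ig] by (intro prod.cong) (auto simp: u)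
  have sm0: "sm ?F ?SS" "hsum sc ?F ?SS = 0" using v by (auto simp: van0_def van_def subs_def)
  have eq: "sc (wt u (g ` C0) e) (L e (X (?t e))) = L \<kappa> (?F (?t e))" if "e \<in> ?S" for e
  proof -
    have "L e = L \<kappa>" by (rule L_eq) (use that in \<open>simp add: sl_def\<close>)
    then show ?thesis by (simp add: wt L)
  qed
  have L0: "L \<kappa> 0 = 0" using L(1)[of \<kappa> 0 0] by simp
  have h: "sm (\<lambda>f. L \<kappa> (?F f)) ?SS" "hsum sc (\<lambda>f. L \<kappa> (?F f)) ?SS = 0"
    using hsum_linear[OF sm0(1), of "L \<kappa>"] L(1,2) sm0(2) L0 by auto
  have r: "sm (\<lambda>e. L \<kappa> (?F (?t e))) ?S" "hsum sc (\<lambda>e. L \<kappa> (?F (?t e))) ?S = 0"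
    using hsum_reindex[OF bij, of "\<lambda>f. L \<kappa> (?F f)"] h by auto
  show "sm (\<lambda>e. sc (wt u (g ` C0) e) (L e (X (?t e)))) ?S \<and> subs (g ` C0) u (\<lambda>e. L e (X (?t e))) \<kappa> n = 0"
    unfolding subs_def using r sm_cong[of ?S, OF eq] hsum_cong[of ?S, OF eq] by simp
qed

text \<open>After substitution on C the polynomial p acts as c times a shift by D: p is homogeneous
  of degree D in the merged variable, and c is its value at u.\<close>

definition hom :: "nat set \<Rightarrow> (nat \<Rightarrow> complex fps) \<Rightarrow> lpoly \<Rightarrow> int \<Rightarrow> complex fps \<Rightarrow> bool" where
  "hom C u p D c \<longleftrightarrow> (\<forall>X. BB X \<longrightarrow> BB (p \<bullet> X) \<and> (\<forall>\<kappa> n. subs C u (p \<bullet> X) \<kappa> n = sc c (subs C u X \<kappa> (n - D))))"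

lemma hom_Var:
  assumes "a \<in> C" "C \<subseteq> V" "\<And>v. v \<in> C \<Longrightarrow> unit0 (u v)" shows "hom C u (Var a ^ d) (int d) (u a)"
proof -
  have "Var a ^ d \<bullet> X = (\<lambda>e. X (e - sg a (int d)))" for X by (rule ext) (rule pt_Var_d)
  then show ?thesis unfolding hom_def using BB_shift subs_shift[where u = u and C = C, OF _ assms(2,3)] assms(1) by simp
qed

lemma hom_Cst: "C \<subseteq> V \<Longrightarrow> hom C u (Cst c) 0 c"
  unfolding hom_def by (simp add: pt_Cst BB_sc subs_sc)

lemma hom_mult: "hom C u p D c \<Longrightarrow> hom C u q D' c' \<Longrightarrow> hom C u (p * q) (D + D') (c * c')"
  unfolding hom_def by (simp add: pt_mult algebra_simps)

lemma hom_add: "C \<subseteq> V \<Longrightarrow> hom C u p D c \<Longrightarrow> hom C u q D c' \<Longrightarrow> hom C u (p + q) D (c + c')"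
  unfolding hom_def by (simp add: pt_add BB_add subs_add scale_left_distrib)

lemma hom_0: "hom C u 0 D 0"
  unfolding hom_def by (simp add: poly_times_def)

lemma hom_sum: "C \<subseteq> V \<Longrightarrow> (\<And>k. k \<in> K \<Longrightarrow> hom C u (p k) D (c k)) \<Longrightarrow> hom C u (sum p K) D (sum c K)"
  by (induction K rule: infinite_finite_induct) (auto simp: hom_0 hom_add)

lemma hom_diff: "C \<subseteq> V \<Longrightarrow> hom C u p D c \<Longrightarrow> hom C u q D c' \<Longrightarrow> hom C u (p - q) D (c - c')"
  unfolding hom_def by (simp add: pt_diff BB_diff subs_diff scale_left_diff_distrib)

lemma hom_power: "C \<subseteq> V \<Longrightarrow> hom C u p D c \<Longrightarrow> hom C u (p ^ n) (int n * D) (c ^ n)"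
proof (induction n)
  case 0 then show ?case using hom_Cst[of C u 1] by (simp add: Cst_1)
next
  case (Suc n) then show ?case using hom_mult[of C u p D c "p ^ n" "int n * D" "c ^ n"] by (simp add: algebra_simps)
qed

lemma hom_prod:
  "finite K \<Longrightarrow> C \<subseteq> V \<Longrightarrow> (\<And>k. k \<in> K \<Longrightarrow> \<exists>D. hom C u (p k) D (c k)) \<Longrightarrow> \<exists>D. hom C u (prod p K) D (prod c K)"
proof (induction K rule: finite_induct)
  case empty then show ?case using hom_Cst[of C u 1] by (auto simp: Cst_1)
next
  case (insert k K)
  obtain D where "hom C u (p k) D (c k)" using insert.prems(2)[of k] by auto
  moreover obtain D' where "hom C u (prod p K) D' (prod c K)" using insert.IH insert.prems by auto
  ultimately have "hom C u (p k * prod p K) (D + D') (c k * prod c K)" by (rule hom_mult)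
  then show ?case using insert.hyps by auto
qed

lemma hom_van: "hom C u p D c \<Longrightarrow> c \<noteq> 0 \<Longrightarrow> BB X \<Longrightarrow> van C u (p \<bullet> X) \<Longrightarrow> van C u X"
  unfolding hom_def van_def by (metis sc_eq_0 add_diff_cancel_right')

end

subsection \<open>Wheels and chains\<close>

text \<open>Two systems of variables: B for a short word, embedded by g as the right end of a longer
  word in the variables of A.\<close>

locale current_pair = A: current_order sc s0 co d x i j cA cB \<alpha> \<beta> ne M hasB k1 k2 k3 w Z
   + B: current_order sc s0 co d x i j cA cB \<alpha> \<beta> ne M hasB k1 k2 k3 w0 Z0
  for sc :: "complex fps \<Rightarrow> 'w \<Rightarrow> 'w::ab_group_add"
    and s0 :: "complex \<Rightarrow> 'v \<Rightarrow> 'v::ab_group_add" and co :: "'w \<Rightarrow> nat \<Rightarrow> 'v" and d :: nat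
    and x :: "'i \<Rightarrow> int \<Rightarrow> 'w \<Rightarrow> 'w" and i j :: 'i
    and cA cB :: "complex fps" and \<alpha> \<beta> :: "nat \<Rightarrow> complex fps" and ne M :: nat and hasB :: bool
    and k1 k2 k3 :: "complex fps" and w Z w0 Z0 +
  fixes g :: "nat \<Rightarrow> nat"
  assumes g: "inj g" "g w0 = w" "g ` Z0 \<subseteq> Z"
begin

lemma mem: "v \<in> insert w0 Z0 \<Longrightarrow> (g v \<in> Z \<longleftrightarrow> v \<in> Z0) \<and> (g v = w \<longleftrightarrow> v = w0)"
  using g A.wnZ B.wnZ by (auto simp: inj_eq dest: injD)

lemma LLg: "a \<in> insert w0 Z0 \<Longrightarrow> b \<in> insert w0 Z0 \<Longrightarrow> (g a, c, g b) \<in> A.LL \<longleftrightarrow> (a, c, b) \<in> B.LL"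
  unfolding A.LL_def B.LL_def A.EA_def B.EA_def A.EB_def B.EB_def A.E\<alpha>_def B.E\<alpha>_def A.E\<beta>_def B.E\<beta>_def
  using mem[of a] mem[of b] inj_eq[OF g(1), of a b] by simp

lemma pos_pair:
  assumes "A.order (os @ map g \<tau>)" "B.order \<tau>" "v \<in> insert w0 Z0"
  shows "pos (os @ map g \<tau>) (g v) = length os + pos \<tau> v"
proof -
  have "g v \<notin> set os" using assms by (auto simp: A.order_def B.order_def)
  then show ?thesis using pos_notin pos_map_inj[OF g(1)] by metis
qed

lemma EL_pair:
  assumes o: "A.order (os @ map g \<tau>)" "B.order \<tau>"
  shows "rl g ` B.EL (pos \<tau>) = {(a, c, b) \<in> A.EL (pos (os @ map g \<tau>)). a \<in> g ` insert w0 Z0 \<and> b \<in> g ` insert w0 Z0}"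
proof (rule subset_antisym; rule subsetI)
  fix t assume "t \<in> rl g ` B.EL (pos \<tau>)"
  then obtain a c b where t: "t = (g a, c, g b)" "(a, c, b) \<in> B.EL (pos \<tau>)" by (auto simp: rl_def)
  then have ab: "a \<in> insert w0 Z0" "b \<in> insert w0 Z0" "(a, c, b) \<in> B.LL" "pos \<tau> a < pos \<tau> b"
    using B.LL_V unfolding B.EL_def by blast+
  then show "t \<in> {(a, c, b) \<in> A.EL (pos (os @ map g \<tau>)). a \<in> g ` insert w0 Z0 \<and> b \<in> g ` insert w0 Z0}"
    using LLg pos_pair[OF o] by (auto simp: t A.EL_def)
next
  fix t assume "t \<in> {(a, c, b) \<in> A.EL (pos (os @ map g \<tau>)). a \<in> g ` insert w0 Z0 \<and> b \<in> g ` insert w0 Z0}"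
  then obtain a c b where t: "t = (g a, c, g b)" "a \<in> insert w0 Z0" "b \<in> insert w0 Z0" "(g a, c, g b) \<in> A.EL (pos (os @ map g \<tau>))"
    by auto
  then have "(a, c, b) \<in> B.EL (pos \<tau>)" using LLg pos_pair[OF o] by (simp add: A.EL_def B.EL_def)
  then show "t \<in> rl g ` B.EL (pos \<tau>)" unfolding t(1) rl_def by force
qed

text \<open>The edges inside the image of g rebuild the short \<open>Phi\<close> after renaming; the
  currents of os act on it from the left, and the remaining edges stay as a factor.\<close>

lemma Phi_pair:
  assumes o: "A.order (os @ map g \<tau>)" "B.order \<tau>"
  shows "A.Phi (os @ map g \<tau>) v = poly_times sc (PT d (A.EL (pos (os @ map g \<tau>)) - rl g ` B.EL (pos \<tau>)))
     (\<lambda>e. rc x (A.wd os) (B.Phi \<tau> v (mk g e)) e)"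
proof -
  let ?E = "A.EL (pos (os @ map g \<tau>))" and ?EE = "rl g ` B.EL (pos \<tau>)"
  have sub: "?E \<inter> ?EE = ?EE" unfolding EL_pair[OF o] by auto
  have f0: "finite ?EE" using B.fin_EL by blast
  have wd: "A.wd (map g \<tau>) = map (\<lambda>(a, b). (a, g b)) (B.wd \<tau>)"
    using mem o(2) by (auto simp: A.wd_def B.wd_def B.order_def)
  have "pv (g ` insert w0 Z0) (PT d ?EE)" by (rule pv_PT[OF f0]) (auto simp: EL_pair[OF o])
  moreover have "g ` insert w0 Z0 \<inter> set os = {}" using o unfolding A.order_def B.order_def by auto
  ultimately have bl: "poly_times sc (PT d ?EE) (rc x (A.wd os @ A.wd (map g \<tau>) @ []) v) e =
      rc x (A.wd os) (poly_times sc (PT d ?EE) (rc x (A.wd (map g \<tau>)) (rc x [] v e)) e) e" for e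
    by (intro A.pt_block) (auto simp: A.snd_wd)
  have eq: "rc x (A.wd (map g \<tau>)) v = (\<lambda>e. rc x (B.wd \<tau>) v (mk g e))"
    unfolding wd by (rule ext) (rule rc_rename[OF g(1)])
  have "poly_times sc (PT d ?EE) (rc x (A.wd os @ A.wd (map g \<tau>) @ []) v) = (\<lambda>e. rc x (A.wd os) (B.Phi \<tau> v (mk g e)) e)"
    unfolding bl rc_Nil eq A.PT_rename[OF g(1) B.fin_EL] B.Phi_def by (rule refl)
  then show ?thesis unfolding A.Phi_def PT_split[OF A.fin_EL, of d _ ?EE] sub
    by (simp add: A.pt_mult A.pt_commute[of "PT d ?EE"] A.wd_append)
qed

lemma van_pair:
  assumes o: "A.order (os @ map g \<tau>)" "B.order \<tau>" and v: "B.van (insert w0 Z0) ut (B.Phi \<tau> v)"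
    and u: "\<And>c. c \<in> insert w0 Z0 \<Longrightarrow> u (g c) = ut c" "\<And>c. c \<in> insert w0 Z0 \<Longrightarrow> unit0 (ut c)"
  shows "A.van (g ` insert w0 Z0) u (A.Phi (os @ map g \<tau>) v)"
proof -
  have fin: "finite (insert w0 Z0)" using B.finZ by simp
  have "B.van0 (insert w0 Z0) ut (B.Phi \<tau> v)"
    using v B.subs_sm[OF B.BB_Phi[OF o(2)] subset_refl] by (simp add: B.van0_def B.van_def)
  then have "A.van0 (g ` insert w0 Z0) u (\<lambda>e. rc x (A.wd os) (B.Phi \<tau> v (mk g e)) e)"
  proof (intro A.transfer_van0[OF g(1) fin])
    fix e e' :: expo assume h: "\<And>v. v \<notin> g ` insert w0 Z0 \<Longrightarrow> lk e v = lk e' v"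
    have dj: "g ` insert w0 Z0 \<inter> set os = {}" using o unfolding A.order_def B.order_def by auto
    show "(\<lambda>y. rc x (A.wd os) y e) = (\<lambda>y. rc x (A.wd os) y e')"
    proof (intro ext rc_cong)
      fix b assume "b \<in> snd ` set (A.wd os)"
      then have "b \<notin> g ` insert w0 Z0" using dj unfolding A.snd_wd by blast
      then show "lk e b = lk e' b" by (rule h)
    qed
  qed (auto simp: u A.rc_add A.rc_sc A.zt_rc)
  then have "A.van0 (g ` insert w0 Z0) u (A.Phi (os @ map g \<tau>) v)"
    unfolding Phi_pair[OF o] by (intro A.van0_PT) (use fin u A.fin_EL in auto)
  then show ?thesis by (simp add: A.van0_def A.van_def)
qed

end

context current_order
begin

lemma Phi_any: "order (l1 @ r) \<Longrightarrow> order (l1 @ r') \<Longrightarrow> \<exists>s. (s = 1 \<or> s = -1) \<and> (\<forall>v e. Phi (l1 @ r') v e = sc s (Phi (l1 @ r) v e))"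
proof (induction r arbitrary: l1 r')
  case Nil
  then have "set l1 \<inter> set r' = {}" "set r' \<subseteq> set l1" by (auto simp: order_def)
  then have "r' = []" by (cases r') auto
  then show ?case by auto
next
  case (Cons b r)
  have "length (l1 @ r') = length (l1 @ b # r)" using Cons.prems unfolding order_def by (metis distinct_card)
  then have "r' \<noteq> []" by auto
  then obtain c r2 where r': "r' = c # r2" by (cases r') auto
  show ?case
  proof (cases "c = b")
    case True
    then show ?thesis using Cons.IH[of "l1 @ [b]" r2] Cons.prems r' by simp
  next
    case False
    have "b \<in> insert w Z" "b \<notin> set l1" using Cons.prems(1) by (auto simp: order_def)
    then have "b \<in> set r2" using Cons.prems(2) False r' by (auto simp: order_def)
    then obtain m m2 where r2: "r2 = m @ b # m2" by (meson split_list)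
    have "order (l1 @ b # m @ c # m2)" by (rule order_perm[OF Cons.prems(2)]) (auto simp: r' r2)
    then obtain s where s: "s = 1 \<or> s = -1" "\<forall>v e. Phi (l1 @ b # m @ c # m2) v e = sc s (Phi (l1 @ b # r) v e)"
      using Cons.IH[of "l1 @ [b]" "m @ c # m2"] Cons.prems(1) by auto
    have "Phi (l1 @ r') v e = sc (- s) (Phi (l1 @ b # r) v e)" for v e
      using Phi_exch[of l1 c m b m2] Cons.prems(2) s(2) by (simp add: r' r2)
    then show ?thesis using s(1) by (intro exI[of _ "- s"]) auto
  qed
qed

text \<open>With equal weights at a and b the substituted sum is invariant under exchanging their
  exponents, while \<open>Phi\<close> changes sign. Twice the sum is therefore zero, and there is no
  torsion.\<close>

lemma van_antisym:
  assumes o: "order \<tau>" and ab: "a \<in> Z" "b \<in> Z" "a \<noteq> b" and u: "u a = u b" "unit0 (u b)"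
  shows "van {a, b} u (Phi \<tau> v)"
proof -
  let ?g = "Transposition.transpose a b" and ?t = "mk (Transposition.transpose a b)"
  have wab: "w \<noteq> a" "w \<noteq> b" using ab wnZ by auto
  have gZ: "?g ` Z = Z" using ab by (auto simp: transpose_image_eq)
  have "current_pair_axioms w Z w Z ?g" by unfold_locales (use wab gZ in auto)
  then interpret P: current_pair sc s0 co d x i j cA cB \<alpha> \<beta> ne M hasB k1 k2 k3 w Z w Z ?g
    by (intro current_pair.intro) (rule current_order_axioms)+
  have oo: "order ([] @ map ?g \<tau>)" by (simp, rule order_map[OF o]) (use ab in \<open>simp add: permutes_swap_id\<close>)
  have V: "?g ` insert w Z = insert w Z" using gZ wab by simp
  have "Phi (map ?g \<tau>) v = (\<lambda>e. Phi \<tau> v (?t e))"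
  proof -
    have z: "EL (pos ([] @ map ?g \<tau>)) - rl ?g ` EL (pos \<tau>) = {}"
      unfolding P.EL_pair[OF oo o] V using LL_V unfolding EL_def by blast
    show ?thesis using P.Phi_pair[OF oo o, of v] unfolding z by (simp add: wd_def)
  qed
  then have neg: "Phi \<tau> v (?t e) = - Phi \<tau> v e" for e
    using Phi_transpose[OF o, of a b v e] ab by (metis insertCI)
  have "subs {a, b} u (Phi \<tau> v) \<kappa> n = 0" for \<kappa> n
  proof -
    let ?F = "\<lambda>e. sc (wt u {a, b} e) (Phi \<tau> v e)"
    have lk: "lk (?t e) y = lk e (?g y)" for e y by (rule lookup_map_key) simp
    have tt: "?t (?t e) = e" for e by (rule poly_mapping_eqI) (simp add: lk)
    have m: "?t e \<in> sl {a, b} \<kappa> n" if "e \<in> sl {a, b} \<kappa> n" for e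
      using that ab by (auto simp: sl_def lk esum_def)
    have bij: "bij_betw ?t (sl {a, b} \<kappa> n) (sl {a, b} \<kappa> n)"
      by (rule bij_betwI[of _ _ _ ?t]) (use m tt in auto)
    have sm: "sm ?F (sl {a, b} \<kappa> n)" by (rule subs_sm[OF BB_Phi[OF o]]) (use ab in auto)
    have "?F (?t e) = - ?F e" for e
      using ab by (simp add: neg wt_def lk u(1) mult.commute)
    then have "hsum sc (\<lambda>e. - ?F e) (sl {a, b} \<kappa> n) = hsum sc ?F (sl {a, b} \<kappa> n)"
      using hsum_reindex(2)[OF bij sm] by simp
    then have n: "- hsum sc ?F (sl {a, b} \<kappa> n) = hsum sc ?F (sl {a, b} \<kappa> n)"
      using hsum_uminus[OF sm] by argo
    have "sc 2 y = 0" if "- y = y" for y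
    proof -
      have "sc 2 y = y + y" using scale_left_distrib[of 1 1 y] by simp
      also have "y + y = - y + y" using that by presburger
      finally show ?thesis by simp
    qed
    from this[OF n] have "sc 2 (hsum sc ?F (sl {a, b} \<kappa> n)) = 0" .
    then show ?thesis unfolding subs_def using sc_eq_0 by (metis zero_neq_numeral)
  qed
  then show ?thesis by (simp add: van_def)
qed

text \<open>The Vandermonde product as a set of edges with coefficient 1, which makes the lemmas on
  \<open>PT\<close> applicable.\<close>

definition VE where "VE = (\<lambda>(y, z). (y, 1 :: complex fps, z)) ` {(y, z). y \<in> Z \<and> z \<in> Z \<and> y < z}"

lemma VD_PT: "VD d Z = PT d VE"
  unfolding VD_def PT_def VE_def by (subst prod.reindex) (auto simp: inj_on_def lf_def Cst_1 intro!: prod.cong)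

lemma fin_VE: "finite VE" unfolding VE_def using finite_pairs[OF finZ] by blast

text \<open>The differences are divided out pair by pair. Those already removed do not vanish on the
  next pair, since they involve some other variable.\<close>

lemma psi_ex:
  assumes o: "order \<tau>" shows "\<exists>\<Psi>. BB \<Psi> \<and> Phi \<tau> v = VD d Z \<bullet> \<Psi>"
proof -
  have "T \<subseteq> VE \<Longrightarrow> \<exists>\<Psi>. BB \<Psi> \<and> Phi \<tau> v = PT d T \<bullet> \<Psi>" if "finite T" for T
    using that
  proof (induction T rule: finite_induct)
    case empty then show ?case using BB_Phi[OF o] by auto
  next
    case (insert t T)
    then obtain \<Psi> where P: "BB \<Psi>" "Phi \<tau> v = PT d T \<bullet> \<Psi>" by blast
    obtain y z where t: "t = (y, 1, z)" "y \<in> Z" "z \<in> Z" "y < z" using insert.prems by (auto simp: VE_def)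
    have "van {y, z} (\<lambda>_. 1) (PT d T \<bullet> \<Psi>)"
      using van_antisym[OF o t(2,3), where u = "\<lambda>_. 1" and v = v] t(4) by (simp add: P(2)[symmetric])
    then have "van {y, z} (\<lambda>_. 1) \<Psi>"
    proof (rule van_PT_cancel[OF insert.hyps(1) _ _ P(1), rotated -1])
      fix a c b assume e: "(a, c, b) \<in> T"
      then have ve: "c = 1" "a \<in> Z" "b \<in> Z" "a < b" using insert.prems by (auto simp: VE_def)
      have "\<not> (a \<in> {y, z} \<and> b \<in> {y, z})" using ve e insert.hyps(2) t by auto
      then show "a \<in> insert w Z \<and> b \<in> insert w Z \<and> a \<noteq> b \<and> unit0 c \<and> \<not> (a \<in> {y, z} \<and> b \<in> {y, z} \<and> 1 = c * 1)"
        using ve by auto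
    qed (use t in auto)
    then obtain Y where Y: "BB Y" "\<Psi> = lf d y 1 z \<bullet> Y"
      using van_dvd[of y z "\<lambda>_. 1" \<Psi> 1] P(1) t by auto
    have "Phi \<tau> v = PT d (insert t T) \<bullet> Y"
      unfolding P(2) Y(2) using insert.hyps t by (simp add: PT_insert pt_mult[symmetric] mult.commute)
    then show ?case using Y(1) by blast
  qed
  then show ?thesis using fin_VE by (simp add: VD_PT)
qed

text \<open>Distinct weights on the variables of Z keep every factor of the Vandermonde product from
  vanishing on C, so the product may be inserted or cancelled; a change of order costs only a
  sign.\<close>

lemma van_Psi:
  assumes o: "order \<tau>" "order \<tau>'" and P: "BB \<Psi>" "Phi \<tau> v = VD d Z \<bullet> \<Psi>"
    and C: "C \<subseteq> insert w Z" and u: "\<And>a. unit0 (u a)" "inj_on u (C \<inter> Z)"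
  shows "van C u (Phi \<tau>' v) \<longleftrightarrow> van C u \<Psi>"
proof -
  obtain s where s: "s = 1 \<or> s = -1" "\<And>e. Phi \<tau>' v e = sc s (Phi \<tau> v e)" using Phi_any[of "[]" \<tau> \<tau>'] o by auto
  have s': "Phi \<tau>' v = (\<lambda>e. sc s (Phi \<tau> v e))" using s(2) by blast
  have "van C u (Phi \<tau>' v) \<longleftrightarrow> van C u (Phi \<tau> v)"
  proof
    assume "van C u (Phi \<tau>' v)"
    then have "sc s (subs C u (Phi \<tau> v) \<kappa> n) = 0" for \<kappa> n
      unfolding van_def s' subs_sc[OF BB_Phi[OF o(1)] C] by blast
    then show "van C u (Phi \<tau> v)" unfolding van_def using s(1) sc_eq_0 by (metis neg_equal_0_iff_equal one_neq_zero)
  qed (simp add: van_def s' subs_sc[OF BB_Phi[OF o(1)] C])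
  also have "\<dots> \<longleftrightarrow> van C u \<Psi>"
  proof
    assume "van C u (Phi \<tau> v)"
    then show "van C u \<Psi>" unfolding P(2) VD_PT
    proof (rule van_PT_cancel[OF fin_VE C _ P(1), rotated -1])
      fix a c b assume "(a, c, b) \<in> VE"
      then have "c = 1" "a \<in> Z" "b \<in> Z" "a < b" by (auto simp: VE_def)
      then show "a \<in> insert w Z \<and> b \<in> insert w Z \<and> a \<noteq> b \<and> unit0 c \<and> \<not> (a \<in> C \<and> b \<in> C \<and> u a = c * u b)"
        using u(2) by (auto dest: inj_onD)
    qed (use u in auto)
  next
    assume "van C u \<Psi>"
    then show "van C u (Phi \<tau> v)" unfolding P(2) VD_PT by (intro van_PT[OF fin_VE _ P(1) C]) (use u in auto)
  qed
  finally show ?thesis .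
qed

text \<open>(Q9) is a relation between the six orders of three currents at the right end of a word.
  Only the order y1, y2, y3 respects the path with coefficients cA, cB, so
  \<open>family_extract\<close> gives vanishing at its weights. There the Serre polynomial has the
  value in \<open>serre_ne\<close>, which is cancelled.\<close>

lemma wheel_Psi:
  assumes o: "order \<tau>" and P: "BB \<Psi>" "Phi \<tau> v = VD d Z \<bullet> \<Psi>"
  shows "wheel \<Psi>"
  unfolding wheel_def
proof (intro impI ballI)
  fix y1 y2 y3 assume hB: hasB and y: "y1 \<in> Z" "y2 \<in> Z" "y3 \<in> Z" "y1 \<noteq> y2" "y2 \<noteq> y3" "y1 \<noteq> y3"
  have yw: "y1 \<noteq> w" "y2 \<noteq> w" "y3 \<noteq> w" using y wnZ by auto
  obtain os where os: "set os = insert w Z - {y1, y2, y3}" "distinct os"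
    using finite_distinct_list[of "insert w Z - {y1, y2, y3}"] finZ by auto
  let ?g = "ren [w, y1, y2, y3]"
  have g: "inj ?g" "?g (Suc 0) = y1" "?g 2 = y2" "?g 3 = y3"
    using inj_ren[of "[w, y1, y2, y3]"] y yw by (auto simp: ren_def)
  define I where "I = {\<sigma>. \<sigma> permutes {1..3::nat}}"
  define bl where "bl \<sigma> = [?g (\<sigma> 1), ?g (\<sigma> 2), ?g (\<sigma> 3)]" for \<sigma> :: "nat \<Rightarrow> nat"
  define ta where "ta \<sigma> = os @ bl \<sigma>" for \<sigma> :: "nat \<Rightarrow> nat"
  have set3: "{1..3::nat} = {1, 2, 3}" by auto
  have sbl: "set (bl \<sigma>) = {y1, y2, y3}" "distinct (bl \<sigma>)" if "\<sigma> \<in> I" for \<sigma>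
  proof -
    have "\<sigma> ` {1, 2, 3} = {1, 2, 3}" using permutes_image[of \<sigma> "{1..3}"] that unfolding I_def set3 by simp
    then have "?g ` \<sigma> ` {1, 2, 3} = ?g ` {1, 2, 3}" by simp
    then show "set (bl \<sigma>) = {y1, y2, y3}" using g by (simp add: bl_def)
    then have "card (set (bl \<sigma>)) = length (bl \<sigma>)" using y by (simp add: bl_def)
    then show "distinct (bl \<sigma>)" by (rule card_distinct)
  qed
  have ord: "order (ta \<sigma>)" if "\<sigma> \<in> I" for \<sigma>
    using sbl[OF that] os y by (auto simp: order_def ta_def)
  have idI: "id \<in> I" using permutes_id by (simp add: I_def)
  have bid: "bl id = [y1, y2, y3]" using g by (simp add: bl_def)
  have finI: "finite I" unfolding I_def by (rule finite_permutations) simp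
  have "\<forall>\<sigma>\<in>I. \<exists>s. (s = 1 \<or> s = -1) \<and> (\<forall>e. Phi (ta \<sigma>) v e = sc s (Phi (ta id) v e))"
    using Phi_any[of "[]" "ta id"] ord idI by fastforce
  then obtain s where s: "\<And>\<sigma>. \<sigma> \<in> I \<Longrightarrow> (s \<sigma> = 1 \<or> s \<sigma> = -1) \<and> (\<forall>e. Phi (ta \<sigma>) v e = sc (s \<sigma>) (Phi (ta id) v e))"
    by (metis (no_types, lifting))
  define num where "num \<sigma> = pS d k1 k2 k3 (?g (\<sigma> 1)) (?g (\<sigma> 2)) (?g (\<sigma> 3))" for \<sigma> :: "nat \<Rightarrow> nat"
  have wdta: "wd (ta \<sigma>) = wd os @ [(i, ?g (\<sigma> 1)), (i, ?g (\<sigma> 2)), (i, ?g (\<sigma> 3))] @ []" if "\<sigma> \<in> I" for \<sigma>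
  proof -
    have "w \<notin> set (bl \<sigma>)" using sbl[OF that] yw by auto
    then show ?thesis by (simp add: wd_def ta_def bl_def)
  qed
  have rel: "(\<Sum>\<sigma>\<in>I. (num \<sigma> \<bullet> rc x (wd (ta \<sigma>)) v) e) = 0" for e
  proof -
    let ?b = "\<lambda>\<sigma> :: nat \<Rightarrow> nat. [(i, \<sigma> 1), (i, \<sigma> 2), (i, \<sigma> 3)]"
    have "(num \<sigma> \<bullet> rc x (wd (ta \<sigma>)) v) e =
        rc x (wd os) ((pS d k1 k2 k3 (\<sigma> 1) (\<sigma> 2) (\<sigma> 3) \<bullet> rc x (?b \<sigma>) v) (mk ?g e)) e" if "\<sigma> \<in> I" for \<sigma>
    proof -
      have "pv {y1, y2, y3} (num \<sigma>)" unfolding num_def pS_def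
        by (intro pv_add pv_diff pv_mult pv_Cst pv_Var) (use sbl(1)[OF that] in \<open>auto simp: bl_def\<close>)
      then have "(num \<sigma> \<bullet> rc x (wd (ta \<sigma>)) v) e =
          rc x (wd os) ((num \<sigma> \<bullet> rc x [(i, ?g (\<sigma> 1)), (i, ?g (\<sigma> 2)), (i, ?g (\<sigma> 3))] v) e) e"
        unfolding wdta[OF that] by (subst pt_block) (use os in \<open>auto simp: snd_wd\<close>)
      moreover have "rc x [(i, ?g (\<sigma> 1)), (i, ?g (\<sigma> 2)), (i, ?g (\<sigma> 3))] v = (\<lambda>e. rc x (?b \<sigma>) v (mk ?g e))"
        using rc_rename[OF g(1), of x "?b \<sigma>" v] by auto
      moreover have "(num \<sigma> \<bullet> (\<lambda>e. X (mk ?g e))) e =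
          (pS d k1 k2 k3 (\<sigma> 1) (\<sigma> 2) (\<sigma> 3) \<bullet> X) (mk ?g e)" for X
        by (simp add: num_def pS_def pt_add pt_diff pt_mult pt_Cst pt_Var_d map_key_minus_sg[OF g(1)])
      ultimately show ?thesis by simp
    qed
    then have "(\<Sum>\<sigma>\<in>I. (num \<sigma> \<bullet> rc x (wd (ta \<sigma>)) v) e) =
        rc x (wd os) (\<Sum>\<sigma>\<in>I. (pS d k1 k2 k3 (\<sigma> 1) (\<sigma> 2) (\<sigma> 3) \<bullet> rc x (?b \<sigma>) v) (mk ?g e)) e"
      by (simp add: rc_sum)
    then show ?thesis using serre[OF hB] by (simp add: I_def)
  qed
  \<comment> \<open>The weights of the path with coefficients cA, cB, ending in 1. The closing edge
    from y3 to y1 has coefficient cB, as cB * (cA * cB) = 1.\<close>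
  define u where "u a = (if a = y1 then cA * cB else if a = y2 then cB else 1)" for a
  have uy: "u y1 = cA * cB" "u y2 = cB" "u y3 = 1" using y by (auto simp: u_def)
  have uu: "unit0 (u a)" for a using cA cB by (simp add: u_def)
  have nz: "cA \<noteq> 0" "cB \<noteq> 0" using cA cB by auto
  have c2: "cA * cA \<noteq> 1" using cBA[of 0 2] by (auto simp: power2_eq_square)
  have hc: "hom {y1, y2, y3} u (num id * Cst (s id)) (int d + 0) ((k1 * u y1 - k2 * u y2 + k3 * u y3) * s id)"
  proof -
    have C: "{y1, y2, y3} \<subseteq> insert w Z" using y by auto
    have "hom {y1, y2, y3} u (Cst k * Var a ^ d) (int d) (k * u a)" if "a \<in> {y1, y2, y3}" for k a
      using hom_mult[OF hom_Cst[OF C] hom_Var[OF that C]] uu by simp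
    then show ?thesis unfolding num_def pS_def using g C
      by (intro hom_mult hom_add hom_diff hom_Cst) auto
  qed
  have BBn: "BB ((num id * Cst (s id)) \<bullet> Phi (ta id) v)" using hc BB_Phi[OF ord[OF idI]] unfolding hom_def by blast
  have LLc: "c = cA \<or> c = cB" if "(a, c, b) \<in> LL" "a \<in> {y1, y2, y3}" "b \<in> {y1, y2, y3}" for a c b
    using that yw by (auto simp: LL_def EA_def EB_def E\<alpha>_def E\<beta>_def)
  have post: "pos (ta \<sigma>) a = length os + pos (bl \<sigma>) a" if "a \<in> {y1, y2, y3}" for \<sigma> a
    unfolding ta_def by (rule pos_notin) (use that os in auto)
  have pid: "pos (ta id) y1 = length os" "pos (ta id) y2 = length os + 1" "pos (ta id) y3 = length os + 2"
    using y by (auto simp: post bid) (auto simp: pos_def)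
  have "van (set [y1, y2, y3]) u ((num id * Cst (s id)) \<bullet> Phi (ta id) v)"
  proof (rule family_extract[where cs = "[cA, cB]" and cf = cB, OF finI idI])
    show "FDp (pos (ta \<sigma>)) (rc x (wd (ta \<sigma>)) v)" if "\<sigma> \<in> I" for \<sigma> by (rule FDp_rc[OF ord[OF that]])
    show "PT d (EL (pos (ta \<sigma>))) \<bullet> rc x (wd (ta \<sigma>)) v = Cst (s \<sigma>) \<bullet> Phi (ta id) v" if "\<sigma> \<in> I" for \<sigma>
      using s[OF that] by (auto simp: pt_Cst Phi_def[of "ta \<sigma>", symmetric])
    show "\<exists>k<length [cA, cB]. \<not> pos (ta \<sigma>) ([y1, y2, y3] ! k) < pos (ta \<sigma>) ([y1, y2, y3] ! Suc k)" if "\<sigma> \<in> I" "\<sigma> \<noteq> id" for \<sigma>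
    proof (rule ccontr)
      assume c: "\<not> ?thesis"
      have "pos (ta \<sigma>) y1 < pos (ta \<sigma>) y2" "pos (ta \<sigma>) y2 < pos (ta \<sigma>) y3"
        using c[simplified, rule_format, of 0] c[simplified, rule_format, of 1] by auto
      then have "[y1, y2, y3] = bl \<sigma>" by (intro sorted_pos_unique) (auto simp: sbl[OF that(1)] post)
      then have "?g (\<sigma> 1) = ?g 1" "?g (\<sigma> 2) = ?g 2" "?g (\<sigma> 3) = ?g 3" using g by (simp_all add: bl_def)
      then have "\<sigma> 1 = 1" "\<sigma> 2 = 2" "\<sigma> 3 = 3" using g(1) by (simp_all add: inj_eq)
      moreover have "\<sigma> permutes {1, 2, 3}" using that(1) unfolding I_def set3 by simp
      ultimately have "\<sigma> k = k" for k by (cases "k \<in> {1, 2, 3}") (auto dest: permutes_not_in)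
      then show False using that(2) by auto
    qed
    show "u a \<noteq> c * u b"
      if e: "(a, c, b) \<in> LL" and a: "a \<in> set [y1, y2, y3]" and b: "b \<in> set [y1, y2, y3]"
        and n: "\<not> pos (ta id) a < pos (ta id) b" "(a, c, b) \<noteq> (last [y1, y2, y3], cB, hd [y1, y2, y3])" for a c b
    proof
      assume eq: "u a = c * u b"
      have c: "c = cA \<or> c = cB" using LLc e a b by simp
      have "a \<noteq> b" using LL_V[OF e] by simp
      then consider "a = y2" "b = y1" | "a = y3" "b = y1" | "a = y3" "b = y2" using a b n(1) pid by auto
      then show False
      proof cases
        case 1
        then have "1 * cB = (c * cA) * cB" using eq uy by (simp add: mult_ac)
        then have "c * cA = 1" using nz by (metis mult_right_cancel)
        then show False using c c2 cB_cA[of 1] by auto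
      next
        case 2
        then have "c = cA" using c n(2) by auto
        then show False using eq uy 2 cB_cA[of 2] by (simp add: power2_eq_square mult_ac)
      next
        case 3
        then have "1 = c * cB" using eq uy by simp
        then show False using c cB_cA[of 1] cBA[of 2 0] by (auto simp: power2_eq_square mult_ac)
      qed
    qed
    show "u a = c * u b" if "(a, c, b) \<in> pedges [y1, y2, y3] [cA, cB]" for a c b
      using that uy by auto
    show "BB (Phi (ta id) v)" by (rule BB_Phi[OF ord[OF idI]])
    show "BB ((num id * Cst (s id)) \<bullet> Phi (ta id) v)" by (rule BBn)
    show "pedges [y1, y2, y3] [cA, cB] \<subseteq> LL" using y hB unfolding LL_def EA_def EB_def by auto
  qed (use y pid uu rel in auto)
  then have "van {y1, y2, y3} u ((num id * Cst (s id)) \<bullet> Phi (ta id) v)" by simp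
  moreover have "(k1 * u y1 - k2 * u y2 + k3 * u y3) * s id \<noteq> 0" using serre_ne[OF hB] s[OF idI] uy by auto
  ultimately have "van {y1, y2, y3} u (Phi (ta id) v)" using hom_van[OF hc] BB_Phi[OF ord[OF idI]] by blast
  moreover have "inj_on u {y1, y2, y3}"
  proof -
    have "cA * cB \<noteq> cB" using nz cBA[of 0 1] by (metis mult_cancel_right1 mult_zero_left numeral_eq_one_iff one_neq_zero power_0 power_one_right mult_1 nat_mult_1_right zero_neq_numeral)
    moreover have "cA * cB \<noteq> 1" using cB_cA[of 1] by (simp add: mult.commute)
    moreover have "cB \<noteq> 1" using cB_cA[of 0] by simp
    ultimately show ?thesis using y by (auto simp: inj_on_def uy)
  qed
  ultimately have "van {y1, y2, y3} u \<Psi>"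
    using van_Psi[OF o ord[OF idI] P, of "{y1, y2, y3}" u] y uu by (auto simp: Int_absorb2)
  then have "Id ((\<lambda>b. (b, u b * inverse (u y3), y3)) ` ({y1, y2, y3} - {y3})) \<Psi>"
    by (rule van_Id[OF _ P(1)]) (use y uu in auto)
  moreover have "{y1, y2, y3} - {y3} = {y1, y2}" using y by auto
  ultimately show "Id {(y1, cA * cB, y3), (y2, cB, y3)} \<Psi>" by (simp add: uy)
qed

end

text \<open>The edges of the model word with currents x_i in the variables 0, ..., M - 1 and x_j in
  the variable M, the word whose normally ordered product occurs in the theorem.\<close>

definition (in current_module) std_E :: "(nat \<times> complex fps \<times> nat) set" where
  "std_E = {(a, c, b). a < b \<and> b < M \<and> (c = cA \<or> hasB \<and> c = cB)} \<union> {(a, c, b). a < M \<and> b = M \<and> c \<in> \<alpha> ` {..<ne}}"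

definition (in current_module) std_Phi :: "'w \<Rightarrow> expo \<Rightarrow> 'w" where
  "std_Phi v = PT d std_E \<bullet> rc x (map (\<lambda>t. (if t = M then j else i, t)) [0..<Suc M]) v"

text \<open>The values of z_t^d on the chain when the variable M is set to 1. The permutation \<rho>
  adapts the order of the chain to that of the exponents of q_i in the normally ordered
  product.\<close>

definition (in current_module) std_u :: "(nat \<Rightarrow> nat) \<Rightarrow> nat \<Rightarrow> nat \<Rightarrow> complex fps" where
  "std_u \<rho> l t = (if t < M then cA ^ (M - 1 - \<rho> t) * \<alpha> l else 1)"

context current_order
begin

lemma std_order: "current_order sc s0 co d x i j cA cB \<alpha> \<beta> ne M hasB k1 k2 k3 M {..<M}"
  by unfold_locales auto

lemma std_Phi_eq: "current_order.Phi sc d x i j cA cB \<alpha> \<beta> ne hasB M {..<M} [0..<Suc M] v = std_Phi v"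
proof -
  interpret S: current_order sc s0 co d x i j cA cB \<alpha> \<beta> ne M hasB k1 k2 k3 M "{..<M}" by (rule std_order)
  have p: "pos [0..<Suc M] t = t" if "t \<le> M" for t using pos_nth[of "[0..<Suc M]" t] that by (simp del: upt_Suc)
  have "t \<in> S.EL (pos [0..<Suc M]) \<longleftrightarrow> t \<in> std_E" for t
  proof -
    obtain a c b where t: "t = (a, c, b)" by (cases t)
    show ?thesis
    proof (cases "a \<le> M \<and> b \<le> M")
      case True
      then show ?thesis unfolding t S.EL_def std_E_def S.LL_def S.EA_def S.EB_def S.E\<alpha>_def S.E\<beta>_def
        using p[of a] p[of b] by auto
    next
      case False
      then have "t \<notin> std_E" by (auto simp: t std_E_def)
      moreover have "t \<notin> S.EL (pos [0..<Suc M])" using False S.LL_V[of a c b] by (auto simp: t S.EL_def)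
      ultimately show ?thesis by blast
    qed
  qed
  then have "S.EL (pos [0..<Suc M]) = std_E" by blast
  then show ?thesis unfolding S.Phi_def std_Phi_def S.wd_def by simp
qed

lemma std_u_unit: "unit0 (std_u \<rho> l t)"
  using cA \<alpha> by (simp add: std_u_def)

text \<open>The model word, renamed and placed at the right end of a word in all variables, carries
  its vanishing over by \<open>van_pair\<close>. The weights on a chain are distinct, so it passes
  to \<Psi>, and \<open>van_Id\<close> with centre w gives the ideal.\<close>

lemma chain_Psi:
  assumes o: "order \<tau>" and P: "BB \<Psi>" "Phi \<tau> v = VD d Z \<bullet> \<Psi>" and rho: "\<rho> permutes {..<M}"
    and std: "\<And>l v. l < ne \<Longrightarrow> van {..M} (std_u \<rho> l) (std_Phi v)"
  shows "chain \<Psi>"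
  unfolding chain_def
proof (intro allI impI)
  fix bs l assume bs: "inj_on bs {..<M}" "bs ` {..<M} \<subseteq> Z" and l: "l < ne"
  interpret S: current_order sc s0 co d x i j cA cB \<alpha> \<beta> ne M hasB k1 k2 k3 M "{..<M}" by (rule std_order)
  \<comment> \<open>The model variable t goes to bs (\<rho> t), so that its weight becomes cA ^ (M -
    1 - s) * \<alpha> l at bs s.\<close>
  define labs where "labs = map (\<lambda>t. bs (\<rho> t)) [0..<M] @ [w]"
  have rr: "\<rho> ` {..<M} = {..<M}" by (rule permutes_image[OF rho])
  have "inj_on (bs \<circ> \<rho>) {..<M}" by (rule comp_inj_on) (use bs rr permutes_inj_on[OF rho] in auto)
  then have dl: "distinct labs" using bs rr wnZ by (auto simp: labs_def distinct_map o_def lessThan_atLeast0)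
  let ?g = "ren labs"
  have gM: "?g M = w" by (simp add: ren_def labs_def nth_append)
  have gt: "?g t = bs (\<rho> t)" if "t < M" for t using that by (simp add: ren_def labs_def nth_append)
  have "bs (\<rho> t) \<in> Z" if "t < M" for t using bs(2) rr that by blast
  then have gZ: "?g ` {..<M} \<subseteq> Z" using gt by auto
  have "current_pair_axioms w Z M {..<M} ?g" by unfold_locales (use inj_ren[OF dl] gM gZ in auto)
  then interpret P: current_pair sc s0 co d x i j cA cB \<alpha> \<beta> ne M hasB k1 k2 k3 w Z M "{..<M}" ?g
    by (intro current_pair.intro current_order_axioms S.current_order_axioms)
  obtain os where os: "set os = insert w Z - ?g ` insert M {..<M}" "distinct os"
    using finite_distinct_list[of "insert w Z - ?g ` insert M {..<M}"] finZ by auto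
  have So: "S.order [0..<Suc M]" by (auto simp: S.order_def)
  have oo: "order (os @ map ?g [0..<Suc M])"
  proof -
    have i: "inj_on ?g A" for A using inj_ren[OF dl] by (meson inj_on_subset subset_UNIV)
    have "set [0..<Suc M] = insert M {..<M}" by auto
    then have sm: "set (map ?g [0..<Suc M]) = ?g ` insert M {..<M}" unfolding set_map by simp
    have "?g ` insert M {..<M} \<subseteq> insert w Z" using gZ gM by auto
    then show ?thesis unfolding order_def distinct_append set_append sm using os i
      by (auto simp: distinct_map simp del: upt_Suc)
  qed
  define u where "u a = (if a \<in> bs ` {..<M} then cA ^ (M - 1 - the_inv_into {..<M} bs a) * \<alpha> l else 1)" for a
  have ub: "u (bs t) = cA ^ (M - 1 - t) * \<alpha> l" if "t < M" for t
    using that the_inv_into_f_f[OF bs(1), of t] by (simp add: u_def)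
  have uw: "u w = 1" using bs(2) wnZ by (auto simp: u_def)
  have uu: "unit0 (u a)" for a using cA \<alpha> by (simp add: u_def)
  have eM: "insert M {..<M} = {..M}" by auto
  have "van (?g ` insert M {..<M}) u (Phi (os @ map ?g [0..<Suc M]) v)"
  proof (rule P.van_pair[OF oo So, where ut = "std_u \<rho> l"])
    show "van (insert M {..<M}) (std_u \<rho> l) (S.Phi [0..<Suc M] v)" unfolding std_Phi_eq eM by (rule std[OF l])
    show "u (?g c) = std_u \<rho> l c" if "c \<in> insert M {..<M}" for c
    proof (cases "c = M")
      case False
      then have "c < M" "\<rho> c < M" using that rr by auto
      then show ?thesis using gt ub by (simp add: std_u_def)
    qed (simp add: gM uw std_u_def)
  qed (rule std_u_unit)
  moreover have gV: "?g ` insert M {..<M} = insert w (bs ` {..<M})"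
  proof -
    have "?g ` {..<M} = bs ` \<rho> ` {..<M}" unfolding image_image using gt by (intro image_cong) auto
    then show ?thesis using gM rr by simp
  qed
  moreover have "inj_on u (insert w (bs ` {..<M}) \<inter> Z)"
  proof -
    have "t = t'" if "t < M" "t' < M" "u (bs t) = u (bs t')" for t t'
    proof -
      have "\<alpha> l \<noteq> 0" using \<alpha>[of l] by auto
      then have "cA ^ (M - 1 - t) = cA ^ (M - 1 - t')" using ub that by (metis mult_right_cancel)
      then have "M - 1 - t = M - 1 - t'" by (rule cA_pow_inj)
      then show ?thesis using that by simp
    qed
    moreover have "insert w (bs ` {..<M}) \<inter> Z = bs ` {..<M}" using bs(2) wnZ by auto
    ultimately show ?thesis by (auto simp: inj_on_def)
  qed
  moreover have C: "insert w (bs ` {..<M}) \<subseteq> insert w Z" using bs(2) by auto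
  ultimately have vp: "van (insert w (bs ` {..<M})) u \<Psi>"
    using van_Psi[OF o oo P C uu] by simp
  have wb: "insert w (bs ` {..<M}) - {w} = bs ` {..<M}" using bs(2) wnZ by auto
  have "Id ((\<lambda>b. (b, u b * inverse (u w), w)) ` (insert w (bs ` {..<M}) - {w})) \<Psi>"
    by (rule van_Id[OF vp P(1) C]) (use bs(2) uu in auto)
  then show "Id ((\<lambda>t. (bs t, cA ^ (M - 1 - t) * \<alpha> l, w)) ` {..<M}) \<Psi>"
    unfolding wb image_image by (simp add: ub uw cong: image_cong_simp)
qed

end

subsection \<open>The currents $D_{ij}$\<close>

lemma Cst_of_int: "Cst (of_int k) = of_int k"
proof (cases k rule: int_cases2)
  case (nonneg n)
  have "Cst (of_nat n) = of_nat n" by (induction n) (simp_all add: Cst_add Cst_1 Cst_0)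
  then show ?thesis using nonneg by simp
next
  case (nonpos n)
  have "Cst (of_nat n) = of_nat n" by (induction n) (simp_all add: Cst_add Cst_1 Cst_0)
  then show ?thesis using nonpos by (simp add: Cst_uminus)
qed

lemma PT_UN:
  assumes "finite K" "\<And>k. k \<in> K \<Longrightarrow> finite (S k)" "\<And>k k'. k \<in> K \<Longrightarrow> k' \<in> K \<Longrightarrow> k \<noteq> k' \<Longrightarrow> S k \<inter> S k' = {}"
  shows "PT d (\<Union>k\<in>K. S k) = (\<Prod>k\<in>K. PT d (S k))"
  unfolding PT_def using assms by (intro prod.UNION_disjoint) auto

text \<open>The order of factors in the r-th summand of D before permutation, where 0 is the
  variable of x_j.\<close>

definition base :: "nat \<Rightarrow> nat \<Rightarrow> nat list" where
  "base m r = [1..<Suc r] @ [0] @ [Suc r..<Suc m]"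

lemma base_props: "r \<le> m \<Longrightarrow> distinct (base m r)" "r \<le> m \<Longrightarrow> set (base m r) = insert 0 {1..m}"
  "r \<le> m \<Longrightarrow> length (base m r) = Suc m"
  by (auto simp: base_def)

lemma base_nth: "r \<le> m \<Longrightarrow> k \<le> m \<Longrightarrow> base m r ! k = (if k < r then Suc k else if k = r then 0 else k)"
  by (auto simp: base_def nth_append simp del: upt_Suc)

lemma pos_base: "r \<le> m \<Longrightarrow> a \<le> m \<Longrightarrow> pos (base m r) a = (if a = 0 then r else if a \<le> r then a - 1 else a)"
proof -
  assume r: "r \<le> m" "a \<le> m"
  define k where "k = (if a = 0 then r else if a \<le> r then a - 1 else a)"
  have k: "k \<le> m" "base m r ! k = a" using r base_nth[of r m k] by (auto simp: k_def split: if_splits)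
  then have "pos (base m r) (base m r ! k) = k" using r by (intro pos_nth) (auto simp: base_props)
  then show ?thesis unfolding k(2) by (simp add: k_def)
qed

text \<open>Up to sign, G is the product of the forms of the reversed edges. This is why P can be
  assembled from the edges that an order lacks.\<close>

locale current_main = current_order sc s0 co d x i j cA cB \<alpha> \<beta> ne M hasB k1 k2 k3 0 Z
  for sc :: "complex fps \<Rightarrow> 'w \<Rightarrow> 'w::ab_group_add"
    and s0 :: "complex \<Rightarrow> 'v \<Rightarrow> 'v::ab_group_add" and co :: "'w \<Rightarrow> nat \<Rightarrow> 'v" and d :: nat
    and x :: "'i \<Rightarrow> int \<Rightarrow> 'w \<Rightarrow> 'w" and i j :: 'i
    and cA cB :: "complex fps" and \<alpha> \<beta> :: "nat \<Rightarrow> complex fps" and ne M :: nat and hasB :: bool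
    and k1 k2 k3 :: "complex fps" and Z :: "nat set" +
  fixes m :: nat and Gii Gij Fij ff :: "nat \<Rightarrow> nat \<Rightarrow> lpoly" and Bc :: "nat \<Rightarrow> complex fps"
  assumes Zm: "Z = {1..m}"
    and Gii: "\<And>a b. a \<noteq> b \<Longrightarrow> Gii a b = - PT d (insert (b, cA, a) (if hasB then {(b, cB, a)} else {}))"
    and Gij: "\<And>a b. a \<noteq> b \<Longrightarrow> Gij a b = - PT d ((\<lambda>l. (b, \<beta> l, a)) ` {..<ne})"
    and Fij: "\<And>a b. a \<noteq> b \<Longrightarrow> Fij a b = PT d ((\<lambda>l. (a, \<alpha> l, b)) ` {..<ne})"
    and P0: "(\<Sum>\<sigma> | \<sigma> permutes {1..m}. of_int (sign \<sigma>) *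
       (\<Sum>r=0..m. (-1) ^ r * Cst (Bc r) *
          (\<Prod>(a, b)\<in>{(a, b). 1 \<le> a \<and> a < b \<and> b \<le> m}. ff (\<sigma> a) (\<sigma> b) * Gii (\<sigma> a) (\<sigma> b)) *
          (\<Prod>a=1..r. Gij (\<sigma> a) 0) * (\<Prod>b=r+1..m. Fij (\<sigma> b) 0))) = 0"
begin

definition PP :: "(nat \<times> nat) set" where "PP = {(a, b). 1 \<le> a \<and> a < b \<and> b \<le> m}"
definition II :: "((nat \<Rightarrow> nat) \<times> nat) set" where "II = {\<sigma>. \<sigma> permutes {1..m}} \<times> {0..m}"
definition ta :: "(nat \<Rightarrow> nat) \<times> nat \<Rightarrow> nat list" where "ta = (\<lambda>(\<sigma>, r). map \<sigma> (base m r))"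
definition sn :: "(nat \<Rightarrow> nat) \<times> nat \<Rightarrow> complex fps" where "sn = (\<lambda>(\<sigma>, r). of_int (sign \<sigma> * (-1) ^ r))"
definition nm :: "(nat \<Rightarrow> nat) \<times> nat \<Rightarrow> lpoly" where
  "nm = (\<lambda>(\<sigma>, r). (\<Prod>(a, b)\<in>PP. ff (\<sigma> a) (\<sigma> b)) * Cst ((-1) ^ r * Bc r))"
definition Dd :: "'w \<Rightarrow> expo \<Rightarrow> 'w" where
  "Dd v e = (\<Sum>\<iota>\<in>II. (nm \<iota> \<bullet> rc x (wd (ta \<iota>)) v) e)"

lemma fin_PP: "finite PP"
  unfolding PP_def by (rule finite_subset[of _ "{..m} \<times> {..m}"]) auto

lemma fin_II: "finite II" unfolding II_def by (intro finite_cartesian_product finite_permutations) auto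

lemma IID:
  assumes "(\<sigma>, r) \<in> II"
  shows "\<sigma> permutes {1..m}" "\<sigma> permutes insert 0 Z" "r \<le> m" "inj \<sigma>" "\<sigma> 0 = 0"
  using assms by (auto simp: II_def Zm permutes_not_in permutes_inj intro: permutes_subset)

lemma order_base: "r \<le> m \<Longrightarrow> order (base m r)"
  unfolding order_def by (simp only: base_props Zm simp_thms)

lemma order_ta: "\<iota> \<in> II \<Longrightarrow> order (ta \<iota>)"
proof (cases \<iota>)
  case (Pair \<sigma> r)
  assume "\<iota> \<in> II"
  then have "\<sigma> permutes insert 0 Z" "r \<le> m" unfolding Pair using IID[of \<sigma> r] by blast+
  then show ?thesis unfolding Pair ta_def prod.case by (intro order_map order_base)
qed

text \<open>Passing x_j over one current is an adjacent exchange and contributes one sign.\<close>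

lemma Phi_base: "r \<le> m \<Longrightarrow> Phi (base m r) v e = sc ((-1) ^ r) (Phi (base m 0) v e)"
proof (induction r)
  case (Suc r)
  have eq: "base m r = [1..<Suc r] @ 0 # Suc r # [Suc (Suc r)..<Suc m]"
    "base m (Suc r) = [1..<Suc r] @ Suc r # 0 # [Suc (Suc r)..<Suc m]"
    using Suc.prems upt_conv_Cons[of "Suc r" "Suc m"] by (auto simp: base_def simp del: upt_Suc) simp
  have "Phi (base m r) v e = - Phi (base m (Suc r)) v e"
    using Phi_swap[of "[1..<Suc r]" 0 "Suc r" "[Suc (Suc r)..<Suc m]" v e] order_base[of r] Suc.prems unfolding eq by simp
  then have "Phi (base m (Suc r)) v e = - Phi (base m r) v e" by simp
  then show ?case using Suc by simp
qed simp

lemma Phi_ta: "\<iota> \<in> II \<Longrightarrow> Phi (ta \<iota>) v e = sc (sn \<iota>) (Phi (base m 0) v e)"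
proof (cases \<iota>)
  case (Pair \<sigma> r)
  assume "\<iota> \<in> II"
  then have s: "\<sigma> permutes insert 0 Z" "r \<le> m" unfolding Pair using IID[of \<sigma> r] by blast+
  show ?thesis using Phi_perm[OF s(1) order_base[OF s(2)], of v e] Phi_base[OF s(2), of v e]
    by (simp add: Pair ta_def sn_def)
qed

lemma pos_ta: "(\<sigma>, r) \<in> II \<Longrightarrow> a \<le> m \<Longrightarrow> pos (ta (\<sigma>, r)) (\<sigma> a) = (if a = 0 then r else if a \<le> r then a - 1 else a)"
proof -
  assume a: "(\<sigma>, r) \<in> II" "a \<le> m"
  show ?thesis using pos_map_inj[OF IID(4)[OF a(1)], of "base m r" a] pos_base[OF IID(3)[OF a(1)] a(2)] by (simp add: ta_def)
qed

lemma pairE_eq: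
  "a \<in> Z \<Longrightarrow> b \<in> Z \<Longrightarrow> a \<noteq> b \<Longrightarrow> pairE a b = insert (a, cA, b) (if hasB then {(a, cB, b)} else {})"
  "a \<in> Z \<Longrightarrow> pairE a 0 = (\<lambda>l. (a, \<alpha> l, 0)) ` {..<ne}"
  "a \<in> Z \<Longrightarrow> pairE 0 a = (\<lambda>l. (0, \<beta> l, a)) ` {..<ne}"
  unfolding pairE_def LL_def EA_def EB_def E\<alpha>_def E\<beta>_def using wnZ by auto

lemma fin_pairE: "finite (pairE a b)" unfolding pairE_def by (rule finite_subset[OF _ fin_LL]) auto

text \<open>An edge absent from the order joins two currents x_i against the order, or leads from 0
  to one of the r currents on its left, or to 0 from a current on its right. These three kinds make
  up the factors G_ii, G_ij and F_ij of P.\<close>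

lemma compl_EL:
  assumes \<iota>: "(\<sigma>, r) \<in> II"
  shows "PT d (LL - EL (pos (ta (\<sigma>, r)))) =
    (\<Prod>(a, b)\<in>PP. - Gii (\<sigma> a) (\<sigma> b)) * (\<Prod>a=1..r. - Gij (\<sigma> a) 0) * (\<Prod>b=r+1..m. Fij (\<sigma> b) 0)"
proof -
  note s = IID[OF \<iota>]
  let ?K1 = "\<Union>p\<in>PP. pairE (\<sigma> (snd p)) (\<sigma> (fst p))" and ?K2 = "\<Union>a\<in>{1..r}. pairE 0 (\<sigma> a)"
    and ?K3 = "\<Union>b\<in>{r+1..m}. pairE (\<sigma> b) 0"
  have s1: "\<sigma> a \<in> Z \<longleftrightarrow> a \<in> Z" for a unfolding Zm using permutes_in_image[OF s(1)] .
  have s0: "\<sigma> a = 0 \<longleftrightarrow> a = 0" for a using s(4,5) by (metis injD)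
  have eq: "LL - EL (pos (ta (\<sigma>, r))) = ?K1 \<union> (?K2 \<union> ?K3)"
  proof (rule subset_antisym; rule subsetI)
    fix t assume t: "t \<in> LL - EL (pos (ta (\<sigma>, r)))"
    obtain a' c b' where t': "t = (a', c, b')" by (cases t)
    have ab': "a' \<in> insert 0 Z" "b' \<in> insert 0 Z" "a' \<noteq> b'" using t LL_V[of a' c b'] unfolding t' by blast+
    then obtain a b where ab: "a' = \<sigma> a" "b' = \<sigma> b" "a \<in> insert 0 Z" "b \<in> insert 0 Z"
      using permutes_image[OF s(2)] by (metis imageE)
    have L: "(\<sigma> a, c, \<sigma> b) \<in> LL" "\<not> pos (ta (\<sigma>, r)) (\<sigma> a) < pos (ta (\<sigma>, r)) (\<sigma> b)"
      using t by (auto simp: t' ab EL_def)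
    have np: "a \<noteq> b" using ab ab' by auto
    have m: "a \<le> m" "b \<le> m" using ab by (auto simp: Zm)
    have "t \<in> pairE (\<sigma> a) (\<sigma> b)" using L by (simp add: t' ab pairE_def)
    consider "(b, a) \<in> PP" | "a = 0" "b \<in> {1..r}" | "b = 0" "a \<in> {r+1..m}"
      using L(2) np m unfolding pos_ta[OF \<iota> m(1)] pos_ta[OF \<iota> m(2)] PP_def by (fastforce split: if_splits)
    then show "t \<in> ?K1 \<union> (?K2 \<union> ?K3)"
    proof cases
      case 1 then show ?thesis using \<open>t \<in> pairE (\<sigma> a) (\<sigma> b)\<close> by force
    next
      case 2 then show ?thesis using \<open>t \<in> pairE (\<sigma> a) (\<sigma> b)\<close> s(5) by auto
    next
      case 3 then show ?thesis using \<open>t \<in> pairE (\<sigma> a) (\<sigma> b)\<close> s(5) by auto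
    qed
  next
    fix t assume t: "t \<in> ?K1 \<union> (?K2 \<union> ?K3)"
    have "\<exists>a b. t \<in> pairE (\<sigma> a) (\<sigma> b) \<and> a \<le> m \<and> b \<le> m \<and> ((b, a) \<in> PP \<or> a = 0 \<and> b \<in> {1..r} \<or> b = 0 \<and> a \<in> {r+1..m})"
    proof -
      consider (1) p where "p \<in> PP" "t \<in> pairE (\<sigma> (snd p)) (\<sigma> (fst p))" | (2) a where "a \<in> {1..r}" "t \<in> pairE 0 (\<sigma> a)"
        | (3) b where "b \<in> {r+1..m}" "t \<in> pairE (\<sigma> b) 0" using t by blast
      then show ?thesis
      proof cases
        case 1 then show ?thesis by (intro exI[of _ "snd p"] exI[of _ "fst p"]) (auto simp: PP_def)
      next
        case 2 then show ?thesis using s(3,5) by (intro exI[of _ 0] exI[of _ a]) auto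
      next
        case 3 then show ?thesis using s(5) by (intro exI[of _ b] exI[of _ 0]) auto
      qed
    qed
    then obtain a b where ab: "t \<in> pairE (\<sigma> a) (\<sigma> b)" "a \<le> m" "b \<le> m" "(b, a) \<in> PP \<or> a = 0 \<and> b \<in> {1..r} \<or> b = 0 \<and> a \<in> {r+1..m}"
      by blast
    have "\<not> pos (ta (\<sigma>, r)) (\<sigma> a) < pos (ta (\<sigma>, r)) (\<sigma> b)"
      unfolding pos_ta[OF \<iota> ab(2)] pos_ta[OF \<iota> ab(3)] using ab(4) by (auto simp: PP_def)
    then show "t \<in> LL - EL (pos (ta (\<sigma>, r)))" using ab(1) by (auto simp: pairE_def EL_def)
  qed
  have dj: "?K1 \<inter> (?K2 \<union> ?K3) = {}" "?K2 \<inter> ?K3 = {}" using s0 by (fastforce simp: pairE_def PP_def)+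
  have fin: "finite ?K1" "finite ?K2" "finite ?K3" using fin_PP fin_pairE by auto
  have K1: "PT d ?K1 = (\<Prod>(a, b)\<in>PP. - Gii (\<sigma> a) (\<sigma> b))"
  proof -
    have "PT d ?K1 = (\<Prod>p\<in>PP. PT d (pairE (\<sigma> (snd p)) (\<sigma> (fst p))))"
      by (rule PT_UN[OF fin_PP fin_pairE]) (auto simp: pairE_def inj_eq[OF s(4)])
    also have "\<dots> = (\<Prod>p\<in>PP. - Gii (\<sigma> (fst p)) (\<sigma> (snd p)))"
    proof (rule prod.cong[OF refl])
      fix p assume "p \<in> PP"
      then have "fst p \<in> Z" "snd p \<in> Z" "fst p \<noteq> snd p" by (auto simp: PP_def Zm)
      then have "\<sigma> (fst p) \<in> Z" "\<sigma> (snd p) \<in> Z" "\<sigma> (fst p) \<noteq> \<sigma> (snd p)" by (simp_all add: s1 inj_eq[OF s(4)])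
      then show "PT d (pairE (\<sigma> (snd p)) (\<sigma> (fst p))) = - Gii (\<sigma> (fst p)) (\<sigma> (snd p))"
        using Gii pairE_eq(1) by simp
    qed
    finally show ?thesis by (simp add: case_prod_beta)
  qed
  have K2: "PT d ?K2 = (\<Prod>a=1..r. - Gij (\<sigma> a) 0)"
  proof -
    have "PT d ?K2 = (\<Prod>a=1..r. PT d (pairE 0 (\<sigma> a)))"
      by (rule PT_UN[OF _ fin_pairE]) (auto simp: pairE_def inj_eq[OF s(4)])
    also have "\<dots> = (\<Prod>a=1..r. - Gij (\<sigma> a) 0)"
    proof (rule prod.cong[OF refl])
      fix a assume "a \<in> {1..r}"
      then have "a \<in> Z" "a \<noteq> 0" using s(3) by (auto simp: Zm)
      then have "\<sigma> a \<in> Z" "\<sigma> a \<noteq> 0" by (simp_all add: s1 s0)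
      then show "PT d (pairE 0 (\<sigma> a)) = - Gij (\<sigma> a) 0" using Gij pairE_eq(3) by simp
    qed
    finally show ?thesis .
  qed
  have K3: "PT d ?K3 = (\<Prod>b=r+1..m. Fij (\<sigma> b) 0)"
  proof -
    have "PT d ?K3 = (\<Prod>b=r+1..m. PT d (pairE (\<sigma> b) 0))"
      by (rule PT_UN[OF _ fin_pairE]) (auto simp: pairE_def inj_eq[OF s(4)])
    also have "\<dots> = (\<Prod>b=r+1..m. Fij (\<sigma> b) 0)"
    proof (rule prod.cong[OF refl])
      fix b assume "b \<in> {r+1..m}"
      then have "b \<in> Z" "b \<noteq> 0" using s(3) by (auto simp: Zm)
      then have "\<sigma> b \<in> Z" "\<sigma> b \<noteq> 0" by (simp_all add: s1 s0)
      then show "PT d (pairE (\<sigma> b) 0) = Fij (\<sigma> b) 0" using Fij pairE_eq(2) by simp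
    qed
    finally show ?thesis .
  qed
  show ?thesis unfolding eq PT_union[OF fin(1) finite_UnI[OF fin(2,3)] dj(1)] PT_union[OF fin(2,3) dj(2)] K1 K2 K3
    by (simp add: mult.assoc)
qed

text \<open>This is P = 0 up to the sign (-1) ^ card PP. The factor (-1) ^ r in \<open>sn\<close>
  cancels against the signs of the G_ij.\<close>

lemma rel0: "(\<Sum>\<iota>\<in>II. Cst (sn \<iota>) * nm \<iota> * PT d (LL - EL (pos (ta \<iota>)))) = 0"
proof -
  let ?t = "\<lambda>\<sigma> r. (-1) ^ r * Cst (Bc r) * (\<Prod>(a, b)\<in>PP. ff (\<sigma> a) (\<sigma> b) * Gii (\<sigma> a) (\<sigma> b)) *
          (\<Prod>a=1..r. Gij (\<sigma> a) 0) * (\<Prod>b=r+1..m. Fij (\<sigma> b) 0)"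
  have "Cst (sn (\<sigma>, r)) * nm (\<sigma>, r) * PT d (LL - EL (pos (ta (\<sigma>, r)))) = (-1) ^ card PP * (of_int (sign \<sigma>) * ?t \<sigma> r)"
    if "(\<sigma>, r) \<in> II" for \<sigma> r
  proof -
    have a: "(\<Prod>(a, b)\<in>PP. - Gii (\<sigma> a) (\<sigma> b)) = (-1) ^ card PP * (\<Prod>(a, b)\<in>PP. Gii (\<sigma> a) (\<sigma> b))"
      using prod_uminus[of "\<lambda>p. Gii (\<sigma> (fst p)) (\<sigma> (snd p))" PP] by (simp add: case_prod_beta)
    have b: "(\<Prod>a=1..r. - Gij (\<sigma> a) 0) = (-1) ^ r * (\<Prod>a=1..r. Gij (\<sigma> a) 0)"
      using prod_uminus[of "\<lambda>a. Gij (\<sigma> a) 0" "{1..r}"] by simp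
    have c: "(\<Prod>(a, b)\<in>PP. ff (\<sigma> a) (\<sigma> b) * Gii (\<sigma> a) (\<sigma> b)) = (\<Prod>(a, b)\<in>PP. ff (\<sigma> a) (\<sigma> b)) * (\<Prod>(a, b)\<in>PP. Gii (\<sigma> a) (\<sigma> b))"
      by (simp add: case_prod_beta prod.distrib)
    have p: "Cst ((-1) ^ r * Bc r) = (-1) ^ r * Cst (Bc r)"
      using Cst_of_int[of "(-1) ^ r"] by (simp add: Cst_mult)
    have q: "Cst (sn (\<sigma>, r)) = of_int (sign \<sigma>) * (-1) ^ r"
      unfolding sn_def prod.case Cst_of_int by simp
    have e: "(-1 :: lpoly) ^ r * (-1) ^ r = 1" by (simp add: power_mult_distrib[symmetric])
    have "Cst (sn (\<sigma>, r)) * nm (\<sigma>, r) * PT d (LL - EL (pos (ta (\<sigma>, r)))) =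
       ((-1) ^ r * (-1) ^ r) * ((-1) ^ card PP * (of_int (sign \<sigma>) * ?t \<sigma> r))"
      unfolding compl_EL[OF that] nm_def prod.case a b c p q by (simp only: ac_simps)
    then show ?thesis unfolding e by simp
  qed
  then have "(\<Sum>\<iota>\<in>II. Cst (sn \<iota>) * nm \<iota> * PT d (LL - EL (pos (ta \<iota>)))) =
      (\<Sum>(\<sigma>, r)\<in>II. (-1) ^ card PP * (of_int (sign \<sigma>) * ?t \<sigma> r))"
    by (intro sum.cong) auto
  also have "\<dots> = (-1) ^ card PP * (\<Sum>\<sigma> | \<sigma> permutes {1..m}. of_int (sign \<sigma>) * (\<Sum>r=0..m. ?t \<sigma> r))"
    unfolding II_def by (simp add: sum.cartesian_product[symmetric] sum_distrib_left)
  finally show ?thesis using P0 unfolding PP_def by simp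
qed

theorem chain_imp_rel:
  assumes rho: "\<rho> permutes {..<M}" and std: "\<And>l v. l < ne \<Longrightarrow> van {..M} (std_u \<rho> l) (std_Phi v)"
  shows "Dd v e = 0"
proof -
  have o: "order (base m 0)" by (rule order_base) simp
  obtain \<Psi> where P: "BB \<Psi>" "Phi (base m 0) v = VD d Z \<bullet> \<Psi>" using psi_ex[OF o] by blast
  show ?thesis unfolding Dd_def
  proof (rule current_relation[where \<Psi> = \<Psi>, OF fin_II])
    show "FDp (pos (ta \<iota>)) (rc x (wd (ta \<iota>)) v)" if "\<iota> \<in> II" for \<iota> by (rule FDp_rc[OF order_ta[OF that]])
    show "PT d (EL (pos (ta \<iota>))) \<bullet> rc x (wd (ta \<iota>)) v = Cst (sn \<iota>) \<bullet> (VD d Z \<bullet> \<Psi>)" if "\<iota> \<in> II" for \<iota>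
      using Phi_ta[OF that] P(2) by (auto simp: pt_Cst Phi_def[of "ta \<iota>", symmetric])
    show "wheel \<Psi>" by (rule wheel_Psi[OF o P])
    show "chain \<Psi>" by (rule chain_Psi[OF o P rho std])
  qed (use P rel0 in auto)
qed

text \<open>The summand (id, r) with nonzero coefficient is singled out. Its order 1, ..., r, 0,
  r+1, ..., m is a path along cA edges, with an \<alpha> edge into 0 and a \<beta> edge out of it,
  so it traverses the closed chain cut open at some place. Whichever r is available, the cluster
  obtained is the same up to naming.\<close>

theorem rel_imp_chain:
  assumes mM: "m = M" and r: "r \<le> m" "Bc r \<noteq> 0"
    and fhom: "\<And>u a b. (\<And>v. unit0 (u v)) \<Longrightarrow> a \<in> Z \<Longrightarrow> b \<in> Z \<Longrightarrow> \<exists>D. hom (insert 0 Z) u (ff a b) D (fv (u a) (u b))"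
    and fne: "\<And>n y. 1 \<le> n \<Longrightarrow> n \<le> M - 1 \<Longrightarrow> unit0 y \<Longrightarrow> fv y (cA ^ n * y) \<noteq> 0 \<and> fv (cA ^ n * y) y \<noteq> 0"
    and match: "\<And>l. l < ne \<Longrightarrow> \<exists>l'<ne. \<beta> l' * cA ^ (M - 1) * \<alpha> l = 1"
    and D0: "\<And>v e. Dd v e = 0" and rho: "\<rho> permutes {..<M}" and l: "l < ne"
  shows "van {..M} (std_u \<rho> l) (std_Phi v)"
proof -
  obtain l' where l': "l' < ne" "\<beta> l' * cA ^ (M - 1) * \<alpha> l = 1" using match[OF l] by blast
  \<comment> \<open>The power of cA at vertex a: M - 1 at r + 1, falling to r at m, and continuing
    from r - 1 at 1 down to 0 at r, the vertex joined to 0 by the \<alpha> edge. For r = 0 that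
    vertex is m.\<close>
  define ex where "ex a = (if a \<le> r then r - a else M + r - a)" for a
  define u where "u a = (if a = 0 then 1 else cA ^ ex a * \<alpha> l)" for a
  have uu: "unit0 (u a)" for a using cA \<alpha> by (simp add: u_def)
  have \<alpha>0: "\<alpha> l \<noteq> 0" and cA0: "cA \<noteq> 0" using \<alpha>[of l] cA by auto
  let ?V = "insert 0 Z"
  have id0: "(id, r) \<in> II" using r permutes_id by (auto simp: II_def)
  have ta0: "ta (id, r) = base m r" by (simp add: ta_def)
  let ?vs = "base m r"
  define cs where "cs = map (\<lambda>k. if Suc k = r then \<alpha> l else if k = r then \<beta> l' else cA) [0..<M]"
  \<comment> \<open>The coefficient of the edge that closes the cycle from the last vertex of the
    order to the first; the vertex 0 takes part in it only for r = 0 and r = M.\<close>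
  define cf where "cf = (if r = 0 then \<alpha> l else if r = M then \<beta> l' else cA)"
  have len: "length ?vs = Suc (length cs)" using base_props(3)[OF r(1)] mM by (simp add: cs_def)
  have vn: "?vs ! k = (if k < r then Suc k else if k = r then 0 else k)" if "k \<le> M" for k
    using base_nth[OF r(1)] that mM by simp
  have lasth: "last ?vs = (if r = M then 0 else M)" "hd ?vs = (if r = 0 then 0 else 1)"
  proof -
    have "?vs \<noteq> []" by (simp add: base_def)
    then have "last ?vs = ?vs ! M" "hd ?vs = ?vs ! 0" using len by (auto simp: last_conv_nth hd_conv_nth cs_def)
    then show "last ?vs = (if r = M then 0 else M)" "hd ?vs = (if r = 0 then 0 else 1)" using vn[of M] vn[of 0] r(1) mM by auto
  qed
  have ped: "u a = c * u b \<and> (a, c, b) \<in> LL" if pe: "(a, c, b) \<in> pedges ?vs cs" for a c b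
  proof -
    obtain k where k: "k < M" "a = ?vs ! k" "c = cs ! k" "b = ?vs ! Suc k"
      using pedges_nth[OF pe] by (auto simp: cs_def)
    have ce: "c = (if Suc k = r then \<alpha> l else if k = r then \<beta> l' else cA)" using k by (simp add: cs_def)
    note ab = k(2)[unfolded vn[OF less_imp_le[OF k(1)]]] k(4)[unfolded vn[OF Suc_leI[OF k(1)]]]
    consider "Suc k < r" | "Suc k = r" | "k = r" | "r < k" by linarith
    then show ?thesis
    proof cases
      case 1
      have "ex (Suc k) = Suc (ex (Suc (Suc k)))" using 1 by (simp add: ex_def)
      then show ?thesis using 1 ab ce k(1) r(1) mM unfolding LL_def EA_def by (auto simp: u_def mult_ac Zm)
    next
      case 2
      then show ?thesis using ab ce k(1) l mM unfolding LL_def E\<alpha>_def by (auto simp: u_def ex_def Zm)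
    next
      case 3
      then have "ex (Suc k) = M - 1" by (simp add: ex_def)
      then show ?thesis using 3 ab ce k(1) l' mM unfolding LL_def E\<beta>_def by (auto simp: u_def mult_ac Zm)
    next
      case 4
      then have "ex k = Suc (ex (Suc k))" using k(1) by (simp add: ex_def)
      then show ?thesis using 4 ab ce k(1) mM unfolding LL_def EA_def by (auto simp: u_def mult_ac Zm)
    qed
  qed
  have exB: "ex a \<le> M - 1" if "a \<in> Z" for a using that[unfolded Zm] r(1) mM by (auto simp: ex_def)
  have exI: "a = b" if "a \<in> Z" "b \<in> Z" "ex a = ex b" for a b
    using that[unfolded Zm] mM r(1) by (auto simp: ex_def split: if_splits)
  have nuE: "u a \<noteq> c * u b" if e: "(a, c, b) \<in> LL" and p: "\<not> pos ?vs a < pos ?vs b" and n: "(a, c, b) \<noteq> (last ?vs, cf, hd ?vs)" for a c b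
  proof
    assume eq: "u a = c * u b"
    have V: "a \<in> ?V" "b \<in> ?V" "a \<noteq> b" using LL_V[OF e] by auto
    have am: "a \<le> m" "b \<le> m" and z0: "0 \<notin> Z" using V by (auto simp: Zm)
    note p' = p[unfolded pos_base[OF r(1) am(1)] pos_base[OF r(1) am(2)]]
    consider (A) "c = cA" "a \<in> Z" "b \<in> Z" | (B) "c = cB" "a \<in> Z" "b \<in> Z"
      | (al) l2 where "b = 0" "a \<in> Z" "l2 < ne" "c = \<alpha> l2" | (be) l2 where "a = 0" "b \<in> Z" "l2 < ne" "c = \<beta> l2"
      using e unfolding LL_def EA_def EB_def E\<alpha>_def E\<beta>_def by auto
    then show False
    proof cases
      case A
      then have "a \<noteq> 0" "b \<noteq> 0" using z0 by metis+
      then have "cA ^ ex a * \<alpha> l = cA * (cA ^ ex b * \<alpha> l)" using eq A(1) by (simp add: u_def)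
      then have "cA ^ ex a * \<alpha> l = cA ^ Suc (ex b) * \<alpha> l" by (simp only: power_Suc mult.assoc)
      then have "cA ^ ex a = cA ^ Suc (ex b)" using \<alpha>0 by (metis mult_right_cancel)
      then have x: "ex a = Suc (ex b)" by (rule cA_pow_inj)
      have "a = M \<and> b = 1 \<and> 0 < r \<and> r < M" using x p' A(2,3)[unfolded Zm] mM r(1) by (auto simp: ex_def split: if_splits)
      then show False using n lasth A(1) by (simp add: cf_def)
    next
      case B
      then have "a \<noteq> 0" "b \<noteq> 0" using z0 by metis+
      then have "cA ^ ex a * \<alpha> l = cB * (cA ^ ex b * \<alpha> l)" using eq B(1) by (simp add: u_def)
      then have "cA ^ ex a * \<alpha> l = (cB * cA ^ ex b) * \<alpha> l" by (simp only: mult.assoc)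
      then have x: "cA ^ ex a = cB * cA ^ ex b" using \<alpha>0 by (metis mult_right_cancel)
      show False
      proof (cases "ex b \<le> ex a")
        case True
        then have "cA ^ (ex a - ex b) * cA ^ ex b = cB * cA ^ ex b" using x by (simp add: power_add[symmetric])
        then have "cA ^ (ex a - ex b) = cB" using cA0 by (metis mult_right_cancel power_not_zero)
        then show False using cA_cB by blast
      next
        case False
        then have p: "cA ^ ex b = cA ^ (ex b - ex a) * cA ^ ex a" by (simp add: power_add[symmetric])
        have "1 * cA ^ ex a = (cB * cA ^ (ex b - ex a)) * cA ^ ex a" unfolding mult.assoc p[symmetric] mult_1_left by (rule x)
        then have "1 = cB * cA ^ (ex b - ex a)" using cA0 by (metis mult_right_cancel power_not_zero)
        then show False using cB_cA by metis
      qed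
    next
      case al
      then have "a \<noteq> 0" using z0 by metis
      then have "\<alpha> l2 = cA ^ ex a * \<alpha> l" using eq al by (simp add: u_def)
      then have x: "ex a = 0" by (rule \<alpha>\<alpha>[OF l al(3)])
      then have c2: "\<alpha> l2 = \<alpha> l" using \<open>\<alpha> l2 = cA ^ ex a * \<alpha> l\<close> by simp
      have "a = M \<and> r = 0" using x p' al(1,2)[unfolded Zm] mM r(1) by (auto simp: ex_def split: if_splits)
      then show False using n lasth al c2 M2 by (simp add: cf_def)
    next
      case be
      then have "b \<noteq> 0" using z0 by metis
      then have q: "\<beta> l2 * cA ^ ex b * \<alpha> l = 1" using eq be by (simp add: u_def mult_ac)
      then have "2 * (M - 1) = 2 * ex b" using closed[OF be(3) l, of 0 "ex b"] by simp
      then have x: "ex b = M - 1" by simp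
      have b1: "b = 1 \<and> r = M" using x p' be(1,2)[unfolded Zm] mM r(1) by (auto simp: ex_def split: if_splits)
      have "\<beta> l2 * (cA ^ (M - 1) * \<alpha> l) = \<beta> l' * (cA ^ (M - 1) * \<alpha> l)" using q l'(2) x by (simp add: mult.assoc)
      moreover have "cA ^ (M - 1) * \<alpha> l \<noteq> 0" using cA0 \<alpha>0 by simp
      ultimately have "\<beta> l2 = \<beta> l'" by (metis mult_right_cancel)
      then show False using n lasth be b1 M2 by (simp add: cf_def)
    qed
  qed
  define val where "val = (\<Prod>(a, b)\<in>PP. fv (u a) (u b)) * ((-1) ^ r * Bc r) * sn (id, r)"
  have "\<exists>D. hom ?V u (nm (id, r) * Cst (sn (id, r))) D val"
  proof -
    have "\<exists>D. hom ?V u (\<Prod>p\<in>PP. ff (fst p) (snd p)) D (\<Prod>p\<in>PP. fv (u (fst p)) (u (snd p)))"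
      by (rule hom_prod[OF fin_PP subset_refl], rule fhom[OF uu]) (auto simp: PP_def Zm)
    then obtain D where "hom ?V u (\<Prod>p\<in>PP. ff (fst p) (snd p)) D (\<Prod>p\<in>PP. fv (u (fst p)) (u (snd p)))" by blast
    then have "hom ?V u ((\<Prod>p\<in>PP. ff (fst p) (snd p)) * Cst ((-1) ^ r * Bc r) * Cst (sn (id, r))) (D + 0 + 0)
        ((\<Prod>p\<in>PP. fv (u (fst p)) (u (snd p))) * ((-1) ^ r * Bc r) * sn (id, r))"
      by (intro hom_mult hom_Cst) auto
    then show ?thesis by (auto simp: nm_def val_def case_prod_beta)
  qed
  then obtain D where hD: "hom ?V u (nm (id, r) * Cst (sn (id, r))) D val" by blast
  \<comment> \<open>The weights of two variables of Z differ by a power of cA with exponent between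
    1 and M - 1, where f does not vanish by assumption.\<close>
  have val0: "val \<noteq> 0"
  proof -
    have "fv (u a) (u b) \<noteq> 0" if "(a, b) \<in> PP" for a b
    proof -
      have ab: "a \<in> Z" "b \<in> Z" "a \<noteq> b" "a \<noteq> 0" "b \<noteq> 0" using that by (auto simp: PP_def Zm)
      then have ne: "ex a \<noteq> ex b" using exI by blast
      show ?thesis
      proof (cases "ex a < ex b")
        case True
        then have "u b = cA ^ (ex b - ex a) * u a" using ab by (auto simp: u_def power_add[symmetric] mult.assoc[symmetric])
        then show ?thesis using fne[of "ex b - ex a" "u a"] True exB[OF ab(2)] uu by simp
      next
        case False
        then have "u a = cA ^ (ex a - ex b) * u b" using ab by (auto simp: u_def power_add[symmetric] mult.assoc[symmetric])
        then show ?thesis using fne[of "ex a - ex b" "u b"] False ne exB[OF ab(1)] uu by simp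
      qed
    qed
    then have "(\<Prod>(a, b)\<in>PP. fv (u a) (u b)) \<noteq> 0" using fin_PP by (auto simp: prod_zero_iff)
    then show ?thesis using r(2) by (auto simp: val_def sn_def)
  qed
  have o0: "order (base m 0)" by (rule order_base) simp
  have setvs: "set ?vs = ?V" using base_props(2)[OF r(1)] by (simp add: Zm)
  have vanV: "van ?V u (Phi (base m 0) v)" for v
  proof -
    let ?\<Phi> = "Phi (base m 0) v"
    have BBn: "BB ((nm (id, r) * Cst (sn (id, r))) \<bullet> ?\<Phi>)" using hD BB_Phi[OF o0] unfolding hom_def by blast
    have "van (set ?vs) u ((nm (id, r) * Cst (sn (id, r))) \<bullet> ?\<Phi>)"
    proof (rule family_extract[where cs = cs and cf = cf, OF fin_II id0])
      show "FDp (pos (ta \<iota>)) (rc x (wd (ta \<iota>)) v)" if "\<iota> \<in> II" for \<iota> by (rule FDp_rc[OF order_ta[OF that]])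
      show "PT d (EL (pos (ta \<iota>))) \<bullet> rc x (wd (ta \<iota>)) v = Cst (sn \<iota>) \<bullet> ?\<Phi>" if "\<iota> \<in> II" for \<iota>
        using Phi_ta[OF that] by (auto simp: pt_Cst Phi_def[of "ta \<iota>", symmetric])
      show "BB ?\<Phi>" by (rule BB_Phi[OF o0])
      show "BB ((nm (id, r) * Cst (sn (id, r))) \<bullet> ?\<Phi>)" by (rule BBn)
      show "(\<Sum>\<iota>\<in>II. (nm \<iota> \<bullet> rc x (wd (ta \<iota>)) v) e) = 0" for e using D0[of v e] by (simp add: Dd_def)
      show "distinct ?vs" "set ?vs \<subseteq> ?V" using base_props(1)[OF r(1)] setvs by auto
      show "length ?vs = Suc (length cs)" by (rule len)
      show "cs \<noteq> []" using M2 by (simp add: cs_def)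
      show "sorted_wrt (\<lambda>a b. pos (ta (id, r)) a < pos (ta (id, r)) b) ?vs"
        unfolding ta0 sorted_wrt_iff_nth_less using pos_nth[OF base_props(1)[OF r(1)]] by simp
      show "pedges ?vs cs \<subseteq> LL" using ped by auto
      show "\<exists>k<length cs. \<not> pos (ta \<iota>) (?vs ! k) < pos (ta \<iota>) (?vs ! Suc k)" if \<iota>: "\<iota> \<in> II" "\<iota> \<noteq> (id, r)" for \<iota>
      proof (rule ccontr)
        assume c: "\<not> ?thesis"
        obtain \<sigma> r' where sr: "\<iota> = (\<sigma>, r')" by (cases \<iota>)
        note s = IID[OF \<iota>(1)[unfolded sr]]
        have "sorted_wrt (\<lambda>a b. pos (ta \<iota>) a < pos (ta \<iota>) b) ?vs"
          by (subst sorted_wrt_iff_nth_Suc_transp) (use c len in \<open>auto simp: transp_def\<close>)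
        then have vt: "?vs = ta \<iota>" by (intro sorted_pos_unique) (use order_ta[OF \<iota>(1)] setvs in \<open>auto simp: order_def\<close>)
        have "pos (ta \<iota>) 0 = r'" using pos_ta[OF \<iota>(1)[unfolded sr], of 0] s(5) by (simp add: sr)
        moreover have "pos ?vs 0 = r" using pos_base[OF r(1), of 0] by simp
        ultimately have rr: "r' = r" using vt by simp
        then have "map \<sigma> ?vs = map id ?vs" using vt by (simp add: ta_def sr)
        then have "\<sigma> a = a" if "a \<in> ?V" for a using that setvs by (metis id_apply map_eq_conv)
        then have "\<sigma> a = a" for a using permutes_not_in[OF s(2)] by blast
        then show False using \<iota>(2) rr sr by auto
      qed
      show "u a \<noteq> c * u b" if "(a, c, b) \<in> LL" "\<not> pos (ta (id, r)) a < pos (ta (id, r)) b" "(a, c, b) \<noteq> (last ?vs, cf, hd ?vs)" for a c b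
        using nuE that unfolding ta0 by blast
    qed (use uu ped in auto)
    then show ?thesis unfolding setvs using hom_van[OF hD val0 BB_Phi[OF o0]] by blast
  qed
  interpret S: current_order sc s0 co d x i j cA cB \<alpha> \<beta> ne M hasB k1 k2 k3 M "{..<M}" by (rule std_order)
  \<comment> \<open>The model variable that has the weight of a: \<open>std_u\<close> there is the
    power M - 1 - \<rho> (h a) = ex a of cA, times \<alpha> l.\<close>
  define h where "h a = inv_into UNIV \<rho> (M - 1 - ex a)" for a
  have rb: "inv_into UNIV \<rho> permutes {..<M}" by (rule permutes_inv[OF rho])
  have hM: "h a < M" if "a \<in> Z" for a
    using permutes_in_image[OF rb, of "M - 1 - ex a"] M2 by (simp add: h_def)
  have rhoh: "\<rho> (h a) = M - 1 - ex a" for a unfolding h_def by (rule permutes_inverses(1)[OF rho])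
  have hinj: "inj_on h Z"
  proof (rule inj_onI)
    fix a b assume ab: "a \<in> Z" "b \<in> Z" "h a = h b"
    then have "M - 1 - ex a = M - 1 - ex b" using rhoh by metis
    then show "a = b" using exI[OF ab(1,2)] exB[OF ab(1)] exB[OF ab(2)] by simp
  qed
  define labs where "labs = M # map h [1..<Suc m]"
  have dl: "distinct labs"
  proof -
    have "M \<notin> h ` Z" using hM by force
    moreover have "set [1..<Suc m] = Z" by (auto simp: Zm)
    ultimately show ?thesis using hinj unfolding labs_def distinct.simps distinct_map set_map by simp
  qed
  let ?g = "ren labs"
  have g0: "?g 0 = M" by (simp add: ren_def labs_def)
  have ga: "?g a = h a" if az: "a \<in> Z" for a
  proof -
    obtain a' where "a = Suc a'" "a' < m" using az by (cases a) (auto simp: Zm)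
    then show ?thesis by (simp add: ren_def labs_def nth_Cons' del: upt_Suc)
  qed
  have "current_pair_axioms M {..<M} 0 Z ?g" by unfold_locales (use inj_ren[OF dl] g0 ga hM in auto)
  then interpret P: current_pair sc s0 co d x i j cA cB \<alpha> \<beta> ne M hasB k1 k2 k3 M "{..<M}" 0 Z ?g
    by (intro current_pair.intro current_order_axioms S.current_order_axioms)
  have gV: "?g ` ?V = {..M}"
  proof -
    have "?g ` Z = h ` Z" using ga by (intro image_cong) auto
    moreover have "h ` Z = {..<M}" using hM hinj by (intro card_subset_eq) (auto simp: card_image mM Zm)
    ultimately show ?thesis using g0 by auto
  qed
  have oS: "S.order ([] @ map ?g (base m 0))"
  proof -
    have so: "distinct (base m 0)" "set (base m 0) = insert 0 Z" using o0 by (auto simp: order_def)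
    have "inj_on ?g (insert 0 Z)" using inj_ren[OF dl] by (meson inj_on_subset subset_UNIV)
    then have "distinct (map ?g (base m 0))" unfolding distinct_map so(2) using so(1) by blast
    moreover have "set (map ?g (base m 0)) = insert M {..<M}" unfolding set_map so(2) gV by auto
    ultimately show ?thesis unfolding S.order_def append_Nil by blast
  qed
  have "S.van (?g ` ?V) (std_u \<rho> l) (S.Phi ([] @ map ?g (base m 0)) v)"
  proof (rule P.van_pair[OF oS o0 vanV])
    show "std_u \<rho> l (?g c) = u c" if c: "c \<in> ?V" for c
    proof (cases "c = 0")
      case False
      then have "c \<in> Z" using c by auto
      then have e: "M - 1 - (M - 1 - ex c) = ex c" and g: "?g c = h c" "h c < M" using exB[of c] ga hM by auto
      show ?thesis unfolding std_u_def u_def g(1) rhoh e using g(2) False by simp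
    qed (simp add: g0 std_u_def u_def)
  qed (rule uu)
  then have sv: "S.van {..M} (std_u \<rho> l) (S.Phi ([] @ map ?g (base m 0)) v)" unfolding gV .
  have eM: "{..M} = insert M {..<M}" by auto
  have o1: "S.order [0..<Suc M]" by (auto simp: S.order_def)
  obtain s where "\<And>e. S.Phi ([] @ [0..<Suc M]) v e = sc s (S.Phi ([] @ map ?g (base m 0)) v e)"
    using S.Phi_any[OF oS, of "[0..<Suc M]"] o1 by auto
  then have "S.Phi [0..<Suc M] v = (\<lambda>e. sc s (S.Phi ([] @ map ?g (base m 0)) v e))" by auto
  moreover have bb: "S.BB (S.Phi (map ?g (base m 0)) v)" using S.BB_Phi[OF oS] by simp
  ultimately show ?thesis unfolding std_Phi_eq[symmetric] using sv
    by (simp add: van_def S.subs_sc[OF bb] eM)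
qed

end

context hmodule
begin

subsection \<open>The normally ordered product\<close>

text \<open>A polynomial has finitely many monomials, so the double sum can be rearranged once the
  product of S and X converges.\<close>

lemma st_assoc:
  assumes sm: "\<And>e. sm (\<lambda>k. sc (S k) (X (e - k))) UNIV"
  shows "p \<bullet> series_times sc S X = series_times sc (poly_times (*) p S) X"
proof
  fix e
  let ?K = "ks p"
  have t: "sm (\<lambda>k. sc (S (k - l)) (X (e - k))) UNIV"
    "hsum sc (\<lambda>k. sc (S (k - l)) (X (e - k))) UNIV = series_times sc S X (e - l)" for l
  proof -
    have b: "bij_betw (\<lambda>k. k - l) (UNIV :: expo set) UNIV" by (rule bij_betwI[of _ _ _ "\<lambda>k. k + l"]) auto
    have eq: "e - l - (k - l) = e - k" for k by simp
    show "sm (\<lambda>k. sc (S (k - l)) (X (e - k))) UNIV"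
      "hsum sc (\<lambda>k. sc (S (k - l)) (X (e - k))) UNIV = series_times sc S X (e - l)"
      using hsum_reindex[OF b, of "\<lambda>k. sc (S k) (X (e - l - k))"] sm[of "e - l"] unfolding series_times_def eq by auto
  qed
  have "(p \<bullet> series_times sc S X) e = (\<Sum>l\<in>?K. sc (lk p l) (hsum sc (\<lambda>k. sc (S (k - l)) (X (e - k))) UNIV))"
    unfolding poly_times_def t(2) ..
  also have "\<dots> = (\<Sum>l\<in>?K. hsum sc (\<lambda>k. sc (lk p l) (sc (S (k - l)) (X (e - k)))) UNIV)"
    using hsum_sc[OF t(1)] by simp
  also have "\<dots> = hsum sc (\<lambda>k. \<Sum>l\<in>?K. sc (lk p l) (sc (S (k - l)) (X (e - k)))) UNIV"
  proof (rule hsum_sum[symmetric])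
    show "sm (\<lambda>k. sc (lk p l) (sc (S (k - l)) (X (e - k)))) UNIV" for l by (rule sm_sc[OF t(1)])
  qed simp
  also have "(\<lambda>k. \<Sum>l\<in>?K. sc (lk p l) (sc (S (k - l)) (X (e - k)))) = (\<lambda>k. sc (poly_times (*) p S k) (X (e - k)))"
    by (simp add: poly_times_def scale_sum_left)
  finally show "(p \<bullet> series_times sc S X) e = series_times sc (poly_times (*) p S) X e" unfolding series_times_def .
qed

lemma st_lookup: "series_times sc (lk q) X = q \<bullet> X"
proof
  fix e show "series_times sc (lk q) X e = (q \<bullet> X) e"
    unfolding series_times_def poly_times_def by (rule hsum_finite) (auto simp: in_keys_iff)
qed

definition rs :: "nat set \<Rightarrow> (expo \<Rightarrow> 'w) \<Rightarrow> expo \<Rightarrow> 'w" where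
  "rs B X e = (if ks e \<subseteq> B then X e else 0)"

lemma rs_pt: assumes "pv B p" shows "p \<bullet> rs B X = rs B (p \<bullet> X)"
proof
  fix e
  have "ks (e - k) \<subseteq> B \<longleftrightarrow> ks e \<subseteq> B" if "k \<in> ks p" for k
  proof -
    have k: "ks k \<subseteq> B" using assms that by (auto simp: pv_def)
    have "ks (e - k) \<subseteq> ks e \<union> ks k" by (rule keys_diff)
    moreover have "ks (e - k + k) \<subseteq> ks (e - k) \<union> ks k" by (rule Poly_Mapping.keys_add)
    ultimately show ?thesis using k by auto
  qed
  then show "(p \<bullet> rs B X) e = rs B (p \<bullet> X) e" by (simp add: poly_times_def rs_def)
qed

end

text \<open>C[[h]] as a module over itself, with the coefficients as coordinates; the lemmas on
  module-valued series thus cover the scalar kernels too.\<close>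

interpretation fpsm: hmodule "(*) :: complex fps \<Rightarrow> complex fps \<Rightarrow> complex fps" "(*)" fps_nth
proof unfold_locales
  show "bij (fps_nth :: complex fps \<Rightarrow> _)"
    by (rule bijI, simp add: inj_def fps_nth_inject, rule surjI[of _ Abs_fps]) auto
qed (auto simp: algebra_simps fps_mult_nth atLeast0AtMost)

lemma poly_times_lookup: "poly_times (*) p (lk q) = lk (p * q)"
proof
  fix e
  have "poly_times (*) r (\<lambda>e. lk 1 e) e = lk r e" for r :: lpoly and e
  proof -
    have "poly_times (*) r (\<lambda>e. lk 1 e) e = (\<Sum>k\<in>ks r. lk r k * (if k = e then 1 else 0))"
      unfolding poly_times_def by (intro sum.cong) (auto simp: lookup_one when_def)
    then show ?thesis by (simp add: if_distrib[of "(*) _"] in_keys_iff cong: if_cong)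
  qed
  then have id: "poly_times (*) r (lk 1) = lk r" for r :: lpoly by (auto simp: eta_contract_eq)
  show "poly_times (*) p (lk q) e = lk (p * q) e"
    using fpsm.pt_mult[of p q "lk 1"] by (simp add: id)
qed

text \<open>Scalar series in the variables 0, ..., M whose degree in every tail of variables is
  bounded below. Expansions in nonnegative powers of the later variable have this property. The
  bound is uniform, not modulo powers of \<open>fps_X\<close>.\<close>

definition sfx :: "nat \<Rightarrow> (expo \<Rightarrow> 'a::zero) \<Rightarrow> bool" where
  "sfx M S \<longleftrightarrow> (\<exists>c. \<forall>k. S k \<noteq> 0 \<longrightarrow> ks k \<subseteq> {..M} \<and> (\<forall>b\<le>M. - c \<le> esum {b..M} k))"

text \<open>Each exponent is a difference of two consecutive tail degrees, hence bounded.\<close>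

lemma finite_sfx: "finite {k :: expo. ks k \<subseteq> {..M} \<and> (\<forall>b\<le>M. l \<le> esum {b..M} k \<and> esum {b..M} k \<le> h)}" (is "finite ?S")
proof -
  let ?f = "\<lambda>k :: expo. map (lk k) [0..<Suc M]"
  have "inj_on ?f ?S"
  proof (rule inj_onI)
    fix k k' assume k: "k \<in> ?S" "k' \<in> ?S" "?f k = ?f k'"
    have "lk k v = lk k' v" for v
    proof (cases "v \<le> M")
      case True then show ?thesis using k(3) by (simp add: map_eq_conv del: upt_Suc)
    next
      case False
      then have "v \<notin> ks k" "v \<notin> ks k'" using k by auto
      then show ?thesis by (simp add: in_keys_iff)
    qed
    then show "k = k'" by (rule poly_mapping_eqI)
  qed
  moreover have "?f ` ?S \<subseteq> {xs. set xs \<subseteq> {min l (l - h)..max h (h - l)} \<and> length xs = Suc M}"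
  proof -
    have "lk k v \<in> {min l (l - h)..max h (h - l)}" if k: "k \<in> ?S" and v: "v \<le> M" for k v
    proof (cases "v = M")
      case True
      have "esum {M..M} k = lk k M" by (simp add: esum_def)
      then show ?thesis using k True by (fastforce dest: spec[of _ M])
    next
      case False
      have "{v..M} = insert v {Suc v..M}" using v by auto
      then have "esum {v..M} k = lk k v + esum {Suc v..M} k" by (simp add: esum_def)
      moreover have "l \<le> esum {v..M} k" "esum {v..M} k \<le> h" "l \<le> esum {Suc v..M} k" "esum {Suc v..M} k \<le> h"
        using k v False by auto
      ultimately show ?thesis by auto
    qed
    then show ?thesis by auto
  qed
  moreover have "finite {xs. set xs \<subseteq> {min l (l - h)..max h (h - l)} \<and> length xs = Suc M}" by (rule finite_lists_length_eq) simp
  ultimately show ?thesis by (meson finite_imageD finite_subset)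
qed

lemma sfx_fin:
  assumes "sfx M S" "sfx M S'" shows "finite {k. S k * S' (e - k) \<noteq> (0 :: complex fps)}"
proof -
  obtain c where c: "\<And>k. S k \<noteq> 0 \<Longrightarrow> ks k \<subseteq> {..M} \<and> (\<forall>b\<le>M. - c \<le> esum {b..M} k)" using assms(1) unfolding sfx_def by blast
  obtain c' where c': "\<And>k. S' k \<noteq> 0 \<Longrightarrow> ks k \<subseteq> {..M} \<and> (\<forall>b\<le>M. - c' \<le> esum {b..M} k)" using assms(2) unfolding sfx_def by blast
  define h where "h = Max ((\<lambda>b. esum {b..M} e + c') ` {..M})"
  have hb: "esum {b..M} e + c' \<le> h" if "b \<le> M" for b unfolding h_def using that by (intro Max_ge) auto
  have "{k. S k * S' (e - k) \<noteq> 0} \<subseteq> {k. ks k \<subseteq> {..M} \<and> (\<forall>b\<le>M. - c \<le> esum {b..M} k \<and> esum {b..M} k \<le> h)}"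
  proof
    fix k assume "k \<in> {k. S k * S' (e - k) \<noteq> 0}"
    then have k: "S k \<noteq> 0" "S' (e - k) \<noteq> 0" by auto
    have "esum {b..M} k \<le> h" if "b \<le> M" for b using c'[OF k(2)] hb[OF that] that by (force simp: esum_diff)
    then show "k \<in> {k. ks k \<subseteq> {..M} \<and> (\<forall>b\<le>M. - c \<le> esum {b..M} k \<and> esum {b..M} k \<le> h)}" using c[OF k(1)] by blast
  qed
  then show ?thesis using finite_sfx finite_subset by blast
qed

lemma sfx_st:
  assumes S: "sfx M S" and S': "sfx M S'" shows "sfx M (series_times (*) S S' :: expo \<Rightarrow> complex fps)"
proof -
  obtain c where c: "\<And>k. S k \<noteq> 0 \<Longrightarrow> ks k \<subseteq> {..M} \<and> (\<forall>b\<le>M. - c \<le> esum {b..M} k)" using S unfolding sfx_def by blast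
  obtain c' where c': "\<And>k. S' k \<noteq> 0 \<Longrightarrow> ks k \<subseteq> {..M} \<and> (\<forall>b\<le>M. - c' \<le> esum {b..M} k)" using S' unfolding sfx_def by blast
  have "ks e \<subseteq> {..M} \<and> (\<forall>b\<le>M. - (c + c') \<le> esum {b..M} e)" if ne: "series_times (*) S S' e \<noteq> 0" for e
  proof -
    have "\<exists>k. S k * S' (e - k) \<noteq> 0"
    proof (rule ccontr)
      assume "\<not> ?thesis"
      then have "series_times (*) S S' e = 0" unfolding series_times_def by (intro fpsm.hsum_0) blast
      then show False using ne by simp
    qed
    then obtain k where k: "S k \<noteq> 0" "S' (e - k) \<noteq> 0" by auto
    have e: "e = k + (e - k)" by simp
    have "ks e \<subseteq> ks k \<union> ks (e - k)" by (subst e) (rule Poly_Mapping.keys_add)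
    moreover have "esum {b..M} e = esum {b..M} k + esum {b..M} (e - k)" for b by (simp add: esum_diff)
    moreover note c[OF k(1)] c'[OF k(2)]
    ultimately show ?thesis by (smt (verit) Un_subset_iff subset_trans)
  qed
  then show ?thesis unfolding sfx_def by blast
qed

lemma sfx_lookup: assumes "pv {..M} p" shows "sfx M (lk p)"
proof -
  let ?E = "(\<lambda>(k, b). - esum {b..M} k) ` (ks p \<times> {..M})"
  have "- Max ?E \<le> esum {b..M} k" if "k \<in> ks p" "b \<le> M" for k b
  proof -
    have "- esum {b..M} k \<le> Max ?E" by (rule Max_ge) (use that in \<open>auto intro!: rev_image_eqI[of "(k, b)"]\<close>)
    then show ?thesis by simp
  qed
  then show ?thesis unfolding sfx_def using assms unfolding pv_def by (intro exI[of _ "Max ?E"]) (auto simp: in_keys_iff)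
qed

text \<open>An expanded rational function is characterized by its denominator: den times the series
  is the polynomial nu. This relation is multiplicative, so it passes to the whole product of
  factors.\<close>

lemma foldr_kernel:
  assumes K: "\<And>r. r \<in> set rs \<Longrightarrow> sfx M (K r) \<and> poly_times (*) (den r) (K r) = lk (nu r)"
    and nu: "\<And>r. r \<in> set rs \<Longrightarrow> pv {..M} (nu r)" and q: "pv {..M} q"
  shows "sfx M (foldr (\<lambda>r. series_times (*) (K r)) rs (lk q)) \<and>
    poly_times (*) (prod_list (map den rs)) (foldr (\<lambda>r. series_times (*) (K r)) rs (lk q)) =
    lk (prod_list (map nu rs) * q)"
  using K nu
proof (induction rs)
  case Nil then show ?case using sfx_lookup[OF q] by simp
next
  case (Cons r rs)
  let ?S = "foldr (\<lambda>r. series_times (*) (K r)) rs (lk q)"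
  have ih: "sfx M ?S" "poly_times (*) (prod_list (map den rs)) ?S = lk (prod_list (map nu rs) * q)"
    using Cons.IH Cons.prems by auto
  have r: "sfx M (K r)" "poly_times (*) (den r) (K r) = lk (nu r)" using Cons.prems(1)[of r] by auto
  have sm: "fpsm.sm (\<lambda>k. K r k * ?S (e - k)) UNIV" for e
    by (rule fpsm.sm_finite_support) (use sfx_fin[OF r(1) ih(1), of e] in simp)
  have "poly_times (*) (den r) (series_times (*) (K r) ?S) = poly_times (*) (nu r) ?S"
    unfolding fpsm.st_assoc[OF sm] r(2) fpsm.st_lookup ..
  then have "poly_times (*) (prod_list (map den rs) * den r) (series_times (*) (K r) ?S) =
      poly_times (*) (nu r) (poly_times (*) (prod_list (map den rs)) ?S)"
    by (simp add: fpsm.pt_mult fpsm.pt_commute[of "nu r"])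
  then show ?case unfolding ih(2) poly_times_lookup using sfx_st[OF r(1) ih(1)] by (simp add: mult_ac)
qed

lemma geom_kernel:
  assumes ab: "a < b" "b \<le> M"
  shows "sfx M (geom c a b)" "poly_times (*) (Var a - Cst c * Var b) (geom c a b) = lk 1"
proof -
  show "sfx M (geom c a b)"
    unfolding sfx_def
  \<comment> \<open>For k = -n-1 at a and n at b with a < b, the tail degrees are -1 up to a, then n
    up to b, then 0.\<close>
  proof (intro exI[of _ 1] allI impI)
    fix k assume k: "geom c a b k \<noteq> 0"
    define n where "n = lk k b"
    have n: "n \<ge> 0" "k = sg a (- n - 1) + sg b n" using k by (auto simp: geom_def Let_def n_def split: if_splits)
    have "ks k \<subseteq> {a, b}" unfolding n(2) using Poly_Mapping.keys_add[of "sg a (- n - 1)" "sg b n"] by (auto split: if_splits)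
    moreover have "- 1 \<le> esum {y..M} k" for y
      unfolding n(2) esum_add using ab n(1) by (simp add: esum_sg)
    ultimately show "ks k \<subseteq> {..M} \<and> (\<forall>y\<le>M. - 1 \<le> esum {y..M} k)" using ab by auto
  qed
  show "poly_times (*) (Var a - Cst c * Var b) (geom c a b) = lk 1"
  proof
    fix e
    have pt: "poly_times (*) (Var a - Cst c * Var b) (geom c a b) e = geom c a b (e - sg a 1) - c * geom c a b (e - sg b 1)"
      by (simp add: fpsm.pt_diff fpsm.pt_mult fpsm.pt_Cst) (simp add: Var_def fpsm.pt_single)
    let ?n = "lk e b"
    have l: "lk (e - sg a 1) b = ?n" "lk (e - sg b 1) b = ?n - 1"
      using ab by (simp_all add: lookup_minus lookup_single)
    let ?P = "e = sg a (- ?n) + sg b ?n"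
    have P1: "e - sg a 1 = sg a (- ?n - 1) + sg b ?n \<longleftrightarrow> ?P"
    proof -
      have "sg a (- ?n - 1) + sg b ?n = sg a (- ?n) + sg b ?n - sg a 1" by (simp add: single_diff)
      then show ?thesis by (metis add_diff_cancel_right' diff_add_cancel)
    qed
    have P2: "e - sg b 1 = sg a (- (?n - 1) - 1) + sg b (?n - 1) \<longleftrightarrow> ?P"
    proof -
      have "sg a (- (?n - 1) - 1) + sg b (?n - 1) = sg a (- ?n) + sg b ?n - sg b 1" by (simp add: single_diff)
      then show ?thesis by (metis add_diff_cancel_right' diff_add_cancel)
    qed
    have g1: "geom c a b (e - sg a 1) = (if ?n \<ge> 0 \<and> ?P then c ^ nat ?n else 0)"
      unfolding geom_def Let_def l P1 ..
    have g2: "geom c a b (e - sg b 1) = (if ?n - 1 \<ge> 0 \<and> ?P then c ^ nat (?n - 1) else 0)"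
      unfolding geom_def Let_def l P2 ..
    have e0: "e = 0 \<longleftrightarrow> ?n = 0 \<and> ?P"
    proof
      assume "?n = 0 \<and> ?P"
      then have "e = sg a (- 0) + sg b 0" by metis
      then show "e = 0" by simp
    qed simp
    have *: "(if n \<ge> 0 \<and> Q then c ^ nat n else 0) - c * (if n - 1 \<ge> 0 \<and> Q then c ^ nat (n - 1) else 0) = (if E then 1 else 0)"
      if "E \<longleftrightarrow> n = 0 \<and> Q" "n \<ge> 1 \<Longrightarrow> c * c ^ nat (n - 1) = c ^ nat n" for E Q and n :: int
      using that by auto
    have cc: "c * c ^ nat (?n - 1) = c ^ nat ?n" if "?n \<ge> 1"
    proof -
      have "nat ?n = Suc (nat (?n - 1))" using that by simp
      then show ?thesis by simp
    qed
    show "poly_times (*) (Var a - Cst c * Var b) (geom c a b) e = lk 1 e"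
      unfolding pt g1 g2 lookup_one when_def by (rule *[OF e0 cc])
  qed
qed

lemma distinct_pairs: "distinct xs \<Longrightarrow> (\<And>a. distinct (ys a)) \<Longrightarrow> distinct (concat (map (\<lambda>a. map (\<lambda>b. (a, b)) (ys a)) xs))"
  by (induction xs) (auto simp: distinct_map inj_on_def)

lemma pairs_list:
  "distinct [(a, b). a \<leftarrow> [0..<L], b \<leftarrow> [Suc a..<L]]" "set [(a, b). a \<leftarrow> [0..<L], b \<leftarrow> [Suc a..<L]] = {(a, b). a < b \<and> b < L}"
proof -
  show "distinct [(a, b). a \<leftarrow> [0..<L], b \<leftarrow> [Suc a..<L]]" by (rule distinct_pairs) auto
  have "set [(a, b). a \<leftarrow> [0..<L], b \<leftarrow> [Suc a..<L]] = Sigma {0..<L} (\<lambda>a. {Suc a..<L})" by auto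
  also have "\<dots> = {(a, b). a < b \<and> b < L}" by auto
  finally show "set [(a, b). a \<leftarrow> [0..<L], b \<leftarrow> [Suc a..<L]] = {(a, b). a < b \<and> b < L}" .
qed

text \<open>The model word together with the factors of the normally ordered product: the
  denominators of f_ii multiply up to z_a^d - z_b^d, and f_ij has none.\<close>

locale current_nop = current_order sc s0 co d x i j cA cB \<alpha> \<beta> ne M hasB k1 k2 k3 M "{..<M}"
  for sc :: "complex fps \<Rightarrow> 'w \<Rightarrow> 'w::ab_group_add"
    and s0 :: "complex \<Rightarrow> 'v \<Rightarrow> 'v::ab_group_add" and co :: "'w \<Rightarrow> nat \<Rightarrow> 'v" and d :: nat
    and x :: "'i \<Rightarrow> int \<Rightarrow> 'w \<Rightarrow> 'w" and i j :: 'i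
    and cA cB :: "complex fps" and \<alpha> \<beta> :: "nat \<Rightarrow> complex fps" and ne M :: nat and hasB :: bool
    and k1 k2 k3 :: "complex fps" +
  fixes T :: "'i datum" and \<epsilon> :: int
  assumes Fii: "\<And>a b. a \<noteq> b \<Longrightarrow> Fpol T \<epsilon> i i (Var a) (Var b) = PT d (insert (a, cA, b) (if hasB then {(a, cB, b)} else {}))"
    and Fij: "\<And>a b. a \<noteq> b \<Longrightarrow> Fpol T \<epsilon> i j (Var a) (Var b) = PT d ((\<lambda>l. (a, \<alpha> l, b)) ` {..<ne})"
    and den: "\<And>a b. (\<Prod>k | k < autord T \<and> 0 < tmat T i i k. Var a - Cst (fps_const (\<xi> T ^ k)) * Var b) = Var a ^ d - Var b ^ d"
    and noden: "\<And>k. tmat T i j k \<le> 0"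
begin

definition ind :: "'i list" where "ind = replicate M i @ [j]"
lemma ind_nth: "a < M \<Longrightarrow> ind ! a = i" "ind ! M = j" "length ind = Suc M"
  by (auto simp: ind_def nth_append)

lemma V_eq: "insert M {..<M} = {..M}" by auto

lemma iota_props:
  assumes ab: "a < b" "b \<le> M"
  shows "sfx M (iota_f T \<epsilon> (ind ! a) (ind ! b) a b)"
    "poly_times (*) (if b < M then Var a ^ d - Var b ^ d else 1) (iota_f T \<epsilon> (ind ! a) (ind ! b) a b) =
       lk (Fpol T \<epsilon> (ind ! a) (ind ! b) (Var a) (Var b))"
    "pv {..M} (Fpol T \<epsilon> (ind ! a) (ind ! b) (Var a) (Var b))"
proof -
  let ?ks = "filter (\<lambda>k. tmat T (ind ! a) (ind ! b) k > 0) [0..<autord T]"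
  let ?q = "Fpol T \<epsilon> (ind ! a) (ind ! b) (Var a) (Var b)"
  have ai: "ind ! a = i" using ab ind_nth by auto
  have q: "pv {..M} ?q"
  proof (cases "b < M")
    case True
    then show ?thesis unfolding ai ind_nth(1)[OF True] using Fii[of a b] ab by (auto intro!: pv_PT)
  next
    case False
    then have "b = M" using ab by simp
    then show ?thesis unfolding ai using ind_nth(2) Fij[of a b] ab by (auto intro!: pv_PT)
  qed
  then show "pv {..M} ?q" .
  have pl: "prod_list (map (\<lambda>k. Var a - Cst (fps_const (\<xi> T ^ k)) * Var b) ?ks) = (if b < M then Var a ^ d - Var b ^ d else 1)"
  proof (cases "b < M")
    case True
    have "set ?ks = {k. k < autord T \<and> 0 < tmat T i i k}" using True ai ind_nth by auto
    then show ?thesis using True den[of a b] prod.distinct_set_conv_list[of ?ks "\<lambda>k. Var a - Cst (fps_const (\<xi> T ^ k)) * Var b"] by simp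
  next
    case False
    then have "b = M" using ab by simp
    then have "?ks = []" using noden ai ind_nth(2) by (simp add: filter_empty_conv not_less)
    then show ?thesis using False by simp
  qed
  have "sfx M (foldr (\<lambda>k. series_times (*) (geom (fps_const (\<xi> T ^ k)) a b)) ?ks (lk ?q)) \<and>
    poly_times (*) (prod_list (map (\<lambda>k. Var a - Cst (fps_const (\<xi> T ^ k)) * Var b) ?ks))
      (foldr (\<lambda>k. series_times (*) (geom (fps_const (\<xi> T ^ k)) a b)) ?ks (lk ?q)) =
    lk (prod_list (map (\<lambda>k. 1) ?ks) * ?q)"
    by (rule foldr_kernel) (use geom_kernel[OF ab] q pv_1 in auto)
  then show "sfx M (iota_f T \<epsilon> (ind ! a) (ind ! b) a b)"
    "poly_times (*) (if b < M then Var a ^ d - Var b ^ d else 1) (iota_f T \<epsilon> (ind ! a) (ind ! b) a b) = lk ?q"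
    unfolding pl iota_f_def by (auto simp: map_replicate_const)
qed

text \<open>Collecting numerators and denominators over all pairs, the kernel is the product of the
  forms of the model word divided by the Vandermonde product.\<close>

lemma kernel: "sfx M (nop_kernel T \<epsilon> ind)" "poly_times (*) (VD d {..<M}) (nop_kernel T \<epsilon> ind) = lk (PT d std_E)"
proof -
  define ps where "ps = [(a, b). a \<leftarrow> [0..<length ind], b \<leftarrow> [Suc a..<length ind]]"
  have ps: "distinct ps" "set ps = {(a, b). a < b \<and> b \<le> M}" using pairs_list[of "length ind"] by (auto simp: ps_def ind_nth(3) simp del: upt_Suc)
  define dn :: "nat \<times> nat \<Rightarrow> lpoly" where "dn p = (if snd p < M then Var (fst p) ^ d - Var (snd p) ^ d else 1)" for p
  define nu where "nu p = Fpol T \<epsilon> (ind ! fst p) (ind ! snd p) (Var (fst p)) (Var (snd p))" for p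
  have fold: "nop_kernel T \<epsilon> ind = foldr (\<lambda>p. series_times (*) (iota_f T \<epsilon> (ind ! fst p) (ind ! snd p) (fst p) (snd p))) ps (lk 1)"
    unfolding nop_kernel_def ps_def case_prod_unfold ..
  have fk: "sfx M (nop_kernel T \<epsilon> ind) \<and> poly_times (*) (prod_list (map dn ps)) (nop_kernel T \<epsilon> ind) = lk (prod_list (map nu ps) * 1)"
    unfolding fold
  proof (rule foldr_kernel)
    fix p assume "p \<in> set ps"
    then have p: "fst p < snd p" "snd p \<le> M" unfolding ps(2) by auto
    show "sfx M (iota_f T \<epsilon> (ind ! fst p) (ind ! snd p) (fst p) (snd p)) \<and>
        poly_times (*) (dn p) (iota_f T \<epsilon> (ind ! fst p) (ind ! snd p) (fst p) (snd p)) = lk (nu p)"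
      unfolding dn_def nu_def using iota_props(1,2)[OF p] by blast
    show "pv {..M} (nu p)" unfolding nu_def by (rule iota_props(3)[OF p])
  qed (rule pv_1)
  then show "sfx M (nop_kernel T \<epsilon> ind)" by blast
  have finS: "finite (set ps)" by simp
  have "prod_list (map dn ps) = prod dn (set ps)" using prod.distinct_set_conv_list[OF ps(1)] by metis
  also have "\<dots> = (\<Prod>p\<in>{(a, b). a \<in> {..<M} \<and> b \<in> {..<M} \<and> a < b}. Var (fst p) ^ d - Var (snd p) ^ d)"
    by (rule prod.mono_neutral_cong_right[OF finS]) (auto simp: ps(2) dn_def)
  finally have d1: "prod_list (map dn ps) = VD d {..<M}" by (simp add: VD_def case_prod_beta)
  define E where "E p = (if snd p < M then insert (fst p, cA, snd p) (if hasB then {(fst p, cB, snd p)} else {}) else (\<lambda>l. (fst p, \<alpha> l, snd p)) ` {..<ne})" for p :: "nat \<times> nat"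
  have nuE: "nu p = PT d (E p)" if "p \<in> set ps" for p
  proof -
    obtain a b where p: "p = (a, b)" "a < b" "b \<le> M" using \<open>p \<in> set ps\<close> ps(2) by auto
    then have ai: "ind ! a = i" using ind_nth by auto
    show ?thesis
    proof (cases "b < M")
      case True then show ?thesis using Fii[of a b] p ai ind_nth by (simp add: nu_def E_def)
    next
      case False then have "b = M" using p by simp
      then show ?thesis using Fij[of a b] p ai ind_nth by (simp add: nu_def E_def)
    qed
  qed
  have "prod_list (map nu ps) = prod nu (set ps)" using prod.distinct_set_conv_list[OF ps(1)] by metis
  also have "\<dots> = (\<Prod>p\<in>set ps. PT d (E p))" using nuE by (rule prod.cong[OF refl])
  also have "\<dots> = PT d (\<Union>p\<in>set ps. E p)"
    by (rule PT_UN[symmetric]) (auto simp: E_def split: if_splits)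
  also have "(\<Union>p\<in>set ps. E p) = std_E"
  proof (rule subset_antisym; rule subsetI)
    fix t assume "t \<in> (\<Union>p\<in>set ps. E p)"
    then obtain a b where p: "a < b" "b \<le> M" "t \<in> E (a, b)" unfolding ps(2) by auto
    then show "t \<in> std_E" by (cases "b < M") (auto simp: E_def std_E_def split: if_splits)
  next
    fix t assume t: "t \<in> std_E"
    obtain a c b where t': "t = (a, c, b)" by (cases t)
    have "(a, b) \<in> set ps \<and> t \<in> E (a, b)" using t unfolding ps(2) by (auto simp: t' std_E_def E_def)
    then show "t \<in> (\<Union>p\<in>set ps. E p)" by blast
  qed
  finally have n1: "prod_list (map nu ps) = PT d std_E" .
  show "poly_times (*) (VD d {..<M}) (nop_kernel T \<epsilon> ind) = lk (PT d std_E)" using fk unfolding d1 n1 by simp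
qed

abbreviation "std \<equiv> [0..<Suc M]"

lemma std_ord: "order std" by (auto simp: order_def)

abbreviation "rst \<equiv> rs {..M}"

lemma currents_rst: "currents x (zip ind [0..<length ind]) v = rst (rc x (wd std) v)"
proof -
  have w: "zip ind [0..<length ind] = wd std"
    by (rule nth_equalityI) (auto simp: ind_nth(3) wd_def ind_nth less_Suc_eq nth_append simp del: upt_Suc)
  have "snd ` set (wd std) = {..M}" by (auto simp: snd_wd)
  then show ?thesis unfolding w by (auto simp: currents_def rs_def rc_def)
qed

lemma pos_std: "t \<le> M \<Longrightarrow> pos std t = t"
  using pos_nth[of std t] by (simp del: upt_Suc)

lemma Sp_rc: "Sp (pos std) (rc x (wd std) v)"
  by (rule PT_Sp[OF ok_EL FDp_rc[OF std_ord] BB_Phi[OF std_ord], of _ 1]) (simp add: Phi_def)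

lemma sfx_sets: "b \<le> M \<Longrightarrow> {y \<in> insert M {..<M}. pos std b \<le> pos std y} = {b..M}"
  using pos_std by auto

lemma Sp_rst: assumes "Sp (pos std) X" shows "Sp (pos std) (rst X)"
proof -
  have "Bd U (rst X)" if "Bd U X" for U using that unfolding Bd_def rs_def by (metis zt_0)
  then show ?thesis using assms unfolding Sp_def by blast
qed

text \<open>For fixed e the kernel bounds the tail degrees of k below, and modulo a power of
  \<open>fps_X\<close> the word of currents bounds them above; \<open>finite_sfx\<close> leaves
  finitely many k.\<close>

lemma nop_sm: "sm (\<lambda>k. sc (nop_kernel T \<epsilon> ind k) (rst (rc x (wd std) v) (e - k))) UNIV" (is "sm ?F UNIV")
  and nop_Sp: "Sp (pos std) (\<lambda>e. series_times sc (nop_kernel T \<epsilon> ind) (rst (rc x (wd std) v)) e)"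
proof -
  let ?S = "nop_kernel T \<epsilon> ind" and ?X = "rst (rc x (wd std) v)"
  obtain c where c: "\<And>k. ?S k \<noteq> 0 \<Longrightarrow> ks k \<subseteq> {..M} \<and> (\<forall>b\<le>M. - c \<le> esum {b..M} k)"
    using kernel(1) unfolding sfx_def by blast
  have bd: "\<exists>N. \<forall>b\<le>M. \<forall>f. esum {b..M} f < N \<longrightarrow> zt p (?X f)" for p
  proof -
    have "Bd {b..M} ?X" if "b \<le> M" for b
      using Sp_rst[OF Sp_rc] that sfx_sets[OF that] unfolding Sp_def by (metis V_eq atMost_iff)
    then have "\<forall>b. \<exists>N. b \<le> M \<longrightarrow> (\<forall>f. esum {b..M} f < N \<longrightarrow> zt p (?X f))" unfolding Bd_def by blast
    then obtain N where N: "\<And>b f. b \<le> M \<Longrightarrow> esum {b..M} f < N b \<Longrightarrow> zt p (?X f)" by metis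
    have "Min (N ` {..M}) \<le> N b" if "b \<le> M" for b using that by (intro Min_le) auto
    then show ?thesis using N by (intro exI[of _ "Min (N ` {..M})"]) force
  qed
  have sm: "sm (\<lambda>k. sc (?S k) (?X (e - k))) UNIV" for e
    unfolding sm_def
  proof
    fix p
    obtain N where N: "\<And>b f. b \<le> M \<Longrightarrow> esum {b..M} f < N \<Longrightarrow> zt p (?X f)" using bd by blast
    define h where "h = Max ((\<lambda>b. esum {b..M} e - N) ` {..M})"
    have hb: "esum {b..M} e - N \<le> h" if "b \<le> M" for b unfolding h_def using that by (intro Max_ge) auto
    have "{k \<in> UNIV. \<not> zt p (sc (?S k) (?X (e - k)))} \<subseteq> {k. ks k \<subseteq> {..M} \<and> (\<forall>b\<le>M. - c \<le> esum {b..M} k \<and> esum {b..M} k \<le> h)}"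
    proof
      fix k assume "k \<in> {k \<in> UNIV. \<not> zt p (sc (?S k) (?X (e - k)))}"
      then have k: "?S k \<noteq> 0" "\<not> zt p (?X (e - k))" using zt_sc by auto
      have "esum {b..M} k \<le> h" if "b \<le> M" for b
      proof -
        have "N \<le> esum {b..M} (e - k)" using N[OF that] k(2) by force
        then show ?thesis using hb[OF that] by (simp add: esum_diff)
      qed
      then show "k \<in> {k. ks k \<subseteq> {..M} \<and> (\<forall>b\<le>M. - c \<le> esum {b..M} k \<and> esum {b..M} k \<le> h)}" using c[OF k(1)] by blast
    qed
    then show "finite {k \<in> UNIV. \<not> zt p (sc (?S k) (?X (e - k)))}" using finite_sfx finite_subset by blast
  qed
  then show "sm ?F UNIV" .
  show "Sp (pos std) (\<lambda>e. series_times sc ?S ?X e)"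
    unfolding Sp_def
  proof
    fix b assume "b \<in> insert M {..<M}"
    then have b: "b \<le> M" by auto
    show "Bd {y \<in> insert M {..<M}. pos std b \<le> pos std y} (\<lambda>e. series_times sc ?S ?X e)"
      unfolding sfx_sets[OF b] Bd_def
    proof
      fix p
      obtain N where N: "\<And>b f. b \<le> M \<Longrightarrow> esum {b..M} f < N \<Longrightarrow> zt p (?X f)" using bd by blast
      have "zt p (series_times sc ?S ?X e)" if e: "esum {b..M} e < N - c" for e
        unfolding series_times_def
      proof (rule zt_hsum[OF sm])
        fix k
        show "zt p (sc (?S k) (?X (e - k)))"
        proof (cases "?S k = 0")
          case False
          then have "- c \<le> esum {b..M} k" using c b by blast
          then have "zt p (?X (e - k))" using N[OF b] e by (simp add: esum_diff)
          then show ?thesis by (rule zt_sc)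
        qed simp
      qed
      then show "\<exists>N. \<forall>e. esum {b..M} e < N \<longrightarrow> zt p (series_times sc ?S ?X e)" by blast
    qed
  qed
qed

text \<open>Multiplied by the Vandermonde product, both sides become the restricted model series.
  Both decay in the standard order, so the product can be cancelled.\<close>

lemma nop_Psi:
  assumes P: "BB \<Psi>" "std_Phi v = VD d {..<M} \<bullet> \<Psi>"
  shows "nop T \<epsilon> sc x ind v = rst \<Psi>"
proof -
  let ?N = "nop T \<epsilon> sc x ind v"
  have pvE: "pv {..M} (PT d std_E)"
  proof (rule pv_PT)
    show "finite std_E" using fin_EL std_Phi_eq
    proof -
      have "std_E \<subseteq> {..M} \<times> ({cA, cB} \<union> \<alpha> ` {..<ne}) \<times> {..M}" by (auto simp: std_E_def)
      then show ?thesis by (rule finite_subset) auto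
    qed
  qed (auto simp: std_E_def)
  have pvV: "pv {..M} (VD d {..<M})" unfolding VD_PT by (rule pv_PT[OF fin_VE]) (auto simp: VE_def)
  have N: "?N = series_times sc (nop_kernel T \<epsilon> ind) (rst (rc x (wd std) v))"
    unfolding nop_def currents_rst ..
  have "VD d {..<M} \<bullet> ?N = PT d std_E \<bullet> rst (rc x (wd std) v)"
    unfolding N st_assoc[OF nop_sm] kernel(2) st_lookup ..
  also have "\<dots> = rst (std_Phi v)" unfolding rs_pt[OF pvE] std_Phi_def wd_def ..
  also have "\<dots> = VD d {..<M} \<bullet> rst \<Psi>" unfolding P(2) rs_pt[OF pvV] ..
  finally have eq: "PT d VE \<bullet> ?N = PT d VE \<bullet> rst \<Psi>" unfolding VD_PT .
  have ok: "ok (pos std) VE" unfolding ok_def using fin_VE pos_std by (auto simp: VE_def simp del: upt_Suc)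
  show ?thesis
  proof (rule PT_inj[OF ok _ _ eq])
    show "FDp (pos std) ?N" unfolding N by (rule Sp_FDp[OF nop_Sp])
    show "FDp (pos std) (rst \<Psi>)" by (rule Sp_FDp[OF Sp_rst[OF BB_Sp[OF P(1)]]])
  qed
qed

text \<open>A translation in the variables above M does not change the word of currents, and \<Psi>
  is determined by it through injectivity of the Vandermonde product.\<close>

lemma Psi_local:
  assumes P: "BB \<Psi>" "std_Phi v = VD d {..<M} \<bullet> \<Psi>" and k: "\<And>a. a \<le> M \<Longrightarrow> lk k a = 0"
  shows "\<Psi> (e + k) = \<Psi> e"
proof -
  define X where "X e = \<Psi> (e + k)" for e
  have sh: "(p \<bullet> (\<lambda>e. Y (e + k))) e = (p \<bullet> Y) (e + k)" for p Y e
    by (simp add: poly_times_def algebra_simps)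
  have "std_Phi v (e + k) = std_Phi v e" for e
  proof -
    have "rc x (wd std) v (f + k) = rc x (wd std) v f" for f
      by (rule rc_cong) (auto simp: snd_wd lookup_add k)
    then have "(\<lambda>e. rc x (wd std) v (e + k)) = rc x (wd std) v" by blast
    then show ?thesis using sh[of "PT d std_E" "rc x (wd std) v" e] unfolding std_Phi_def wd_def by simp
  qed
  then have "VD d {..<M} \<bullet> X = VD d {..<M} \<bullet> \<Psi>" unfolding X_def using sh[of "VD d {..<M}" \<Psi>] P(2) by auto
  then have eq: "PT d VE \<bullet> X = PT d VE \<bullet> \<Psi>" unfolding VD_PT .
  have ok: "ok (pos std) VE" unfolding ok_def using fin_VE pos_std by (auto simp: VE_def simp del: upt_Suc)
  have "BB X" unfolding BB_def
  proof (intro conjI ballI allI impI)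
    fix y assume y: "y \<in> insert M {..<M}"
    have "esum {y} (f + k) = esum {y} f" for f using y k[of y] by (auto simp: esum_single lookup_add)
    then show "Bd {y} X" using P(1) y unfolding BB_def Bd_def X_def by metis
  next
    fix e a assume "X e \<noteq> 0" "a \<in> {..<M}"
    then have "int d dvd lk (e + k) a" "a \<le> M" using P(1) unfolding BB_def X_def by auto
    then show "int d dvd lk e a" by (simp add: lookup_add k)
  qed
  then have "X = \<Psi>" using PT_inj[OF ok _ _ eq] Sp_FDp BB_Sp P(1) by blast
  then show ?thesis unfolding X_def by metis
qed

text \<open>In \<Psi> the exponents of z_a for a < M are multiples of d, so substituting a multiple
  of w for z_a only involves the d-th power of the factor, which is u a.\<close>

theorem nop_van:
  assumes cs: "length cs = Suc M" "cs ! M = 1" "\<And>t. t < M \<Longrightarrow> unit0 (cs ! t)" "\<And>t. t < M \<Longrightarrow> (cs ! t) ^ d = u t" "u M = 1"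
    and ui: "inj_on u {..<M}" and uu: "\<And>t. unit0 (u t)"
  shows "(\<forall>n. subst_coeff sc cs (nop T \<epsilon> sc x ind v) n = 0) \<longleftrightarrow> van {..M} u (std_Phi v)"
proof -
  obtain \<Psi> where P: "BB \<Psi>" "Phi std v = VD d {..<M} \<bullet> \<Psi>" using psi_ex[OF std_ord] by blast
  have P': "std_Phi v = VD d {..<M} \<bullet> \<Psi>" using P(2) unfolding std_Phi_eq .
  have vP: "van {..M} u (std_Phi v) \<longleftrightarrow> van {..M} u \<Psi>"
  proof -
    have "{..M} \<inter> {..<M} = {..<M}" "{..M} \<subseteq> insert M {..<M}" by auto
    then show ?thesis using van_Psi[OF std_ord std_ord P, of "{..M}" u] uu ui unfolding std_Phi_eq by auto
  qed
  have sub: "subst_coeff sc cs (nop T \<epsilon> sc x ind v) n = subs {..M} u \<Psi> 0 n" for n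
  proof -
    have set: "{e. ks e \<subseteq> {..<length cs} \<and> (\<Sum>a<length cs. lk e a) = n} = sl {..M} 0 n"
      unfolding cs(1) sl_def esum_def lessThan_Suc_atMost by (auto simp: in_keys_iff subset_iff)
    have "sc (\<Prod>a<length cs. (cs ! a) powi lk e a) (rst \<Psi> e) = sc (wt u {..M} e) (\<Psi> e)" if e: "e \<in> sl {..M} 0 n" for e
    proof (cases "\<Psi> e = 0")
      case True then show ?thesis by (simp add: rs_def)
    next
      case False
      have k: "ks e \<subseteq> {..M}" using e by (auto simp: sl_def in_keys_iff)
      have "(\<Prod>a<length cs. (cs ! a) powi lk e a) = wt u {..M} e"
        unfolding wt_def cs(1) lessThan_Suc_atMost
      proof (rule prod.cong[OF refl])
        fix a assume a: "a \<in> {..M}"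
        show "(cs ! a) powi lk e a = ipw (u a) (lk e a div int d)"
        proof (cases "a = M")
          case True then show ?thesis using cs by (simp add: ipw_def power_int_def)
        next
          case False
          then have aM: "a < M" using a by simp
          have "int d dvd lk e a" using P(1) \<open>\<Psi> e \<noteq> 0\<close> aM unfolding BB_def by blast
          then obtain q where q: "lk e a = int d * q" by blast
          have "lk e a div int d = q" using q d_pos by simp
          moreover have "(cs ! a) powi (int d * q) = ipw (u a) q"
          proof (cases "q \<ge> 0")
            case True
            then obtain n where "q = int n" by (metis nonneg_int_cases)
            then show ?thesis using cs(4)[OF aM] by (simp add: ipw_def power_int_def nat_mult_distrib power_mult)
          next
            case False
            then obtain n where n: "q = - int n" "n > 0" by (metis int_cases4 less_imp_of_nat_less linorder_not_less neg_int_cases zero_le_imp_eq_int)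
            then have "int d * q < 0" using d_pos by (intro mult_pos_neg) auto
            then have "\<not> 0 \<le> int d * q" by simp
            moreover have "nat (- (int d * q)) = d * n" using n by (simp add: nat_mult_distrib)
            ultimately show ?thesis using cs(4)[OF aM] n
              by (simp add: ipw_def power_int_def power_mult fps_inverse_power[symmetric])
          qed
          ultimately show ?thesis using q by simp
        qed
      qed
      then show ?thesis using k by (simp add: rs_def)
    qed
    then show ?thesis unfolding subst_coeff_def nop_Psi[OF P(1) P'] subs_def set by (rule hsum_cong)
  qed
  \<comment> \<open>\<open>van\<close> ranges over all exponents outside the cluster, the
    substitution in the theorem only over 0. By \<open>Psi_local\<close> this makes no
    difference.\<close>
  have loc: "subs {..M} u \<Psi> \<kappa> n = subs {..M} u \<Psi> 0 n" for \<kappa> n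
  proof -
    define k where "k = \<kappa> - (\<Sum>a\<le>M. sg a (lk \<kappa> a))"
    have lk: "lk k a = (if a \<le> M then 0 else lk \<kappa> a)" for a
      by (auto simp: k_def lookup_minus lookup_sum lookup_single when_def)
    have bij: "bij_betw (\<lambda>e. e + k) (sl {..M} 0 n) (sl {..M} \<kappa> n)"
      by (rule bij_betwI[of _ _ _ "\<lambda>e. e - k"]) (auto simp: sl_def lookup_add lookup_minus lk esum_def)
    have "wt u {..M} (e + k) = wt u {..M} e" for e unfolding wt_def by (intro prod.cong) (auto simp: lookup_add lk)
    moreover have "\<Psi> (e + k) = \<Psi> e" for e by (rule Psi_local[OF P(1) P']) (simp add: lk)
    moreover have "sm (\<lambda>e. sc (wt u {..M} e) (\<Psi> e)) (sl {..M} \<kappa> n)" by (rule subs_sm[OF P(1)]) auto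
    ultimately show ?thesis using hsum_reindex(2)[OF bij, of "\<lambda>e. sc (wt u {..M} e) (\<Psi> e)"] unfolding subs_def by simp
  qed
  have "van {..M} u \<Psi> \<longleftrightarrow> (\<forall>n. subs {..M} u \<Psi> 0 n = 0)" unfolding van_def using loc by metis
  then show ?thesis unfolding sub vP by blast
qed

end

subsection \<open>The Cartan datum\<close>

lemma prim_root_pow: "prim_root n ^ k = cis (2 * pi * real k / real n)"
proof -
  have "prim_root n = cis (2 * pi / real n)"
    unfolding prim_root_def cis_conv_exp by (simp add: mult_ac)
  then show ?thesis by (simp add: DeMoivre mult_ac)
qed

lemma prim_root_inj: "0 < n \<Longrightarrow> inj_on (\<lambda>k. prim_root n ^ k) {..<n}"
  using bij_betw_roots_unity[of n] unfolding bij_betw_def prim_root_pow by simp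

lemma prim_root_n: "0 < n \<Longrightarrow> prim_root n ^ n = 1"
  by (simp add: prim_root_pow)

lemma prim_root_1_iff: assumes "0 < n" shows "prim_root n ^ k = 1 \<longleftrightarrow> n dvd k"
proof -
  have "prim_root n ^ k = (prim_root n ^ n) ^ (k div n) * prim_root n ^ (k mod n)"
    by (simp add: power_mult[symmetric] power_add[symmetric])
  then have "prim_root n ^ k = prim_root n ^ (k mod n)" using prim_root_n[OF assms] by simp
  also have "\<dots> = 1 \<longleftrightarrow> k mod n = 0"
    using prim_root_inj[OF assms] assms by (auto dest!: inj_onD[of _ _ "k mod n" 0])
  finally show ?thesis by (simp add: dvd_eq_mod_eq_0)
qed

lemma prim_root_div: assumes "0 < n" "d dvd n" shows "prim_root n ^ d = prim_root (n div d)"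
proof -
  obtain e where e: "n = d * e" using assms(2) by blast
  have "prim_root (n div d) = prim_root (n div d) ^ 1" by simp
  then show ?thesis unfolding prim_root_pow using assms(1) by (simp add: e field_simps)
qed

lemma prim_root_nz: "prim_root n \<noteq> 0" by (simp add: prim_root_def)

text \<open>The homogenization of p in z and y with degree n. It carries factorizations over the
  complex numbers to Laurent polynomials.\<close>

definition hmg :: "lpoly \<Rightarrow> lpoly \<Rightarrow> nat \<Rightarrow> complex poly \<Rightarrow> lpoly" where
  "hmg z y n p = (\<Sum>j\<le>n. Cst (fps_const (coeff p j)) * z ^ j * y ^ (n - j))"

lemma hmg_add: "hmg z y n (p + q) = hmg z y n p + hmg z y n q"
  unfolding hmg_def by (simp only: coeff_add fps_const_add[symmetric] Cst_add distrib_right sum.distrib)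

lemma hmg_prod:
  assumes "finite K"
  shows "hmg z y (card K) (\<Prod>k\<in>K. [:- s k, 1:]) = (\<Prod>k\<in>K. z - Cst (fps_const (s k)) * y) \<and> degree (\<Prod>k\<in>K. [:- s k, 1:]) \<le> card K"
  using assms
proof (induction K rule: finite_induct)
  case (insert k K)
  let ?p = "\<Prod>k\<in>K. [:- s k, 1:]" and ?n = "card K"
  have ih: "hmg z y ?n ?p = (\<Prod>k\<in>K. z - Cst (fps_const (s k)) * y)" "degree ?p \<le> ?n" using insert.IH by auto
  have pr: "(\<Prod>k\<in>insert k K. [:- s k, 1:]) = smult (- s k) ?p + pCons 0 ?p" using insert.hyps by simp
  have c: "coeff ?p (Suc ?n) = 0" using ih(2) by (intro coeff_eq_0) simp
  have 1: "hmg z y (Suc ?n) (smult (- s k) ?p) = - Cst (fps_const (s k)) * y * hmg z y ?n ?p"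
  proof -
    have "hmg z y (Suc ?n) (smult (- s k) ?p) = (\<Sum>j\<le>?n. Cst (fps_const (- s k * coeff ?p j)) * z ^ j * y ^ (Suc ?n - j))"
      by (simp add: hmg_def c)
    also have "\<dots> = (\<Sum>j\<le>?n. - Cst (fps_const (s k)) * y * (Cst (fps_const (coeff ?p j)) * z ^ j * y ^ (?n - j)))"
    proof (rule sum.cong[OF refl])
      fix j assume j: "j \<in> {..?n}"
      then have e: "y ^ (Suc ?n - j) = y * y ^ (?n - j)" by (simp add: Suc_diff_le)
      have f: "Cst (fps_const (- s k * coeff ?p j)) = - Cst (fps_const (s k)) * Cst (fps_const (coeff ?p j))"
        by (simp add: Cst_mult[symmetric] Cst_uminus[symmetric])
      show "Cst (fps_const (- s k * coeff ?p j)) * z ^ j * y ^ (Suc ?n - j) = - Cst (fps_const (s k)) * y * (Cst (fps_const (coeff ?p j)) * z ^ j * y ^ (?n - j))"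
        unfolding e f by (simp add: mult_ac)
    qed
    finally show ?thesis by (simp add: hmg_def sum_distrib_left)
  qed
  have 2: "hmg z y (Suc ?n) (pCons 0 ?p) = z * hmg z y ?n ?p"
    unfolding hmg_def sum_distrib_left by (subst sum.atMost_Suc_shift) (simp add: mult_ac)
  have "hmg z y (Suc ?n) (smult (- s k) ?p + pCons 0 ?p) = hmg z y (Suc ?n) (smult (- s k) ?p) + hmg z y (Suc ?n) (pCons 0 ?p)"
    by (rule hmg_add)
  also have "\<dots> = (z - Cst (fps_const (s k)) * y) * hmg z y ?n ?p" unfolding 1 2 by (simp add: algebra_simps)
  finally have "hmg z y (card (insert k K)) (\<Prod>k\<in>insert k K. [:- s k, 1:]) = (\<Prod>k\<in>insert k K. z - Cst (fps_const (s k)) * y)"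
    unfolding pr using insert.hyps ih(1) by simp
  moreover have "degree (\<Prod>k\<in>insert k K. [:- s k, 1:]) \<le> card (insert k K)"
    using insert.hyps by (subst degree_prod_eq_sum_degree) auto
  ultimately show ?case by blast
qed (simp add: hmg_def)

text \<open>Two monic polynomials of degree n with the same n distinct roots agree: their difference
  has smaller degree. The claim is the homogenized factorization of X^n - \<omega>.\<close>

lemma prod_roots:
  assumes K: "finite K" "card K = n" "0 < n" "inj_on s K" "\<And>k. k \<in> K \<Longrightarrow> s k ^ n = \<omega>"
  shows "(\<Prod>k\<in>K. z - Cst (fps_const (s k)) * y) = z ^ n - Cst (fps_const \<omega>) * y ^ n"
proof -
  let ?P = "\<Prod>k\<in>K. [:- s k, 1:]"
  define D where "D = ?P - (monom 1 n - [:\<omega>:])"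
  have dP: "degree ?P = n" using degree_prod_eq_sum_degree[of K "\<lambda>k. [:- s k, 1:]"] K(2) by simp
  have "lead_coeff ?P = 1" by (simp add: lead_coeff_prod)
  then have cP: "coeff ?P n = 1" using dP by simp
  have "coeff (monom 1 n - [:\<omega>:]) n = 1" using K(3) by (cases n) auto
  then have cD: "coeff D n = 0" using cP by (simp add: D_def)
  have dD: "degree D \<le> n" unfolding D_def using dP
    by (intro degree_diff_le order_trans[OF degree_monom_le]) auto
  have "D = 0"
  proof (rule ccontr)
    assume D0: "D \<noteq> 0"
    have "degree D \<noteq> n" using cD D0 by (metis leading_coeff_0_iff)
    then have lt: "degree D < n" using dD by simp
    have "s ` K \<subseteq> {x. poly D x = 0}"
    proof
      fix a assume "a \<in> s ` K"
      then obtain k where k: "k \<in> K" "a = s k" by blast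
      have "poly ?P (s k) = 0" using k K(1) by (auto simp: poly_prod prod_zero_iff)
      then show "a \<in> {x. poly D x = 0}" using K(5)[OF k(1)] k(2) by (simp add: D_def poly_monom)
    qed
    then have "card (s ` K) \<le> card {x. poly D x = 0}" by (rule card_mono[OF poly_roots_finite[OF D0]])
    also have "\<dots> \<le> degree D" using D0 by (rule card_poly_roots_bound)
    finally show False using lt K(2,4) by (simp add: card_image)
  qed
  then have P: "?P = monom 1 n - [:\<omega>:]" by (simp add: D_def)
  have "(\<Prod>k\<in>K. z - Cst (fps_const (s k)) * y) = hmg z y n (monom 1 n - [:\<omega>:])"
    using hmg_prod[OF K(1), of z y s] K(2) P by simp
  also have "\<dots> = z ^ n - Cst (fps_const \<omega>) * y ^ n"
  proof -
    obtain n' where n': "n = Suc n'" using K(3) by (cases n) auto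
    have c: "coeff (monom 1 n - [:\<omega>:]) j = (if j = n then 1 else if j = 0 then - \<omega> else 0)" for j
      unfolding n' by (cases j) simp_all
    have "hmg z y n (monom 1 n - [:\<omega>:]) = (\<Sum>j\<le>n. (if j = n then z ^ n else 0) + (if j = 0 then - Cst (fps_const \<omega>) * y ^ n else 0))"
      unfolding hmg_def
    proof (rule sum.cong[OF refl])
      fix j
      consider "j = n" | "j = 0" "j \<noteq> n" | "j \<noteq> n" "j \<noteq> 0" by blast
      then show "Cst (fps_const (coeff (monom 1 n - [:\<omega>:]) j)) * z ^ j * y ^ (n - j) =
          (if j = n then z ^ n else 0) + (if j = 0 then - Cst (fps_const \<omega>) * y ^ n else 0)"
        unfolding c using K(3) by cases (simp_all add: Cst_uminus[symmetric])
    qed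
    then show ?thesis by (simp add: sum.distrib)
  qed
  finally show ?thesis .
qed

text \<open>The series c * exp(s * h). All constants of the graph have this form, and for nonzero c
  both c and s can be recovered, which reduces products equal to 1 to linear equations between
  exponents.\<close>

definition qc :: "complex \<Rightarrow> complex \<Rightarrow> complex fps" where "qc c s = fps_const c * fps_exp s"

lemma qc_mult: "qc c s * qc c' s' = qc (c * c') (s + s')"
  unfolding qc_def fps_exp_add_mult fps_const_mult[symmetric] by (simp only: mult_ac)
lemma qc_power: "qc c s ^ n = qc (c ^ n) (of_nat n * s)"
  by (simp add: qc_def power_mult_distrib fps_const_power fps_exp_power_mult)
lemma qc_nth0: "fps_nth (qc c s) 0 = c" by (simp add: qc_def)
lemma qc_1: "qc 1 0 = 1" by (simp add: qc_def)
lemma qc_inj: assumes "qc c s = qc c' s'" "c \<noteq> 0" shows "c = c' \<and> s = s'"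
proof -
  have "c = c'" using arg_cong[OF assms(1), of "\<lambda>f. fps_nth f 0"] by (simp add: qc_nth0)
  moreover have "c * s = c' * s'" using arg_cong[OF assms(1), of "\<lambda>f. fps_nth f 1"] by (simp add: qc_def)
  ultimately show ?thesis using assms(2) by simp
qed
lemma qpow_qc: "qpow T i s = qc 1 (of_int (sym T i) * s)" by (simp add: qpow_def qc_def)

locale cartan =
  fixes T :: "'i::finite datum"
  assumes cd: "cartan_datum T"
begin

abbreviation "\<mu> \<equiv> aut T"
abbreviation "N \<equiv> autord T"

lemma bij_\<mu>: "bij \<mu>" using cd by (simp add: cartan_datum_def)
lemma bij_pow: "bij (\<mu> ^^ n)" using bij_\<mu> by (rule bij_betw_funpow)
lemma inj_pow: "(\<mu> ^^ n) a = (\<mu> ^^ n) b \<longleftrightarrow> a = b" using bij_pow[of n] by (meson bij_is_inj inj_eq)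

lemma N_props: "0 < N" "\<mu> ^^ N = id"
proof -
  have "\<not> inj (\<lambda>n. \<mu> ^^ n)" using finite_imageD[of "\<lambda>n. \<mu> ^^ n" UNIV] finite_subset[OF subset_UNIV] by (metis finite infinite_UNIV_nat)
  then obtain k l where kl: "\<mu> ^^ k = \<mu> ^^ l" "k < l" unfolding inj_def by (metis linorder_neqE_nat)
  have "(\<mu> ^^ k) ((\<mu> ^^ (l - k)) a) = (\<mu> ^^ k) a" for a using kl by (metis comp_apply funpow_add le_add_diff_inverse less_imp_le)
  then have "\<mu> ^^ (l - k) = id" unfolding inj_pow by (simp add: fun_eq_iff)
  then obtain n where "\<mu> ^^ n = id" "0 < n" using kl(2) by (metis zero_less_diff)
  then have "0 < N \<and> \<mu> ^^ N = id" unfolding autord_def using LeastI[of "\<lambda>n. 0 < n \<and> \<mu> ^^ n = id" n] by simp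
  then show "0 < N" "\<mu> ^^ N = id" by auto
qed

lemma pow_mod: "\<mu> ^^ (k mod N) = \<mu> ^^ k"
proof -
  have "(\<mu> ^^ N) ^^ q = id" for q using N_props(2) by (induction q) auto
  then have "\<mu> ^^ (k mod N) \<circ> (\<mu> ^^ N) ^^ (k div N) = \<mu> ^^ (k mod N)" by (metis comp_id)
  moreover have "\<mu> ^^ (k mod N) \<circ> (\<mu> ^^ N) ^^ (k div N) = \<mu> ^^ (k mod N + N * (k div N))" by (simp only: funpow_add funpow_mult)
  moreover have "k mod N + N * (k div N) = k" by simp
  ultimately show ?thesis by metis
qed

lemma cm_pow: "cmat T ((\<mu> ^^ n) a) ((\<mu> ^^ n) b) = cmat T a b" "sym T ((\<mu> ^^ n) a) = sym T a"
  using cd by (induction n) (auto simp: cartan_datum_def)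

text \<open>The size of the orbit, introduced as a minimal period so that powers of \<mu> can be
  compared by remainders.\<close>

definition per :: "'i \<Rightarrow> nat" where "per i = (LEAST n. 0 < n \<and> (\<mu> ^^ n) i = i)"

lemma per: "0 < per i" "(\<mu> ^^ per i) i = i"
  using LeastI[of "\<lambda>n. 0 < n \<and> (\<mu> ^^ n) i = i" N] N_props by (auto simp: per_def)

lemma per_le: "0 < n \<Longrightarrow> (\<mu> ^^ n) i = i \<Longrightarrow> per i \<le> n"
  unfolding per_def by (rule Least_le) auto

lemma per_mod: "(\<mu> ^^ (k mod per i)) i = (\<mu> ^^ k) i"
proof -
  have p: "((\<mu> ^^ per i) ^^ q) i = i" for q using per(2) by (induction q) auto
  have "(\<mu> ^^ k) i = (\<mu> ^^ (k mod per i + per i * (k div per i))) i" by simp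
  also have "\<dots> = (\<mu> ^^ (k mod per i)) (((\<mu> ^^ per i) ^^ (k div per i)) i)" by (simp only: funpow_add funpow_mult o_apply)
  finally show ?thesis using p by simp
qed

lemma pow_eq_iff: "(\<mu> ^^ k) i = (\<mu> ^^ l) i \<longleftrightarrow> k mod per i = l mod per i"
proof -
  have lt: "k = l" if "k \<le> l" "l < per i" "(\<mu> ^^ k) i = (\<mu> ^^ l) i" for k l
  proof (rule ccontr)
    assume "k \<noteq> l"
    have "(\<mu> ^^ k) i = (\<mu> ^^ k) ((\<mu> ^^ (l - k)) i)" using that by (metis comp_apply funpow_add le_add_diff_inverse)
    then have "(\<mu> ^^ (l - k)) i = i" by (simp add: inj_pow)
    then show False using per_le[of "l - k" i] \<open>k \<noteq> l\<close> that by simp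
  qed
  have "k mod per i < per i" "l mod per i < per i" using per(1) by auto
  then have "(\<mu> ^^ (k mod per i)) i = (\<mu> ^^ (l mod per i)) i \<longleftrightarrow> k mod per i = l mod per i"
    using lt[of "k mod per i" "l mod per i"] lt[of "l mod per i" "k mod per i"] by (metis linear)
  then show ?thesis by (simp add: per_mod)
qed

lemma orb_eq: "orb T i = (\<lambda>k. (\<mu> ^^ k) i) ` {..<per i}"
proof -
  have "orb T i = {(\<mu> ^^ n) i | n. 0 < n}" unfolding orb_def by (rule orbit_altdef)
  also have "\<dots> = (\<lambda>k. (\<mu> ^^ k) i) ` {..<per i}"
  proof (rule subset_antisym; rule subsetI)
    fix p assume "p \<in> {(\<mu> ^^ n) i | n. 0 < n}"
    then obtain n where "p = (\<mu> ^^ (n mod per i)) i" by (auto simp: per_mod)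
    then show "p \<in> (\<lambda>k. (\<mu> ^^ k) i) ` {..<per i}" using per(1) by auto
  next
    fix p assume "p \<in> (\<lambda>k. (\<mu> ^^ k) i) ` {..<per i}"
    then obtain k where k: "p = (\<mu> ^^ k) i" by blast
    have "p = (\<mu> ^^ (k + per i)) i" unfolding k pow_eq_iff by simp
    then show "p \<in> {(\<mu> ^^ n) i | n. 0 < n}" using per(1) by blast
  qed
  finally show ?thesis .
qed

lemma orbsize: "orbsize T i = per i"
  unfolding orbsize_def orb_eq by (subst card_image) (auto simp: inj_on_def pow_eq_iff)

lemma per_dvd: "per i dvd N"
proof -
  have "(\<mu> ^^ N) i = (\<mu> ^^ 0) i" using N_props(2) by simp
  then show ?thesis unfolding pow_eq_iff by (simp add: dvd_eq_mod_eq_0)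
qed

lemma dnum: "N = per i * dnum T i" "0 < dnum T i"
  using per_dvd[of i] N_props(1) per(1)[of i] by (auto simp: dnum_def orbsize div_greater_zero_iff dvd_imp_le)

lemma pow_in_orb: "(\<mu> ^^ k) i \<in> orb T i"
proof -
  have "(\<mu> ^^ k) i = (\<mu> ^^ (k mod per i)) i" by (simp add: per_mod)
  then show ?thesis unfolding orb_eq using per(1) by auto
qed

lemma self_orb: "i \<in> orb T i" using pow_in_orb[of 0 i] by simp

text \<open>The class consists of r + per i * t for t < d_i. Because N = per i * d_i, the powers of
  \<xi> at these numbers are exactly the d_i-th roots of \<xi>^(r d_i).\<close>

lemma class_prod:
  assumes r: "r < per i"
  shows "(\<Prod>k | k < N \<and> k mod per i = r. z - Cst (fps_const (\<xi> T ^ k)) * y) =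
    z ^ dnum T i - Cst (fps_const (\<xi> T ^ (r * dnum T i))) * y ^ dnum T i"
proof (rule prod_roots[OF _ _ dnum(2)])
  let ?K = "{k. k < N \<and> k mod per i = r}"
  have K: "?K = (\<lambda>t. r + per i * t) ` {..<dnum T i}"
  proof (rule subset_antisym; rule subsetI)
    fix k assume "k \<in> ?K"
    then have k: "k < per i * dnum T i" "k = r + per i * (k div per i)" using dnum(1)[of i] mult_div_mod_eq[of "per i" k] by auto
    then have "k div per i < dnum T i" by (simp add: less_mult_imp_div_less mult.commute)
    then show "k \<in> (\<lambda>t. r + per i * t) ` {..<dnum T i}" using k(2) by blast
  next
    fix k assume "k \<in> (\<lambda>t. r + per i * t) ` {..<dnum T i}"
    then obtain t where t: "k = r + per i * t" "t < dnum T i" by blast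
    have "per i * t + per i \<le> per i * dnum T i" using t(2) by (metis Suc_leI mult_Suc_right add.commute mult_le_mono2)
    then show "k \<in> ?K" using r t dnum(1)[of i] by auto
  qed
  show "finite ?K" by simp
  show "card ?K = dnum T i" unfolding K using per(1)[of i] by (subst card_image) (auto simp: inj_on_def)
  show "inj_on (\<lambda>k. \<xi> T ^ k) ?K" by (rule inj_on_subset[OF prim_root_inj[OF N_props(1)]]) auto
  fix k assume "k \<in> ?K"
  then obtain t where t: "k = r + per i * t" unfolding K by blast
  have "k * dnum T i = r * dnum T i + N * t" using t dnum(1)[of i] by (simp add: algebra_simps)
  then have "\<xi> T ^ (k * dnum T i) = \<xi> T ^ (r * dnum T i) * (\<xi> T ^ N) ^ t" by (simp add: power_add power_mult)
  then show "(\<xi> T ^ k) ^ dnum T i = \<xi> T ^ (r * dnum T i)" using prim_root_n[OF N_props(1)] by (simp add: power_mult)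
qed

lemma tmat_diag: "tmat T i i k = 2 \<longleftrightarrow> k mod per i = 0" "tmat T i i k \<le> 0 \<or> tmat T i i k = 2"
proof -
  have gc: "cmat T a a = 2" "a \<noteq> b \<Longrightarrow> cmat T a b \<le> 0" for a b
    using cd by (auto simp: cartan_datum_def gen_cartan_matrix_def)
  have "(\<mu> ^^ k) i = i \<longleftrightarrow> k mod per i = 0" using pow_eq_iff[of k i 0] by simp
  then show "tmat T i i k = 2 \<longleftrightarrow> k mod per i = 0" "tmat T i i k \<le> 0 \<or> tmat T i i k = 2"
    unfolding tmat_def using gc by (metis not_numeral_le_zero)+
qed

lemma den_prod:
  "(\<Prod>k | k < N \<and> 0 < tmat T i i k. Var a - Cst (fps_const (\<xi> T ^ k)) * Var b) = Var a ^ dnum T i - Var b ^ dnum T i"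
proof -
  have "0 < tmat T i i k \<longleftrightarrow> k mod per i = 0" for k using tmat_diag[of i k] by auto
  then have "{k. k < N \<and> 0 < tmat T i i k} = {k. k < N \<and> k mod per i = 0}" by simp
  then show ?thesis using class_prod[OF per(1), of "Var a" "Var b"] by simp
qed

text \<open>In the A_2 case the power of \<mu> that takes i to its partner takes the partner back to
  i, so the period is 2 r. In the other case an entry off the diagonal that is nonzero would have to
  be -1 and the only one, because the sum in (LC1) is positive; translated along the orbit, this
  would give an A_2 orbit.\<close>

lemma orb_case:
  assumes "LC1 T"
  shows "(snum T i \<noteq> 2 \<and> (\<forall>k. tmat T i i k \<noteq> 0 \<longrightarrow> k mod per i = 0)) \<or>
    (snum T i = 2 \<and> (\<exists>r. 0 < r \<and> per i = 2 * r \<and> (\<forall>k. tmat T i i k = (if k mod per i = 0 then 2 else if k mod per i = r then -1 else 0))))"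
proof (cases "orb_A2 T i")
  case True
  then obtain p where p: "p \<in> orb T i" "p \<noteq> i" "cmat T i p = -1" "\<And>p''. p'' \<in> orb T i \<Longrightarrow> p'' \<noteq> i \<Longrightarrow> p'' \<noteq> p \<Longrightarrow> cmat T i p'' = 0"
    unfolding orb_A2_def using self_orb[of i] by blast
  obtain r where r: "r < per i" "p = (\<mu> ^^ r) i" using p(1) unfolding orb_eq by auto
  have r0: "0 < r" using r p(2) by (cases r) auto
  obtain p' where p': "p' \<in> orb T i" "cmat T p p' = -1" "\<And>p''. p'' \<in> orb T i \<Longrightarrow> p'' \<noteq> p \<Longrightarrow> p'' \<noteq> p' \<Longrightarrow> cmat T p p'' = 0"
    using True p(1) unfolding orb_A2_def by blast
  have s: "sym T p = sym T i" unfolding r(2) by (rule cm_pow(2))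
  have "sym T p * cmat T p i = sym T i * cmat T i p" "0 < sym T i" using cd by (auto simp: cartan_datum_def)
  then have "sym T i * cmat T p i = sym T i * (-1)" "sym T i \<noteq> 0" using s p(3) by auto
  then have pi: "cmat T p i = -1" by (metis mult_left_cancel)
  have "cmat T p ((\<mu> ^^ (r + r)) i) = cmat T ((\<mu> ^^ r) i) ((\<mu> ^^ r) p)" unfolding r(2) funpow_add by simp
  also have "\<dots> = -1" unfolding cm_pow(1) by (rule p(3))
  finally have pr: "cmat T p ((\<mu> ^^ (r + r)) i) = -1" .
  have nz: "q = p'" if "q \<in> orb T i" "cmat T p q = -1" for q
  proof -
    have "cmat T p p = 2" using cd by (auto simp: cartan_datum_def gen_cartan_matrix_def)
    then have "q \<noteq> p" using that by auto
    then show ?thesis using p'(3)[OF that(1)] that(2) by fastforce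
  qed
  \<comment> \<open>Both i and its image under r + r steps are neighbours of p with entry -1, and p
    has only one neighbour in the orbit.\<close>
  have "(\<mu> ^^ (r + r)) i = (\<mu> ^^ 0) i" using nz[OF pow_in_orb pr] nz[OF self_orb pi] by simp
  then have "per i dvd r + r" unfolding pow_eq_iff by (simp add: dvd_eq_mod_eq_0)
  then obtain q where q: "r + r = per i * q" by blast
  have "q = 1"
  proof -
    have "per i * q < per i * 2" using q r(1) by linarith
    then have "q < 2" using nat_mult_less_cancel1[of "per i" q 2] per(1)[of i] by simp
    moreover have "q \<noteq> 0" using q r0 by (cases q) auto
    ultimately show ?thesis by simp
  qed
  then have pe: "per i = 2 * r" using q by simp
  have "tmat T i i k = (if k mod per i = 0 then 2 else if k mod per i = r then -1 else 0)" for k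
  proof -
    have "(\<mu> ^^ k) i = i \<longleftrightarrow> k mod per i = 0" using pow_eq_iff[of k i 0] by simp
    moreover have "(\<mu> ^^ k) i = p \<longleftrightarrow> k mod per i = r" unfolding r(2) pow_eq_iff using r(1) by simp
    ultimately show ?thesis using tmat_diag(1)[of i k] p(3) p(4)[OF pow_in_orb[of k i]] unfolding tmat_def by auto
  qed
  then show ?thesis using True pe r0 by (auto simp: snum_def)
next
  case False
  have gc: "cmat T a a = 2" "a \<noteq> b \<Longrightarrow> cmat T a b \<le> 0" for a b
    using cd by (auto simp: cartan_datum_def gen_cartan_matrix_def)
  have symo: "cmat T a b = cmat T b a" if "a \<in> orb T i" "b \<in> orb T i" for a b
  proof -
    have "sym T a = sym T b" using that cm_pow(2) unfolding orb_eq by auto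
    moreover have "sym T a * cmat T a b = sym T b * cmat T b a" "0 < sym T b" using cd by (auto simp: cartan_datum_def)
    ultimately show ?thesis by simp
  qed
  have "cmat T i p = 0" if p: "p \<in> orb T i" "p \<noteq> i" for p
  proof (rule ccontr)
    assume n0: "cmat T i p \<noteq> 0"
    then have le: "cmat T p i \<le> -1" using symo[OF self_orb p(1)] gc(2)[OF p(2)] by simp
    have fin: "finite (orb T i)" by simp
    have sum: "(\<Sum>q\<in>orb T i. cmat T q i) = 2 + cmat T p i + (\<Sum>q\<in>orb T i - {i} - {p}. cmat T q i)"
      using sum.remove[OF fin self_orb, of "\<lambda>q. cmat T q i"] sum.remove[of "orb T i - {i}" p "\<lambda>q. cmat T q i"] p gc(1) by simp
    have np: "(\<Sum>q\<in>orb T i - {i} - {p}. cmat T q i) \<le> 0" by (rule sum_nonpos) (use gc(2) in auto)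
    have pos: "0 < (\<Sum>q\<in>orb T i. cmat T q i)" using assms by (simp add: LC1_def)
    have pm: "cmat T p i = -1" and s0: "(\<Sum>q\<in>orb T i - {i} - {p}. cmat T q i) = 0" using sum np pos le by linarith+
    have z: "cmat T q i = 0" if "q \<in> orb T i" "q \<noteq> i" "q \<noteq> p" for q
    proof -
      have "(\<Sum>q\<in>orb T i - {i} - {p}. - cmat T q i) = 0" using s0 by (simp add: sum_negf)
      then have "\<forall>q\<in>orb T i - {i} - {p}. - cmat T q i = 0" using gc(2) by (subst (asm) sum_nonneg_eq_0_iff) auto
      then show ?thesis using that by auto
    qed
    have "orb_A2 T i" unfolding orb_A2_def
    proof
      fix a assume "a \<in> orb T i"
      then obtain k where k: "a = (\<mu> ^^ k) i" unfolding orb_eq by blast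
      obtain r where r: "p = (\<mu> ^^ r) i" using p(1) unfolding orb_eq by blast
      let ?b = "(\<mu> ^^ k) p"
      have b: "?b \<in> orb T i" unfolding r using pow_in_orb[of "k + r" i] by (simp add: funpow_add)
      have "?b \<noteq> a" using p(2) unfolding k inj_pow .
      moreover have "cmat T a ?b = -1" "cmat T ?b a = -1" unfolding k cm_pow using pm symo[OF self_orb p(1)] by auto
      moreover have "cmat T a c = 0" if c: "c \<in> orb T i" "c \<noteq> a" "c \<noteq> ?b" for c
      proof -
        obtain l where l: "c = (\<mu> ^^ l) i" using c(1) unfolding orb_eq by blast
        have "\<exists>c'. c = (\<mu> ^^ k) c' \<and> c' \<in> orb T i"
        proof -
          have "c = (\<mu> ^^ (k + (l + N * k - k))) i"
          proof -
            have "k \<le> N * k" using N_props(1) by (cases N) auto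
            from le_add_diff_inverse[OF trans_le_add2[OF this]] have "k + (l + N * k - k) = l + N * k" .
            moreover have "(\<mu> ^^ (l + N * k)) = \<mu> ^^ l" using pow_mod[of "l + N * k"] pow_mod[of l] by simp
            ultimately show ?thesis using l by simp
          qed
          then show ?thesis using pow_in_orb by (metis comp_apply funpow_add)
        qed
        then obtain c' where c': "c = (\<mu> ^^ k) c'" "c' \<in> orb T i" by blast
        have "c' \<noteq> i" "c' \<noteq> p" using c c'(1) k by auto
        then have "cmat T c' i = 0" using z c'(2) by blast
        then show ?thesis unfolding k c'(1) cm_pow using symo[OF self_orb c'(2)] by simp
      qed
      ultimately show "\<exists>p'\<in>orb T i. p' \<noteq> a \<and> cmat T a p' = -1 \<and> cmat T p' a = -1 \<and>
          (\<forall>p''\<in>orb T i. p'' \<noteq> a \<and> p'' \<noteq> p' \<longrightarrow> cmat T a p'' = 0)" using b by blast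
    qed
    then show False using False by simp
  qed
  then have "k mod per i = 0" if "tmat T i i k \<noteq> 0" for k
    using that tmat_diag(1)[of i k] pow_in_orb[of k i] gc(1) unfolding tmat_def by metis
  then show ?thesis using False by (auto simp: snum_def)
qed

text \<open>\<Gamma> is the class 0 modulo the period, with entry 2, and for s_i = 2 also the class
  r, with entry -1. As r is half the period, \<xi>^(r d_i) = -1; this is the sign in
  \<open>cBc\<close>.\<close>

lemma \<Gamma>_split:
  assumes "LC1 T" and g: "\<And>k. tmat T i i k = 2 \<Longrightarrow> g k = h k" "\<And>k. tmat T i i k = -1 \<Longrightarrow> g k = h' k"
  shows "\<exists>r. (\<Prod>k\<in>\<Gamma> T i i. g k) = (\<Prod>k | k < N \<and> k mod per i = 0. h k) * (if snum T i = 2 then \<Prod>k | k < N \<and> k mod per i = r. h' k else 1 :: lpoly) \<and>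
     (snum T i = 2 \<longrightarrow> 0 < r \<and> r < per i \<and> \<xi> T ^ (r * dnum T i) = -1)"
  using orb_case[OF assms(1), of i]
proof (elim disjE conjE exE)
  assume s: "snum T i \<noteq> 2" and k: "\<forall>k. tmat T i i k \<noteq> 0 \<longrightarrow> k mod per i = 0"
  have "tmat T i i k \<noteq> 0 \<longleftrightarrow> k mod per i = 0" for k using k tmat_diag(1)[of i k] by auto
  then have G: "\<Gamma> T i i = {k. k < N \<and> k mod per i = 0}" by (simp add: \<Gamma>_def)
  have "prod g {k. k < N \<and> k mod per i = 0} = prod h {k. k < N \<and> k mod per i = 0}"
    by (rule prod.cong) (use g(1) tmat_diag(1)[of i] in auto)
  then show ?thesis using s unfolding G by simp
next
  fix r assume s: "snum T i = 2" and r: "0 < r" "per i = 2 * r"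
    and t: "\<forall>k. tmat T i i k = (if k mod per i = 0 then 2 else if k mod per i = r then -1 else 0)"
  have G: "\<Gamma> T i i = {k. k < N \<and> k mod per i = 0} \<union> {k. k < N \<and> k mod per i = r}" using t by (auto simp: \<Gamma>_def split: if_splits)
  have 1: "prod g {k. k < N \<and> k mod per i = 0} = prod h {k. k < N \<and> k mod per i = 0}" by (rule prod.cong) (use g(1) t in auto)
  have 2: "prod g {k. k < N \<and> k mod per i = r} = prod h' {k. k < N \<and> k mod per i = r}" by (rule prod.cong) (use g(2) t r in auto)
  have "(\<Prod>k\<in>\<Gamma> T i i. g k) = prod g {k. k < N \<and> k mod per i = 0} * prod g {k. k < N \<and> k mod per i = r}"
    unfolding G by (rule prod.union_disjoint) (use r in auto)
  moreover have "\<xi> T ^ (r * dnum T i) = -1"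
  proof -
    let ?x = "\<xi> T ^ (r * dnum T i)"
    have Nr: "N = 2 * (r * dnum T i)" using dnum(1)[of i] r(2) by simp
    have "?x ^ 2 = 1" using prim_root_n[OF N_props(1)] Nr by (metis power_mult mult.commute)
    moreover have "\<not> N dvd r * dnum T i" using Nr r(1) dnum(2)[of i] by (auto dest: dvd_imp_le)
    then have "?x \<noteq> 1" using prim_root_1_iff[OF N_props(1)] by blast
    ultimately show ?thesis using power2_eq_1_iff by blast
  qed
  ultimately show ?thesis using s r 1 2 by (intro exI[of _ r]) simp
qed

text \<open>These three constants are the ratios z^d / w^d at the zeros of F_ii and F_ij: q_i^(2
  \<epsilon> d_i), -q_i^(-\<epsilon> d_i), and q_i^(\<epsilon> a_ij d_i) times a root of unity of
  order dividing d_ij / d_i.\<close>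

definition cAc :: "int \<Rightarrow> 'i \<Rightarrow> complex fps" where
  "cAc \<epsilon> i = qc 1 (of_int (sym T i) * (2 * of_int \<epsilon> * of_nat (dnum T i)))"
definition cBc :: "int \<Rightarrow> 'i \<Rightarrow> complex fps" where
  "cBc \<epsilon> i = qc (-1) (of_int (sym T i) * (- of_int \<epsilon> * of_nat (dnum T i)))"
definition alc :: "int \<Rightarrow> 'i \<Rightarrow> 'i \<Rightarrow> nat \<Rightarrow> complex fps" where
  "alc \<epsilon> i j l = qc (prim_root (dpair T i j div dnum T i) ^ l) (of_int (sym T i) * (of_int \<epsilon> * of_int (cmat T i j) * of_nat (dnum T i)))"

lemma qpow_pow: "qpow T i s ^ n = qc 1 (of_int (sym T i) * (s * of_nat n))"
  by (simp add: qpow_qc qc_power mult_ac)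

lemma cAc_pow: "qpow T i (of_int (\<epsilon> * 2)) ^ dnum T i = cAc \<epsilon> i"
  by (simp add: qpow_pow cAc_def mult_ac)
lemma cBc_pow: "- (qpow T i (of_int (\<epsilon> * - 1)) ^ dnum T i) = cBc \<epsilon> i"
  by (simp add: qpow_pow cBc_def mult_ac) (simp add: qc_def fps_const_neg[symmetric] del: fps_const_neg)

lemma cA_neq_cB: "cAc \<epsilon> i \<noteq> cBc \<epsilon> i"
  using qc_nth0 by (metis cAc_def cBc_def one_neq_neg_one)

lemma PT_AB: "PT d (insert (a, cAc \<epsilon> i, b) (if h then {(a, cBc \<epsilon> i, b)} else {})) = lf d a (cAc \<epsilon> i) b * (if h then lf d a (cBc \<epsilon> i) b else 1)"
  using cA_neq_cB by (auto simp: PT_insert)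

lemma Fii:
  assumes "LC1 T"
  shows "Fpol T \<epsilon> i i (Var a) (Var b) = PT (dnum T i) (insert (a, cAc \<epsilon> i, b) (if snum T i = 2 then {(a, cBc \<epsilon> i, b)} else {}))"
proof -
  let ?d = "dnum T i"
  define h where "h c k = Var a - Cst (fps_const (\<xi> T ^ k)) * (Cst (qpow T i c) * Var b)" for c k
  obtain r where r: "Fpol T \<epsilon> i i (Var a) (Var b) = (\<Prod>k | k < N \<and> k mod per i = 0. h (of_int (\<epsilon> * 2)) k) *
      (if snum T i = 2 then \<Prod>k | k < N \<and> k mod per i = r. h (of_int (\<epsilon> * - 1)) k else 1)"
    "snum T i = 2 \<Longrightarrow> r < per i \<and> \<xi> T ^ (r * ?d) = -1"
    using \<Gamma>_split[OF assms, of i "\<lambda>k. Var a - Cst (fps_const (\<xi> T ^ k) * qpow T i (of_int (\<epsilon> * tmat T i i k))) * Var b" "h (of_int (\<epsilon> * 2))" "h (of_int (\<epsilon> * - 1))"]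
    unfolding Fpol_def h_def by (auto simp: Cst_mult mult.assoc)
  have 1: "(\<Prod>k | k < N \<and> k mod per i = 0. h (of_int (\<epsilon> * 2)) k) = lf ?d a (cAc \<epsilon> i) b"
    unfolding h_def class_prod[OF per(1)] by (simp add: lf_def power_mult_distrib Cst_power[symmetric] cAc_pow[symmetric])
  have 2: "(\<Prod>k | k < N \<and> k mod per i = r. h (of_int (\<epsilon> * - 1)) k) = lf ?d a (cBc \<epsilon> i) b" if "snum T i = 2"
  proof -
    have "r < per i" "\<xi> T ^ (r * ?d) = -1" using r(2)[OF that] by auto
    then show ?thesis unfolding h_def class_prod[OF \<open>r < per i\<close>] cBc_pow[symmetric]
      by (simp add: lf_def power_mult_distrib Cst_power[symmetric] Cst_uminus fps_const_neg[symmetric] del: fps_const_neg)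
  qed
  show ?thesis unfolding PT_AB r(1) 1 using 2 by auto
qed

lemma Gii:
  assumes "LC1 T"
  shows "Gpol T \<epsilon> i i (Var a) (Var b) = - PT (dnum T i) (insert (b, cAc \<epsilon> i, a) (if snum T i = 2 then {(b, cBc \<epsilon> i, a)} else {}))"
proof -
  let ?d = "dnum T i"
  define h where "h c k = Cst (qpow T i c) * Var a - Cst (fps_const (\<xi> T ^ k)) * Var b" for c k
  obtain r where r: "Gpol T \<epsilon> i i (Var a) (Var b) = (\<Prod>k | k < N \<and> k mod per i = 0. h (of_int (\<epsilon> * 2)) k) *
      (if snum T i = 2 then \<Prod>k | k < N \<and> k mod per i = r. h (of_int (\<epsilon> * - 1)) k else 1)"
    "snum T i = 2 \<Longrightarrow> r < per i \<and> \<xi> T ^ (r * ?d) = -1"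
    using \<Gamma>_split[OF assms, of i "\<lambda>k. Cst (qpow T i (of_int (\<epsilon> * tmat T i i k))) * Var a - Cst (fps_const (\<xi> T ^ k)) * Var b" "h (of_int (\<epsilon> * 2))" "h (of_int (\<epsilon> * - 1))"]
    unfolding Gpol_def h_def by auto
  have 1: "(\<Prod>k | k < N \<and> k mod per i = 0. h (of_int (\<epsilon> * 2)) k) = - lf ?d b (cAc \<epsilon> i) a"
    unfolding h_def class_prod[OF per(1)] by (simp add: lf_def power_mult_distrib Cst_power[symmetric] cAc_pow[symmetric])
  have 2: "(\<Prod>k | k < N \<and> k mod per i = r. h (of_int (\<epsilon> * - 1)) k) = lf ?d b (cBc \<epsilon> i) a" if "snum T i = 2"
  proof -
    have "r < per i" "\<xi> T ^ (r * ?d) = -1" using r(2)[OF that] by auto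
    then show ?thesis unfolding h_def class_prod[OF \<open>r < per i\<close>] cBc_pow[symmetric]
      by (simp add: lf_def power_mult_distrib Cst_power[symmetric] Cst_uminus fps_const_neg[symmetric] del: fps_const_neg)
  qed
  show ?thesis unfolding PT_AB r(1) 1 using 2 by auto
qed

lemma \<Gamma>_mod: "\<xi> T ^ (k mod N) = \<xi> T ^ k"
proof -
  have "\<xi> T ^ (k mod N + N * (k div N)) = \<xi> T ^ (k mod N)"
    unfolding power_add power_mult prim_root_n[OF N_props(1)] by simp
  then show ?thesis by simp
qed

context
  fixes i j assumes ij: "(i, j) \<in> \<II> T" and lc2: "LC2 T" and lc3: "LC3 T"
begin

lemma aij: "cmat T i j < 0" "i \<notin> orb T j" using ij by (auto simp: \<II>_def)

lemma \<Gamma>0: "0 \<in> \<Gamma> T i j" using aij(1) N_props(1) by (simp add: \<Gamma>_def tmat_def)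

lemma fin_\<Gamma>: "finite (\<Gamma> T i j)" unfolding \<Gamma>_def by simp

lemma tmat_\<Gamma>: "k \<in> \<Gamma> T i j \<Longrightarrow> tmat T i j k = cmat T i j"
  using lc2 ij unfolding LC2_def by blast

lemma D_pos: "0 < dpair T i j" unfolding dpair_def using \<Gamma>0 fin_\<Gamma> by (auto simp: card_gt_0_iff)

lemma \<Gamma>_closed: assumes "a \<in> \<Gamma> T i j" "b \<in> \<Gamma> T i j" shows "(a + b) mod N \<in> \<Gamma> T i j"
proof -
  have "subgroup (int ` \<Gamma> T i j) (integer_mod_group N)" using lc3 ij unfolding LC3_def by blast
  then have "int a \<otimes>\<^bsub>integer_mod_group N\<^esub> int b \<in> int ` \<Gamma> T i j" by (rule subgroup.m_closed) (use assms in auto)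
  then have "(int a + int b) mod int N \<in> int ` \<Gamma> T i j" by (simp add: mult_integer_mod_group)
  then have "int ((a + b) mod N) \<in> int ` \<Gamma> T i j" by (simp add: zmod_int)
  then show ?thesis by (metis imageE of_nat_eq_iff)
qed

text \<open>Translation by k permutes \<Gamma>, so the product of all \<xi>^g over \<Gamma> is
  unchanged, although each of the d_ij factors acquires \<xi>^k.\<close>

lemma \<Gamma>_root: assumes k: "k \<in> \<Gamma> T i j" shows "(\<xi> T ^ k) ^ dpair T i j = 1"
proof -
  let ?G = "\<Gamma> T i j" and ?t = "\<lambda>g. (g + k) mod N"
  have lt: "g < N" if "g \<in> ?G" for g using that by (simp add: \<Gamma>_def)
  have inj: "inj_on ?t ?G"
  proof (rule inj_onI)
    fix g g' assume g: "g \<in> ?G" "g' \<in> ?G" "?t g = ?t g'"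
    have "\<xi> T ^ g * \<xi> T ^ k = \<xi> T ^ g' * \<xi> T ^ k" using g(3) \<Gamma>_mod by (metis power_add)
    then have "\<xi> T ^ g = \<xi> T ^ g'" using prim_root_nz by simp
    then show "g = g'" using prim_root_inj[OF N_props(1)] lt g by (auto dest: inj_onD)
  qed
  have "?t ` ?G = ?G" by (rule endo_inj_surj[OF fin_\<Gamma> _ inj]) (use \<Gamma>_closed k in auto)
  then have "(\<Prod>g\<in>?G. \<xi> T ^ g) = (\<Prod>g\<in>?G. \<xi> T ^ ?t g)" using prod.reindex[OF inj, of "\<lambda>g. \<xi> T ^ g"] by simp
  also have "\<dots> = (\<Prod>g\<in>?G. \<xi> T ^ g) * (\<xi> T ^ k) ^ dpair T i j" unfolding \<Gamma>_mod power_add by (simp add: prod.distrib dpair_def)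
  finally show ?thesis using prim_root_nz fin_\<Gamma> by (simp add: prod_zero_iff)
qed

lemma \<Gamma>_prod: "(\<Prod>k\<in>\<Gamma> T i j. z - Cst (fps_const (\<xi> T ^ k)) * y) = z ^ dpair T i j - y ^ dpair T i j"
proof -
  have "inj_on (\<lambda>k. \<xi> T ^ k) (\<Gamma> T i j)" by (rule inj_on_subset[OF prim_root_inj[OF N_props(1)]]) (auto simp: \<Gamma>_def)
  then show ?thesis using prod_roots[OF fin_\<Gamma> dpair_def[symmetric] D_pos, of "\<lambda>k. \<xi> T ^ k" 1] \<Gamma>_root by simp
qed

text \<open>If the period of i is less than N it lies in \<Gamma>, since that power of \<mu> fixes
  i. Its power of \<xi> has order d_i, and by \<open>\<Gamma>_root\<close> this order divides
  d_ij.\<close>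

lemma d_dvd_D: "dnum T i dvd dpair T i j"
proof (cases "per i = N")
  case True
  then have "dnum T i = 1" using dnum(1)[of i] per(1)[of i] by simp
  then show ?thesis by simp
next
  case False
  then have "per i < N" using per_dvd[of i] N_props(1) by (metis dvd_imp_le le_neq_implies_less)
  moreover have "tmat T i j (per i) = cmat T i j" unfolding tmat_def using cm_pow(1)[of "per i" i j] per(2)[of i] by simp
  ultimately have "per i \<in> \<Gamma> T i j" using aij(1) by (simp add: \<Gamma>_def)
  then have "\<xi> T ^ (per i * dpair T i j) = 1" using \<Gamma>_root by (simp add: power_mult)
  then have "per i * dnum T i dvd per i * dpair T i j" using prim_root_1_iff[OF N_props(1)] dnum(1)[of i] by metis
  then show ?thesis using per(1)[of i] by simp
qed

abbreviation "ne \<equiv> dpair T i j div dnum T i"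

lemma ne: "dpair T i j = dnum T i * ne" "0 < ne"
  using d_dvd_D D_pos dnum(2)[of i] by (auto simp: div_greater_zero_iff dvd_imp_le)

lemma PT_al: "PT (dnum T i) ((\<lambda>l. (a, alc \<epsilon> i j l, b)) ` {..<ne}) =
    Var a ^ dpair T i j - (Cst (qpow T i (of_int (\<epsilon> * cmat T i j))) * Var b) ^ dpair T i j"
proof -
  let ?d = "dnum T i" and ?q = "qpow T i (of_int (\<epsilon> * cmat T i j))"
  have al: "alc \<epsilon> i j l = fps_const (prim_root ne ^ l) * ?q ^ ?d" for l
    unfolding alc_def qpow_pow qc_def by (simp add: mult_ac)
  have "inj_on (\<lambda>l. (a, alc \<epsilon> i j l, b)) {..<ne}"
    using prim_root_inj[OF ne(2)] qc_nth0 unfolding alc_def inj_on_def by (metis prod.inject)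
  then have "PT ?d ((\<lambda>l. (a, alc \<epsilon> i j l, b)) ` {..<ne}) = (\<Prod>l<ne. lf ?d a (alc \<epsilon> i j l) b)"
    unfolding PT_def by (subst prod.reindex) auto
  also have "\<dots> = (\<Prod>l<ne. Var a ^ ?d - Cst (fps_const (prim_root ne ^ l)) * (Cst ?q * Var b) ^ ?d)"
    by (simp add: lf_def al Cst_mult Cst_power power_mult_distrib mult_ac)
  also have "\<dots> = (Var a ^ ?d) ^ ne - ((Cst ?q * Var b) ^ ?d) ^ ne"
  proof -
    have "(prim_root ne ^ l) ^ ne = 1" for l using prim_root_n[OF ne(2)] by (metis power_mult mult.commute power_one)
    then show ?thesis using prod_roots[of "{..<ne}" ne "\<lambda>l. prim_root ne ^ l" 1 "Var a ^ ?d" "(Cst ?q * Var b) ^ ?d"] ne(2) prim_root_inj[OF ne(2)]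
      by simp
  qed
  finally show ?thesis unfolding power_mult[symmetric] ne(1)[symmetric] .
qed

lemma Fij: "Fpol T \<epsilon> i j (Var a) (Var b) = PT (dnum T i) ((\<lambda>l. (a, alc \<epsilon> i j l, b)) ` {..<ne})"
proof -
  have "Fpol T \<epsilon> i j (Var a) (Var b) = (\<Prod>k\<in>\<Gamma> T i j. Var a - Cst (fps_const (\<xi> T ^ k)) * (Cst (qpow T i (of_int (\<epsilon> * cmat T i j))) * Var b))"
    unfolding Fpol_def by (rule prod.cong) (auto simp: tmat_\<Gamma> Cst_mult mult.assoc)
  then show ?thesis unfolding \<Gamma>_prod PT_al .
qed

lemma Gij: "Gpol T \<epsilon> i j (Var a) (Var b) = - PT (dnum T i) ((\<lambda>l. (b, alc \<epsilon> i j l, a)) ` {..<ne})"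
proof -
  have "Gpol T \<epsilon> i j (Var a) (Var b) = (\<Prod>k\<in>\<Gamma> T i j. Cst (qpow T i (of_int (\<epsilon> * cmat T i j))) * Var a - Cst (fps_const (\<xi> T ^ k)) * Var b)"
    unfolding Gpol_def by (rule prod.cong) (auto simp: tmat_\<Gamma>)
  then show ?thesis unfolding \<Gamma>_prod PT_al by simp
qed

lemma noden: "tmat T i j k \<le> 0"
proof -
  have "(\<mu> ^^ k) j \<noteq> i" using aij(2) pow_in_orb by metis
  then show ?thesis using cd unfolding tmat_def cartan_datum_def gen_cartan_matrix_def by metis
qed

lemma mnum_eq: "mnum T i j = nat (1 - cmat T i j)"
proof -
  have "Min (tmat T i j ` {..<N}) = cmat T i j"
  proof (rule Min_eqI)
    fix y assume "y \<in> tmat T i j ` {..<N}"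
    then obtain k where k: "k < N" "y = tmat T i j k" by blast
    show "cmat T i j \<le> y"
    proof (cases "tmat T i j k = 0")
      case False
      then have "k \<in> \<Gamma> T i j" using k by (simp add: \<Gamma>_def)
      then show ?thesis using tmat_\<Gamma> k by simp
    qed (use k aij in simp)
  next
    show "cmat T i j \<in> tmat T i j ` {..<N}" using N_props(1) by (intro image_eqI[of _ _ 0]) (auto simp: tmat_def)
  qed simp
  then show ?thesis by (simp add: mnum_def)
qed

lemma alc_unit: "unit0 (alc \<epsilon> i j l)"
  using prim_root_nz by (simp add: alc_def qc_nth0)

end

lemma sym_pos: "(of_int (sym T i) :: complex) \<noteq> 0" "(of_nat (dnum T i) :: complex) \<noteq> 0"
proof -
  have "0 < sym T i" using cd by (simp add: cartan_datum_def)
  then show "(of_int (sym T i) :: complex) \<noteq> 0" "(of_nat (dnum T i) :: complex) \<noteq> 0" using dnum(2)[of i] by simp_all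
qed

lemma qc_exp_0:
  assumes "qc c (of_int (sym T i) * (of_int z * of_nat (dnum T i))) = qc c' 0" "c \<noteq> 0"
  shows "z = 0"
  using qc_inj[OF assms] sym_pos[of i] by simp

lemma AB_pow: "cBc \<epsilon> i ^ n * cAc \<epsilon> i ^ t = qc ((-1) ^ n) (of_int (sym T i) * (of_int (\<epsilon> * (2 * int t - int n)) * of_nat (dnum T i)))"
  unfolding cAc_def cBc_def qc_power qc_mult by (simp add: algebra_simps)

lemma cAB: "cAc \<epsilon> i * cBc \<epsilon> i ^ 2 = 1"
  using AB_pow[of \<epsilon> i 2 1] qc_1 by (simp add: mult.commute)

lemma cBA: assumes e: "\<epsilon> \<in> {1, -1}" and "cBc \<epsilon> i ^ n * cAc \<epsilon> i ^ t = 1" shows "n = 2 * t"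
proof -
  have "\<epsilon> * (2 * int t - int n) = 0"
  proof (rule qc_exp_0)
    show "qc ((-1) ^ n) (of_int (sym T i) * (of_int (\<epsilon> * (2 * int t - int n)) * of_nat (dnum T i))) = qc 1 0"
      using assms(2) by (simp only: AB_pow qc_1)
  qed simp
  then show ?thesis using e by auto
qed

lemma al_prod: "alc \<epsilon> i j l * (cBc \<epsilon> i ^ n * cAc \<epsilon> i ^ t) * alc \<epsilon> i j l' =
   qc (prim_root (dpair T i j div dnum T i) ^ (l + l') * (-1) ^ n)
      (of_int (sym T i) * (of_int (\<epsilon> * (2 * cmat T i j + 2 * int t - int n)) * of_nat (dnum T i)))"
  unfolding AB_pow alc_def qc_mult by (simp add: algebra_simps power_add)

text \<open>The exponents of q_i must cancel, so 2 a_ij + 2 t - n = 0; with M = 1 - a_ij this is the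
  equation assumed in \<open>linkage\<close>.\<close>

lemma closed:
  assumes e: "\<epsilon> \<in> {1, -1}" and a: "cmat T i j < 0" and h: "alc \<epsilon> i j l * cBc \<epsilon> i ^ n * cAc \<epsilon> i ^ t * alc \<epsilon> i j l' = 1"
  shows "n + 2 * (nat (1 - cmat T i j) - 1) = 2 * t"
proof -
  have "\<epsilon> * (2 * cmat T i j + 2 * int t - int n) = 0"
  proof (rule qc_exp_0)
    have "alc \<epsilon> i j l * (cBc \<epsilon> i ^ n * cAc \<epsilon> i ^ t) * alc \<epsilon> i j l' = 1" using h by (simp only: mult.assoc)
    then show "qc (prim_root (dpair T i j div dnum T i) ^ (l + l') * (-1) ^ n)
      (of_int (sym T i) * (of_int (\<epsilon> * (2 * cmat T i j + 2 * int t - int n)) * of_nat (dnum T i))) = qc 1 0"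
      by (simp only: al_prod qc_1)
  qed (simp add: prim_root_nz)
  then show ?thesis using e a by auto
qed

lemma alal:
  assumes e: "\<epsilon> \<in> {1, -1}" and h: "alc \<epsilon> i j l' = cAc \<epsilon> i ^ k * alc \<epsilon> i j l"
  shows "k = 0"
proof -
  let ?s = "of_int (sym T i) * (of_int \<epsilon> * of_int (cmat T i j) * of_nat (dnum T i)) :: complex"
  have "qc (prim_root (dpair T i j div dnum T i) ^ l') ?s =
      qc (prim_root (dpair T i j div dnum T i) ^ l) (of_int (sym T i) * (of_int (\<epsilon> * 2 * int k) * of_nat (dnum T i)) + ?s)"
    using h unfolding alc_def cAc_def qc_power qc_mult by (simp add: mult_ac)
  then have "of_int (sym T i) * (of_int (\<epsilon> * 2 * int k) * of_nat (dnum T i)) = (0 :: complex)"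
    using qc_inj prim_root_nz by (metis add_cancel_left_left power_not_zero)
  then have "of_int (\<epsilon> * 2 * int k) = (0 :: complex)" using sym_pos[of i] by (metis mult_eq_0_iff)
  then show ?thesis using e by auto
qed

text \<open>l' indexes the inverse root of unity, and the exponent M - 1 = -a_ij makes the powers of
  q_i cancel.\<close>

lemma match:
  assumes "0 < dpair T i j div dnum T i" and a: "cmat T i j < 0" and l: "l < dpair T i j div dnum T i"
  shows "\<exists>l' < dpair T i j div dnum T i. alc \<epsilon> i j l' * cAc \<epsilon> i ^ (nat (1 - cmat T i j) - 1) * alc \<epsilon> i j l = 1"
proof -
  let ?n = "dpair T i j div dnum T i" and ?t = "nat (1 - cmat T i j) - 1"
  define l' where "l' = (if l = 0 then 0 else ?n - l)"
  have "prim_root ?n ^ (l' + l) = 1" using l prim_root_n[OF assms(1)] by (simp add: l'_def)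
  moreover have "2 * cmat T i j + 2 * int ?t - int 0 = 0" using a by simp
  ultimately have "alc \<epsilon> i j l' * cAc \<epsilon> i ^ ?t * alc \<epsilon> i j l = 1"
    using al_prod[of \<epsilon> i j l' 0 ?t l] by (simp add: qc_1)
  moreover have "l' < ?n" using l by (auto simp: l'_def)
  ultimately show ?thesis by blast
qed

end

section \<open>Truncated exponents and values of the polynomial f\<close>

definition res :: "nat set \<Rightarrow> expo \<Rightarrow> expo" where
  "res B e = (\<Sum>b\<in>B. sg b (lk e b))"

lemma lookup_res: "finite B \<Longrightarrow> lk (res B e) a = (if a \<in> B then lk e a else 0)"
  by (simp add: res_def lookup_sum lookup_single when_def)

lemma keys_res: "finite B \<Longrightarrow> ks (res B e) \<subseteq> B"
  by (auto simp: in_keys_iff lookup_res split: if_splits)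

lemma res_id: "finite B \<Longrightarrow> ks e \<subseteq> B \<Longrightarrow> res B e = e"
  by (rule poly_mapping_eqI) (auto simp: lookup_res in_keys_iff)

context hmodule
begin

lemma currents_rs: "snd ` set l = B \<Longrightarrow> currents x l v = rs B (rc x l v)"
  by (auto simp: currents_def rs_def rc_def)

text \<open>Passes between the two versions of a product of currents: the one without support
  condition at e equals the one with it at e truncated to the variables that occur.\<close>

lemma rc_currents:
  assumes "pv B p" "finite B" "snd ` set l = B"
  shows "(p \<bullet> rc x l v) e = (p \<bullet> currents x l v) (res B e)"
proof -
  have "(p \<bullet> currents x l v) (res B e) = (p \<bullet> rc x l v) (res B e)"
    unfolding currents_rs[OF assms(3)] rs_pt[OF assms(1)] by (simp add: rs_def keys_res[OF assms(2)])
  also have "\<dots> = (p \<bullet> rc x l v) e"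
    unfolding poly_times_def
  proof (intro sum.cong refl arg_cong2[where f = sc])
    fix k show "rc x l v (res B e - k) = rc x l v (e - k)"
      by (rule rc_cong) (simp add: assms(3) lookup_minus lookup_res[OF assms(2)])
  qed
  finally show ?thesis by simp
qed

end

lemma poly_map_poly_sum:
  fixes g :: "'a::zero \<Rightarrow> 'b::comm_semiring_1"
  assumes "g 0 = 0" shows "poly (map_poly g f) z = (\<Sum>p\<le>degree f. g (coeff f p) * z ^ p)"
proof -
  have "poly (map_poly g f) z = (\<Sum>p\<le>degree (map_poly g f). coeff (map_poly g f) p * z ^ p)" by (rule poly_altdef)
  also have "\<dots> = (\<Sum>p\<le>degree f. coeff (map_poly g f) p * z ^ p)"
  proof (rule sum.mono_neutral_left)
    have "degree (map_poly g f) \<le> degree f" by (rule degree_le) (simp add: coeff_map_poly assms coeff_eq_0)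
    then show "{..degree (map_poly g f)} \<subseteq> {..degree f}" by simp
  qed (auto simp: coeff_eq_0)
  finally show ?thesis by (simp add: coeff_map_poly[of g, OF assms])
qed

definition ixs :: "bipoly \<Rightarrow> (nat \<times> nat) set" where
  "ixs f = (SIGMA p:{..degree f}. {..degree (coeff f p)})"

lemma eval2_sum: "eval2 f z y = (\<Sum>(p, r)\<in>ixs f. Cst (coeff (coeff f p) r) * y ^ r * z ^ p)"
  unfolding eval2_def ixs_def by (simp add: poly_map_poly_sum sum_distrib_right sum.Sigma)

text \<open>The value of f, viewed as a polynomial in the d-th powers of its variables, when these
  are y for the first and z for the second variable.\<close>

definition fval :: "nat \<Rightarrow> bipoly \<Rightarrow> complex fps \<Rightarrow> complex fps \<Rightarrow> complex fps" where
  "fval d f y z = (\<Sum>(p, r)\<in>ixs f. coeff (coeff f p) r * z ^ (r div d) * y ^ (p div d))"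

lemma pv_sum: "(\<And>k. k \<in> K \<Longrightarrow> pv B (g k)) \<Longrightarrow> pv B (sum g K)"
  by (induction K rule: infinite_finite_induct) (simp_all add: pv_add, simp_all add: pv_def)

lemma pv_prod: "(\<And>k. k \<in> K \<Longrightarrow> pv B (g k)) \<Longrightarrow> pv B (prod g K)"
  by (induction K rule: infinite_finite_induct) (auto intro: pv_mult pv_1)

lemma pv_eval2: "a \<in> B \<Longrightarrow> b \<in> B \<Longrightarrow> pv B (eval2 f (Var a) (Var b))"
  unfolding eval2_sum by (auto intro!: pv_sum pv_mult pv_Cst pv_Var)

context hmodule_vars
begin

lemma hom_eval2:
  assumes f: "in_powers d f" "homogeneous f" and u: "\<And>v. unit0 (u v)" and ab: "a \<in> V" "b \<in> V"
  shows "\<exists>D. hom V u (eval2 f (Var a) (Var b)) D (fval d f (u a) (u b))"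
proof -
  obtain n where n: "\<And>p r. coeff (coeff f p) r \<noteq> 0 \<Longrightarrow> p + r = n" using f(2) unfolding homogeneous_def by blast
  have pw: "hom V u (Var c ^ r) (int r) (u c ^ (r div d))" if "d dvd r" "c \<in> V" for r c
  proof -
    have "r = d * (r div d)" using that(1) by simp
    then have "Var c ^ r = (Var c ^ d) ^ (r div d)" "int r = int (r div d) * int d" by (metis power_mult, metis mult.commute of_nat_mult)
    then show ?thesis using hom_power[OF subset_refl hom_Var[OF that(2) subset_refl u]] by simp
  qed
  have "hom V u (Cst (coeff (coeff f p) r) * Var b ^ r * Var a ^ p) (int n) (coeff (coeff f p) r * u b ^ (r div d) * u a ^ (p div d))" for p r
  proof (cases "coeff (coeff f p) r = 0")
    case True then show ?thesis using hom_0 by simp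
  next
    case False
    then have "d dvd p" "d dvd r" "int n = 0 + int r + int p" using f(1) n[OF False] unfolding in_powers_def by auto
    then show ?thesis using hom_mult[OF hom_mult[OF hom_Cst[OF subset_refl] pw[OF _ ab(2)]] pw[OF _ ab(1)]] by simp
  qed
  then have "hom V u (eval2 f (Var a) (Var b)) (int n) (fval d f (u a) (u b))"
    unfolding eval2_sum fval_def by (intro hom_sum) auto
  then show ?thesis by blast
qed

end

text \<open>By homogeneity the two values are, up to powers of y and of q_i, the values of f at 1
  and q_i^(2 n \<epsilon>), and at 1 and q_i^(-2 n \<epsilon>). This accounts for both signs
  \<delta> in the hypothesis.\<close>

lemma fval_ne:
  assumes f: "in_powers d f" "homogeneous f" and d: "0 < d"
    and e: "\<epsilon> \<in> {1, -1 :: int}" and y: "unit0 y" and c: "c = qpow T i (of_int (\<epsilon> * 2 * int n)) ^ d"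
    and ne: "\<And>\<delta>. \<delta> \<in> {1, -1} \<Longrightarrow> eval2 f (Var 0) (Cst (qpow T i (of_int (\<delta> * 2 * int n))) * Var 0) \<noteq> 0"
  shows "fval d f y (c * y) \<noteq> 0 \<and> fval d f (c * y) y \<noteq> 0"
proof -
  obtain k where k: "\<And>p r. coeff (coeff f p) r \<noteq> 0 \<Longrightarrow> p + r = k" using f(2) unfolding homogeneous_def by blast
  have dv: "d dvd p \<and> d dvd r" if "coeff (coeff f p) r \<noteq> 0" for p r using f(1) that unfolding in_powers_def by blast
  let ?q = "\<lambda>\<delta> :: int. qpow T i (of_int (\<delta> * 2 * int n))"
  define S where "S \<delta> = (\<Sum>(p, r)\<in>ixs f. coeff (coeff f p) r * ?q \<delta> ^ r)" for \<delta>
  have S: "S \<delta> \<noteq> 0" if "\<delta> \<in> {1, -1}" for \<delta>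
  proof
    assume S0: "S \<delta> = 0"
    have "eval2 f (Var 0) (Cst (?q \<delta>) * Var 0) = (\<Sum>(p, r)\<in>ixs f. Cst (coeff (coeff f p) r * ?q \<delta> ^ r) * Var 0 ^ k)"
      unfolding eval2_sum
    proof (intro sum.cong refl, clarify)
      fix p r
      show "Cst (coeff (coeff f p) r) * (Cst (?q \<delta>) * Var 0) ^ r * Var 0 ^ p = Cst (coeff (coeff f p) r * ?q \<delta> ^ r) * Var 0 ^ k"
      proof (cases "coeff (coeff f p) r = 0")
        case False
        then have "Var 0 ^ k = Var 0 ^ r * Var 0 ^ p" using k[OF False] by (metis add.commute power_add)
        then show ?thesis by (simp add: power_mult_distrib Cst_mult Cst_power mult_ac)
      qed simp
    qed
    also have "\<dots> = (\<Sum>(p, r)\<in>ixs f. Cst (coeff (coeff f p) r * ?q \<delta> ^ r)) * Var 0 ^ k"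
      by (simp add: case_prod_unfold sum_distrib_right)
    also have "(\<Sum>(p, r)\<in>ixs f. Cst (coeff (coeff f p) r * ?q \<delta> ^ r)) = Cst (S \<delta>)"
    proof -
      have "Cst (sum g K) = (\<Sum>x\<in>K. Cst (g x))" for g :: "nat \<times> nat \<Rightarrow> complex fps" and K
        by (induction K rule: infinite_finite_induct) (auto simp: Cst_add)
      then show ?thesis unfolding S_def by (simp add: case_prod_unfold)
    qed
    finally show False using ne[OF that] S0 by simp
  qed
  have y0: "y \<noteq> 0" using y by auto
  have cr: "c ^ (r div d) = ?q \<epsilon> ^ r" if "d dvd r" for r
    using that unfolding c power_mult[symmetric] by simp
  have yk: "y ^ (r div d) * y ^ (p div d) = y ^ (k div d)" if nz: "coeff (coeff f p) r \<noteq> 0" for p r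
  proof -
    have "(p + r) div d = p div d + r div d" using dv[OF nz] by (simp add: div_plus_div_distrib_dvd_left)
    then show ?thesis using k[OF nz] by (simp add: power_add[symmetric] add.commute)
  qed
  have qq: "?q \<epsilon> ^ p = ?q \<epsilon> ^ k * ?q (- \<epsilon>) ^ r" if nz: "coeff (coeff f p) r \<noteq> 0" for p r
  proof -
    have "?q \<epsilon> * ?q (- \<epsilon>) = 1" unfolding qpow_qc qc_mult by (simp add: qc_1)
    then have "?q \<epsilon> ^ r * ?q (- \<epsilon>) ^ r = 1" by (metis power_mult_distrib power_one)
    moreover have "?q \<epsilon> ^ k * ?q (- \<epsilon>) ^ r = ?q \<epsilon> ^ p * (?q \<epsilon> ^ r * ?q (- \<epsilon>) ^ r)"
      unfolding k[OF nz, symmetric] power_add by (simp only: mult.assoc)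
    ultimately show ?thesis by simp
  qed
  have "fval d f y (c * y) = y ^ (k div d) * S \<epsilon>"
    unfolding fval_def S_def sum_distrib_left
  proof (intro sum.cong refl, clarify)
    fix p r
    show "coeff (coeff f p) r * (c * y) ^ (r div d) * y ^ (p div d) = y ^ (k div d) * (coeff (coeff f p) r * ?q \<epsilon> ^ r)"
    proof (cases "coeff (coeff f p) r = 0")
      case False
      have "coeff (coeff f p) r * (c * y) ^ (r div d) * y ^ (p div d) = (y ^ (r div d) * y ^ (p div d)) * (coeff (coeff f p) r * c ^ (r div d))"
        unfolding power_mult_distrib by (simp only: mult_ac)
      then show ?thesis unfolding yk[OF False] using cr dv[OF False] by simp
    qed simp
  qed
  moreover have "fval d f (c * y) y = y ^ (k div d) * ?q \<epsilon> ^ k * S (- \<epsilon>)"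
    unfolding fval_def S_def sum_distrib_left
  proof (intro sum.cong refl, clarify)
    fix p r
    show "coeff (coeff f p) r * y ^ (r div d) * (c * y) ^ (p div d) = y ^ (k div d) * ?q \<epsilon> ^ k * (coeff (coeff f p) r * ?q (- \<epsilon>) ^ r)"
    proof (cases "coeff (coeff f p) r = 0")
      case False
      have "coeff (coeff f p) r * y ^ (r div d) * (c * y) ^ (p div d) = (y ^ (r div d) * y ^ (p div d)) * (coeff (coeff f p) r * c ^ (p div d))"
        unfolding power_mult_distrib by (simp only: mult_ac)
      also have "c ^ (p div d) = ?q \<epsilon> ^ k * ?q (- \<epsilon>) ^ r" using cr[of p] dv[OF False] qq[OF False] by simp
      finally show ?thesis unfolding yk[OF False] by (simp only: mult_ac)
    qed simp
  qed
  moreover have "?q \<epsilon> ^ k \<noteq> 0"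
  proof -
    have "?q \<epsilon> \<noteq> 0" unfolding qpow_qc using qc_nth0[of 1] by (metis fps_zero_nth one_neq_zero)
    then show ?thesis by simp
  qed
  ultimately show ?thesis using S[OF e] S[of "- \<epsilon>"] e y0 by auto
qed

subsection \<open>Modules\<close>

text \<open>The action is pulled back to the completed free algebra, where the relations are
  explicit. The assumptions on the ideal are available unless W is zero, by
  \<open>ideal_or_trivial\<close>.\<close>

locale free_action =
  fixes T :: "'i::finite datum" and \<epsilon> :: int
    and sW :: "complex fps \<Rightarrow> 'w \<Rightarrow> 'w::ab_group_add" and act :: "'i wfun set \<Rightarrow> 'w \<Rightarrow> 'w"
  assumes U: "U_module T \<epsilon> sW act" and I: "ideal (rel_ideal T \<epsilon>) free_alg"
    and rels: "relQ0 T \<union> relQ8 T \<epsilon> \<union> relQ9 T \<epsilon> \<subseteq> rel_ideal T \<epsilon>"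
begin

interpretation I: ideal "rel_ideal T \<epsilon>" "free_alg :: 'i wfun ring" by (rule I)

abbreviation "F \<equiv> (free_alg :: 'i wfun ring)"

definition A :: "'i wfun \<Rightarrow> 'w \<Rightarrow> 'w" where "A u = act (Ucls T \<epsilon> u)"

lemma car: "u \<in> carrier F \<longleftrightarrow> (\<forall>n. finite {w. \<not> fps_X ^ n dvd u w})" by (simp add: free_alg_def)
lemma add_F: "u \<oplus>\<^bsub>F\<^esub> v = u + v" by (simp add: free_alg_def plus_fun_def)
lemma mult_F: "u \<otimes>\<^bsub>F\<^esub> v = (\<lambda>w. \<Sum>k\<le>length w. u (take k w) * v (drop k w))" by (simp add: free_alg_def)
lemma one_F: "\<one>\<^bsub>F\<^esub> = (\<lambda>w. if w = [] then 1 else 0)" by (simp add: free_alg_def)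
lemma zero_F: "\<zero>\<^bsub>F\<^esub> = 0" by (simp add: free_alg_def zero_fun_def)

lemma gen_car: "gen a n \<in> carrier F"
  unfolding car gen_def by (intro allI, rule finite_subset[of _ "{[(a, n)]}"]) auto
lemma c1_car: "wscale c \<one>\<^bsub>F\<^esub> \<in> carrier F"
  unfolding car wscale_def one_F by (intro allI, rule finite_subset[of _ "{[]}"]) auto

text \<open>Scalars are multiples of the unit, from the left and, in the next lemma, from the right;
  so compatibility with scalars follows from multiplicativity of the action.\<close>

lemma wscale_l: "wscale c u = wscale c \<one>\<^bsub>F\<^esub> \<otimes>\<^bsub>F\<^esub> u"
proof
  fix w
  have "(wscale c \<one>\<^bsub>F\<^esub> \<otimes>\<^bsub>F\<^esub> u) w = (\<Sum>k\<le>length w. if k = 0 then c * u w else 0)"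
    unfolding mult_F wscale_def one_F by (intro sum.cong) auto
  then show "wscale c u w = (wscale c \<one>\<^bsub>F\<^esub> \<otimes>\<^bsub>F\<^esub> u) w" by (simp add: wscale_def)
qed

lemma wscale_r: "wscale c u = u \<otimes>\<^bsub>F\<^esub> wscale c \<one>\<^bsub>F\<^esub>"
proof
  fix w
  have "(u \<otimes>\<^bsub>F\<^esub> wscale c \<one>\<^bsub>F\<^esub>) w = (\<Sum>k\<le>length w. if k = length w then c * u w else 0)"
    unfolding mult_F wscale_def one_F by (intro sum.cong) auto
  then show "wscale c u w = (u \<otimes>\<^bsub>F\<^esub> wscale c \<one>\<^bsub>F\<^esub>) w" by (simp add: wscale_def)
qed

lemma wscale_car: "u \<in> carrier F \<Longrightarrow> wscale c u \<in> carrier F"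
  unfolding wscale_l[of c u] using c1_car by (rule I.m_closed)

lemma plus_car: "u \<in> carrier F \<Longrightarrow> v \<in> carrier F \<Longrightarrow> u + v \<in> carrier F"
  unfolding add_F[symmetric] by (rule I.a_closed)

lemma cls: "u \<in> carrier F \<Longrightarrow> Ucls T \<epsilon> u \<in> carrier (Ualg T \<epsilon>)"
  "u \<in> carrier F \<Longrightarrow> v \<in> carrier F \<Longrightarrow> Ucls T \<epsilon> (u \<oplus>\<^bsub>F\<^esub> v) = Ucls T \<epsilon> u \<oplus>\<^bsub>Ualg T \<epsilon>\<^esub> Ucls T \<epsilon> v"
  "u \<in> carrier F \<Longrightarrow> v \<in> carrier F \<Longrightarrow> Ucls T \<epsilon> (u \<otimes>\<^bsub>F\<^esub> v) = Ucls T \<epsilon> u \<otimes>\<^bsub>Ualg T \<epsilon>\<^esub> Ucls T \<epsilon> v"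
  using ring_hom_closed[OF I.rcos_ring_hom] ring_hom_add[OF I.rcos_ring_hom] ring_hom_mult[OF I.rcos_ring_hom]
  unfolding Ucls_def Ualg_def by auto

lemma mod: "Modules.module sW" using U by (simp add: U_module_def)

interpretation W: Modules.module sW by (rule mod)

lemma A_lin: "u \<in> carrier F \<Longrightarrow> A u (v + w) = A u v + A u w"
  using U cls(1) unfolding U_module_def A_def by blast
lemma act_U: "p \<in> carrier (Ualg T \<epsilon>) \<Longrightarrow> q \<in> carrier (Ualg T \<epsilon>) \<Longrightarrow> act (p \<oplus>\<^bsub>Ualg T \<epsilon>\<^esub> q) w = act p w + act q w"
  "p \<in> carrier (Ualg T \<epsilon>) \<Longrightarrow> q \<in> carrier (Ualg T \<epsilon>) \<Longrightarrow> act (p \<otimes>\<^bsub>Ualg T \<epsilon>\<^esub> q) w = act p (act q w)"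
  using U unfolding U_module_def by blast+
lemma A_add: "u \<in> carrier F \<Longrightarrow> v \<in> carrier F \<Longrightarrow> A (u + v) w = A u w + A v w"
  unfolding A_def add_F[symmetric] cls(2) by (intro act_U cls)
lemma A_mult: "u \<in> carrier F \<Longrightarrow> v \<in> carrier F \<Longrightarrow> A (u \<otimes>\<^bsub>F\<^esub> v) w = A u (A v w)"
  unfolding A_def cls(3) by (intro act_U cls)
lemma A_c1: "A (wscale c \<one>\<^bsub>F\<^esub>) w = sW c w"
  using U unfolding U_module_def A_def by blast
lemma A_wscale: "u \<in> carrier F \<Longrightarrow> A (wscale c u) w = sW c (A u w)"
  unfolding wscale_l[of c u] using A_mult[OF c1_car] A_c1 by simp
lemma A_sc: "u \<in> carrier F \<Longrightarrow> A u (sW c w) = sW c (A u w)"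
  using A_mult[OF _ c1_car, of u c w] A_wscale[of u c w] unfolding A_c1 wscale_r[of c u, symmetric] by simp
lemma A_0: "A 0 w = 0"
proof -
  have "(0 :: 'i wfun) = wscale 0 \<one>\<^bsub>F\<^esub>" by (simp add: wscale_def zero_fun_def)
  then show ?thesis using A_c1[of 0 w] by simp
qed

lemma A_diff: assumes "u \<in> carrier F" "v \<in> carrier F" shows "A (u - v) w = A u w - A v w"
proof -
  have e: "u - v = u + wscale (-1) v" by (auto simp: wscale_def fun_eq_iff)
  show ?thesis unfolding e A_add[OF assms(1) wscale_car[OF assms(2)]] A_wscale[OF assms(2)] by simp
qed

lemma A_rel: assumes "u \<in> rel_ideal T \<epsilon>" shows "A u w = 0"
proof -
  have "Ucls T \<epsilon> u = rel_ideal T \<epsilon>" "Ucls T \<epsilon> \<zero>\<^bsub>F\<^esub> = rel_ideal T \<epsilon>"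
    unfolding Ucls_def using I.a_rcos_const[OF assms] I.a_rcos_const[OF additive_subgroup.zero_closed[OF ideal.axioms(1)[OF I]]] by auto
  then have "A u w = A \<zero>\<^bsub>F\<^esub> w" by (simp add: A_def)
  then show ?thesis unfolding zero_F A_0 .
qed

lemma sum_car: "(\<And>k. k \<in> K \<Longrightarrow> g k \<in> carrier F) \<Longrightarrow> sum g K \<in> carrier F \<and> A (sum g K) w = (\<Sum>k\<in>K. A (g k) w)"
proof (induction K rule: infinite_finite_induct)
  case (insert k K)
  then have ih: "g k \<in> carrier F" "sum g K \<in> carrier F" "A (sum g K) w = (\<Sum>k\<in>K. A (g k) w)" by auto
  show ?case unfolding sum.insert[OF insert.hyps] A_add[OF ih(1,2)] ih(3) using plus_car[OF ih(1,2)] by blast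
qed (use I.zero_closed zero_F A_0 in auto)

lemma A_pt:
  assumes "\<And>e. X e \<in> carrier F"
  shows "poly_times wscale p X e \<in> carrier F" "A (poly_times wscale p X e) w = poly_times sW p (\<lambda>e. A (X e) w) e"
  unfolding poly_times_def using sum_car[of "ks p" "\<lambda>k. wscale (lk p k) (X (e - k))" w] assms wscale_car A_wscale
  by auto

lemma A_gc: "gcurrents l e \<in> carrier F" "A (gcurrents l e) w = currents (xop T \<epsilon> act) l w e"
proof -
  let ?f = "foldr (\<lambda>(i, a) u. gen i (- lk e a) \<otimes>\<^bsub>F\<^esub> u) l \<one>\<^bsub>F\<^esub>"
  have one: "\<one>\<^bsub>F\<^esub> = wscale 1 \<one>\<^bsub>F\<^esub>" by (simp add: wscale_def)
  have f: "?f \<in> carrier F \<and> A ?f w = foldr (\<lambda>(i, a) u. xop T \<epsilon> act i (- lk e a) u) l w"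
  proof (induction l)
    case Nil
    then show ?case using c1_car[of 1] A_c1[of 1 w] one by simp
  next
    case (Cons p l)
    obtain i a where p: "p = (i, a)" by (cases p)
    show ?case using Cons.IH A_mult[OF gen_car] I.m_closed[OF gen_car] by (auto simp: p xop_def A_def)
  qed
  show "gcurrents l e \<in> carrier F" "A (gcurrents l e) w = currents (xop T \<epsilon> act) l w e"
    unfolding gcurrents_def currents_def using f A_0 I.zero_closed zero_F by auto
qed

lemma xop_A: "xop T \<epsilon> act a n = A (gen a n)" by (simp add: xop_def A_def)

lemma xop_lin: "xop T \<epsilon> act a n (u + v) = xop T \<epsilon> act a n u + xop T \<epsilon> act a n v"
  "xop T \<epsilon> act a n (sW c u) = sW c (xop T \<epsilon> act a n u)"
  unfolding xop_A by (simp_all add: A_lin A_sc gen_car)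

lemma Q0: "xop T \<epsilon> act (aut T a) n w = sW (fps_const (\<xi> T powi n)) (xop T \<epsilon> act a n w)"
proof -
  have "A (gen (aut T a) n - wscale (fps_const (\<xi> T powi n)) (gen a n)) w = 0"
    by (rule A_rel) (use rels in \<open>auto simp: relQ0_def\<close>)
  then show ?thesis by (simp add: A_diff gen_car wscale_car A_wscale xop_A)
qed

lemma Q8: "poly_times sW (Fpol T \<epsilon> a b (Var 0) (Var 1)) (currents (xop T \<epsilon> act) [(a, 0), (b, 1)] w) e =
    poly_times sW (Gpol T \<epsilon> a b (Var 0) (Var 1)) (currents (xop T \<epsilon> act) [(b, 1), (a, 0)] w) e"
proof -
  have "A (poly_times wscale (Fpol T \<epsilon> a b (Var 0) (Var 1)) (gcurrents [(a, 0), (b, 1)]) e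
      - poly_times wscale (Gpol T \<epsilon> a b (Var 0) (Var 1)) (gcurrents [(b, 1), (a, 0)]) e) w = 0"
    by (rule A_rel, rule subsetD[OF rels], unfold relQ8_def, blast)
  then show ?thesis by (simp add: A_diff A_pt A_gc)
qed

lemma Q9: assumes "snum T a = 2"
  shows "(\<Sum>\<sigma> | \<sigma> permutes {1..3::nat}. poly_times sW (ppol T \<epsilon> a (Var (\<sigma> 1)) (Var (\<sigma> 2)) (Var (\<sigma> 3)))
         (currents (xop T \<epsilon> act) [(a, \<sigma> 1), (a, \<sigma> 2), (a, \<sigma> 3)] w) e) = 0"
proof -
  let ?g = "\<lambda>\<sigma> :: nat \<Rightarrow> nat. poly_times wscale (ppol T \<epsilon> a (Var (\<sigma> 1)) (Var (\<sigma> 2)) (Var (\<sigma> 3))) (gcurrents [(a, \<sigma> 1), (a, \<sigma> 2), (a, \<sigma> 3)]) e"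
  have "A (\<Sum>\<sigma> | \<sigma> permutes {1..3::nat}. ?g \<sigma>) w = 0"
    by (rule A_rel, rule subsetD[OF rels]) (use assms in \<open>unfold relQ9_def, blast\<close>)
  moreover have "A (\<Sum>\<sigma> | \<sigma> permutes {1..3::nat}. ?g \<sigma>) w = (\<Sum>\<sigma> | \<sigma> permutes {1..3::nat}. A (?g \<sigma>) w)"
    using sum_car[of "{\<sigma>. \<sigma> permutes {1..3}}" ?g w] A_pt(1) A_gc(1) by blast
  ultimately show ?thesis by (simp add: A_pt A_gc)
qed

end

text \<open>If no closed ideal contained the relations, \<open>rel_ideal\<close> would be an
  intersection over the empty family, hence everything. All classes would then coincide, the scalars
  1 and 0 would act alike, and W would be zero. Otherwise any such ideal brings the ring axioms for
  \<open>free_alg\<close> with it.\<close>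

lemma ideal_or_trivial:
  fixes T :: "'i::finite datum" and sW :: "complex fps \<Rightarrow> 'w \<Rightarrow> 'w::ab_group_add" and act :: "'i wfun set \<Rightarrow> 'w \<Rightarrow> 'w"
  assumes U: "U_module T \<epsilon> sW act"
  shows "free_action T \<epsilon> sW act \<or> (\<forall>w :: 'w. w = 0)"
proof (cases "\<exists>J. ideal J (free_alg :: 'i wfun ring) \<and> hclosed J \<and> relQ0 T \<union> relQ8 T \<epsilon> \<union> relQ9 T \<epsilon> \<subseteq> J")
  case True
  let ?S = "{J. ideal J (free_alg :: 'i wfun ring) \<and> hclosed J \<and> relQ0 T \<union> relQ8 T \<epsilon> \<union> relQ9 T \<epsilon> \<subseteq> J}"
  obtain J where J: "J \<in> ?S" using True by blast
  then have "ring (free_alg :: 'i wfun ring)" using ideal.axioms(2) by blast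
  then have "ideal (\<Inter>?S) (free_alg :: 'i wfun ring)" by (rule ring.i_Intersect) (use J in auto)
  then have "ideal (rel_ideal T \<epsilon>) (free_alg :: 'i wfun ring)" unfolding rel_ideal_def .
  moreover have "relQ0 T \<union> relQ8 T \<epsilon> \<union> relQ9 T \<epsilon> \<subseteq> rel_ideal T \<epsilon>" unfolding rel_ideal_def by blast
  ultimately have "free_action T \<epsilon> sW act" by (rule free_action.intro[OF U])
  then show ?thesis ..
next
  case False
  then have "rel_ideal T \<epsilon> = UNIV" unfolding rel_ideal_def by blast
  then have cl: "Ucls T \<epsilon> u = UNIV" for u :: "'i wfun"
  proof -
    assume r: "rel_ideal T \<epsilon> = UNIV"
    have "f \<in> Ucls T \<epsilon> u" for f
      unfolding Ucls_def r a_r_coset_def r_coset_def by (auto simp: free_alg_def intro!: exI[of _ "\<lambda>w. f w - u w"])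
    then show ?thesis by blast
  qed
  interpret W: Modules.module sW using U by (simp add: U_module_def)
  have "sW c w = act UNIV w" for c w
    using U cl unfolding U_module_def by metis
  then have "sW 1 w = sW 0 w" for w by metis
  then show ?thesis by simp
qed

lemma hmodule_top_free:
  assumes "Modules.module sW" "top_free sW (s0 :: complex \<Rightarrow> 'v \<Rightarrow> 'v::ab_group_add)"
  shows "\<exists>co. hmodule sW s0 co"
proof -
  obtain \<phi> :: "(nat \<Rightarrow> 'v) \<Rightarrow> 'a" where p: "vector_space s0" "bij \<phi>" "module_hom (pseries_scale s0) sW \<phi>"
    using assms(2) unfolding top_free_def by blast
  interpret h: module_hom "pseries_scale s0" sW \<phi> by (rule p(3))
  let ?co = "inv_into UNIV \<phi>"
  have i: "\<phi> (?co y) = y" "?co (\<phi> g) = g" for y g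
    using p(2) by (simp_all add: bij_is_surj surj_f_inv_f bij_is_inj inv_f_f)
  have a: "?co (y + z) = ?co y + ?co z" for y z
    using h.add[of "?co y" "?co z"] i by metis
  have s: "?co (sW c y) = pseries_scale s0 c (?co y)" for c y
    using h.scale[of c "?co y"] i by metis
  interpret M: Modules.module sW by (rule assms(1))
  have "hmodule sW s0 ?co"
  proof (rule hmodule.intro[OF assms(1)], rule hmodule_axioms.intro)
    show "bij ?co" by (rule bij_imp_bij_inv[OF p(2)])
  qed (simp_all add: p(1) a s pseries_scale_def)
  then show ?thesis by (intro exI)
qed

lemma root_powi: assumes "0 < n" "(prim_root n powi z) ^ p = 1" shows "int n dvd z * int p"
proof -
  have nat: "int n dvd int k * int p" if "(prim_root n ^ k) ^ p = 1" for k
  proof -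
    have "prim_root n ^ (k * p) = 1" using that by (simp add: power_mult)
    then have "n dvd k * p" using prim_root_1_iff[OF assms(1)] by blast
    then show ?thesis by (metis of_nat_dvd_iff of_nat_mult)
  qed
  show ?thesis
  proof (cases z rule: int_cases2)
    case (nonneg k)
    then show ?thesis using nat[of k] assms(2) by simp
  next
    case (nonpos k)
    have "(prim_root n ^ k) ^ p = 1"
      using assms(2) by (simp add: nonpos power_int_minus power_inverse)
    then show ?thesis using nat[of k] by (simp add: nonpos)
  qed
qed

lemma (in cartan) std_pow:
  "cAc \<epsilon> i ^ s * alc \<epsilon> i j l = qc (prim_root (dpair T i j div dnum T i) ^ l) (of_int (sym T i) * (of_int (\<epsilon> * (2 * int s + cmat T i j)) * of_nat (dnum T i)))"
  unfolding cAc_def alc_def qc_power qc_mult by (simp add: algebra_simps)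

text \<open>By (Q0), going once around the orbit of i multiplies the mode by the scalar \<xi>^(n *
  per i), which is 1 only if d_i divides n. Without torsion the mode vanishes otherwise.\<close>

lemma (in free_action) x_sup:
  assumes cd: "cartan_datum T" and tf: "hmodule sW s0 co" and n: "\<not> int (dnum T i) dvd n"
  shows "xop T \<epsilon> act i n v = 0"
proof -
  interpret C: cartan T by unfold_locales (rule cd)
  interpret H: hmodule sW s0 co by (rule tf)
  let ?c = "\<lambda>k. fps_const ((\<xi> T powi n) ^ k)"
  have it: "xop T \<epsilon> act ((aut T ^^ k) i) n v = sW (?c k) (xop T \<epsilon> act i n v)" for k
    by (induction k) (simp_all add: Q0)
  let ?y = "xop T \<epsilon> act i n v" and ?p = "C.per i"
  have "?y = sW (?c ?p) ?y" using it[of ?p] C.per(2)[of i] by simp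
  then have "sW (1 - ?c ?p) ?y = 0" by (simp add: H.scale_left_diff_distrib)
  moreover have "1 - ?c ?p \<noteq> 0"
  proof
    assume "1 - ?c ?p = 0"
    then have "fps_nth (1 - ?c ?p) 0 = 0" by simp
    then have "(\<xi> T powi n) ^ ?p = 1" by simp
    then have "int (autord T) dvd n * int ?p" by (rule root_powi[OF C.N_props(1)])
    then have "int ?p * int (dnum T i) dvd int ?p * n" using C.dnum(1)[of i] by (metis mult.commute of_nat_mult)
    then show False using n C.per(1)[of i] by simp
  qed
  ultimately show ?thesis by (rule H.sc_eq_0)
qed

theorem theorem5p16:
  fixes T :: "'i::finite datum" and \<epsilon> :: int
    and sW :: "complex fps \<Rightarrow> 'w \<Rightarrow> 'w::ab_group_add"
    and s0 :: "complex \<Rightarrow> 'v \<Rightarrow> 'v::ab_group_add"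
    and act :: "'i wfun set \<Rightarrow> 'w \<Rightarrow> 'w"
    and i j :: 'i and m :: nat and f :: bipoly and B :: "nat \<Rightarrow> complex fps"
  assumes "cartan_datum T" and "LC1 T" and "LC2 T" and "LC3 T"
    and "\<epsilon> \<in> {1, -1}"
    and "restricted_module T \<epsilon> sW s0 act"
    and "(i, j) \<in> \<II> T"
    and "m > 0"
    and "in_powers (dnum T i) f" and "homogeneous f"
    and "Ppol T \<epsilon> i j m f B = 0"
  shows "((\<forall>l < dpair T i j div dnum T i. nop_vanishes T \<epsilon> sW (xop T \<epsilon> act) i j l) \<longrightarrow>
            (\<forall>v e. Ddist sW (xop T \<epsilon> act) i j m f B v e = 0))
       \<and> (m = mnum T i j \<and> (\<exists>r\<le>m. B r \<noteq> 0) \<and>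
          (\<forall>n \<in> {1..nat (- cmat T i j)}. \<forall>\<delta> \<in> {1, -1}.
              eval2 f (Var 0) (Cst (qpow T i (of_int (\<delta> * 2 * int n))) * Var 0) \<noteq> 0) \<and>
          (\<forall>v e. Ddist sW (xop T \<epsilon> act) i j m f B v e = 0) \<longrightarrow>
            (\<forall>l < dpair T i j div dnum T i. nop_vanishes T \<epsilon> sW (xop T \<epsilon> act) i j l))"
proof (cases "free_action T \<epsilon> sW act")
  case False
  then have z: "w = 0" for w :: 'w using ideal_or_trivial[of T \<epsilon> sW act] assms(6) unfolding restricted_module_def by blast
  have "nop_vanishes T \<epsilon> sW (xop T \<epsilon> act) i j l" for l unfolding nop_vanishes_def Let_def using z by blast
  moreover have "Ddist sW (xop T \<epsilon> act) i j m f B v e = 0" for v e by (rule z)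
  ultimately show ?thesis by blast
next
  case True
  interpret A: free_action T \<epsilon> sW act by (rule True)
  interpret C: cartan T by unfold_locales (rule assms(1))
  note ctx = assms(7,3,4)
  have res: "\<exists>N. \<forall>n\<ge>N. xop T \<epsilon> act a n w \<in> hfilt sW p" for a w p
    using assms(6) unfolding restricted_module_def eventually_at_top_linorder by blast
  obtain co where co: "hmodule sW s0 co" using hmodule_top_free[OF A.mod] assms(6) unfolding restricted_module_def by blast
  define d where "d = dnum T i"
  define M where "M = nat (1 - cmat T i j)"
  define hB where "hB = (snum T i = 2)"
  define x where "x = xop T \<epsilon> act"
  define ne where "ne = dpair T i j div d"
  define k1 where "k1 = qpow T i (- of_int \<epsilon> * 3 / 2 * of_nat d)"
  define k2 where "k2 = qpow T i (of_nat d / 2) + qpow T i (- of_nat d / 2)"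
  define k3 where "k3 = qpow T i (of_int \<epsilon> * 3 / 2 * of_nat d)"
  let ?cA = "C.cAc \<epsilon> i" and ?cB = "C.cBc \<epsilon> i" and ?al = "C.alc \<epsilon> i j"
  note aij = C.aij(1)[OF ctx]
  have M1: "int (M - 1) = - cmat T i j" and M2: "2 \<le> M" using aij by (auto simp: M_def)
  have ne0: "0 < ne" using C.ne(2)[OF ctx] by (simp add: ne_def d_def)
  interpret H: hmodule_step sW s0 co d
    by (rule hmodule_step.intro[OF co], rule hmodule_step_axioms.intro) (simp add: d_def C.dnum(2))
  note Fii = C.Fii[OF assms(2), of \<epsilon> i, folded d_def hB_def] and Gii = C.Gii[OF assms(2), of \<epsilon> i, folded d_def hB_def]
  note Fij = C.Fij[OF ctx, of \<epsilon>, folded d_def, folded ne_def] and Gij = C.Gij[OF ctx, of \<epsilon>, folded d_def, folded ne_def]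
  have sw: "poly_times sW (Fpol T \<epsilon> a b (Var 0) (Var 1)) (rc x [(a, 0), (b, 1)] v) e =
      poly_times sW (Gpol T \<epsilon> a b (Var 0) (Var 1)) (rc x [(b, 1), (a, 0)] v) e"
    if "pv {0, 1} (Fpol T \<epsilon> a b (Var 0) (Var 1))" "pv {0, 1} (Gpol T \<epsilon> a b (Var 0) (Var 1))" for a b v e
    using H.rc_currents[OF that(1), of "[(a, 0), (b, 1)]" x v e] H.rc_currents[OF that(2), of "[(b, 1), (a, 0)]" x v e] A.Q8
    by (simp add: x_def insert_commute)
  have pvu: "pv C (- p)" if "pv C p" for C p using that by (simp add: pv_def)
  have pvF: "pv {0, 1} (Fpol T \<epsilon> i i (Var 0) (Var 1))" "pv {0, 1} (Fpol T \<epsilon> i j (Var 0) (Var 1))"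
    unfolding Fii Fij by (rule pv_PT; auto split: if_splits)+
  have pvG: "pv {0, 1} (Gpol T \<epsilon> i i (Var 0) (Var 1))" "pv {0, 1} (Gpol T \<epsilon> i j (Var 0) (Var 1))"
    unfolding Gii Gij by (rule pvu, rule pv_PT; auto split: if_splits)+
  interpret CM: current_module sW s0 co d x i j ?cA ?cB ?al ?al ne M hB k1 k2 k3
  proof unfold_locales
    show "x a n (u + v) = x a n u + x a n v" "x a n (sW c u) = sW c (x a n u)" for a n u v c
      unfolding x_def by (rule A.xop_lin)+
    show "\<exists>N. \<forall>n\<ge>N. H.zt p (x a n v)" for a p v using res unfolding x_def H.hfilt_zt by blast
    show "x i n v = 0" if "\<not> int d dvd n" for n v
      unfolding x_def by (rule A.x_sup[OF assms(1) co]) (use that in \<open>simp add: d_def\<close>)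
    show "fps_nth ?cA 0 \<noteq> 0" "fps_nth ?cB 0 \<noteq> 0" by (simp_all add: C.cAc_def C.cBc_def qc_nth0)
    show "unit0 (?al l)" for l by (rule C.alc_unit[OF ctx])
    show "?cA * ?cB ^ 2 = 1" by (rule C.cAB)
    show "n = 2 * t" if "?cB ^ n * ?cA ^ t = 1" for n t by (rule C.cBA[OF assms(5) that])
    show "n + 2 * (M - 1) = 2 * t" if "?al l * ?cB ^ n * ?cA ^ t * ?al l' = 1" for l l' n t
      unfolding M_def by (rule C.closed[OF assms(5) aij that])
    show "k = 0" if "?al l' = ?cA ^ k * ?al l" for l l' k by (rule C.alal[OF assms(5) that])
    show "2 \<le> M" by (rule M2)
    show "poly_times sW (PT d (insert (0, ?cA, 1) (if hB then {(0, ?cB, 1)} else {}))) (rc x [(i, 0), (i, 1)] v) e =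
       - poly_times sW (PT d (insert (1, ?cA, 0) (if hB then {(1, ?cB, 0)} else {}))) (rc x [(i, 1), (i, 0)] v) e" for v e
      using sw[OF pvF(1) pvG(1), of v e] unfolding Fii Gii H.pt_uminus .
    show "poly_times sW (PT d ((\<lambda>l. (0, ?al l, 1)) ` {..<ne})) (rc x [(i, 0), (j, 1)] v) e =
       - poly_times sW (PT d ((\<lambda>l. (1, ?al l, 0)) ` {..<ne})) (rc x [(j, 1), (i, 0)] v) e" for v e
      using sw[OF pvF(2) pvG(2), of v e] unfolding Fij Gij H.pt_uminus .
    show "k1 * (?cA * ?cB) - k2 * ?cB + k3 \<noteq> 0"
    proof -
      \<comment> \<open>Constant terms: cA becomes 1 and cB becomes -1, so the three summands become
        -1, 2 and 1.\<close>
      have "fps_nth (k1 * (?cA * ?cB) - k2 * ?cB + k3) 0 = 2"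
        by (simp add: k1_def k2_def k3_def C.cAc_def C.cBc_def qc_nth0 qpow_qc)
      then show ?thesis by (metis fps_zero_nth zero_neq_numeral)
    qed
    show "(\<Sum>\<sigma> | \<sigma> permutes {1..3::nat}. poly_times sW (pS d k1 k2 k3 (\<sigma> 1) (\<sigma> 2) (\<sigma> 3)) (rc x [(i, \<sigma> 1), (i, \<sigma> 2), (i, \<sigma> 3)] v) e) = 0"
      if hB for v e
    proof -
      have pS: "ppol T \<epsilon> i (Var a) (Var b) (Var c) = pS d k1 k2 k3 a b c" for a b c
        unfolding ppol_def pS_def Let_def d_def[symmetric] k1_def k2_def k3_def ..
      have "poly_times sW (pS d k1 k2 k3 (\<sigma> 1) (\<sigma> 2) (\<sigma> 3)) (rc x [(i, \<sigma> 1), (i, \<sigma> 2), (i, \<sigma> 3)] v) e =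
          poly_times sW (pS d k1 k2 k3 (\<sigma> 1) (\<sigma> 2) (\<sigma> 3)) (currents x [(i, \<sigma> 1), (i, \<sigma> 2), (i, \<sigma> 3)] v) (res {1..3} e)"
        if s: "\<sigma> permutes {1..3}" for \<sigma>
      proof (rule H.rc_currents)
        have s3: "{1..3::nat} = {1, 2, 3}" by auto
        have "\<sigma> ` {1, 2, 3} = {1..3}" using permutes_image[OF s] unfolding s3 .
        then show "snd ` set [(i, \<sigma> 1), (i, \<sigma> 2), (i, \<sigma> 3)] = {1..3}" by simp
        have "\<sigma> 1 \<in> {1..3}" "\<sigma> 2 \<in> {1..3}" "\<sigma> 3 \<in> {1..3}" using permutes_in_image[OF s] by auto
        then show "pv {1..3} (pS d k1 k2 k3 (\<sigma> 1) (\<sigma> 2) (\<sigma> 3))" unfolding pS_def by (intro pv_add pv_diff pv_mult pv_Cst pv_Var)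
      qed simp
      then show ?thesis using A.Q9[of i v "res {1..3} e"] that unfolding pS hB_def x_def[symmetric] by simp
    qed
  qed
  interpret N: current_nop sW s0 co d x i j ?cA ?cB ?al ?al ne M hB k1 k2 k3 T \<epsilon>
  proof unfold_locales
    show "Fpol T \<epsilon> i i (Var a) (Var b) = PT d (insert (a, ?cA, b) (if hB then {(a, ?cB, b)} else {}))" for a b by (rule Fii)
    show "Fpol T \<epsilon> i j (Var a) (Var b) = PT d ((\<lambda>l. (a, ?al l, b)) ` {..<ne})" for a b by (rule Fij)
    show "(\<Prod>k | k < autord T \<and> 0 < tmat T i i k. Var a - Cst (fps_const (\<xi> T ^ k)) * Var b) = Var a ^ d - Var b ^ d" for a b
      unfolding d_def by (rule C.den_prod)
    show "tmat T i j k \<le> 0" for k by (rule C.noden[OF ctx])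
  qed auto
  interpret R: current_main sW s0 co d x i j ?cA ?cB ?al ?al ne M hB k1 k2 k3 "{1..m}" m
    "\<lambda>a b. Gpol T \<epsilon> i i (Var a) (Var b)" "\<lambda>a b. Gpol T \<epsilon> i j (Var a) (Var b)" "\<lambda>a b. Fpol T \<epsilon> i j (Var a) (Var b)"
    "\<lambda>a b. eval2 f (Var a) (Var b)" B
  proof unfold_locales
    show "(\<Sum>\<sigma> | \<sigma> permutes {1..m}. of_int (sign \<sigma>) *
       (\<Sum>r=0..m. (-1) ^ r * Cst (B r) *
          (\<Prod>(a, b)\<in>{(a, b). 1 \<le> a \<and> a < b \<and> b \<le> m}. eval2 f (Var (\<sigma> a)) (Var (\<sigma> b)) * Gpol T \<epsilon> i i (Var (\<sigma> a)) (Var (\<sigma> b))) *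
          (\<Prod>a=1..r. Gpol T \<epsilon> i j (Var (\<sigma> a)) (Var 0)) * (\<Prod>b=r+1..m. Fpol T \<epsilon> i j (Var (\<sigma> b)) (Var 0)))) = 0"
      using assms(11) unfolding Ppol_def .
  qed (use Fij Gii Gij in auto)
  \<comment> \<open>In \<open>std_u\<close> the power of cA falls as \<rho> t grows, whereas the
    exponents a_ij + 2 t of q_i rise with t. For \<epsilon> = 1 the chain is therefore reversed; for
    \<epsilon> = -1 the base cA is a negative power of q_i and no reversal takes place.\<close>
  define \<rho> where "\<rho> t = (if t < M \<and> \<epsilon> = 1 then M - 1 - t else t)" for t
  have rho: "\<rho> permutes {..<M}"
    by (rule bij_imp_permutes) (auto simp: \<rho>_def intro!: bij_betwI[of _ _ _ \<rho>])
  have nv: "nop_vanishes T \<epsilon> sW x i j l \<longleftrightarrow> (\<forall>v. N.van {..M} (CM.std_u \<rho> l) (CM.std_Phi v))" if l: "l < ne" for l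
  proof -
    define cs where "cs = map (\<lambda>t. qpow T i (of_int (cmat T i j + 2 * int t)) * fps_const (prim_root (dpair T i j) ^ l)) [0..<M] @ [1]"
    have "(\<forall>n. subst_coeff sW cs (nop T \<epsilon> sW x N.ind v) n = 0) \<longleftrightarrow> N.van {..M} (CM.std_u \<rho> l) (CM.std_Phi v)" for v
    proof (rule N.nop_van)
      show "length cs = Suc M" "cs ! M = 1" by (auto simp: cs_def nth_append)
      have ct: "cs ! t = qpow T i (of_int (cmat T i j + 2 * int t)) * fps_const (prim_root (dpair T i j) ^ l)" if "t < M" for t
        using that by (simp add: cs_def nth_append)
      show "unit0 (cs ! t)" if "t < M" for t using ct[OF that] prim_root_nz by (simp add: qpow_qc qc_nth0)
      show "(cs ! t) ^ d = CM.std_u \<rho> l t" if t: "t < M" for t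
      proof -
        have "(prim_root (dpair T i j) ^ l) ^ d = (prim_root (dpair T i j) ^ d) ^ l" by (simp add: power_mult[symmetric] mult.commute)
        also have "\<dots> = prim_root ne ^ l" unfolding ne_def d_def using prim_root_div[OF C.D_pos[OF ctx] C.d_dvd_D[OF ctx]] by simp
        finally have pr: "(prim_root (dpair T i j) ^ l) ^ d = prim_root ne ^ l" .
        have e1: "cs ! t ^ d = qc (prim_root ne ^ l) (of_int (sym T i) * (of_int (cmat T i j + 2 * int t) * of_nat d))"
          unfolding ct[OF t] power_mult_distrib d_def[symmetric] C.qpow_pow fps_const_power pr by (simp add: qc_def mult.commute)
        have e2: "CM.std_u \<rho> l t = qc (prim_root ne ^ l) (of_int (sym T i) * (of_int (\<epsilon> * (2 * int (M - 1 - \<rho> t) + cmat T i j)) * of_nat d))"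
          unfolding CM.std_u_def using t C.std_pow[of \<epsilon> i "M - 1 - \<rho> t" j l] by (simp add: ne_def d_def)
        have "\<epsilon> * (2 * int (M - 1 - \<rho> t) + cmat T i j) = cmat T i j + 2 * int t"
          using assms(5) t M1 by (auto simp: \<rho>_def of_nat_diff)
        then show ?thesis unfolding e1 e2 by simp
      qed
      show "CM.std_u \<rho> l M = 1" by (simp add: CM.std_u_def)
      show "inj_on (CM.std_u \<rho> l) {..<M}"
      proof (rule inj_onI)
        fix t t' assume t: "t \<in> {..<M}" "t' \<in> {..<M}" "CM.std_u \<rho> l t = CM.std_u \<rho> l t'"
        have "?al l \<noteq> 0" using C.alc_unit[OF ctx, of \<epsilon> l] by auto
        then have "?cA ^ (M - 1 - \<rho> t) = ?cA ^ (M - 1 - \<rho> t')" using t unfolding CM.std_u_def by auto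
        then have "M - 1 - \<rho> t = M - 1 - \<rho> t'" by (rule N.cA_pow_inj)
        then have "\<rho> t = \<rho> t'" using t permutes_in_image[OF rho, of t] permutes_in_image[OF rho, of t'] by auto
        then show "t = t'" using permutes_inj[OF rho] by (simp add: inj_eq)
      qed
      show "unit0 (CM.std_u \<rho> l t)" for t by (rule N.std_u_unit)
    qed
    then show ?thesis unfolding nop_vanishes_def Let_def cs_def M_def[symmetric] N.ind_def by blast
  qed
  let ?Bs = "insert 0 {1..m}"
  have wdt: "R.wd (R.ta (\<sigma>, r)) = map (\<lambda>a. (i, \<sigma> a)) [1..<Suc r] @ [(j, 0)] @ map (\<lambda>a. (i, \<sigma> a)) [Suc r..<Suc m]" if "(\<sigma>, r) \<in> R.II" for \<sigma> r
  proof -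
    have "\<sigma> a = 0 \<longleftrightarrow> a = 0" for a using R.IID(4,5)[OF that] by (metis injD)
    then show ?thesis by (simp add: R.wd_def R.ta_def base_def o_def del: upt_Suc)
  qed
  have snd: "snd ` set (R.wd (R.ta \<iota>)) = ?Bs" if "\<iota> \<in> R.II" for \<iota>
    using R.order_ta[OF that] unfolding R.snd_wd R.order_def by blast
  have pvn: "pv ?Bs (R.nm (\<sigma>, r))" if "(\<sigma>, r) \<in> R.II" for \<sigma> r
  proof -
    have s: "\<sigma> a \<in> ?Bs" if "a \<in> {1..m}" for a
      using permutes_in_image[OF R.IID(1)[OF \<open>(\<sigma>, r) \<in> R.II\<close>], of a] that by blast
    show ?thesis unfolding R.nm_def prod.case
    proof (intro pv_mult pv_prod pv_Cst)
      fix p assume "p \<in> R.PP"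
      then have "fst p \<in> {1..m}" "snd p \<in> {1..m}" by (auto simp: R.PP_def)
      then show "pv ?Bs (case p of (a, b) \<Rightarrow> eval2 f (Var (\<sigma> a)) (Var (\<sigma> b)))"
        unfolding case_prod_unfold using s by (intro pv_eval2) blast+
    qed
  qed
  have Dsum: "Ddist sW x i j m f B v e = (\<Sum>\<iota>\<in>R.II. poly_times sW (R.nm \<iota>) (currents x (R.wd (R.ta \<iota>)) v) e)" for v e
  proof -
    have "(\<Sum>\<iota>\<in>R.II. poly_times sW (R.nm \<iota>) (currents x (R.wd (R.ta \<iota>)) v) e) =
        (\<Sum>\<sigma> | \<sigma> permutes {1..m}. \<Sum>r=0..m. poly_times sW (R.nm (\<sigma>, r)) (currents x (R.wd (R.ta (\<sigma>, r))) v) e)"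
      unfolding R.II_def by (simp add: sum.cartesian_product)
    also have "\<dots> = Ddist sW x i j m f B v e"
      unfolding Ddist_def
    proof (rule sum.cong[OF refl])
      fix \<sigma> assume s: "\<sigma> \<in> {\<sigma>. \<sigma> permutes {1..m}}"
      let ?P = "\<Prod>(a, b)\<in>{(a, b). 1 \<le> a \<and> a < b \<and> b \<le> m}. eval2 f (Var (\<sigma> a)) (Var (\<sigma> b))"
      have "poly_times sW (R.nm (\<sigma>, r)) (currents x (R.wd (R.ta (\<sigma>, r))) v) e =
          poly_times sW ?P (\<lambda>e'. sW ((-1) ^ r * B r) (currents x
               (map (\<lambda>a. (i, \<sigma> a)) [1..<Suc r] @ [(j, 0)] @ map (\<lambda>a. (i, \<sigma> a)) [Suc r..<Suc m]) v e')) e"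
        if "r \<in> {0..m}" for r
      proof -
        have II: "(\<sigma>, r) \<in> R.II" using s that by (simp add: R.II_def)
        show ?thesis unfolding wdt[OF II] R.nm_def prod.case R.PP_def H.pt_mult H.pt_Cst by (rule refl)
      qed
      then show "(\<Sum>r=0..m. poly_times sW (R.nm (\<sigma>, r)) (currents x (R.wd (R.ta (\<sigma>, r))) v) e) =
          poly_times sW ?P (\<lambda>e'. \<Sum>r=0..m. sW ((-1) ^ r * B r) (currents x
               (map (\<lambda>a. (i, \<sigma> a)) [1..<Suc r] @ [(j, 0)] @ map (\<lambda>a. (i, \<sigma> a)) [Suc r..<Suc m]) v e')) e"
        unfolding H.pt_sum_right by (rule sum.cong[OF refl])
    qed
    finally show ?thesis ..
  qed
  \<comment> \<open>\<open>Ddist\<close> carries the support condition and \<open>R.Dd\<close> does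
    not. The two vanish together, as this identity and \<open>D2\<close> show.\<close>
  have D1: "R.Dd v e = Ddist sW x i j m f B v (res ?Bs e)" for v e
    unfolding Dsum R.Dd_def
  proof (intro sum.cong refl)
    fix \<iota> assume "\<iota> \<in> R.II"
    then show "poly_times sW (R.nm \<iota>) (rc x (R.wd (R.ta \<iota>)) v) e = poly_times sW (R.nm \<iota>) (currents x (R.wd (R.ta \<iota>)) v) (res ?Bs e)"
      using pvn snd by (cases \<iota>) (intro H.rc_currents, auto)
  qed
  have D2: "Ddist sW x i j m f B v e = (if ks e \<subseteq> ?Bs then R.Dd v e else 0)" for v e
  proof (cases "ks e \<subseteq> ?Bs")
    case True
    then have "res ?Bs e = e" by (intro res_id) auto
    then show ?thesis using D1[of v e] True by simp
  next
    case False
    have "poly_times sW (R.nm \<iota>) (currents x (R.wd (R.ta \<iota>)) v) e = 0" if "\<iota> \<in> R.II" for \<iota>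
    proof -
      have "pv ?Bs (R.nm \<iota>)" using pvn that by (cases \<iota>) auto
      then show ?thesis unfolding H.currents_rs[OF snd[OF that]] H.rs_pt[OF \<open>pv ?Bs (R.nm \<iota>)\<close>] using False by (simp add: H.rs_def)
    qed
    then show ?thesis unfolding Dsum using False by (simp add: sum.neutral)
  qed
  have part1: "Ddist sW x i j m f B v e = 0" if h: "\<forall>l<ne. nop_vanishes T \<epsilon> sW x i j l" for v e
  proof -
    have "R.Dd v e = 0" by (rule R.chain_imp_rel[OF rho]) (use h nv in blast)
    then show ?thesis using D2 by simp
  qed
  have part2: "nop_vanishes T \<epsilon> sW x i j l"
    if mm: "m = mnum T i j" and Br: "\<exists>r\<le>m. B r \<noteq> 0"
      and fn: "\<forall>n \<in> {1..nat (- cmat T i j)}. \<forall>\<delta> \<in> {1, -1}. eval2 f (Var 0) (Cst (qpow T i (of_int (\<delta> * 2 * int n))) * Var 0) \<noteq> 0"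
      and D0: "\<forall>v e. Ddist sW x i j m f B v e = 0" and l: "l < ne" for l
  proof -
    \<comment> \<open>A nonzero B r fixes the place of x_j at which the closed chain is cut
      open.\<close>
    obtain r where r: "r \<le> m" "B r \<noteq> 0" using Br by blast
    have mM: "m = M" using mm C.mnum_eq[OF ctx] by (simp add: M_def)
    have "N.van {..M} (CM.std_u \<rho> l) (CM.std_Phi v)" for v
    proof (rule R.rel_imp_chain[OF mM r, where fv = "fval d f"])
      show "\<exists>D. R.hom (insert 0 {1..m}) u (eval2 f (Var a) (Var b)) D (fval d f (u a) (u b))"
        if "\<And>v. unit0 (u v)" "a \<in> {1..m}" "b \<in> {1..m}" for u a b
        by (rule R.hom_eval2) (use assms(9,10) that d_def in auto)
      show "fval d f y (?cA ^ n * y) \<noteq> 0 \<and> fval d f (?cA ^ n * y) y \<noteq> 0"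
        if n: "1 \<le> n" "n \<le> M - 1" and y: "unit0 y" for n y
      proof (rule fval_ne[OF assms(9)[folded d_def] assms(10) H.d_pos assms(5) y])
        show "?cA ^ n = qpow T i (of_int (\<epsilon> * 2 * int n)) ^ d"
          unfolding C.cAc_def qc_power C.qpow_pow d_def by (simp add: mult_ac)
        show "eval2 f (Var 0) (Cst (qpow T i (of_int (\<delta> * 2 * int n))) * Var 0) \<noteq> 0" if "\<delta> \<in> {1, -1}" for \<delta>
          using fn n M1 that by auto
      qed
      show "\<exists>l'<ne. ?al l' * ?cA ^ (M - 1) * ?al l = 1" if "l < ne" for l
        unfolding ne_def d_def M_def by (rule C.match) (use that ne0 aij in \<open>auto simp: ne_def d_def\<close>)
      show "R.Dd v e = 0" for v e using D1 D0 by simp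
    qed (use rho l in auto)
    then show ?thesis using nv[OF l] by blast
  qed
  show ?thesis unfolding x_def[symmetric] d_def[symmetric] ne_def[symmetric] using part1 part2 by blast
qed

end
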